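(* Let $0<p,q<\infty$ and $s\in\mathbb R$ with $|s|<1$. If $f\in\dot F^s_{p,q}(\mathbb R^n)$ is a function belonging to $L^{p_0}(\mathbb R^n)$ for some $p_0\in[1,\infty]$, then $$\|\mathfrak g_{s,q}(f)\|_{L^p(\mathbb R^n)}\le C\|f\|_{\dot F^s_{p,q}(\mathbb R^n)},$$ with $C$ independent of $f$.
   Context: Poisson kernel: $P_t(x)=C_0\,t\,(t^2+|x|^2)^{-\frac{n+1}{2}}$, $t>0$, $x\in\mathbb R^n$, with $C_0=\Gamma(\frac{n+1}{2})\pi^{-\frac{n+1}{2}}$. Poisson integral: $\mathscr P(f;x,t)=f*P_t(x)=\int f(y)P_t(x-y)dy$. $\nabla_{n+1}\mathscr P(f;x,t)$ is the gradient in all variables $(x,t)\in\mathbb R^{n+1}_+$; $\partial_k$ ($1\le k\le n$) denotes $\partial/\partial x_k$ and $\partial_{n+1}=\partial/\partial t$. Littlewood–Paley–Poisson function: $\mathfrak g_{s,q}(f)(x)=\left(\int_0^\infty t^{q-sq-1}|\nabla_{n+1}\mathscr P(f;x,t)|^q\,dt\right)^{1/q}$. Homogeneous Triebel–Lizorkin space: fix $\psi\in\mathcal S(\mathbb R^n)$ with $0\le\mathcal F_n\psi\le1$, $\operatorname{supp}\mathcal F_n\psi\subseteq\{1/2\le|\xi|<2\}$, $\sum_{j\in\mathbb Z}\mathcal F_n\psi(2^{-j}\xi)=1$ for $\xi\ne0$ (with $\mathcal F_nf(\xi)=\int f(x)e^{-2\pi ix\cdot\xi}dx$); set $f_j=\psi_{2^{-j}}*f$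 with $\psi_{2^{-j}}(x)=2^{jn}\psi(2^jx)$. For $0<p<\infty$, $0<q\le\infty$, $s\in\mathbb R$, $f\in\mathcal S_0'(\mathbb R^n)$ (tempered distributions modulo polynomials) lies in $\dot F^s_{p,q}$ iff $\|f\|_{\dot F^s_{p,q}}=\big\|\big(\sum_{k\in\mathbb Z}(2^{ks}|f_k|)^q\big)^{1/q}\big\|_{L^p(\mathbb R^n)}<\infty$. *)

theory Defs
  imports "HOL-Analysis.Analysis"
begin

section \<open>Powers of extended nonnegative reals (r > 0)\<close>

definition epowr :: "ennreal \<Rightarrow> real \<Rightarrow> ennreal" where
  "epowr x r = (if x = \<infinity> then \<infinity> else ennreal (enn2real x powr r))"

definition in_Lp :: "real \<Rightarrow> ('a::euclidean_space \<Rightarrow> complex) \<Rightarrow> bool" where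
  "in_Lp p f \<longleftrightarrow> f \<in> borel_measurable lebesgue \<and>
      (\<integral>\<^sup>+ x. ennreal (norm (f x) powr p) \<partial>lebesgue) < \<infinity>"

definition in_Linfty :: "('a::euclidean_space \<Rightarrow> complex) \<Rightarrow> bool" where
  "in_Linfty f \<longleftrightarrow> f \<in> borel_measurable lebesgue \<and>
      (\<exists>M. AE x in lebesgue. norm (f x) \<le> M)"

fun iter_partial :: "'a list \<Rightarrow> ('a::euclidean_space \<Rightarrow> complex) \<Rightarrow> ('a \<Rightarrow> complex)" where
  "iter_partial [] g = g"
| "iter_partial (v # vs) g = (\<lambda>x. frechet_derivative (iter_partial vs g) (at x) v)"

definition schwartz :: "('a::euclidean_space \<Rightarrow> complex) \<Rightarrow> bool" where
  "schwartz g \<longleftrightarrow>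
     (\<forall>vs. set vs \<subseteq> Basis \<longrightarrow> (iter_partial vs g) differentiable_on UNIV) \<and>
     (\<forall>vs (N::nat). set vs \<subseteq> Basis \<longrightarrow>
        bounded (range (\<lambda>x. (1 + norm x) ^ N * norm (iter_partial vs g x))))"

definition fourier :: "('a::euclidean_space \<Rightarrow> complex) \<Rightarrow> 'a \<Rightarrow> complex" where
  "fourier g \<xi> = (\<integral>x. g x * cis (- 2 * pi * (x \<bullet> \<xi>)) \<partial>lebesgue)"

definition LP_admissible :: "('a::euclidean_space \<Rightarrow> complex) \<Rightarrow> bool" where
  "LP_admissible \<psi> \<longleftrightarrow> schwartz \<psi> \<and>
     (\<forall>\<xi>. Im (fourier \<psi> \<xi>) = 0 \<and> 0 \<le> Re (fourier \<psi> \<xi>) \<and> Re (fourier \<psi> \<xi>) \<le> 1) \<and>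
     closure {\<xi>. fourier \<psi> \<xi> \<noteq> 0} \<subseteq> {\<xi>. 1/2 \<le> norm \<xi> \<and> norm \<xi> < 2} \<and>
     (\<forall>\<xi>. \<xi> \<noteq> 0 \<longrightarrow> ((\<lambda>j::int. fourier \<psi> ((2 powr (- real_of_int j)) *\<^sub>R \<xi>)) has_sum 1) UNIV)"

definition psi_dil :: "('a::euclidean_space \<Rightarrow> complex) \<Rightarrow> int \<Rightarrow> 'a \<Rightarrow> complex" where
  "psi_dil \<psi> j x = of_real (2 powr (real_of_int j * real DIM('a))) * \<psi> ((2 powr real_of_int j) *\<^sub>R x)"

definition LP_piece :: "('a::euclidean_space \<Rightarrow> complex) \<Rightarrow> ('a \<Rightarrow> complex) \<Rightarrow> int \<Rightarrow> 'a \<Rightarrow> complex" where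
  "LP_piece \<psi> f j x = (\<integral>y. psi_dil \<psi> j (x - y) * f y \<partial>lebesgue)"

definition TL_norm :: "('a::euclidean_space \<Rightarrow> complex) \<Rightarrow> real \<Rightarrow> real \<Rightarrow> real \<Rightarrow> ('a \<Rightarrow> complex) \<Rightarrow> ennreal" where
  "TL_norm \<psi> s p q f =
     epowr (\<integral>\<^sup>+ x. epowr (epowr (\<integral>\<^sup>+ k. ennreal ((2 powr (real_of_int k * s) * norm (LP_piece \<psi> f k x)) powr q)
              \<partial>(count_space (UNIV::int set))) (1 / q)) p
        \<partial>lebesgue) (1 / p)"

definition poisson_const :: "nat \<Rightarrow> real" where
  "poisson_const n = Gamma ((real n + 1) / 2) * pi powr (- (real n + 1) / 2)"

definition poisson_kernel :: "real \<Rightarrow> 'a::euclidean_space \<Rightarrow> real" where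
  "poisson_kernel t x = poisson_const DIM('a) * t * (t\<^sup>2 + (norm x)\<^sup>2) powr (- (real DIM('a) + 1) / 2)"

definition poisson_integral :: "('a::euclidean_space \<Rightarrow> complex) \<Rightarrow> 'a \<Rightarrow> real \<Rightarrow> complex" where
  "poisson_integral f x t = (\<integral>y. f y * of_real (poisson_kernel t (x - y)) \<partial>lebesgue)"

definition poisson_grad_norm :: "('a::euclidean_space \<Rightarrow> complex) \<Rightarrow> 'a \<Rightarrow> real \<Rightarrow> real" where
  "poisson_grad_norm f x t = sqrt
     ((\<Sum>b\<in>Basis. (norm (vector_derivative (\<lambda>h. poisson_integral f (x + h *\<^sub>R b) t) (at 0)))\<^sup>2)
      + (norm (vector_derivative (\<lambda>h. poisson_integral f x (t + h)) (at 0)))\<^sup>2)"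

definition g_function :: "real \<Rightarrow> real \<Rightarrow> ('a::euclidean_space \<Rightarrow> complex) \<Rightarrow> 'a \<Rightarrow> ennreal" where
  "g_function s q f x = epowr (\<integral>\<^sup>+ t\<in>{0<..}. ennreal (t powr (q - s * q - 1) * poisson_grad_norm f x t powr q) \<partial>lborel) (1 / q)"

definition Lp_enorm :: "real \<Rightarrow> ('a::euclidean_space \<Rightarrow> ennreal) \<Rightarrow> ennreal" where
  "Lp_enorm p g = epowr (\<integral>\<^sup>+ x. epowr (g x) p \<partial>lebesgue) (1 / p)"

end

theory Submission
  imports Defs "HOL-Probability.Characteristic_Functions"
begin

text \<open>
  Write \<open>f\<^sub>j = \<psi>\<^sub>j * f\<close> for the Littlewood-Paley pieces and let \<open>\<phi>\<^sub>j = \<psi>\<^sub>j\<^sub>-\<^sub>1 + \<psi>\<^sub>j + \<psi>\<^sub>j\<^sub>+\<^sub>1\<close>, so that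
  \<open>\<phi>\<^sub>j * \<psi>\<^sub>j = \<psi>\<^sub>j\<close>. For a derivative \<open>k\<^sub>t\<close> of the Poisson kernel one has \<open>k\<^sub>t * f = \<Sum>\<^sub>j (k\<^sub>t * \<phi>\<^sub>j) * f\<^sub>j\<close>; this
  follows from uniqueness of the Fourier transform applied to \<open>\<Sum>\<^sub>j k\<^sub>t * \<psi>\<^sub>j = k\<^sub>t\<close>, without computing the Fourier
  transform of the Poisson kernel. All moments of \<open>\<phi>\<^sub>j\<close> vanish, hence Taylor expansion of
  \<open>(t\<^sup>2 + |x - y|\<^sup>2)\<^sup>-\<^sup>a\<close> in \<open>y\<close> shows that \<open>k\<^sub>t * \<phi>\<^sub>j\<close> is rapidly decreasing at scale \<open>2\<^sup>-\<^sup>j\<close>, with size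
  \<open>2\<^sup>j min ((2\<^sup>j t)\<^sup>-\<^sup>\<epsilon>, (2\<^sup>j t)\<^sup>-\<^sup>M)\<close>. So \<open>|k\<^sub>t * f|\<close> is bounded by a sum of Peetre maximal functions of the \<open>f\<^sub>j\<close>, and
  integrating in \<open>t\<close> decouples the scales because \<open>|s| < 1\<close>. The Peetre maximal functions are bounded by convolutions
  \<open>\<eta>\<^sub>j * |f\<^sub>j|\<^sup>r\<close> with small \<open>r\<close>.

  It remains to bound \<open>g\<^sub>j \<mapsto> \<eta>\<^sub>j * g\<^sub>j\<close> on \<open>L\<^sup>P(\<ell>\<^sup>Q)\<close> for \<open>P, Q > 1\<close>. Since these operators are linear and
  self-adjoint, duality reduces \<open>P < Q\<close> to \<open>P \<ge> Q\<close>, and Jensen's inequality reduces that case to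
  \<open>\<parallel>\<Sum>\<^sub>j \<eta>\<^sub>j * u\<^sub>j\<parallel>\<^sub>m \<le> K \<parallel>\<Sum>\<^sub>j u\<^sub>j\<parallel>\<^sub>m\<close> for \<open>u\<^sub>j \<ge> 0\<close>, \<open>m \<ge> 1\<close>. No maximal theorem is used for this: for ball averages it
  follows by a bootstrapping argument as in the dual Doob inequality for martingales.
\<close>

section \<open>Powers of extended nonnegative reals\<close>

text \<open>The decomposition is applied to the kernel and not to f: the pieces of a function in
  L^infinity need not sum to it (a nonzero constant has all pieces zero), whereas the differentiated
  kernel decomposes with a majorant of order (1 + |x|)^(-n - 1/2), against which every f in some
  L^(p_0) is integrable. The same weight makes the Peetre maximal functions finite, which permits
  division by a power of them.

  The exponent r lies below p and q, so that P = p/r and Q = q/r exceed 1, and the Peetre exponent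
  is \<mu> = (n + 1)/r, so that the kernel \<eta>_j, with decay \<mu> r = n + 1, is integrable.
  Bounding the maximal functions by convolutions at a single scale keeps the operators linear; this
  is what makes duality available. The kernel \<eta>_j is a superposition of ball kernels of radii
  2^k 2^(-j) with geometrically decreasing coefficients, hence the constant for ball averages has to
  be independent of the radii.\<close>

lemma epowr_ennreal: "epowr (ennreal a) r = ennreal (a powr r)" if "0 \<le> a"
  using that by (simp add: epowr_def)

lemma epowr_top [simp]: "epowr top r = top"
  by (simp add: epowr_def)

lemma epowr_0 [simp]: "epowr 0 r = 0"
  by (simp add: epowr_def)

lemma epowr_one_exp [simp]: "epowr x 1 = x"
  by (cases x) (auto simp: epowr_ennreal)

lemma epowr_eq_0_iff [simp]: "epowr x r = 0 \<longleftrightarrow> x = 0"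
  by (cases x) (auto simp: epowr_ennreal)

lemma epowr_eq_top_iff [simp]: "epowr x r = top \<longleftrightarrow> x = top"
  by (cases x) (auto simp: epowr_ennreal)

lemma epowr_mono: "x \<le> y \<Longrightarrow> 0 \<le> r \<Longrightarrow> epowr x r \<le> epowr y r"
  by (cases x; cases y) (auto simp: epowr_ennreal top_unique intro!: ennreal_leI powr_mono2)

lemma epowr_epowr: "epowr (epowr x a) b = epowr x (a * b)"
  by (cases x) (auto simp: epowr_ennreal powr_powr)

lemma epowr_mult: "epowr (x * y) r = epowr x r * epowr y r"
proof (cases x; cases y)
  fix a b assume "x = ennreal a" "0 \<le> a" "y = ennreal b" "0 \<le> b"
  then show ?thesis
    by (auto simp: epowr_ennreal powr_mult ennreal_mult[symmetric])
next
  fix a assume *: "x = ennreal a" "0 \<le> a" "y = top"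
  show ?thesis
  proof (cases "a = 0")
    case False
    then have "x * top = top" "epowr x r * top = top" using * by (auto simp: ennreal_mult_top)
    then show ?thesis using * by simp
  qed (use * in auto)
next
  fix b assume *: "y = ennreal b" "0 \<le> b" "x = top"
  show ?thesis
  proof (cases "b = 0")
    case False
    then have "top * y = top" "top * epowr y r = top" using * by (auto simp: ennreal_top_mult)
    then show ?thesis using * by simp
  qed (use * in auto)
qed (auto)

text \<open>Unconditional by convention: \<open>0 powr r\<close> is 0 for every r, and
  \<open>epowr\<close> sends infinity to infinity for every r, also for a negative one, so both
  degenerate values of x satisfy the identity.\<close>

lemma epowr_add: "epowr x (a + b) = epowr x a * epowr x b"
  by (cases x) (auto simp: epowr_ennreal powr_add ennreal_mult)

lemma epowr_le_iff: "0 < r \<Longrightarrow> epowr x r \<le> y \<longleftrightarrow> x \<le> epowr y (1 / r)"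
  using epowr_mono[of "epowr x r" y "1/r"] epowr_mono[of x "epowr y (1/r)" r]
  by (auto simp: epowr_epowr)

lemma epowr_measurable [measurable]:
  assumes [measurable]: "f \<in> borel_measurable M"
  shows "(\<lambda>x. epowr (f x) r) \<in> borel_measurable M"
  unfolding epowr_def by measurable

text \<open>For r > 0 the power is an order isomorphism with inverse exponent 1/r
  (\<open>epowr_le_iff\<close>), and such maps commute with suprema.\<close>

lemma epowr_SUP:
  assumes "0 < r"
  shows "epowr (SUP i\<in>I. f i) r = (SUP i\<in>I. epowr (f i) r)"
proof (rule antisym)
  show "epowr (SUP i\<in>I. f i) r \<le> (SUP i\<in>I. epowr (f i) r)"
    unfolding epowr_le_iff[OF assms]
  proof (rule SUP_least)
    fix i assume "i \<in> I"
    then show "f i \<le> epowr (SUP i\<in>I. epowr (f i) r) (1 / r)"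
      unfolding epowr_le_iff[OF assms, symmetric] by (rule SUP_upper)
  qed
  show "(SUP i\<in>I. epowr (f i) r) \<le> epowr (SUP i\<in>I. f i) r"
    using assms by (auto intro!: SUP_least epowr_mono SUP_upper)
qed

text \<open>By convexity x^m lies above its tangent at b. Young's inequality with the conjugate
  exponent m' = m/(m - 1) gives this without calculus and covers b = 0.\<close>

lemma tangent_powr:
  fixes x b m :: real
  assumes "1 < m" "0 \<le> x" "0 \<le> b"
  shows "m * (b powr (m - 1) * x) \<le> x powr m + (m - 1) * b powr m"
proof -
  define m' where "m' = m / (m - 1)"
  have m': "1 < m'" "1 / m + 1 / m' = 1"
    using assms unfolding m'_def by (auto simp: field_simps)
  have "x * b powr (m - 1) \<le> x powr m / m + (b powr (m - 1)) powr m' / m'"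
    using Youngs_inequality[of m m' x "b powr (m - 1)"] m' assms by simp
  also have "(b powr (m - 1)) powr m' = b powr m"
    unfolding m'_def powr_powr using assms by simp
  finally have "m * (x * b powr (m - 1)) \<le> m * (x powr m / m + b powr m / m')"
    using assms by (intro mult_left_mono) auto
  also have "\<dots> = x powr m + (m - 1) * b powr m"
    using assms unfolding m'_def by (simp add: field_simps)
  finally show ?thesis by (simp add: mult_ac)
qed

lemma epowr_tangent:
  assumes "1 < m"
  shows "ennreal m * (epowr b (m - 1) * x) \<le> epowr x m + ennreal (m - 1) * epowr b m"
proof (cases x; cases b)
  fix y c assume "x = ennreal y" "0 \<le> y" "b = ennreal c" "0 \<le> c"
  then show ?thesis using tangent_powr[OF assms, of y c] assms
    by (auto simp: epowr_ennreal ennreal_mult[symmetric] ennreal_plus[symmetric] simp del: ennreal_plus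
        intro!: ennreal_leI)
qed (use assms in \<open>auto simp: ennreal_mult_top top_unique\<close>)

text \<open>Discrete form of F^m = m times the integral of F^(m-1) dF: by the tangent inequality at
  the new partial sum, adding a term a to S raises the m-th power by at most m a (a + S)^(m-1). The
  induction adds the largest index, so the earlier partial sums stay the same.\<close>

lemma sum_powr_tangent:
  fixes a :: "'i::linorder \<Rightarrow> ennreal"
  assumes "finite J" "1 < m"
  shows "epowr (\<Sum>j\<in>J. a j) m \<le> ennreal m * (\<Sum>j\<in>J. a j * epowr (\<Sum>i\<in>{i\<in>J. i \<le> j}. a i) (m - 1))"
  using assms(1)
proof (induction J rule: finite_linorder_max_induct)
  case (insert b A)
  have [simp]: "b \<notin> A" using insert by auto
  define S where "S = (\<Sum>j\<in>A. a j)"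
  have 1: "{i \<in> insert b A. i \<le> b} = insert b A" using insert by auto
  have 2: "{i \<in> insert b A. i \<le> j} = {i \<in> A. i \<le> j}" if "j \<in> A" for j using insert that by auto
  have "(\<Sum>j\<in>insert b A. a j * epowr (\<Sum>i\<in>{i\<in>insert b A. i \<le> j}. a i) (m - 1))
      = a b * epowr (a b + S) (m - 1) + (\<Sum>j\<in>A. a j * epowr (\<Sum>i\<in>{i\<in>A. i \<le> j}. a i) (m - 1))"
    unfolding sum.insert[OF insert(1) \<open>b \<notin> A\<close>] 1 using 2 insert by (simp add: S_def)
  moreover have "epowr (a b + S) m \<le> ennreal m * (a b * epowr (a b + S) (m - 1)) + epowr S m"
  proof (cases "a b + S")
    case (real s)
    then obtain x y where xy: "a b = ennreal x" "0 \<le> x" "S = ennreal y" "0 \<le> y"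
      by (cases "a b"; cases S) auto
    have "(x + y) powr m \<le> m * (x * (x + y) powr (m - 1)) + y powr m"
    proof -
      define Z where "Z = (x + y) powr (m - 1)"
      have "(x + y) powr m = x * Z + y * Z"
        unfolding Z_def using powr_mult_base[of "x + y" "m - 1"] xy by (simp add: algebra_simps)
      moreover have "m * (Z * y) \<le> y powr m + (m - 1) * (x + y) powr m"
        unfolding Z_def by (rule tangent_powr) (use assms xy in auto)
      ultimately show ?thesis unfolding Z_def[symmetric] by (simp add: algebra_simps)
    qed
    then show ?thesis using xy assms
      by (auto simp: epowr_ennreal ennreal_mult[symmetric] ennreal_plus[symmetric] simp del: ennreal_plus
        intro!: ennreal_leI)
  next
    case top
    then show ?thesis using assms
      by (cases "a b = 0") (auto simp: ennreal_mult_top ennreal_add_eq_top)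
  qed
  ultimately show ?case
    using insert
    by (simp add: S_def[symmetric] distrib_left) (meson add_left_mono order_trans)
qed simp

text \<open>Jensen's inequality for a measure of mass at most c, obtained by integrating the tangent
  inequality at the point \<open>b\<close>, the mean of f with c in place of the mass; the terms (m
  - 1) b^m c then cancel.\<close>

lemma ennreal_Jensen_powr:
  assumes "1 \<le> m" and [measurable]: "f \<in> borel_measurable M"
    and c: "emeasure M (space M) \<le> ennreal c" and "0 < c"
  shows "epowr (\<integral>\<^sup>+x. f x \<partial>M) m \<le> ennreal (c powr (m - 1)) * (\<integral>\<^sup>+x. epowr (f x) m \<partial>M)"
proof (cases "m = 1")
  case True
  then show ?thesis using assms by simp
next
  case False
  then have m: "1 < m" using assms by simp
  define I where "I = (\<integral>\<^sup>+x. f x \<partial>M)"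
  define P where "P = (\<integral>\<^sup>+x. epowr (f x) m \<partial>M)"
  show ?thesis
  proof (cases I)
    \<comment> \<open>An infinite integral forces an infinite right side, because f \<le> 1 + f^m
      and the total mass is finite.\<close>
    case top
    have "f x \<le> 1 + epowr (f x) m" for x
    proof (cases "f x")
      case (real r)
      have "r \<le> 1 + r powr m"
      proof (cases "r \<le> 1")
        case False
        then have "r powr 1 \<le> r powr m" using m by (intro powr_mono) auto
        then show ?thesis using False by simp
      qed (simp add: add_increasing2)
      then show ?thesis using real by (auto simp: epowr_ennreal simp flip: ennreal_plus ennreal_1 intro!: ennreal_leI)
    qed auto
    then have "I \<le> (\<integral>\<^sup>+x. 1 + epowr (f x) m \<partial>M)"
      unfolding I_def by (intro nn_integral_mono)
    also have "\<dots> = emeasure M (space M) + P" unfolding P_def by (subst nn_integral_add) auto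
    finally have "P = top" using top c by (auto simp: top_unique ennreal_add_eq_top)
    then show ?thesis using assms unfolding P_def by (simp add: ennreal_mult_top)
  next
    case (real i)
    define b where "b = i / c"
    have b: "0 \<le> b" "i = b * c" using real assms by (auto simp: b_def)
    have "ennreal m * (ennreal (b powr (m - 1)) * I) = (\<integral>\<^sup>+x. ennreal m * (epowr (ennreal b) (m - 1) * f x) \<partial>M)"
      unfolding I_def using b by (simp add: nn_integral_cmult epowr_ennreal)
    also have "\<dots> \<le> (\<integral>\<^sup>+x. epowr (f x) m + ennreal (m - 1) * epowr (ennreal b) m \<partial>M)"
      by (intro nn_integral_mono epowr_tangent m)
    also have "\<dots> = P + ennreal (m - 1) * ennreal (b powr m) * emeasure M (space M)"
      using b unfolding P_def by (subst nn_integral_add) (auto simp: epowr_ennreal)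
    also have "\<dots> \<le> P + ennreal (m - 1) * ennreal (b powr m) * ennreal c"
      by (intro add_left_mono mult_left_mono c) auto
    finally have *: "ennreal (m * (b powr (m - 1) * (b * c))) \<le> P + ennreal ((m - 1) * b powr m * c)"
      using m b real assms by (simp add: ennreal_mult)
    have bm: "b powr (m - 1) * (b * c) = b powr m * c"
      using powr_mult_base[of b "m - 1"] b by (simp add: mult.commute)
    have bb: "ennreal (b powr m * c) \<le> P"
    proof (cases P)
      case p: (real p)
      have "ennreal (m * (b powr m * c)) \<le> ennreal (p + (m - 1) * b powr m * c)"
        using * p m assms unfolding bm by (subst ennreal_plus) auto
      then have "m * (b powr m * c) \<le> p + (m - 1) * b powr m * c"
        using p m assms by (subst (asm) ennreal_le_iff) auto
      then show ?thesis using p by (auto simp: algebra_simps intro!: ennreal_leI)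
    qed auto
    have "epowr I m = ennreal (i powr m)" using real by (simp add: epowr_ennreal)
    also have "i powr m = c powr (m - 1) * (b powr m * c)"
      using b assms powr_mult_base[of c "m - 1"] by (simp add: powr_mult mult.commute)
    also have "ennreal \<dots> \<le> ennreal (c powr (m - 1)) * P"
      using bb assms by (simp add: ennreal_mult mult_left_mono)
    finally show ?thesis unfolding I_def P_def .
  qed
qed

lemma ennreal_Jensen_weight:
  assumes "1 \<le> m" and [measurable]: "f \<in> borel_measurable M" "k \<in> borel_measurable M"
    and c: "(\<integral>\<^sup>+x. k x \<partial>M) \<le> ennreal c" and "0 < c"
  shows "epowr (\<integral>\<^sup>+x. k x * f x \<partial>M) m \<le> ennreal (c powr (m - 1)) * (\<integral>\<^sup>+x. k x * epowr (f x) m \<partial>M)"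
  using ennreal_Jensen_powr[of m f "density M k" c] assms
  by (simp add: nn_integral_density emeasure_density cong: nn_integral_cong)

lemma Jensen_sum:
  assumes "1 \<le> m" "finite J" "0 < c" "(\<Sum>j\<in>J. k j) \<le> ennreal c"
  shows "epowr (\<Sum>j\<in>J. k j * f j) m \<le> ennreal (c powr (m - 1)) * (\<Sum>j\<in>J. k j * epowr (f j) m)"
  using ennreal_Jensen_weight[of m f "count_space J" k c] assms
  by (simp add: nn_integral_count_space_finite)

text \<open>The fractions a/(a + b) and b/(a + b) lie in [0, 1], where raising to the power r \<le>
  1 does not decrease.\<close>

lemma epowr_add_le:
  assumes "0 < r" "r \<le> 1"
  shows "epowr (x + y) r \<le> epowr x r + epowr y r"
proof (cases "x + y")
  case (real s)
  then obtain a b where ab: "x = ennreal a" "0 \<le> a" "y = ennreal b" "0 \<le> b"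
    by (cases x; cases y) auto
  have "(a + b) powr r \<le> a powr r + b powr r"
  proof (cases "a + b = 0")
    case False
    then have s: "a + b > 0" using ab by simp
    have "a / (a + b) \<le> (a / (a + b)) powr r" "b / (a + b) \<le> (b / (a + b)) powr r"
      using powr_mono'[of r 1 "a / (a + b)"] powr_mono'[of r 1 "b / (a + b)"] ab s assms by auto
    then have "1 \<le> (a / (a + b)) powr r + (b / (a + b)) powr r"
      using s add_divide_distrib[of a b "a + b"] by simp
    then have "1 \<le> (a powr r + b powr r) / (a + b) powr r"
      using s ab by (simp add: powr_divide add_divide_distrib)
    then show ?thesis using s by (simp add: pos_le_divide_eq)
  qed (use ab in auto)
  then show ?thesis using ab
    by (auto simp: epowr_ennreal ennreal_plus[symmetric] simp del: ennreal_plus intro!: ennreal_leI)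
qed (auto simp: ennreal_add_eq_top)

lemma epowr_sum_le:
  assumes "0 < r" "r \<le> 1" "finite J"
  shows "epowr (\<Sum>j\<in>J. f j) r \<le> (\<Sum>j\<in>J. epowr (f j) r)"
  using assms(3)
proof (induction J rule: finite_induct)
  case (insert x F)
  have "epowr (f x + sum f F) r \<le> epowr (f x) r + epowr (sum f F) r"
    by (rule epowr_add_le[OF assms(1,2)])
  then show ?case using insert by (simp) (meson add_left_mono order_trans)
qed simp

section \<open>Ball averages\<close>

lemma nn_integral_lborel_affine:
  fixes f :: "'a::euclidean_space \<Rightarrow> ennreal"
  assumes [measurable]: "f \<in> borel_measurable borel" and "c \<noteq> 0"
  shows "(\<integral>\<^sup>+x. f x \<partial>lborel) = ennreal (\<bar>c\<bar> ^ DIM('a)) * (\<integral>\<^sup>+x. f (t + c *\<^sub>R x) \<partial>lborel)"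
  by (subst lborel_affine[OF \<open>c \<noteq> 0\<close>, of t])
     (simp add: nn_integral_density nn_integral_distr nn_integral_cmult)

lemma lborel_integral_affine:
  fixes f :: "'a::euclidean_space \<Rightarrow> 'b::{banach, second_countable_topology}"
  assumes [measurable]: "f \<in> borel_measurable borel" and "c \<noteq> 0"
  shows "(\<integral>x. f x \<partial>lborel) = (\<bar>c\<bar> ^ DIM('a)) *\<^sub>R (\<integral>x. f (t + c *\<^sub>R x) \<partial>lborel)"
  by (subst lborel_affine[OF \<open>c \<noteq> 0\<close>, of t])
     (simp add: integral_density integral_distr)

lemma nn_integral_lborel_reflect:
  fixes f :: "'a::euclidean_space \<Rightarrow> ennreal"
  assumes [measurable]: "f \<in> borel_measurable borel"
  shows "(\<integral>\<^sup>+y. f (x - y) \<partial>lborel) = (\<integral>\<^sup>+y. f y \<partial>lborel)"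
  using nn_integral_lborel_affine[of f "-1" x] by simp

lemma nn_integral_lborel_shift:
  fixes f :: "'a::euclidean_space \<Rightarrow> ennreal"
  assumes [measurable]: "f \<in> borel_measurable borel"
  shows "(\<integral>\<^sup>+y. f (y - x) \<partial>lborel) = (\<integral>\<^sup>+y. f y \<partial>lborel)"
  using nn_integral_lborel_affine[of f 1 "-x"] by simp

section \<open>Convolution and ball averages of nonnegative functions\<close>

definition nnconv :: "('a::euclidean_space \<Rightarrow> ennreal) \<Rightarrow> ('a \<Rightarrow> ennreal) \<Rightarrow> 'a \<Rightarrow> ennreal" where
  "nnconv k u x = (\<integral>\<^sup>+y. k (x - y) * u y \<partial>lborel)"

lemma nnconv_measurable [measurable]:
  assumes [measurable]: "k \<in> borel_measurable borel" "u \<in> borel_measurable borel"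
  shows "nnconv k u \<in> borel_measurable borel"
  unfolding nnconv_def by measurable

lemma nnconv_selfadjoint:
  assumes [measurable]: "k \<in> borel_measurable borel" "u \<in> borel_measurable borel" "v \<in> borel_measurable borel"
    and even: "\<And>x. k (- x) = k x"
  shows "(\<integral>\<^sup>+x. nnconv k u x * v x \<partial>lborel) = (\<integral>\<^sup>+x. u x * nnconv k v x \<partial>lborel)"
proof -
  have "(\<integral>\<^sup>+x. nnconv k u x * v x \<partial>lborel) = (\<integral>\<^sup>+x. \<integral>\<^sup>+y. k (x - y) * u y * v x \<partial>lborel \<partial>lborel)"
    unfolding nnconv_def by (simp add: nn_integral_multc)
  also have "\<dots> = (\<integral>\<^sup>+y. \<integral>\<^sup>+x. k (x - y) * u y * v x \<partial>lborel \<partial>lborel)"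
    by (rule lborel_pair.Fubini') measurable
  also have "\<dots> = (\<integral>\<^sup>+y. \<integral>\<^sup>+x. u y * (k (y - x) * v x) \<partial>lborel \<partial>lborel)"
  proof (intro nn_integral_cong)
    fix x y :: 'a
    show "k (x - y) * u y * v x = u y * (k (y - x) * v x)"
      using even[of "x - y"] by (simp add: mult_ac)
  qed
  also have "\<dots> = (\<integral>\<^sup>+x. u x * nnconv k v x \<partial>lborel)"
    unfolding nnconv_def by (simp add: nn_integral_cmult)
  finally show ?thesis .
qed

lemma nn_integral_nnconv:
  assumes [measurable]: "k \<in> borel_measurable borel" "u \<in> borel_measurable borel"
  shows "(\<integral>\<^sup>+x. nnconv k u x \<partial>lborel) = (\<integral>\<^sup>+x. k x \<partial>lborel) * (\<integral>\<^sup>+x. u x \<partial>lborel)"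
proof -
  have "(\<integral>\<^sup>+x. nnconv k u x \<partial>lborel) = (\<integral>\<^sup>+y. \<integral>\<^sup>+x. k (x - y) * u y \<partial>lborel \<partial>lborel)"
    unfolding nnconv_def by (rule lborel_pair.Fubini') measurable
  also have "\<dots> = (\<integral>\<^sup>+y. (\<integral>\<^sup>+x. k x \<partial>lborel) * u y \<partial>lborel)"
    by (simp add: nn_integral_multc nn_integral_lborel_shift)
  also have "\<dots> = (\<integral>\<^sup>+x. k x \<partial>lborel) * (\<integral>\<^sup>+x. u x \<partial>lborel)"
    by (simp add: nn_integral_cmult)
  finally show ?thesis .
qed

lemma nnconv_cmult:
  assumes [measurable]: "k \<in> borel_measurable borel" "u \<in> borel_measurable borel"
  shows "nnconv k (\<lambda>x. c * u x) x = c * nnconv k u x"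
  unfolding nnconv_def by (subst nn_integral_cmult[symmetric]) (auto simp: mult_ac)

lemma nnconv_powr_le:
  assumes [measurable]: "k \<in> borel_measurable borel" "u \<in> borel_measurable borel"
    and m: "1 \<le> m" and c: "(\<integral>\<^sup>+x. k x \<partial>lborel) \<le> ennreal c" "0 < c"
  shows "epowr (nnconv k u x) m \<le> ennreal (c powr (m - 1)) * nnconv k (\<lambda>y. epowr (u y) m) x"
  unfolding nnconv_def
  by (rule ennreal_Jensen_weight) (use m c in \<open>auto simp: nn_integral_lborel_reflect\<close>)

text \<open>Division by \<rho>^n instead of the volume gives the total mass \<open>unit_vol\<close>
  for every radius, so true averages differ by this constant factor.\<close>

definition ball_kernel :: "real \<Rightarrow> 'a::euclidean_space \<Rightarrow> ennreal" where
  "ball_kernel \<rho> y = ennreal (1 / \<rho> ^ DIM('a)) * indicator (cball 0 \<rho>) y"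

lemma ball_kernel_measurable [measurable]: "(ball_kernel \<rho> :: 'a::euclidean_space \<Rightarrow> ennreal) \<in> borel_measurable borel"
proof -
  have [measurable]: "cball (0::'a) \<rho> \<in> sets borel" by simp
  show ?thesis unfolding ball_kernel_def by measurable
qed

lemma ball_kernel_even: "ball_kernel \<rho> (- x) = ball_kernel \<rho> x"
  by (simp add: ball_kernel_def indicator_def)

definition unit_vol :: "'a::euclidean_space itself \<Rightarrow> real" where
  "unit_vol _ = measure lborel (cball (0::'a) 1)"

lemma unit_vol_pos: "0 < unit_vol TYPE('a::euclidean_space)"
  unfolding unit_vol_def using content_cball_pos[of 1 "0::'a"] by simp

lemma nn_integral_ball_kernel:
  assumes "0 < \<rho>"
  shows "(\<integral>\<^sup>+x. ball_kernel \<rho> (x::'a::euclidean_space) \<partial>lborel) = ennreal (unit_vol TYPE('a))"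
proof -
  have "(\<integral>\<^sup>+x. ball_kernel \<rho> (x::'a) \<partial>lborel)
      = ennreal (\<rho> ^ DIM('a)) * (\<integral>\<^sup>+x. ball_kernel \<rho> (\<rho> *\<^sub>R (x::'a)) \<partial>lborel)"
    using nn_integral_lborel_affine[of "ball_kernel \<rho> :: 'a \<Rightarrow> _" \<rho> 0] assms by simp
  also have "(\<lambda>x::'a. ball_kernel \<rho> (\<rho> *\<^sub>R x)) = (\<lambda>x. ennreal (1 / \<rho> ^ DIM('a)) * indicator (cball (0::'a) 1) x)"
    using assms by (auto simp: ball_kernel_def fun_eq_iff indicator_def)
  also have "(\<integral>\<^sup>+x. ennreal (1 / \<rho> ^ DIM('a)) * indicator (cball (0::'a) 1) x \<partial>lborel)
     = ennreal (1 / \<rho> ^ DIM('a)) * emeasure lborel (cball (0::'a) 1)"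
    by (subst nn_integral_cmult) (auto intro!: borel_measurable_indicator)
  also have "emeasure lborel (cball (0::'a) 1) = ennreal (unit_vol TYPE('a))"
    unfolding unit_vol_def by (rule emeasure_eq_ennreal_measure) (use emeasure_bounded_finite[of "cball (0::'a) 1"] in auto)
  finally show ?thesis using assms by (simp add: ennreal_mult[symmetric] mult.assoc[symmetric])
qed

text \<open>The ball of radius \<rho> about y lies in the ball of radius 2 \<rho> about x; the
  factor 2^n compensates the different normalisations.\<close>

lemma nnconv_ball_kernel_shift:
  fixes x y :: "'a::euclidean_space"
  assumes "norm (x - y) \<le> \<rho>'" "\<rho>' \<le> \<rho>" "0 < \<rho>" and [measurable]: "u \<in> borel_measurable borel"
  shows "nnconv (ball_kernel \<rho>) u y \<le> ennreal (2 ^ DIM('a)) * nnconv (ball_kernel (2 * \<rho>)) u x"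
proof -
  have "ball_kernel \<rho> (y - z) * u z \<le> ennreal (2 ^ DIM('a)) * (ball_kernel (2 * \<rho>) (x - z) * u z)" for z
  proof -
    have "norm (x - z) \<le> 2 * \<rho>" if "norm (y - z) \<le> \<rho>"
      using norm_triangle_ineq[of "x - y" "y - z"] that assms by simp
    then have "ball_kernel \<rho> (y - z) \<le> ennreal (2 ^ DIM('a)) * ball_kernel (2 * \<rho>) (x - z)"
      using assms by (auto simp: ball_kernel_def indicator_def ennreal_mult[symmetric] power_mult_distrib)
    then show ?thesis
      by (metis mult.assoc mult_right_mono zero_le)
  qed
  then have "nnconv (ball_kernel \<rho>) u y \<le> (\<integral>\<^sup>+z. ennreal (2 ^ DIM('a)) * (ball_kernel (2 * \<rho>) (x - z) * u z) \<partial>lborel)"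
    unfolding nnconv_def by (intro nn_integral_mono)
  also have "\<dots> = ennreal (2 ^ DIM('a)) * nnconv (ball_kernel (2 * \<rho>)) u x"
    unfolding nnconv_def by (rule nn_integral_cmult) measurable
  finally show ?thesis .
qed

lemma Young_absorb:
  assumes "1 < m" "0 < D"
  obtains C where "0 < C" "\<And>U b. ennreal D * (U * epowr b (m - 1)) \<le> ennreal C * epowr U m + ennreal (1/2) * epowr b m"
proof -
  \<comment> \<open>This scaling of U makes the coefficient D (m - 1)/(m l) of b^m equal to
    1/2.\<close>
  define l where "l = 2 * D * (m - 1) / m"
  have l: "0 < l" using assms by (simp add: l_def)
  show ?thesis
  proof (rule that[of "D / (m * l) * l powr m"])
    fix U b
    have "ennreal D * (U * epowr b (m - 1)) = ennreal (D / (m * l)) * (ennreal m * (epowr b (m - 1) * (ennreal l * U)))"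
    proof -
      have "ennreal D = ennreal (D / (m * l)) * ennreal m * ennreal l"
        using assms l by (simp add: ennreal_mult[symmetric])
      then show ?thesis by (simp add: mult_ac)
    qed
    also have "\<dots> \<le> ennreal (D / (m * l)) * (epowr (ennreal l * U) m + ennreal (m - 1) * epowr b m)"
      by (intro mult_left_mono epowr_tangent assms) auto
    also have "\<dots> = ennreal (D / (m * l) * l powr m) * epowr U m + ennreal (D / (m * l) * (m - 1)) * epowr b m"
    proof -
      have "ennreal (D / (m * l) * l powr m) = ennreal (D / (m * l)) * ennreal (l powr m)"
        "ennreal (D / (m * l) * (m - 1)) = ennreal (D / (m * l)) * ennreal (m - 1)"
        by (rule ennreal_mult; use assms l in simp)+
      then show ?thesis using l by (simp only: epowr_mult epowr_ennreal distrib_left mult.assoc less_imp_le)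
    qed
    also have "D / (m * l) * (m - 1) = 1/2"
      using assms by (simp add: l_def field_simps)
    finally show "ennreal D * (U * epowr b (m - 1)) \<le> ennreal (D / (m * l) * l powr m) * epowr U m + ennreal (1/2) * epowr b m" .
  qed (use assms l in auto)
qed

text \<open>The radii are only required to decrease along the index set; the constant may not depend on them.\<close>

definition dual_Doob_bound :: "'a::euclidean_space itself \<Rightarrow> real \<Rightarrow> 'i::linorder set \<Rightarrow> real \<Rightarrow> bool" where
  "dual_Doob_bound _ m J K \<longleftrightarrow> 0 \<le> K \<and> (\<forall>(r::'i \<Rightarrow> real) (u::'i \<Rightarrow> 'a \<Rightarrow> ennreal).
     (\<forall>i. 0 < r i) \<and> (\<forall>i j. i \<le> j \<longrightarrow> r j \<le> r i) \<and> (\<forall>i. u i \<in> borel_measurable borel) \<longrightarrow>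
     (\<integral>\<^sup>+x. epowr (\<Sum>i\<in>J. nnconv (ball_kernel (r i)) (u i) x) m \<partial>lborel)
       \<le> ennreal K * (\<integral>\<^sup>+x. epowr (\<Sum>i\<in>J. u i x) m \<partial>lborel))"

text \<open>The constant depends on the number of indices; it only shows that some finite constant
  exists, which the bootstrapping needs as a start.\<close>

lemma dual_Doob_apriori:
  assumes "1 < m" "finite J"
  shows "\<exists>K. dual_Doob_bound TYPE('a::euclidean_space) m (J::'i::linorder set) K"
proof (cases "J = {}")
  case True
  then show ?thesis by (auto simp: dual_Doob_bound_def)
next
  case False
  define N where "N = real (card J)"
  have N: "0 < N" using False assms by (simp add: N_def card_gt_0_iff)
  define w where "w = unit_vol TYPE('a)"
  have w: "0 < w" by (simp add: w_def unit_vol_pos)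
  \<comment> \<open>N^(m-1) is the cost of Jensen's inequality for N summands, w^(m-1) that for one
    average, w is the mass of the kernel, and the last N comes from bounding each \<open>u i\<close>
    by the full sum.\<close>
  define K where "K = N powr (m - 1) * w powr (m - 1) * w * N"
  have "dual_Doob_bound TYPE('a) m J K"
    unfolding dual_Doob_bound_def
  proof (intro conjI allI impI)
    show "0 \<le> K" using N w by (simp add: K_def)
    fix r :: "'i \<Rightarrow> real" and u :: "'i \<Rightarrow> 'a \<Rightarrow> ennreal"
    assume A: "(\<forall>i. 0 < r i) \<and> (\<forall>i j. i \<le> j \<longrightarrow> r j \<le> r i) \<and> (\<forall>i. u i \<in> borel_measurable borel)"
    then have [measurable]: "\<And>i. u i \<in> borel_measurable borel" and r: "\<And>i. 0 < r i" by auto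
    define a where "a i x = nnconv (ball_kernel (r i)) (u i) x" for i x
    define X where "X = (\<integral>\<^sup>+x. epowr (\<Sum>i\<in>J. u i x) m \<partial>lborel)"
    have "(\<integral>\<^sup>+x. epowr (\<Sum>i\<in>J. a i x) m \<partial>lborel)
       \<le> (\<integral>\<^sup>+x. ennreal (N powr (m - 1)) * (\<Sum>i\<in>J. ennreal (w powr (m - 1)) * nnconv (ball_kernel (r i)) (\<lambda>y. epowr (u i y) m) x) \<partial>lborel)"
    proof (rule nn_integral_mono)
      fix x
      have "epowr (\<Sum>i\<in>J. 1 * a i x) m \<le> ennreal (N powr (m - 1)) * (\<Sum>i\<in>J. 1 * epowr (a i x) m)"
        by (rule Jensen_sum) (use assms N in \<open>auto simp: N_def ennreal_of_nat_eq_real_of_nat\<close>)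
      also have "\<dots> \<le> ennreal (N powr (m - 1)) * (\<Sum>i\<in>J. ennreal (w powr (m - 1)) * nnconv (ball_kernel (r i)) (\<lambda>y. epowr (u i y) m) x)"
        unfolding a_def
        by (simp, intro mult_left_mono sum_mono nnconv_powr_le)
           (use assms w r in \<open>auto simp: nn_integral_ball_kernel w_def\<close>)
      finally show "epowr (\<Sum>i\<in>J. a i x) m \<le> ennreal (N powr (m - 1)) * (\<Sum>i\<in>J. ennreal (w powr (m - 1)) * nnconv (ball_kernel (r i)) (\<lambda>y. epowr (u i y) m) x)"
        by simp
    qed
    also have "\<dots> = ennreal (N powr (m - 1)) * (\<Sum>i\<in>J. ennreal (w powr (m - 1)) * (ennreal w * (\<integral>\<^sup>+x. epowr (u i x) m \<partial>lborel)))"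
      by (simp add: nn_integral_cmult nn_integral_sum nn_integral_nnconv r nn_integral_ball_kernel w_def)
    also have "\<dots> \<le> ennreal (N powr (m - 1)) * (\<Sum>i\<in>J. ennreal (w powr (m - 1)) * (ennreal w * X))"
      unfolding X_def
      by (intro mult_left_mono sum_mono nn_integral_mono epowr_mono member_le_sum) (use assms in auto)
    also have "\<dots> = ennreal K * X"
      using N w by (simp add: K_def ennreal_mult N_def ennreal_of_nat_eq_real_of_nat mult_ac)
    finally show "(\<integral>\<^sup>+x. epowr (\<Sum>i\<in>J. nnconv (ball_kernel (r i)) (u i) x) m \<partial>lborel) \<le> ennreal K * (\<integral>\<^sup>+x. epowr (\<Sum>i\<in>J. u i x) m \<partial>lborel)"
      unfolding a_def X_def .
  qed
  then show ?thesis ..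
qed

text \<open>
  With \<open>a\<^sub>j = A\<^sub>j u\<^sub>j\<close>, expand \<open>(\<Sum> a\<^sub>j)\<^sup>m\<close> as \<open>m \<Sum> a\<^sub>j F\<^sub>j\<^sup>m\<^sup>-\<^sup>1\<close> with \<open>F\<^sub>j = \<Sum>\<^sub>i\<^sub>\<le>\<^sub>j a\<^sub>i\<close> and move \<open>A\<^sub>j\<close> onto \<open>F\<^sub>j\<^sup>m\<^sup>-\<^sup>1\<close>. Averages over
  balls at least as large as the \<open>j\<close>-th one change little on that ball when their radii are doubled, and the bound
  for the doubled radii is again an instance of the hypothesis.
\<close>

lemma dual_Doob_iterate:
  assumes m: "1 < m"
  obtains C where "0 < C" "\<And>J K. finite J \<Longrightarrow> dual_Doob_bound TYPE('a::euclidean_space) m (J::'i::linorder set) K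
      \<Longrightarrow> dual_Doob_bound TYPE('a) m J (C + K / 2)"
proof -
  define w where "w = unit_vol TYPE('a)"
  have w: "0 < w" by (simp add: w_def unit_vol_pos)
  define d where "d = (2::real) ^ DIM('a)"
  have d: "0 < d" by (simp add: d_def)
  define D where "D = m * (w * d powr (m - 1))"
  have "0 < D" using m w d by (simp add: D_def)
  obtain C where C: "0 < C" "\<And>U b. ennreal D * (U * epowr b (m - 1)) \<le> ennreal C * epowr U m + ennreal (1/2) * epowr b m"
    using Young_absorb[OF m \<open>0 < D\<close>] by blast
  show ?thesis
  proof (rule that[OF C(1)])
    fix J :: "'i set" and K
    assume J: "finite J" and bd: "dual_Doob_bound TYPE('a) m J K"
    then have K: "0 \<le> K" by (simp add: dual_Doob_bound_def)
    show "dual_Doob_bound TYPE('a) m J (C + K / 2)"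
      unfolding dual_Doob_bound_def
    proof (intro conjI allI impI)
      show "0 \<le> C + K / 2" using C K by simp
      fix r :: "'i \<Rightarrow> real" and u :: "'i \<Rightarrow> 'a \<Rightarrow> ennreal"
      assume A: "(\<forall>i. 0 < r i) \<and> (\<forall>i j. i \<le> j \<longrightarrow> r j \<le> r i) \<and> (\<forall>i. u i \<in> borel_measurable borel)"
      then have [measurable]: "\<And>i. u i \<in> borel_measurable borel" and r: "\<And>i. 0 < r i"
        and anti: "\<And>i j. i \<le> j \<Longrightarrow> r j \<le> r i" by auto
      define a where "a i = nnconv (ball_kernel (r i)) (u i)" for i
      define F where "F j x = (\<Sum>i\<in>{i\<in>J. i \<le> j}. a i x)" for j x
      define G where "G x = (\<Sum>i\<in>J. nnconv (ball_kernel (2 * r i)) (u i) x)" for x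
      define U where "U x = (\<Sum>i\<in>J. u i x)" for x
      have [measurable]: "a i \<in> borel_measurable borel" for i unfolding a_def by measurable
      have [measurable]: "F j \<in> borel_measurable borel" for j unfolding F_def by measurable
      have [measurable]: "G \<in> borel_measurable borel" unfolding G_def by measurable
      have [measurable]: "U \<in> borel_measurable borel" unfolding U_def by measurable
      \<comment> \<open>Since the radii decrease, i \<le> j gives \<open>r j\<close> \<le>
        \<open>r i\<close>, so a displacement by at most \<open>r j\<close> is within the doubling
        estimate for each i that occurs in \<open>F j\<close>.\<close>
      have FG: "F j y \<le> ennreal d * G x" if "norm (x - y) \<le> r j" for j x y
      proof -
        have "F j y \<le> (\<Sum>i\<in>{i\<in>J. i \<le> j}. ennreal d * nnconv (ball_kernel (2 * r i)) (u i) x)"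
          unfolding F_def a_def d_def
          by (intro sum_mono nnconv_ball_kernel_shift[OF that]) (auto simp: r anti)
        also have "\<dots> \<le> (\<Sum>i\<in>J. ennreal d * nnconv (ball_kernel (2 * r i)) (u i) x)"
          by (intro sum_mono2 J) auto
        finally show ?thesis unfolding G_def by (simp add: sum_distrib_left)
      qed
      \<comment> \<open>On the support of the ball kernel about x, \<open>F j\<close> is controlled
        by the single value \<open>G x\<close>; what remains is the mass of the kernel.\<close>
      have conv: "nnconv (ball_kernel (r j)) (\<lambda>y. epowr (F j y) (m - 1)) x \<le> ennreal (w * d powr (m - 1)) * epowr (G x) (m - 1)" for j x
      proof -
        have "nnconv (ball_kernel (r j)) (\<lambda>y. epowr (F j y) (m - 1)) x
           \<le> (\<integral>\<^sup>+y. ball_kernel (r j) (x - y) * epowr (ennreal d * G x) (m - 1) \<partial>lborel)"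
          unfolding nnconv_def
        proof (rule nn_integral_mono)
          fix y
          show "ball_kernel (r j) (x - y) * epowr (F j y) (m - 1) \<le> ball_kernel (r j) (x - y) * epowr (ennreal d * G x) (m - 1)"
          proof (cases "norm (x - y) \<le> r j")
            case True
            then show ?thesis using m by (intro mult_left_mono epowr_mono FG) auto
          qed (auto simp: ball_kernel_def)
        qed
        also have "\<dots> = ennreal w * epowr (ennreal d * G x) (m - 1)"
          by (simp add: nn_integral_multc nn_integral_lborel_reflect nn_integral_ball_kernel r w_def)
        also have "\<dots> = ennreal (w * d powr (m - 1)) * epowr (G x) (m - 1)"
          using w d by (simp add: epowr_mult epowr_ennreal ennreal_mult mult.assoc)
        finally show ?thesis .
      qed
      have "(\<integral>\<^sup>+x. epowr (\<Sum>i\<in>J. a i x) m \<partial>lborel) \<le> (\<integral>\<^sup>+x. ennreal m * (\<Sum>j\<in>J. a j x * epowr (F j x) (m - 1)) \<partial>lborel)"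
        unfolding F_def by (intro nn_integral_mono sum_powr_tangent J m)
      also have "\<dots> = ennreal m * (\<Sum>j\<in>J. \<integral>\<^sup>+x. a j x * epowr (F j x) (m - 1) \<partial>lborel)"
        by (simp add: nn_integral_cmult nn_integral_sum)
      also have "\<dots> = ennreal m * (\<Sum>j\<in>J. \<integral>\<^sup>+x. u j x * nnconv (ball_kernel (r j)) (\<lambda>y. epowr (F j y) (m - 1)) x \<partial>lborel)"
        unfolding a_def[of j for j]
        by (subst nnconv_selfadjoint) (auto simp: ball_kernel_even)
      also have "\<dots> \<le> ennreal m * (\<Sum>j\<in>J. \<integral>\<^sup>+x. u j x * (ennreal (w * d powr (m - 1)) * epowr (G x) (m - 1)) \<partial>lborel)"
        by (intro mult_left_mono sum_mono nn_integral_mono conv) auto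
      also have "\<dots> = (\<integral>\<^sup>+x. ennreal m * (\<Sum>j\<in>J. u j x * (ennreal (w * d powr (m - 1)) * epowr (G x) (m - 1))) \<partial>lborel)"
        by (simp add: nn_integral_cmult nn_integral_sum)
      also have "\<dots> = (\<integral>\<^sup>+x. ennreal D * (U x * epowr (G x) (m - 1)) \<partial>lborel)"
        unfolding U_def D_def sum_distrib_right[symmetric] using m w d
        by (intro nn_integral_cong) (simp add: ennreal_mult mult_ac)
      \<comment> \<open>Young's inequality leaves half of the m-th power of \<open>G\<close>, which
        has the form of the left side with doubled radii.\<close>
      also have "\<dots> \<le> (\<integral>\<^sup>+x. ennreal C * epowr (U x) m + ennreal (1/2) * epowr (G x) m \<partial>lborel)"
        by (intro nn_integral_mono C)
      also have "\<dots> = ennreal C * (\<integral>\<^sup>+x. epowr (U x) m \<partial>lborel) + ennreal (1/2) * (\<integral>\<^sup>+x. epowr (G x) m \<partial>lborel)"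
        by (simp add: nn_integral_add nn_integral_cmult)
      finally have 1: "(\<integral>\<^sup>+x. epowr (\<Sum>i\<in>J. a i x) m \<partial>lborel)
          \<le> ennreal C * (\<integral>\<^sup>+x. epowr (U x) m \<partial>lborel) + ennreal (1/2) * (\<integral>\<^sup>+x. epowr (G x) m \<partial>lborel)" .
      have 2: "(\<integral>\<^sup>+x. epowr (G x) m \<partial>lborel) \<le> ennreal K * (\<integral>\<^sup>+x. epowr (U x) m \<partial>lborel)"
        using bd[unfolded dual_Doob_bound_def, THEN conjunct2, rule_format, of "\<lambda>i. 2 * r i" u] r anti
        unfolding G_def U_def by simp
      note 1
      also have "ennreal C * (\<integral>\<^sup>+x. epowr (U x) m \<partial>lborel) + ennreal (1/2) * (\<integral>\<^sup>+x. epowr (G x) m \<partial>lborel)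
          \<le> ennreal C * (\<integral>\<^sup>+x. epowr (U x) m \<partial>lborel) + ennreal (1/2) * (ennreal K * (\<integral>\<^sup>+x. epowr (U x) m \<partial>lborel))"
        by (intro add_left_mono mult_left_mono 2) auto
      also have "\<dots> = ennreal (C + K / 2) * (\<integral>\<^sup>+x. epowr (U x) m \<partial>lborel)"
      proof -
        have "ennreal (K / 2) = ennreal (1/2) * ennreal K"
          using K by (subst ennreal_mult[symmetric]) auto
        then have "ennreal (C + K / 2) = ennreal C + ennreal (1/2) * ennreal K"
          using C(1) K by simp
        then show ?thesis by (simp add: distrib_right mult.assoc)
      qed
      finally show "(\<integral>\<^sup>+x. epowr (\<Sum>i\<in>J. nnconv (ball_kernel (r i)) (u i) x) m \<partial>lborel)
        \<le> ennreal (C + K / 2) * (\<integral>\<^sup>+x. epowr (\<Sum>i\<in>J. u i x) m \<partial>lborel)"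
        unfolding a_def U_def .
    qed
  qed
qed

text \<open>The map from K to C + K/2 preserves admissibility and has the fixed point 2 C, so the
  infimum of the admissible constants is at most 2 C. As C depends only on m and the dimension, 2 C
  + 1 is admissible for every finite J and all radii.\<close>

lemma dual_Doob:
  assumes m: "1 < m"
  obtains K where "\<And>J. finite J \<Longrightarrow> dual_Doob_bound TYPE('a::euclidean_space) m (J::'i::linorder set) K"
proof -
  obtain C where C: "0 < C" "\<And>J K. finite J \<Longrightarrow> dual_Doob_bound TYPE('a::euclidean_space) m (J::'i set) K
      \<Longrightarrow> dual_Doob_bound TYPE('a) m J (C + K / 2)"
    using dual_Doob_iterate[OF m] by blast
  show ?thesis
  proof (rule that)
    fix J :: "'i set" assume J: "finite J"
    define V where "V = {K. dual_Doob_bound TYPE('a) m J K}"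
    have V: "V \<noteq> {}" using dual_Doob_apriori[OF m J] by (auto simp: V_def)
    have bdd: "bdd_below V" by (rule bdd_belowI[of _ 0]) (auto simp: V_def dual_Doob_bound_def)
    have "Inf V < 2 * C + 1"
    proof (rule ccontr)
      \<comment> \<open>Were the infimum above 2 C, an admissible K close to it would make C + K/2
        admissible and smaller than the infimum.\<close>
      assume "\<not> Inf V < 2 * C + 1"
      then have "Inf V < 2 * Inf V - 2 * C" using C by simp
      then obtain K where K: "K \<in> V" "K < 2 * Inf V - 2 * C" using cInf_lessD[OF V] by blast
      then have "C + K / 2 \<in> V" using C(2)[OF J] by (simp add: V_def)
      then have "Inf V \<le> C + K / 2" using bdd by (rule cInf_lower)
      then show False using K by simp
    qed
    then obtain K where K: "K \<in> V" "K < 2 * C + 1" using cInf_lessD[OF V] by blast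
    show "dual_Doob_bound TYPE('a) m J (2 * C + 1)"
      unfolding dual_Doob_bound_def
    proof (intro conjI allI impI)
      show "0 \<le> 2 * C + 1" using C by simp
      fix r :: "'i \<Rightarrow> real" and u :: "'i \<Rightarrow> 'a \<Rightarrow> ennreal"
      assume "(\<forall>i. 0 < r i) \<and> (\<forall>i j. i \<le> j \<longrightarrow> r j \<le> r i) \<and> (\<forall>i. u i \<in> borel_measurable borel)"
      then have "(\<integral>\<^sup>+x. epowr (\<Sum>i\<in>J. nnconv (ball_kernel (r i)) (u i) x) m \<partial>lborel)
         \<le> ennreal K * (\<integral>\<^sup>+x. epowr (\<Sum>i\<in>J. u i x) m \<partial>lborel)"
        using K(1) unfolding V_def dual_Doob_bound_def by blast
      also have "\<dots> \<le> ennreal (2 * C + 1) * (\<integral>\<^sup>+x. epowr (\<Sum>i\<in>J. u i x) m \<partial>lborel)"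
        using K(2) by (intro mult_right_mono ennreal_leI) auto
      finally show "(\<integral>\<^sup>+x. epowr (\<Sum>i\<in>J. nnconv (ball_kernel (r i)) (u i) x) m \<partial>lborel)
         \<le> ennreal (2 * C + 1) * (\<integral>\<^sup>+x. epowr (\<Sum>i\<in>J. u i x) m \<partial>lborel)" .
    qed
  qed
qed

section \<open>Polynomial weights and kernels of polynomial decay\<close>

text \<open>A negative exponent is used as well and then describes polynomial growth.\<close>

definition wt :: "real \<Rightarrow> 'a::euclidean_space \<Rightarrow> real" where
  "wt a x = (1 + norm x) powr (- a)"

lemma wt_pos: "0 < wt a x"
proof -
  have "1 + norm x \<noteq> 0" using norm_ge_zero[of x] by linarith
  then show ?thesis by (simp add: wt_def)
qed

lemma wt_nonneg [simp]: "0 \<le> wt a x"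
  using wt_pos[of a x] by simp

lemma wt_minus [simp]: "wt a (- x) = wt a x"
  by (simp add: wt_def)

lemma wt_add: "wt (a + b) x = wt a x * wt b x"
  by (simp add: wt_def powr_add[symmetric])

lemma wt_antimono: "a \<le> b \<Longrightarrow> wt b x \<le> wt a x"
  unfolding wt_def by (intro powr_mono) auto

lemma wt_le_1: "0 \<le> a \<Longrightarrow> wt a x \<le> 1"
  using wt_antimono[of 0 a x] by (simp add: wt_def add_nonneg_eq_0_iff)

lemma wt_measurable [measurable]: "wt a \<in> borel_measurable borel"
  unfolding wt_def by measurable

text \<open>From 1 + |x + y| \<le> (1 + |x|)(1 + |y|). This moves a weight from one point to another
  in the later convolution estimates.\<close>

lemma wt_Peetre:
  assumes "0 \<le> a"
  shows "wt a x * wt a y \<le> wt a (x + y)"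
proof -
  have "1 + norm (x + y) \<le> (1 + norm x) * (1 + norm y)"
    using norm_triangle_ineq[of x y] mult_nonneg_nonneg[OF norm_ge_zero[of x] norm_ge_zero[of y]]
    unfolding distrib_left distrib_right by linarith
  then have "((1 + norm x) * (1 + norm y)) powr (- a) \<le> (1 + norm (x + y)) powr (- a)"
    using assms add_pos_nonneg[of 1 "norm (x+y)"] by (intro powr_mono2') auto
  then show ?thesis by (simp add: wt_def powr_mult)
qed

text \<open>An L^1-normalised dilation, where l is the inverse of the length scale.\<close>

definition wt_kernel :: "real \<Rightarrow> real \<Rightarrow> 'a::euclidean_space \<Rightarrow> ennreal" where
  "wt_kernel N l x = ennreal (l ^ DIM('a) * wt N (l *\<^sub>R x))"

lemma wt_kernel_measurable [measurable]: "(wt_kernel N l :: 'a::euclidean_space \<Rightarrow> ennreal) \<in> borel_measurable borel"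
  unfolding wt_kernel_def by measurable

lemma wt_kernel_even: "wt_kernel N l (- x) = wt_kernel N l x"
  by (simp add: wt_kernel_def)

lemma nn_integral_wt_kernel_scale:
  assumes "0 < l"
  shows "(\<integral>\<^sup>+x. wt_kernel N l (x::'a::euclidean_space) \<partial>lborel) = (\<integral>\<^sup>+x. ennreal (wt N (x::'a)) \<partial>lborel)"
proof -
  have "(\<integral>\<^sup>+x. ennreal (wt N (x::'a)) \<partial>lborel) = ennreal (l ^ DIM('a)) * (\<integral>\<^sup>+x. ennreal (wt N (l *\<^sub>R (x::'a))) \<partial>lborel)"
    using nn_integral_lborel_affine[of "\<lambda>x::'a. ennreal (wt N x)" l 0] assms by simp
  also have "\<dots> = (\<integral>\<^sup>+x. wt_kernel N l (x::'a) \<partial>lborel)"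
    unfolding wt_kernel_def using assms by (subst nn_integral_cmult[symmetric]) (auto simp: ennreal_mult)
  finally show ?thesis ..
qed

text \<open>On the shell where |l x| is comparable to 2^k the weight is at most 2^N 2^(-k N), and
  passing to the normalised ball of radius 2^k / l costs a factor 2^(k n).\<close>

definition wt_coeff :: "real \<Rightarrow> nat \<Rightarrow> nat \<Rightarrow> real" where
  "wt_coeff N n k = 2 powr N * (2 powr (real n - N)) ^ k"

lemma wt_coeff_nonneg [simp]: "0 \<le> wt_coeff N n k"
  by (simp add: wt_coeff_def)

lemma wt_coeff_summable: "real n < N \<Longrightarrow> summable (wt_coeff N n)"
  unfolding wt_coeff_def by (intro summable_mult summable_geometric) (auto simp: powr_less_one)

lemma wt_kernel_le_ball_kernels:
  fixes x :: "'a::euclidean_space"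
  assumes "0 < l" "0 \<le> N"
  shows "wt_kernel N l x \<le> (\<Sum>k. ennreal (wt_coeff N DIM('a) k) * ball_kernel (2 ^ k / l) x)"
proof -
  have "\<exists>k::nat. norm (l *\<^sub>R x) \<le> 2 ^ k"
    using real_arch_pow[of 2 "norm (l *\<^sub>R x)"] by (auto intro: less_imp_le)
  \<comment> \<open>Minimality places l x outside the ball of radius 2^(k-1) when k > 0, so this
    single term of the series already dominates the kernel.\<close>
  define k where "k = (LEAST k::nat. norm (l *\<^sub>R x) \<le> 2 ^ k)"
  have k: "norm (l *\<^sub>R x) \<le> 2 ^ k"
    unfolding k_def by (rule LeastI_ex) fact
  have "wt N (l *\<^sub>R x) \<le> 2 powr N * 2 powr (- (real k * N))"
  proof (cases k)
    case 0
    then show ?thesis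
      using wt_le_1[OF assms(2), of "l *\<^sub>R x"] ge_one_powr_ge_zero[of 2 N] assms by simp
  next
    case (Suc j)
    have "\<not> norm (l *\<^sub>R x) \<le> 2 ^ j"
      using Suc not_less_Least[of j "\<lambda>k. norm (l *\<^sub>R x) \<le> 2 ^ k"] unfolding k_def by auto
    then have "2 ^ j \<le> 1 + norm (l *\<^sub>R x)" by simp
    then have "wt N (l *\<^sub>R x) \<le> (2 ^ j) powr (- N)"
      unfolding wt_def using assms by (intro powr_mono2') auto
    also have "\<dots> = 2 powr N * 2 powr (- (real k * N))"
      using Suc by (simp add: powr_realpow[symmetric] powr_powr powr_add[symmetric] algebra_simps)
    finally show ?thesis .
  qed
  then have "l ^ DIM('a) * wt N (l *\<^sub>R x) \<le> l ^ DIM('a) * (2 powr N * 2 powr (- (real k * N)))"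
    using assms by (intro mult_left_mono) auto
  also have "\<dots> = wt_coeff N DIM('a) k * (1 / (2 ^ k / l) ^ DIM('a))"
    using assms by (simp add: wt_coeff_def power_divide powr_realpow[symmetric] powr_powr powr_diff powr_minus algebra_simps field_simps powr_add[symmetric])
  finally have "wt_kernel N l x \<le> ennreal (wt_coeff N DIM('a) k) * ball_kernel (2 ^ k / l) x"
    unfolding wt_kernel_def using k assms
    by (auto simp: ball_kernel_def indicator_def ennreal_mult[symmetric] field_simps intro!: ennreal_leI)
  also have "\<dots> \<le> (\<Sum>k. ennreal (wt_coeff N DIM('a) k) * ball_kernel (2 ^ k / l) x)"
    using sum_le_suminf[of "\<lambda>k. ennreal (wt_coeff N DIM('a) k) * ball_kernel (2 ^ k / l) x" "{k}"] by simp
  finally show ?thesis .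
qed

lemma nnconv_wt_kernel_le:
  fixes x :: "'a::euclidean_space"
  assumes "0 < l" "0 \<le> N" and [measurable]: "u \<in> borel_measurable borel"
  shows "nnconv (wt_kernel N l) u x \<le> (\<Sum>k. ennreal (wt_coeff N DIM('a) k) * nnconv (ball_kernel (2 ^ k / l)) u x)"
proof -
  have "nnconv (wt_kernel N l) u x \<le> (\<integral>\<^sup>+y. (\<Sum>k. ennreal (wt_coeff N DIM('a) k) * (ball_kernel (2 ^ k / l) (x - y) * u y)) \<partial>lborel)"
    unfolding nnconv_def
  proof (intro nn_integral_mono)
    fix y
    have "wt_kernel N l (x - y) * u y \<le> (\<Sum>k. ennreal (wt_coeff N DIM('a) k) * ball_kernel (2 ^ k / l) (x - y)) * u y"
      by (intro mult_right_mono wt_kernel_le_ball_kernels assms) auto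
    also have "\<dots> = (\<Sum>k. ennreal (wt_coeff N DIM('a) k) * (ball_kernel (2 ^ k / l) (x - y) * u y))"
      by (subst ennreal_suminf_multc[symmetric]) (simp add: mult.assoc)
    finally show "wt_kernel N l (x - y) * u y \<le> \<dots>" .
  qed
  also have "\<dots> = (\<Sum>k. ennreal (wt_coeff N DIM('a) k) * nnconv (ball_kernel (2 ^ k / l)) u x)"
    unfolding nnconv_def by (simp add: nn_integral_suminf nn_integral_cmult)
  finally show ?thesis .
qed

text \<open>Domination by ball kernels of radii 2^k reduces the integral to a geometric series and
  takes the place of polar coordinates.\<close>

lemma nn_integral_wt_finite:
  assumes "real DIM('a::euclidean_space) < N"
  shows "(\<integral>\<^sup>+x. ennreal (wt N (x::'a)) \<partial>lborel) < \<infinity>"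
proof -
  have "(\<integral>\<^sup>+x. ennreal (wt N (x::'a)) \<partial>lborel) = (\<integral>\<^sup>+x. wt_kernel N 1 (x::'a) \<partial>lborel)"
    by (simp add: wt_kernel_def)
  also have "\<dots> \<le> (\<integral>\<^sup>+x. (\<Sum>k. ennreal (wt_coeff N DIM('a) k) * ball_kernel (2 ^ k / 1) (x::'a)) \<partial>lborel)"
    using assms by (intro nn_integral_mono wt_kernel_le_ball_kernels) auto
  also have "\<dots> = (\<Sum>k. ennreal (wt_coeff N DIM('a) k) * ennreal (unit_vol TYPE('a)))"
    by (simp add: nn_integral_suminf nn_integral_cmult nn_integral_ball_kernel)
  also have "\<dots> = ennreal (suminf (wt_coeff N DIM('a))) * ennreal (unit_vol TYPE('a))"
    using assms by (simp add: ennreal_suminf_multc suminf_ennreal2 wt_coeff_summable)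
  also have "\<dots> < \<infinity>" by (simp add: ennreal_mult_less_top)
  finally show ?thesis .
qed

text \<open>As a Bochner integral this is 0 when the weight is not integrable, so it is the true
  mass only for N > n.\<close>

definition wt_int :: "'a::euclidean_space itself \<Rightarrow> real \<Rightarrow> real" where
  "wt_int _ N = (\<integral>x. wt N (x::'a) \<partial>lborel)"

lemma integrable_wt: "real DIM('a::euclidean_space) < N \<Longrightarrow> integrable lborel (wt N :: 'a \<Rightarrow> real)"
  using nn_integral_wt_finite[where 'a='a, of N] by (intro integrableI_nonneg) auto

lemma nn_integral_wt:
  "real DIM('a::euclidean_space) < N \<Longrightarrow> (\<integral>\<^sup>+x. ennreal (wt N (x::'a)) \<partial>lborel) = ennreal (wt_int TYPE('a) N)"
  unfolding wt_int_def by (rule nn_integral_eq_integral) (auto intro: integrable_wt)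

lemma nn_integral_wt_kernel:
  "0 < l \<Longrightarrow> real DIM('a::euclidean_space) < N \<Longrightarrow> (\<integral>\<^sup>+x. wt_kernel N l (x::'a) \<partial>lborel) = ennreal (wt_int TYPE('a) N)"
  by (simp add: nn_integral_wt_kernel_scale nn_integral_wt)

lemma wt_int_nonneg [simp]: "0 \<le> wt_int TYPE('a::euclidean_space) N"
  by (simp add: wt_int_def)

text \<open>For fixed k the balls of radius \<open>2 ^ k / l i\<close> have decreasing radii, so the
  bound for ball averages applies with a constant independent of k; Jensen's inequality for the
  summable coefficients adds up the contributions. For m = 1 only the mass of the kernels
  matters.\<close>

lemma dual_Doob_wt_kernel:
  assumes m: "1 \<le> m" and N: "real DIM('a::euclidean_space) < N"
  obtains K where "0 \<le> K" "\<And>(J::'i::linorder set) (l::'i \<Rightarrow> real) (u::'i \<Rightarrow> 'a \<Rightarrow> ennreal). finite J \<Longrightarrow> (\<And>i. 0 < l i) \<Longrightarrow>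
    (\<And>i j. i \<le> j \<Longrightarrow> l i \<le> l j) \<Longrightarrow> (\<And>i. u i \<in> borel_measurable borel) \<Longrightarrow>
    (\<integral>\<^sup>+x. epowr (\<Sum>i\<in>J. nnconv (wt_kernel N (l i)) (u i) x) m \<partial>lborel) \<le> ennreal K * (\<integral>\<^sup>+x. epowr (\<Sum>i\<in>J. u i x) m \<partial>lborel)"
proof (cases "m = 1")
  case True
  show ?thesis
  proof (rule that[of "wt_int TYPE('a) N"])
    fix J :: "'i set" and l :: "'i \<Rightarrow> real" and u :: "'i \<Rightarrow> 'a \<Rightarrow> ennreal"
    assume J: "finite J" and l: "\<And>i. 0 < l i" and [measurable]: "\<And>i. u i \<in> borel_measurable borel"
    show "(\<integral>\<^sup>+x. epowr (\<Sum>i\<in>J. nnconv (wt_kernel N (l i)) (u i) x) m \<partial>lborel)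
       \<le> ennreal (wt_int TYPE('a) N) * (\<integral>\<^sup>+x. epowr (\<Sum>i\<in>J. u i x) m \<partial>lborel)"
      by (simp add: True nn_integral_sum nn_integral_nnconv nn_integral_wt_kernel l N sum_distrib_left)
  qed simp
next
  case False
  then have m1: "1 < m" using m by simp
  obtain K where K: "\<And>J. finite J \<Longrightarrow> dual_Doob_bound TYPE('a::euclidean_space) m (J::'i set) K"
    using dual_Doob[OF m1] by blast
  have K0: "0 \<le> K" using K[of "{}"] by (simp add: dual_Doob_bound_def)
  define c where "c = wt_coeff N DIM('a)"
  define cs where "cs = suminf c"
  have sc: "summable c" unfolding c_def by (rule wt_coeff_summable[OF N])
  have c0: "0 < c 0" "\<And>k. 0 \<le> c k" by (auto simp: c_def wt_coeff_def)
  have cs: "0 < cs" unfolding cs_def using c0 sc by (intro suminf_pos2[of c 0]) auto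
  show ?thesis
  proof (rule that[of "cs powr (m - 1) * (cs * K)"])
    show "0 \<le> cs powr (m - 1) * (cs * K)" using cs K0 by simp
    fix J :: "'i set" and l :: "'i \<Rightarrow> real" and u :: "'i \<Rightarrow> 'a \<Rightarrow> ennreal"
    assume J: "finite J" and l: "\<And>i. 0 < l i" and l2: "\<And>i j. i \<le> j \<Longrightarrow> l i \<le> l j"
      and [measurable]: "\<And>i. u i \<in> borel_measurable borel"
    define Z where "Z k x = (\<Sum>i\<in>J. nnconv (ball_kernel (2 ^ k / l i)) (u i) x)" for k :: nat and x
    have [measurable]: "Z k \<in> borel_measurable borel" for k unfolding Z_def by measurable
    define X where "X = (\<integral>\<^sup>+x. epowr (\<Sum>i\<in>J. u i x) m \<partial>lborel)"
    have "(\<integral>\<^sup>+x. epowr (\<Sum>i\<in>J. nnconv (wt_kernel N (l i)) (u i) x) m \<partial>lborel)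
      \<le> (\<integral>\<^sup>+x. ennreal (cs powr (m - 1)) * (\<Sum>k. ennreal (c k) * epowr (Z k x) m) \<partial>lborel)"
    proof (rule nn_integral_mono)
      fix x
      have "(\<Sum>i\<in>J. nnconv (wt_kernel N (l i)) (u i) x) \<le> (\<Sum>i\<in>J. \<Sum>k. ennreal (c k) * nnconv (ball_kernel (2 ^ k / l i)) (u i) x)"
        unfolding c_def using N by (intro sum_mono nnconv_wt_kernel_le l) auto
      also have "\<dots> = (\<Sum>k. \<Sum>i\<in>J. ennreal (c k) * nnconv (ball_kernel (2 ^ k / l i)) (u i) x)"
        by (rule suminf_sum[symmetric]) auto
      also have "\<dots> = (\<integral>\<^sup>+k. ennreal (c k) * Z k x \<partial>count_space UNIV)"
        by (simp add: nn_integral_count_space_nat Z_def sum_distrib_left)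
      finally have "epowr (\<Sum>i\<in>J. nnconv (wt_kernel N (l i)) (u i) x) m \<le> epowr (\<integral>\<^sup>+k. ennreal (c k) * Z k x \<partial>count_space UNIV) m"
        using m by (intro epowr_mono) auto
      also have "\<dots> \<le> ennreal (cs powr (m - 1)) * (\<integral>\<^sup>+k. ennreal (c k) * epowr (Z k x) m \<partial>count_space UNIV)"
        by (rule ennreal_Jensen_weight) (use m cs sc c0 in \<open>auto simp: nn_integral_count_space_nat cs_def suminf_ennreal2\<close>)
      finally show "epowr (\<Sum>i\<in>J. nnconv (wt_kernel N (l i)) (u i) x) m \<le> ennreal (cs powr (m - 1)) * (\<Sum>k. ennreal (c k) * epowr (Z k x) m)"
        by (simp add: nn_integral_count_space_nat)
    qed
    also have "\<dots> = ennreal (cs powr (m - 1)) * (\<Sum>k. ennreal (c k) * (\<integral>\<^sup>+x. epowr (Z k x) m \<partial>lborel))"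
      by (simp add: nn_integral_cmult nn_integral_suminf)
    also have "\<dots> \<le> ennreal (cs powr (m - 1)) * (\<Sum>k. ennreal (c k) * (ennreal K * X))"
    proof (intro mult_left_mono suminf_le)
      fix k
      show "(\<integral>\<^sup>+x. epowr (Z k x) m \<partial>lborel) \<le> ennreal K * X"
        using K[OF J, unfolded dual_Doob_bound_def, THEN conjunct2, rule_format, of "\<lambda>i. 2 ^ k / l i" u] l l2
        unfolding Z_def X_def by (simp add: frac_le)
    qed auto
    also have "\<dots> = ennreal (cs powr (m - 1) * (cs * K)) * X"
      using cs K0 sc c0 by (simp add: ennreal_suminf_multc suminf_ennreal2 cs_def ennreal_mult mult.assoc)
    finally show "(\<integral>\<^sup>+x. epowr (\<Sum>i\<in>J. nnconv (wt_kernel N (l i)) (u i) x) m \<partial>lborel)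
       \<le> ennreal (cs powr (m - 1) * (cs * K)) * (\<integral>\<^sup>+x. epowr (\<Sum>i\<in>J. u i x) m \<partial>lborel)"
      unfolding X_def .
  qed
qed

section \<open>A vector-valued convolution inequality\<close>

lemma Holder_sum:
  fixes g v :: "'i \<Rightarrow> ennreal"
  assumes J: "finite J" and P: "1 < P" "1 < P'" "1 / P + 1 / P' = 1"
  shows "(\<Sum>j\<in>J. g j * v j) \<le> epowr (\<Sum>j\<in>J. epowr (g j) P) (1 / P) * epowr (\<Sum>j\<in>J. epowr (v j) P') (1 / P')"
proof -
  define A where "A = (\<Sum>j\<in>J. epowr (g j) P)"
  define B where "B = (\<Sum>j\<in>J. epowr (v j) P')"
  consider "A = 0 \<or> B = 0" | "A \<noteq> 0" "B \<noteq> 0" "A = top \<or> B = top" | "A \<noteq> 0" "B \<noteq> 0" "A \<noteq> top" "B \<noteq> top"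
    by blast
  then show ?thesis
  proof cases
    case 1
    then have "g j * v j = 0" if "j \<in> J" for j
      using that J by (auto simp: A_def B_def sum_eq_0_iff)
    then have "(\<Sum>j\<in>J. g j * v j) = 0" by (intro sum.neutral) blast
    then show ?thesis by simp
  next
    case 2
    then have "epowr A (1 / P) * epowr B (1 / P') = top"
      by (auto simp: ennreal_mult_eq_top_iff)
    then show ?thesis unfolding A_def B_def by simp
  next
    case 3
    have fin: "g j \<noteq> top" "v j \<noteq> top" if "j \<in> J" for j
      using 3 that J by (auto simp: A_def B_def)
    define x where "x j = enn2real (g j)" for j
    define y where "y j = enn2real (v j)" for j
    have xy: "g j = ennreal (x j)" "v j = ennreal (y j)" "0 \<le> x j" "0 \<le> y j" if "j \<in> J" for j
      using fin[OF that] by (auto simp: x_def y_def less_top)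
    define a where "a = (\<Sum>j\<in>J. x j powr P)"
    define b where "b = (\<Sum>j\<in>J. y j powr P')"
    have A: "A = ennreal a" unfolding A_def a_def using xy by (simp add: epowr_ennreal sum_ennreal)
    have B: "B = ennreal b" unfolding B_def b_def using xy by (simp add: epowr_ennreal sum_ennreal)
    have "0 \<le> a" "0 \<le> b" by (auto simp: a_def b_def intro!: sum_nonneg)
    then have ab: "0 < a" "0 < b" using 3 A B by (auto simp: less_le)
    define \<alpha> where "\<alpha> = a powr (1 / P)"
    define \<beta> where "\<beta> = b powr (1 / P')"
    have \<alpha>: "0 < \<alpha>" "0 < \<beta>" "\<alpha> powr P = a" "\<beta> powr P' = b" using ab P by (auto simp: \<alpha>_def \<beta>_def powr_powr)
    have "(\<Sum>j\<in>J. x j * y j) = (\<Sum>j\<in>J. \<alpha> * \<beta> * ((x j / \<alpha>) * (y j / \<beta>)))"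
      using \<alpha> by (simp add: field_simps)
    also have "\<dots> \<le> (\<Sum>j\<in>J. \<alpha> * \<beta> * ((x j / \<alpha>) powr P / P + (y j / \<beta>) powr P' / P'))"
      using \<alpha> xy P by (intro sum_mono mult_left_mono Youngs_inequality) auto
    also have "\<dots> = (\<Sum>j\<in>J. \<alpha> * \<beta> * (x j powr P / (a * P) + y j powr P' / (b * P')))"
      using \<alpha> xy by (intro sum.cong) (auto simp: powr_divide)
    also have "\<dots> = \<alpha> * \<beta> * (a / (a * P) + b / (b * P'))"
      unfolding a_def b_def sum_divide_distrib sum_distrib_left[symmetric] sum.distrib[symmetric] ..
    also have "\<dots> = \<alpha> * \<beta>" using ab P by simp
    finally have "ennreal (\<Sum>j\<in>J. x j * y j) \<le> ennreal (\<alpha> * \<beta>)" by (rule ennreal_leI)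
    also have "ennreal (\<Sum>j\<in>J. x j * y j) = (\<Sum>j\<in>J. g j * v j)"
      using xy by (subst sum_ennreal[symmetric]) (auto simp: ennreal_mult intro!: sum.cong)
    also have "ennreal (\<alpha> * \<beta>) = epowr A (1 / P) * epowr B (1 / P')"
      using A B \<alpha> ab by (simp add: epowr_ennreal \<alpha>_def \<beta>_def ennreal_mult)
    finally show ?thesis unfolding A_def B_def .
  qed
qed

text \<open>Young's inequality for a/d and d b, where d^P' = e; the factors 1/P and 1/P' are at most
  1 and are discarded.\<close>

lemma Young_eps:
  fixes P P' :: real
  assumes P: "1 < P" "1 < P'" "1 / P + 1 / P' = 1" and e: "0 < e"
  obtains C where "0 < C" "\<And>a b. a * b \<le> ennreal C * epowr a P + ennreal e * epowr b P'"
proof -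
  define d where "d = e powr (1 / P')"
  have d: "0 < d" "d powr P' = e" using e P by (auto simp: d_def powr_powr)
  show ?thesis
  proof (rule that[of "(1 / d) powr P"])
    show "0 < (1 / d) powr P" using d by simp
    fix a b
    show "a * b \<le> ennreal ((1 / d) powr P) * epowr a P + ennreal e * epowr b P'"
    proof (cases a; cases b)
      fix x y assume xy: "a = ennreal x" "0 \<le> x" "b = ennreal y" "0 \<le> y"
      have "x * y = (1 / d * x) * (d * y)" using d by simp
      also have "\<dots> \<le> (1 / d * x) powr P / P + (d * y) powr P' / P'"
        using d xy P by (intro Youngs_inequality) auto
      also have "\<dots> \<le> (1 / d * x) powr P / 1 + (d * y) powr P' / 1"
        using P by (intro add_mono divide_left_mono) auto
      also have "\<dots> = (1 / d) powr P * x powr P + e * y powr P'"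
        using d xy by (simp only: powr_mult div_by_1 zero_le_divide_1_iff less_imp_le)
      finally show ?thesis using xy e
        by (auto simp: epowr_ennreal ennreal_mult[symmetric] ennreal_plus[symmetric] simp del: ennreal_plus intro!: ennreal_leI)
    qed (use d e in \<open>auto simp: ennreal_mult_top top_unique ennreal_add_eq_top\<close>)
  qed
qed

text \<open>With m = P/Q both integrals are P-th powers of L^P(l^Q) norms, so K bounds the P-th
  power of an operator norm. It may depend neither on the finite set J nor on the scales l.\<close>

definition vv_bound :: "'a::euclidean_space itself \<Rightarrow> real \<Rightarrow> real \<Rightarrow> real \<Rightarrow> real \<Rightarrow> bool" where
  "vv_bound _ N Q m K \<longleftrightarrow> 0 \<le> K \<and> (\<forall>J (l::int \<Rightarrow> real) (g::int \<Rightarrow> 'a \<Rightarrow> ennreal). finite J \<longrightarrow> (\<forall>i. 0 < l i) \<longrightarrow>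
    (\<forall>i j. i \<le> j \<longrightarrow> l i \<le> l j) \<longrightarrow> (\<forall>i. g i \<in> borel_measurable borel) \<longrightarrow>
    (\<integral>\<^sup>+x. epowr (\<Sum>i\<in>J. epowr (nnconv (wt_kernel N (l i)) (g i) x) Q) m \<partial>lborel)
       \<le> ennreal K * (\<integral>\<^sup>+x. epowr (\<Sum>i\<in>J. epowr (g i x) Q) m \<partial>lborel))"

text \<open>Jensen's inequality moves the power Q inside the convolution, after which the estimate
  for sums applies to the functions g_i^Q with the exponent m = P/Q.\<close>

lemma vv_bound_ge:
  assumes m: "1 \<le> m" and Q: "1 \<le> Q" and N: "real DIM('a::euclidean_space) < N"
  shows "\<exists>K. vv_bound TYPE('a) N Q m K"
proof -
  obtain K where K: "0 \<le> K" "\<And>(J::int set) (l::int \<Rightarrow> real) (u::int \<Rightarrow> 'a \<Rightarrow> ennreal). finite J \<Longrightarrow> (\<And>i. 0 < l i) \<Longrightarrow>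
    (\<And>i j. i \<le> j \<Longrightarrow> l i \<le> l j) \<Longrightarrow> (\<And>i. u i \<in> borel_measurable borel) \<Longrightarrow>
    (\<integral>\<^sup>+x. epowr (\<Sum>i\<in>J. nnconv (wt_kernel N (l i)) (u i) x) m \<partial>lborel) \<le> ennreal K * (\<integral>\<^sup>+x. epowr (\<Sum>i\<in>J. u i x) m \<partial>lborel)"
    using dual_Doob_wt_kernel[where 'i=int, OF m N] by blast
  define w where "w = wt_int TYPE('a) N + 1"
  have w: "0 < w" "wt_int TYPE('a) N \<le> w" by (auto simp: w_def add_nonneg_pos)
  define c where "c = (w powr (Q - 1)) powr m"
  have "vv_bound TYPE('a) N Q m (c * K)"
    unfolding vv_bound_def
  proof (intro conjI allI impI)
    show "0 \<le> c * K" using K by (simp add: c_def)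
    fix J :: "int set" and l :: "int \<Rightarrow> real" and g :: "int \<Rightarrow> 'a \<Rightarrow> ennreal"
    assume J: "finite J" and l: "\<forall>i. 0 < l i" "\<forall>i j. i \<le> j \<longrightarrow> l i \<le> l j" and "\<forall>i. g i \<in> borel_measurable borel"
    then have [measurable]: "\<And>i. g i \<in> borel_measurable borel" by auto
    have "(\<integral>\<^sup>+x. epowr (\<Sum>i\<in>J. epowr (nnconv (wt_kernel N (l i)) (g i) x) Q) m \<partial>lborel)
      \<le> (\<integral>\<^sup>+x. epowr (\<Sum>i\<in>J. ennreal (w powr (Q - 1)) * nnconv (wt_kernel N (l i)) (\<lambda>y. epowr (g i y) Q) x) m \<partial>lborel)"
      by (intro nn_integral_mono epowr_mono sum_mono nnconv_powr_le)
         (use l Q m w N in \<open>auto simp: nn_integral_wt_kernel\<close>)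
    also have "\<dots> = (\<integral>\<^sup>+x. ennreal c * epowr (\<Sum>i\<in>J. nnconv (wt_kernel N (l i)) (\<lambda>y. epowr (g i y) Q) x) m \<partial>lborel)"
      by (simp add: sum_distrib_left[symmetric] epowr_mult epowr_ennreal c_def)
    also have "\<dots> = ennreal c * (\<integral>\<^sup>+x. epowr (\<Sum>i\<in>J. nnconv (wt_kernel N (l i)) (\<lambda>y. epowr (g i y) Q) x) m \<partial>lborel)"
      by (rule nn_integral_cmult) measurable
    also have "\<dots> \<le> ennreal c * (ennreal K * (\<integral>\<^sup>+x. epowr (\<Sum>i\<in>J. epowr (g i x) Q) m \<partial>lborel))"
      using l J by (intro mult_left_mono K(2)) auto
    also have "\<dots> = ennreal (c * K) * (\<integral>\<^sup>+x. epowr (\<Sum>i\<in>J. epowr (g i x) Q) m \<partial>lborel)"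
      using K by (simp add: ennreal_mult c_def mult.assoc)
    finally show "(\<integral>\<^sup>+x. epowr (\<Sum>i\<in>J. epowr (nnconv (wt_kernel N (l i)) (g i) x) Q) m \<partial>lborel)
       \<le> ennreal (c * K) * (\<integral>\<^sup>+x. epowr (\<Sum>i\<in>J. epowr (g i x) Q) m \<partial>lborel)" .
  qed
  then show ?thesis ..
qed

text \<open>
  The dual function is \<open>h\<^sub>i = G\<^sub>i\<^sup>Q\<^sup>-\<^sup>1 S\<^sup>\<alpha>\<^sup>-\<^sup>1\<close> with \<open>S = \<Sum> G\<^sub>i\<^sup>Q\<close> and \<open>\<alpha> = P/Q < 1\<close>. Here \<^const>\<open>epowr\<close> is used with a
  negative exponent: it sends 0 to 0, which is harmless since \<open>G\<^sub>i = 0\<close> there, and \<open>\<infinity>\<close> to \<open>\<infinity>\<close>, which only happens on a null set.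
\<close>

lemma vv_bound_less:
  assumes P: "1 < P" and PQ: "P < Q" and N: "real DIM('a::euclidean_space) < N"
  shows "\<exists>K. vv_bound TYPE('a) N Q (P / Q) K"
proof -
  define P' where "P' = P / (P - 1)"
  define Q' where "Q' = Q / (Q - 1)"
  have P': "1 < P'" "1 / P + 1 / P' = 1" using P by (auto simp: P'_def field_simps)
  have Q': "1 < Q" "1 < Q'" "1 / Q + 1 / Q' = 1" using P PQ by (auto simp: Q'_def field_simps)
  define \<alpha> where "\<alpha> = P / Q"
  have \<alpha>: "0 < \<alpha>" "\<alpha> \<le> 1" using P PQ by (auto simp: \<alpha>_def)
  \<comment> \<open>For P < Q the conjugate exponents satisfy Q' \<le> P', so the dual space
    L^P'(l^Q') falls under the case already settled.\<close>
  define m where "m = P' / Q'"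
  have "Q / (Q - 1) \<le> P / (P - 1)" using P PQ by (simp add: field_simps)
  then have "Q' \<le> P'" unfolding P'_def Q'_def .
  then have m: "1 \<le> m" using Q' by (simp add: m_def le_divide_eq)
  obtain K1 where "vv_bound TYPE('a) N Q' m K1" using vv_bound_ge[OF m _ N, of Q'] Q' by auto
  then have K1: "0 \<le> K1" and K1b: "\<And>J (l::int \<Rightarrow> real) (g::int \<Rightarrow> 'a \<Rightarrow> ennreal). finite J \<Longrightarrow> (\<forall>i. 0 < l i) \<Longrightarrow>
    (\<forall>i j. i \<le> j \<longrightarrow> l i \<le> l j) \<Longrightarrow> (\<forall>i. g i \<in> borel_measurable borel) \<Longrightarrow>
    (\<integral>\<^sup>+x. epowr (\<Sum>i\<in>J. epowr (nnconv (wt_kernel N (l i)) (g i) x) Q') m \<partial>lborel)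
       \<le> ennreal K1 * (\<integral>\<^sup>+x. epowr (\<Sum>i\<in>J. epowr (g i x) Q') m \<partial>lborel)"
    unfolding vv_bound_def by blast+
  \<comment> \<open>Small enough that the term e K1 X returned by duality is at most X/2 and can be
    absorbed.\<close>
  define e where "e = 1 / (2 * (K1 + 1))"
  have e: "0 < e" "e * K1 \<le> 1/2" using K1 by (auto simp: e_def field_simps)
  obtain C where C: "0 < C" "\<And>a b. a * b \<le> ennreal C * epowr a P + ennreal e * epowr b P'"
    using Young_eps[OF P P' e(1)] by blast
  define w where "w = wt_int TYPE('a) N + 1"
  have w: "0 < w" "wt_int TYPE('a) N \<le> w" by (auto simp: w_def add_nonneg_pos)
  have "vv_bound TYPE('a) N Q \<alpha> (2 * C)"
    unfolding vv_bound_def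
  proof (intro conjI allI impI)
    show "0 \<le> 2 * C" using C by simp
    fix J :: "int set" and l :: "int \<Rightarrow> real" and g :: "int \<Rightarrow> 'a \<Rightarrow> ennreal"
    assume J: "finite J" and l: "\<forall>i. 0 < l i" "\<forall>i j. i \<le> j \<longrightarrow> l i \<le> l j" and gm: "\<forall>i. g i \<in> borel_measurable borel"
    then have [measurable]: "\<And>i. g i \<in> borel_measurable borel" by auto
    define G where "G i = nnconv (wt_kernel N (l i)) (g i)" for i
    have [measurable]: "G i \<in> borel_measurable borel" for i unfolding G_def by measurable
    define S where "S x = (\<Sum>i\<in>J. epowr (G i x) Q)" for x
    have [measurable]: "S \<in> borel_measurable borel" unfolding S_def by measurable
    define X where "X = (\<integral>\<^sup>+x. epowr (S x) \<alpha> \<partial>lborel)"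
    define Y where "Y = (\<integral>\<^sup>+x. epowr (\<Sum>i\<in>J. epowr (g i x) Q) \<alpha> \<partial>lborel)"
    \<comment> \<open>Absorption requires X to be finite. As \<alpha> \<le> 1, the power S^\<alpha>
      is at most the sum of the G_i^P, and each single convolution is bounded on L^P; dependence on
      J does no harm here.\<close>
    have XY: "X < \<infinity>" if "Y < \<infinity>"
    proof -
      have "X \<le> (\<integral>\<^sup>+x. (\<Sum>i\<in>J. ennreal (w powr (P - 1)) * nnconv (wt_kernel N (l i)) (\<lambda>y. epowr (g i y) P) x) \<partial>lborel)"
        unfolding X_def
      proof (rule nn_integral_mono)
        fix x
        have "epowr (S x) \<alpha> \<le> (\<Sum>i\<in>J. epowr (epowr (G i x) Q) \<alpha>)"
          unfolding S_def by (rule epowr_sum_le[OF \<alpha> J])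
        also have "\<dots> = (\<Sum>i\<in>J. epowr (G i x) P)"
          using P PQ by (simp add: epowr_epowr \<alpha>_def)
        also have "\<dots> \<le> (\<Sum>i\<in>J. ennreal (w powr (P - 1)) * nnconv (wt_kernel N (l i)) (\<lambda>y. epowr (g i y) P) x)"
          unfolding G_def by (intro sum_mono nnconv_powr_le) (use l P w N in \<open>auto simp: nn_integral_wt_kernel\<close>)
        finally show "epowr (S x) \<alpha> \<le> \<dots>" .
      qed
      also have "\<dots> = (\<Sum>i\<in>J. ennreal (w powr (P - 1)) * (ennreal (wt_int TYPE('a) N) * (\<integral>\<^sup>+x. epowr (g i x) P \<partial>lborel)))"
        using l N by (simp add: nn_integral_sum nn_integral_cmult nn_integral_nnconv nn_integral_wt_kernel)
      also have "\<dots> < \<infinity>"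
      proof -
        have "(\<integral>\<^sup>+x. epowr (g i x) P \<partial>lborel) < \<infinity>" if "i \<in> J" for i
        proof -
          have "(\<integral>\<^sup>+x. epowr (g i x) P \<partial>lborel) = (\<integral>\<^sup>+x. epowr (epowr (g i x) Q) \<alpha> \<partial>lborel)"
            using P PQ by (simp add: epowr_epowr \<alpha>_def)
          also have "\<dots> \<le> Y"
            unfolding Y_def using J that \<alpha> by (intro nn_integral_mono epowr_mono member_le_sum) auto
          finally show ?thesis using \<open>Y < \<infinity>\<close> by (simp add: le_less_trans)
        qed
        then show ?thesis using J by (auto simp: ennreal_mult_less_top)
      qed
      finally show ?thesis .
    qed
    define h where "h i x = epowr (G i x) (Q - 1) * epowr (S x) (\<alpha> - 1)" for i x
    have [measurable]: "h i \<in> borel_measurable borel" for i unfolding h_def by measurable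
    define v where "v i = nnconv (wt_kernel N (l i)) (h i)" for i
    have [measurable]: "v i \<in> borel_measurable borel" for i unfolding v_def by measurable
    have Gh: "(\<Sum>i\<in>J. G i x * h i x) = epowr (S x) \<alpha>" for x
    proof -
      have "(\<Sum>i\<in>J. G i x * h i x) = (\<Sum>i\<in>J. epowr (G i x) Q * epowr (S x) (\<alpha> - 1))"
        using epowr_add[of "G i x" 1 "Q - 1" for i] by (simp add: h_def mult.assoc)
      also have "\<dots> = epowr (S x) \<alpha>"
        using epowr_add[of "S x" 1 "\<alpha> - 1"] by (simp add: S_def sum_distrib_right[symmetric])
      finally show ?thesis .
    qed
    \<comment> \<open>The exponents are those of the extremal element of duality: the products G_i
      h_i sum to S^\<alpha>, and the P'-th power of the L^P'(l^Q') norm of h is the same integral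
      X.\<close>
    have hQ: "epowr (\<Sum>i\<in>J. epowr (h i x) Q') m = epowr (S x) \<alpha>" if "S x \<noteq> top" for x
    proof -
      obtain s where s: "S x = ennreal s" "0 \<le> s" using \<open>S x \<noteq> top\<close> by (cases "S x") auto
      have "(\<Sum>i\<in>J. epowr (h i x) Q') = S x * epowr (S x) ((\<alpha> - 1) * Q')"
        using Q' by (simp add: h_def epowr_mult epowr_epowr S_def sum_distrib_right Q'_def)
      also have "\<dots> = epowr (S x) (1 + (\<alpha> - 1) * Q')"
        by (simp add: epowr_add)
      also have "epowr \<dots> m = epowr (S x) ((1 + (\<alpha> - 1) * Q') * m)"
        by (simp add: epowr_epowr)
      also have "(1 + (\<alpha> - 1) * Q') * m = \<alpha>"
      proof -
        have "(\<alpha> - 1) * Q' = (P - Q) / (Q - 1)" using P PQ by (simp add: \<alpha>_def Q'_def field_simps)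
        moreover have "1 + (P - Q) / (Q - 1) = (P - 1) / (Q - 1)" using P PQ by (simp add: field_simps)
        moreover have "m = (Q - 1) / (P - 1) * \<alpha>" by (simp add: m_def \<alpha>_def P'_def Q'_def)
        ultimately show ?thesis using P PQ by simp
      qed
      finally show ?thesis .
    qed
    have XX: "X \<le> ennreal (2 * C) * Y"
    proof (cases "Y < \<infinity>")
      case True
      then have Xfin: "X < \<infinity>" by (rule XY)
      then have "AE x in lborel. epowr (S x) \<alpha> \<noteq> \<infinity>"
        unfolding X_def by (intro nn_integral_PInf_AE) auto
      then have AES: "AE x in lborel. S x \<noteq> top" by simp
      have "X = (\<Sum>i\<in>J. \<integral>\<^sup>+x. G i x * h i x \<partial>lborel)"
        unfolding X_def Gh[symmetric] by (rule nn_integral_sum) measurable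
      also have "\<dots> = (\<Sum>i\<in>J. \<integral>\<^sup>+x. g i x * v i x \<partial>lborel)"
        unfolding G_def v_def by (intro sum.cong nnconv_selfadjoint) (auto simp: wt_kernel_even)
      also have "\<dots> = (\<integral>\<^sup>+x. (\<Sum>i\<in>J. g i x * v i x) \<partial>lborel)"
        by (simp add: nn_integral_sum)
      also have "\<dots> \<le> (\<integral>\<^sup>+x. ennreal C * epowr (\<Sum>i\<in>J. epowr (g i x) Q) \<alpha> + ennreal e * epowr (\<Sum>i\<in>J. epowr (v i x) Q') m \<partial>lborel)"
      proof (rule nn_integral_mono)
        fix x
        have "(\<Sum>i\<in>J. g i x * v i x) \<le> epowr (\<Sum>j\<in>J. epowr (g j x) Q) (1 / Q) * epowr (\<Sum>j\<in>J. epowr (v j x) Q') (1 / Q')"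
          by (rule Holder_sum[OF J Q'])
        also have "\<dots> \<le> ennreal C * epowr (epowr (\<Sum>j\<in>J. epowr (g j x) Q) (1 / Q)) P
            + ennreal e * epowr (epowr (\<Sum>j\<in>J. epowr (v j x) Q') (1 / Q')) P'"
          by (rule C)
        finally show "(\<Sum>i\<in>J. g i x * v i x) \<le> ennreal C * epowr (\<Sum>i\<in>J. epowr (g i x) Q) \<alpha> + ennreal e * epowr (\<Sum>i\<in>J. epowr (v i x) Q') m"
          by (simp add: epowr_epowr \<alpha>_def m_def)
      qed
      also have "\<dots> = ennreal C * Y + ennreal e * (\<integral>\<^sup>+x. epowr (\<Sum>i\<in>J. epowr (v i x) Q') m \<partial>lborel)"
        unfolding Y_def by (simp add: nn_integral_add nn_integral_cmult)
      also have "\<dots> \<le> ennreal C * Y + ennreal e * (ennreal K1 * (\<integral>\<^sup>+x. epowr (\<Sum>i\<in>J. epowr (h i x) Q') m \<partial>lborel))"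
        unfolding v_def using J l by (intro add_left_mono mult_left_mono K1b) auto
      also have "(\<integral>\<^sup>+x. epowr (\<Sum>i\<in>J. epowr (h i x) Q') m \<partial>lborel) = X"
        unfolding X_def by (intro nn_integral_cong_AE) (use AES in \<open>auto simp: hQ\<close>)
      also have "ennreal e * (ennreal K1 * X) = ennreal (e * K1) * X"
        using e K1 by (simp add: ennreal_mult mult.assoc)
      also have "ennreal C * Y + \<dots> \<le> ennreal C * Y + ennreal (1/2) * X"
        using e by (intro add_left_mono mult_right_mono ennreal_leI) auto
      finally have main: "X \<le> ennreal C * Y + ennreal (1/2) * X" .
      obtain xr yr where r: "X = ennreal xr" "0 \<le> xr" "Y = ennreal yr" "0 \<le> yr"
        using Xfin True by (cases X; cases Y) auto
      have "ennreal xr \<le> ennreal (C * yr + 1/2 * xr)"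
      proof -
        have "ennreal (C * yr + 1/2 * xr) = ennreal C * Y + ennreal (1/2) * X"
        proof -
          have "ennreal (C * yr) = ennreal C * Y" "ennreal (1/2 * xr) = ennreal (1/2) * X"
            unfolding r(1,3) by (rule ennreal_mult; use r C(1) in simp)+
          moreover have "ennreal (C * yr + 1/2 * xr) = ennreal (C * yr) + ennreal (1/2 * xr)"
            by (rule ennreal_plus) (use r C(1) in auto)
          ultimately show ?thesis by simp
        qed
        then show ?thesis using main r by simp
      qed
      then have "xr \<le> C * yr + 1/2 * xr"
        using r C by (subst (asm) ennreal_le_iff) auto
      then show ?thesis using r C by (auto simp: ennreal_mult[symmetric] intro!: ennreal_leI)
    next
      case False
      then have "Y = top" by (metis infinity_ennreal_def less_top)
      then show ?thesis using C by (simp add: ennreal_mult_top)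
    qed
    then show "(\<integral>\<^sup>+x. epowr (\<Sum>i\<in>J. epowr (nnconv (wt_kernel N (l i)) (g i) x) Q) \<alpha> \<partial>lborel)
       \<le> ennreal (2 * C) * (\<integral>\<^sup>+x. epowr (\<Sum>i\<in>J. epowr (g i x) Q) \<alpha> \<partial>lborel)"
      unfolding X_def Y_def S_def G_def .
  qed
  then show ?thesis unfolding \<alpha>_def ..
qed

text \<open>Symmetric partial sums increase to the full sum; measurability, powers and monotone
  convergence are thereby reduced to finite sums.\<close>

lemma nn_integral_count_space_int_SUP:
  fixes f :: "int \<Rightarrow> ennreal"
  shows "(\<integral>\<^sup>+i. f i \<partial>count_space UNIV) = (SUP L. \<Sum>i\<in>{- int L..int L}. f i)"
proof -
  have "(SUP L. \<Sum>i\<in>{- int L..int L}. f i) = (SUP L. \<integral>\<^sup>+i. f i * indicator {- int L..int L} i \<partial>count_space UNIV)"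
    by (simp add: nn_integral_count_space_indicator[symmetric] nn_integral_count_space_finite)
  also have "\<dots> = (\<integral>\<^sup>+i. (SUP L. f i * indicator {- int L..int L} i) \<partial>count_space UNIV)"
    by (rule nn_integral_monotone_convergence_SUP[symmetric])
       (auto simp: incseq_def le_fun_def indicator_def)
  also have "\<dots> = (\<integral>\<^sup>+i. f i \<partial>count_space UNIV)"
  proof (rule nn_integral_cong)
    fix i
    show "(SUP L. f i * indicator {- int L..int L} i) = f i"
    proof (rule antisym)
      show "(SUP L. f i * indicator {- int L..int L} i) \<le> f i"
        by (rule SUP_least) (auto simp: indicator_def)
      have "f i = f i * indicator {- int (nat \<bar>i\<bar>)..int (nat \<bar>i\<bar>)} i" by (cases "0 \<le> i") auto
      also have "\<dots> \<le> (SUP L. f i * indicator {- int L..int L} i)" by (rule SUP_upper) simp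
      finally show "f i \<le> (SUP L. f i * indicator {- int L..int L} i)" .
    qed
  qed
  finally show ?thesis ..
qed

text \<open>The constants of both cases are uniform in the finite index set, so monotone convergence
  extends the bound to all integers.\<close>

lemma vector_valued_maximal:
  assumes P: "1 < P" and Q: "1 < Q" and N: "real DIM('a::euclidean_space) < N"
  obtains K where "0 \<le> K" "\<And>(l::int \<Rightarrow> real) (g::int \<Rightarrow> 'a \<Rightarrow> ennreal). (\<And>i. 0 < l i) \<Longrightarrow>
    (\<And>i j. i \<le> j \<Longrightarrow> l i \<le> l j) \<Longrightarrow> (\<And>i. g i \<in> borel_measurable borel) \<Longrightarrow>
    (\<integral>\<^sup>+x. epowr (\<integral>\<^sup>+i. epowr (nnconv (wt_kernel N (l i)) (g i) x) Q \<partial>count_space UNIV) (P / Q) \<partial>lborel)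
       \<le> ennreal K * (\<integral>\<^sup>+x. epowr (\<integral>\<^sup>+i. epowr (g i x) Q \<partial>count_space UNIV) (P / Q) \<partial>lborel)"
proof -
  obtain K where K: "vv_bound TYPE('a) N Q (P / Q) K"
  proof (cases "P < Q")
    case True
    then show ?thesis using vv_bound_less[OF P True N] that by blast
  next
    case False
    then show ?thesis using vv_bound_ge[of "P / Q" Q N, OF _ _ N] that P Q by auto
  qed
  show ?thesis
  proof (rule that[of K])
    show "0 \<le> K" using K by (simp add: vv_bound_def)
    fix l :: "int \<Rightarrow> real" and g :: "int \<Rightarrow> 'a \<Rightarrow> ennreal"
    assume l: "\<And>i. 0 < l i" "\<And>i j. i \<le> j \<Longrightarrow> l i \<le> l j" and [measurable]: "\<And>i. g i \<in> borel_measurable borel"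
    define R where "R = (\<integral>\<^sup>+x. epowr (\<integral>\<^sup>+i. epowr (g i x) Q \<partial>count_space UNIV) (P / Q) \<partial>lborel)"
    define S where "S L x = (\<Sum>i\<in>{- int L..int L}. epowr (nnconv (wt_kernel N (l i)) (g i) x) Q)" for L x
    have [measurable]: "S L \<in> borel_measurable borel" for L unfolding S_def by measurable
    have "(\<integral>\<^sup>+x. epowr (\<integral>\<^sup>+i. epowr (nnconv (wt_kernel N (l i)) (g i) x) Q \<partial>count_space UNIV) (P / Q) \<partial>lborel)
       = (\<integral>\<^sup>+x. (SUP L. epowr (S L x) (P / Q)) \<partial>lborel)"
      unfolding nn_integral_count_space_int_SUP S_def using P Q by (subst epowr_SUP) auto
    also have "\<dots> = (SUP L. \<integral>\<^sup>+x. epowr (S L x) (P / Q) \<partial>lborel)"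
    proof (rule nn_integral_monotone_convergence_SUP)
      show "incseq (\<lambda>L x. epowr (S L x) (P / Q))"
        unfolding incseq_def le_fun_def S_def using P Q
        by (auto intro!: epowr_mono sum_mono2)
    qed measurable
    also have "\<dots> \<le> ennreal K * R"
    proof (rule SUP_least)
      fix L
      have "(\<integral>\<^sup>+x. epowr (S L x) (P / Q) \<partial>lborel)
        \<le> ennreal K * (\<integral>\<^sup>+x. epowr (\<Sum>i\<in>{- int L..int L}. epowr (g i x) Q) (P / Q) \<partial>lborel)"
        using K l unfolding vv_bound_def S_def by simp
      also have "\<dots> \<le> ennreal K * R"
        unfolding R_def nn_integral_count_space_int_SUP
        using P Q by (intro mult_left_mono nn_integral_mono epowr_mono SUP_upper) auto
      finally show "(\<integral>\<^sup>+x. epowr (S L x) (P / Q) \<partial>lborel) \<le> ennreal K * R" .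
    qed
    finally show "(\<integral>\<^sup>+x. epowr (\<integral>\<^sup>+i. epowr (nnconv (wt_kernel N (l i)) (g i) x) Q \<partial>count_space UNIV) (P / Q) \<partial>lborel)
       \<le> ennreal K * (\<integral>\<^sup>+x. epowr (\<integral>\<^sup>+i. epowr (g i x) Q \<partial>count_space UNIV) (P / Q) \<partial>lborel)"
      unfolding R_def .
  qed
qed

section \<open>Uniqueness of the Fourier transform\<close>

lemma lborel_Fubini:
  fixes F :: "'a::euclidean_space \<Rightarrow> 'b::euclidean_space \<Rightarrow> 'c::{banach, second_countable_topology}"
  assumes [measurable]: "case_prod F \<in> borel_measurable (borel \<Otimes>\<^sub>M borel)"
    and fin: "(\<integral>\<^sup>+x. \<integral>\<^sup>+y. ennreal (norm (F x y)) \<partial>lborel \<partial>lborel) < \<infinity>"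
  shows "(\<integral>x. \<integral>y. F x y \<partial>lborel \<partial>lborel) = (\<integral>y. \<integral>x. F x y \<partial>lborel \<partial>lborel)"
proof -
  have "integrable (lborel \<Otimes>\<^sub>M lborel) (case_prod F)"
  proof (rule integrableI_bounded)
    show "case_prod F \<in> borel_measurable (lborel \<Otimes>\<^sub>M lborel)" by measurable
    have "(\<integral>\<^sup>+z. ennreal (norm (case_prod F z)) \<partial>(lborel \<Otimes>\<^sub>M lborel)) = (\<integral>\<^sup>+x. \<integral>\<^sup>+y. ennreal (norm (F x y)) \<partial>lborel \<partial>lborel)"
      by (subst lborel.nn_integral_fst[symmetric]) auto
    then show "(\<integral>\<^sup>+z. ennreal (norm (case_prod F z)) \<partial>(lborel \<Otimes>\<^sub>M lborel)) < \<infinity>" using fin by simp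
  qed
  then show ?thesis by (rule lborel_pair.Fubini_integral[symmetric])
qed

lemma lborel_integrable_affine:
  fixes f :: "'a::euclidean_space \<Rightarrow> 'b::{banach, second_countable_topology}"
  assumes f: "integrable lborel f" and c: "c \<noteq> 0"
  shows "integrable lborel (\<lambda>x. f (t + c *\<^sub>R x))"
proof -
  have [measurable]: "f \<in> borel_measurable borel" using borel_measurable_integrable[OF f] by simp
  have "(\<integral>\<^sup>+x. ennreal (norm (f x)) \<partial>lborel) = ennreal (\<bar>c\<bar> ^ DIM('a)) * (\<integral>\<^sup>+x. ennreal (norm (f (t + c *\<^sub>R x))) \<partial>lborel)"
    by (rule nn_integral_lborel_affine) (use c in auto)
  moreover have "(\<integral>\<^sup>+x. ennreal (norm (f x)) \<partial>lborel) < \<infinity>" using f by (simp add: integrable_iff_bounded)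
  ultimately show ?thesis using c by (auto simp: integrable_iff_bounded ennreal_mult_less_top)
qed

text \<open>Lebesgue measure is the image of the product measure over \<open>Basis\<close> under the
  map from coordinates to points, which turns the integrand into a product of functions of separate
  variables.\<close>

lemma
  fixes f :: "'a::euclidean_space \<Rightarrow> real \<Rightarrow> 'b::{real_normed_field, banach, second_countable_topology}"
  assumes f: "\<And>b. b \<in> Basis \<Longrightarrow> integrable lborel (f b)"
  shows lborel_integrable_Basis_prod: "integrable lborel (\<lambda>x::'a. \<Prod>b\<in>Basis. f b (x \<bullet> b))"
    and lborel_integral_Basis_prod: "(\<integral>x. (\<Prod>b\<in>Basis. f b (x \<bullet> b)) \<partial>lborel) = (\<Prod>b\<in>Basis. \<integral>x. f b x \<partial>lborel)"
proof -
  interpret product_sigma_finite "\<lambda>b::'a. lborel :: real measure" by standard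
  have [measurable]: "f b \<in> borel_measurable borel" if "b \<in> Basis" for b
    using borel_measurable_integrable[OF f[OF that]] by simp
  have m1: "(\<lambda>x::'a. \<Prod>b\<in>Basis. f b (x \<bullet> b)) \<in> borel_measurable borel" by measurable
  have m2: "(\<lambda>f. \<Sum>b\<in>Basis. f b *\<^sub>R b) \<in> measurable (\<Pi>\<^sub>M b\<in>(Basis::'a set). lborel) borel" by measurable
  have eq: "(\<Prod>b\<in>Basis. f b ((\<Sum>c\<in>Basis. x c *\<^sub>R c) \<bullet> b)) = (\<Prod>b\<in>Basis. f b (x b))" for x :: "'a \<Rightarrow> real"
    by (rule prod.cong) (auto simp: inner_sum_left inner_Basis if_distrib cong: if_cong)
  show "integrable lborel (\<lambda>x::'a. \<Prod>b\<in>Basis. f b (x \<bullet> b))"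
    unfolding lborel_eq[where 'a='a] integrable_distr_eq[OF m2 m1] eq
    by (rule product_integrable_prod) (use f in auto)
  show "(\<integral>x. (\<Prod>b\<in>Basis. f b (x \<bullet> b)) \<partial>lborel) = (\<Prod>b\<in>Basis. \<integral>x. f b x \<partial>lborel)"
    unfolding lborel_eq[where 'a='a] integral_distr[OF m2 m1] eq
    by (rule product_integral_prod) (use f in auto)
qed

section \<open>The Gaussian, its Fourier transform and Gaussian means\<close>

definition gauss :: "'a::euclidean_space \<Rightarrow> real" where
  "gauss x = exp (- (norm x)\<^sup>2 / 2)"

lemma gauss_measurable [measurable]: "gauss \<in> borel_measurable borel"
  unfolding gauss_def by measurable

text \<open>Up to the factor sqrt(2 pi) the integral is the characteristic function of the standard
  normal distribution.\<close>

lemma gauss_real_ft: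
  shows "integrable lborel (\<lambda>x::real. complex_of_real (exp (- x\<^sup>2 / 2)) * cis (t * x))"
    and "(\<integral>x. complex_of_real (exp (- x\<^sup>2 / 2)) * cis (t * x) \<partial>lborel) = complex_of_real (sqrt (2 * pi) * exp (- t\<^sup>2 / 2))"
proof -
  have 1: "complex_of_real (exp (- x\<^sup>2 / 2)) * cis (t * x) = complex_of_real (sqrt (2 * pi)) * (std_normal_density x *\<^sub>R iexp (t * x))" for x
    by (simp add: std_normal_density_def scaleR_conv_of_real cis_conv_exp mult_ac)
  have "integrable lborel (\<lambda>x. std_normal_density x *\<^sub>R iexp (t * x))"
    by (rule Bochner_Integration.integrable_bound[OF integrable_normal_density[of 1 0]]) (auto simp: norm_mult)
  then show "integrable lborel (\<lambda>x::real. complex_of_real (exp (- x\<^sup>2 / 2)) * cis (t * x))"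
    unfolding 1 by (rule integrable_mult_right)
  have "(\<integral>x. std_normal_density x *\<^sub>R iexp (t * x) \<partial>lborel) = char std_normal_distribution t"
    unfolding char_def by (subst integral_density) auto
  also have "\<dots> = complex_of_real (exp (- t\<^sup>2 / 2))" by (simp add: char_std_normal_distribution)
  finally show "(\<integral>x. complex_of_real (exp (- x\<^sup>2 / 2)) * cis (t * x) \<partial>lborel) = complex_of_real (sqrt (2 * pi) * exp (- t\<^sup>2 / 2))"
    unfolding 1 integral_mult_right_zero by simp
qed

lemma cis_sum: "finite A \<Longrightarrow> cis (\<Sum>b\<in>A. f b) = (\<Prod>b\<in>A. cis (f b))"
  by (induction A rule: finite_induct) (auto simp: cis_mult[symmetric])

lemma gauss_prod: "gauss x = (\<Prod>b\<in>Basis. exp (- (x \<bullet> b)\<^sup>2 / 2))"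
proof -
  have "- (norm x)\<^sup>2 / 2 = (\<Sum>b\<in>Basis. - (x \<bullet> b)\<^sup>2 / 2)"
    by (simp add: power2_norm_eq_inner power2_eq_square[symmetric] sum_negf sum_divide_distrib[symmetric] euclidean_inner[of x x])
  then show ?thesis by (simp add: gauss_def exp_sum)
qed

lemma gauss_ft:
  fixes y :: "'a::euclidean_space"
  shows "integrable lborel (\<lambda>x. complex_of_real (gauss x) * cis (y \<bullet> x))"
    and "(\<integral>x. complex_of_real (gauss x) * cis (y \<bullet> x) \<partial>lborel) = complex_of_real (sqrt (2 * pi) ^ DIM('a) * gauss y)"
proof -
  define f where "f b t = complex_of_real (exp (- t\<^sup>2 / 2)) * cis ((y \<bullet> b) * t)" for b :: 'a and t :: real
  have 1: "complex_of_real (gauss x) * cis (y \<bullet> x) = (\<Prod>b\<in>Basis. f b (x \<bullet> b))" for x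
    unfolding f_def gauss_prod prod.distrib by (simp add: cis_sum[symmetric] euclidean_inner[of y x])
  have f: "integrable lborel (f b)" for b unfolding f_def by (rule gauss_real_ft)
  show "integrable lborel (\<lambda>x. complex_of_real (gauss x) * cis (y \<bullet> x))"
    unfolding 1 by (rule lborel_integrable_Basis_prod) (rule f)
  have "(\<integral>x. complex_of_real (gauss x) * cis (y \<bullet> x) \<partial>lborel) = (\<Prod>b\<in>Basis. \<integral>t. f b t \<partial>lborel)"
    unfolding 1 by (rule lborel_integral_Basis_prod) (rule f)
  also have "\<dots> = complex_of_real (sqrt (2 * pi) ^ DIM('a) * gauss y)"
    unfolding f_def gauss_real_ft by (simp add: gauss_prod prod.distrib)
  finally show "(\<integral>x. complex_of_real (gauss x) * cis (y \<bullet> x) \<partial>lborel) = complex_of_real (sqrt (2 * pi) ^ DIM('a) * gauss y)" .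
qed

lemma gauss_integral:
  shows "integrable lborel (gauss :: 'a::euclidean_space \<Rightarrow> real)"
    and "(\<integral>x. gauss (x::'a) \<partial>lborel) = sqrt (2 * pi) ^ DIM('a)"
proof -
  have "integrable lborel (\<lambda>x::'a. Re (complex_of_real (gauss x) * cis (0 \<bullet> x)))"
    by (rule integrable_Re) (rule gauss_ft)
  then show i: "integrable lborel (gauss :: 'a::euclidean_space \<Rightarrow> real)" by simp
  have "complex_of_real (\<integral>x. gauss (x::'a) \<partial>lborel) = (\<integral>x. complex_of_real (gauss (x::'a)) * cis (0 \<bullet> x) \<partial>lborel)"
    by simp
  also have "\<dots> = complex_of_real (sqrt (2 * pi) ^ DIM('a))"
    unfolding gauss_ft by (simp add: gauss_def)
  finally show "(\<integral>x. gauss (x::'a) \<partial>lborel) = sqrt (2 * pi) ^ DIM('a)"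
    using of_real_eq_iff by blast
qed

lemma cis_measurable [measurable]: "f \<in> borel_measurable M \<Longrightarrow> (\<lambda>x. cis (f x)) \<in> borel_measurable M"
  unfolding cis_conv_exp by measurable

lemma fourier_lborel:
  assumes [measurable]: "g \<in> borel_measurable borel"
  shows "fourier g \<xi> = (\<integral>x. g x * cis (- 2 * pi * (x \<bullet> \<xi>)) \<partial>lborel)"
  unfolding fourier_def by (rule integral_completion) measurable

text \<open>Integrating the transform of g against a Gaussian times a character and exchanging the
  integrals yields Gaussian means of g about x0; they vanish at every scale d and tend to g(x0)
  times the Gaussian mass as d tends to 0. The value at \<xi> = 0 is left open because the partition
  of unity for \<psi> says nothing there; a single point is null.\<close>

lemma fourier_injective:
  fixes g :: "'a::euclidean_space \<Rightarrow> complex"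
  assumes cont: "continuous_on UNIV g" and int: "integrable lborel g" and bdd: "\<And>x. norm (g x) \<le> B"
    and zero: "\<And>\<xi>. \<xi> \<noteq> 0 \<Longrightarrow> fourier g \<xi> = 0"
  shows "g x0 = 0"
proof -
  have gm [measurable]: "g \<in> borel_measurable borel" using cont by (rule borel_measurable_continuous_onI)
  have main: "(\<integral>z. g (x0 + d *\<^sub>R z) * gauss z \<partial>lborel) = 0" if d: "0 < d" for d
  proof -
    \<comment> \<open>With this factor the transform of the dilated Gaussian is a multiple of the
      Gaussian of width d.\<close>
    define e where "e = 2 * pi * d"
    have e: "0 < e" using d by (simp add: e_def)
    define F where "F \<xi> x = complex_of_real (gauss (e *\<^sub>R \<xi>)) * cis (2 * pi * (x0 \<bullet> \<xi>)) * (g x * cis (- 2 * pi * (x \<bullet> \<xi>)))" for \<xi> x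
    have "(\<integral>\<xi>. \<integral>x. F \<xi> x \<partial>lborel \<partial>lborel) = (\<integral>\<xi>. 0 \<partial>(lborel :: 'a measure))"
    proof (rule integral_cong_AE)
      have "AE \<xi> in (lborel :: 'a measure). \<xi> \<noteq> 0" by (rule AE_lborel_singleton)
      then show "AE \<xi> in lborel. (\<integral>x. F \<xi> x \<partial>lborel) = 0"
      proof (rule AE_mp, intro AE_I2 impI)
        fix \<xi> :: 'a assume "\<xi> \<noteq> 0"
        have "(\<integral>x. F \<xi> x \<partial>lborel) = complex_of_real (gauss (e *\<^sub>R \<xi>)) * cis (2 * pi * (x0 \<bullet> \<xi>)) * fourier g \<xi>"
          unfolding F_def fourier_lborel[OF gm] by (rule integral_mult_right_zero)
        then show "(\<integral>x. F \<xi> x \<partial>lborel) = 0" using zero[OF \<open>\<xi> \<noteq> 0\<close>] by simp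
      qed
      show "(\<lambda>\<xi>. \<integral>x. F \<xi> x \<partial>lborel) \<in> borel_measurable lborel" unfolding F_def cis_conv_exp by measurable
    qed simp
    moreover have "(\<integral>\<xi>. \<integral>x. F \<xi> x \<partial>lborel \<partial>lborel) = (\<integral>x. \<integral>\<xi>. F \<xi> x \<partial>lborel \<partial>lborel)"
    proof (rule lborel_Fubini)
      show "case_prod F \<in> borel_measurable (borel \<Otimes>\<^sub>M borel)" unfolding F_def cis_conv_exp by measurable
      have "(\<integral>\<^sup>+\<xi>. \<integral>\<^sup>+x. ennreal (norm (F \<xi> x)) \<partial>lborel \<partial>lborel) = (\<integral>\<^sup>+\<xi>. ennreal (gauss (e *\<^sub>R \<xi>)) * (\<integral>\<^sup>+x. ennreal (norm (g x)) \<partial>lborel) \<partial>(lborel :: 'a measure))"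
        unfolding F_def by (simp add: norm_mult gauss_def ennreal_mult nn_integral_cmult)
      also have "\<dots> = (\<integral>\<^sup>+\<xi>. ennreal (gauss (e *\<^sub>R \<xi>)) \<partial>(lborel :: 'a measure)) * (\<integral>\<^sup>+x. ennreal (norm (g x)) \<partial>lborel)"
        by (rule nn_integral_multc) measurable
      also have "\<dots> < \<infinity>"
      proof -
        have "integrable lborel (\<lambda>\<xi>::'a. gauss (e *\<^sub>R \<xi>))"
          using lborel_integrable_affine[OF gauss_integral(1), of e 0] e by simp
        then show ?thesis using int
          by (auto simp: ennreal_mult_less_top integrable_iff_bounded gauss_def)
      qed
      finally show "(\<integral>\<^sup>+\<xi>. \<integral>\<^sup>+x. ennreal (norm (F \<xi> x)) \<partial>lborel \<partial>lborel) < \<infinity>" .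
    qed
    moreover have "(\<integral>\<xi>. F \<xi> x \<partial>lborel) = complex_of_real ((1 / e ^ DIM('a)) * sqrt (2 * pi) ^ DIM('a)) * (g x * gauss ((1 / d) *\<^sub>R (x0 - x)))" for x
    proof -
      have "(\<integral>\<xi>. complex_of_real (gauss \<xi>) * cis (((1 / d) *\<^sub>R (x0 - x)) \<bullet> \<xi>) \<partial>lborel)
        = (\<bar>e\<bar> ^ DIM('a)) *\<^sub>R (\<integral>\<xi>. complex_of_real (gauss (0 + e *\<^sub>R \<xi>)) * cis (((1 / d) *\<^sub>R (x0 - x)) \<bullet> (0 + e *\<^sub>R \<xi>)) \<partial>lborel)"
        by (rule lborel_integral_affine) (use e in \<open>auto simp: cis_conv_exp\<close>)
      also have "(\<lambda>\<xi>. complex_of_real (gauss (0 + e *\<^sub>R \<xi>)) * cis (((1 / d) *\<^sub>R (x0 - x)) \<bullet> (0 + e *\<^sub>R \<xi>)))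
        = (\<lambda>\<xi>. complex_of_real (gauss (e *\<^sub>R \<xi>)) * cis (2 * pi * (x0 \<bullet> \<xi>)) * cis (- 2 * pi * (x \<bullet> \<xi>)))"
        using d by (auto simp: fun_eq_iff cis_mult e_def inner_diff_left algebra_simps)
      finally have *: "complex_of_real (sqrt (2 * pi) ^ DIM('a) * gauss ((1 / d) *\<^sub>R (x0 - x)))
        = (e ^ DIM('a)) *\<^sub>R (\<integral>\<xi>. complex_of_real (gauss (e *\<^sub>R \<xi>)) * cis (2 * pi * (x0 \<bullet> \<xi>)) * cis (- 2 * pi * (x \<bullet> \<xi>)) \<partial>lborel)"
        using e unfolding gauss_ft by simp
      have "(\<integral>\<xi>. F \<xi> x \<partial>lborel) = (\<integral>\<xi>. g x * (complex_of_real (gauss (e *\<^sub>R \<xi>)) * cis (2 * pi * (x0 \<bullet> \<xi>)) * cis (- 2 * pi * (x \<bullet> \<xi>))) \<partial>lborel)"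
        unfolding F_def by (simp add: mult_ac)
      also have "\<dots> = g x * (\<integral>\<xi>. complex_of_real (gauss (e *\<^sub>R \<xi>)) * cis (2 * pi * (x0 \<bullet> \<xi>)) * cis (- 2 * pi * (x \<bullet> \<xi>)) \<partial>lborel)"
        by (rule integral_mult_right_zero)
      also have "\<dots> = complex_of_real ((1 / e ^ DIM('a)) * sqrt (2 * pi) ^ DIM('a)) * (g x * gauss ((1 / d) *\<^sub>R (x0 - x)))"
        using * e by (simp add: scaleR_conv_of_real field_simps)
      finally show ?thesis .
    qed
    ultimately have "(\<integral>x. complex_of_real ((1 / e ^ DIM('a)) * sqrt (2 * pi) ^ DIM('a)) * (g x * gauss ((1 / d) *\<^sub>R (x0 - x))) \<partial>lborel) = 0"
      by simp
    then have "(\<integral>x. g x * complex_of_real (gauss ((1 / d) *\<^sub>R (x0 - x))) \<partial>lborel) = 0"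
      using e by (subst (asm) integral_mult_right_zero) auto
    moreover have "(\<integral>x. g x * complex_of_real (gauss ((1 / d) *\<^sub>R (x0 - x))) \<partial>lborel)
       = (\<bar>d\<bar> ^ DIM('a)) *\<^sub>R (\<integral>z. g (x0 + d *\<^sub>R z) * complex_of_real (gauss ((1 / d) *\<^sub>R (x0 - (x0 + d *\<^sub>R z)))) \<partial>lborel)"
      by (rule lborel_integral_affine) (use d in auto)
    moreover have "gauss ((1 / d) *\<^sub>R (x0 - (x0 + d *\<^sub>R z))) = gauss z" for z
      using d by (simp add: gauss_def)
    ultimately show ?thesis using d by simp
  qed
  have "(\<lambda>k. \<integral>z. g (x0 + (1 / real (Suc k)) *\<^sub>R z) * complex_of_real (gauss z) \<partial>lborel) \<longlonglongrightarrow> (\<integral>z. g x0 * complex_of_real (gauss (z::'a)) \<partial>lborel)"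
  proof (rule integral_dominated_convergence[where w = "\<lambda>z::'a. B * gauss z"])
    show "integrable lborel (\<lambda>z::'a. B * gauss z)" by (intro integrable_mult_right gauss_integral)
    show "AE z in lborel. (\<lambda>k. g (x0 + (1 / real (Suc k)) *\<^sub>R z) * complex_of_real (gauss z)) \<longlonglongrightarrow> g x0 * complex_of_real (gauss z)"
    proof (intro AE_I2 tendsto_mult tendsto_const)
      fix z
      have "(\<lambda>k. x0 + (1 / real (Suc k)) *\<^sub>R z) \<longlonglongrightarrow> x0 + 0 *\<^sub>R z"
        by (intro tendsto_intros) (use LIMSEQ_inverse_real_of_nat in \<open>simp add: inverse_eq_divide\<close>)
      then show "(\<lambda>k. g (x0 + (1 / real (Suc k)) *\<^sub>R z)) \<longlonglongrightarrow> g x0"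
        using continuous_on_tendsto_compose[OF cont, of "\<lambda>k. x0 + (1 / real (Suc k)) *\<^sub>R z" x0 sequentially] by simp
    qed
    show "AE z in lborel. norm (g (x0 + (1 / real (Suc k)) *\<^sub>R z) * complex_of_real (gauss z)) \<le> B * gauss z" for k
      using bdd by (intro AE_I2) (simp add: norm_mult gauss_def mult_right_mono)
  qed measurable
  then have "(\<integral>z. g x0 * complex_of_real (gauss (z::'a)) \<partial>lborel) = 0"
    using main by (simp add: LIMSEQ_const_iff del: of_nat_Suc)
  moreover have "(\<integral>z. g x0 * complex_of_real (gauss (z::'a)) \<partial>lborel) = g x0 * complex_of_real (sqrt (2 * pi) ^ DIM('a))"
    using gauss_integral(2)[where 'a='a] by (subst integral_mult_right_zero) simp
  ultimately show ?thesis by (auto simp: gauss_integral)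
qed

section \<open>Rapid decay and vanishing moments\<close>

text \<open>The mean value inequality bounds the difference quotients by g, and dominated
  convergence along arbitrary null sequences gives the derivative. Integrability of
  \<open>F h\<close> for h \<noteq> 0 follows from that of \<open>F 0\<close> and the same Lipschitz
  bound.\<close>

lemma has_vector_derivative_lborel_integral:
  fixes F :: "real \<Rightarrow> 'a::euclidean_space \<Rightarrow> 'b::euclidean_space"
  assumes d: "0 < d"
    and meas: "\<And>h. \<bar>h\<bar> < d \<Longrightarrow> F h \<in> borel_measurable borel" and meas': "F' 0 \<in> borel_measurable borel"
    and int: "integrable lborel (F 0)"
    and der: "\<And>h y. \<bar>h\<bar> < d \<Longrightarrow> ((\<lambda>h. F h y) has_vector_derivative F' h y) (at h)"
    and bound: "\<And>h y. \<bar>h\<bar> < d \<Longrightarrow> norm (F' h y) \<le> g y" and g: "integrable lborel g"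
  shows "((\<lambda>h. \<integral>y. F h y \<partial>lborel) has_vector_derivative (\<integral>y. F' 0 y \<partial>lborel)) (at 0)"
proof -
  have lip: "norm (F h y - F 0 y) \<le> \<bar>h\<bar> * g y" if h: "\<bar>h\<bar> < d" for h y
  proof -
    have "norm (F h y - F 0 y) \<le> g y * norm (h - 0)"
    proof (rule differentiable_bound[of "{-d<..<d}" "\<lambda>h. F h y" "\<lambda>h k. k *\<^sub>R F' h y"])
      show "((\<lambda>h. F h y) has_derivative (\<lambda>k. k *\<^sub>R F' z y)) (at z within {-d<..<d})" if "z \<in> {-d<..<d}" for z
        using der[of z y] that by (auto simp: has_vector_derivative_def intro: has_derivative_at_withinI)
      show "onorm (\<lambda>k. k *\<^sub>R F' z y) \<le> g y" if "z \<in> {-d<..<d}" for z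
      proof -
        have "norm (F' z y) \<le> g y" using bound[of z y] that by (simp add: abs_less_iff)
        then show ?thesis by (intro onorm_le) (auto simp: mult.commute[of "g y"] intro!: mult_left_mono)
      qed
    qed (use h d in auto)
    then show ?thesis by (simp add: mult.commute)
  qed
  have intF: "integrable lborel (F h)" if h: "\<bar>h\<bar> < d" for h
  proof (rule Bochner_Integration.integrable_bound)
    show "integrable lborel (\<lambda>y. norm (F 0 y) + \<bar>h\<bar> * g y)"
      by (intro Bochner_Integration.integrable_add integrable_norm int integrable_mult_right g)
    show "F h \<in> borel_measurable lborel" using meas[OF h] by simp
    show "AE y in lborel. norm (F h y) \<le> norm (norm (F 0 y) + \<bar>h\<bar> * g y)"
    proof (rule AE_I2)
      fix y
      have "norm (F h y) \<le> norm (F 0 y) + norm (F h y - F 0 y)" by (metis norm_triangle_sub add.commute)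
      then show "norm (F h y) \<le> norm (norm (F 0 y) + \<bar>h\<bar> * g y)" using lip[OF h, of y] by simp
    qed
  qed
  have g0: "0 \<le> g y" for y using bound[of 0 y] d norm_ge_zero[of "F' 0 y"] by linarith
  have intF': "integrable lborel (F' 0)"
    by (rule Bochner_Integration.integrable_bound[OF g]) (use meas' bound[of 0] d in \<open>auto simp: g0\<close>)
  define D where "D = (\<integral>y. F' 0 y \<partial>lborel)"
  show ?thesis
    unfolding has_vector_derivative_def has_derivative_iff_norm
  proof (intro conjI)
    show "bounded_linear (\<lambda>x. x *\<^sub>R (\<integral>y. F' 0 y \<partial>lborel))" by (rule bounded_linear_scaleR_left)
    show "((\<lambda>h. norm ((\<integral>y. F h y \<partial>lborel) - (\<integral>y. F 0 y \<partial>lborel) - (h - 0) *\<^sub>R (\<integral>y. F' 0 y \<partial>lborel)) / norm (h - 0)) \<longlongrightarrow> 0) (at 0)"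
      unfolding tendsto_at_iff_sequentially
    proof (intro allI impI)
      fix X :: "nat \<Rightarrow> real" assume X0: "\<forall>i. X i \<in> UNIV - {0}" and X: "X \<longlonglongrightarrow> 0"
      have "eventually (\<lambda>k. \<bar>X k\<bar> < d) sequentially"
        using tendstoD[OF X d] by simp
      then obtain k0 where k0: "\<And>k. k \<ge> k0 \<Longrightarrow> \<bar>X k\<bar> < d" by (auto simp: eventually_sequentially)
      \<comment> \<open>The shift by k0 keeps all members of the sequence in the interval where the
        bounds hold; \<open>LIMSEQ_offset\<close> removes it in the end.\<close>
      define Q where "Q k y = (1 / X (k + k0)) *\<^sub>R (F (X (k + k0)) y - F 0 y) - F' 0 y" for k y
      have lim: "(\<lambda>k. \<integral>y. Q k y \<partial>lborel) \<longlonglongrightarrow> (\<integral>y. 0 \<partial>(lborel :: 'a measure))"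
      proof (rule integral_dominated_convergence[where w = "\<lambda>y. 2 * g y"])
        show "Q k \<in> borel_measurable lborel" for k
          unfolding Q_def using meas[OF k0[of "k + k0"]] meas[of 0] meas' d by simp
        show "integrable lborel (\<lambda>y. 2 * g y)" using g by simp
        show "AE y in lborel. (\<lambda>k. Q k y) \<longlonglongrightarrow> 0"
        proof (rule AE_I2)
          fix y
          have "((\<lambda>h. norm (F h y - F 0 y - (h - 0) *\<^sub>R F' 0 y) / norm (h - 0)) \<longlongrightarrow> 0) (at 0)"
            using der[of 0 y] d unfolding has_vector_derivative_def has_derivative_iff_norm by simp
          then have "((\<lambda>h. norm (F h y - F 0 y - (h - 0) *\<^sub>R F' 0 y) / norm (h - 0)) \<circ> X) \<longlonglongrightarrow> 0"
            unfolding tendsto_at_iff_sequentially using X0 X by blast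
          then have "(\<lambda>k. norm (F (X (k + k0)) y - F 0 y - X (k + k0) *\<^sub>R F' 0 y) / \<bar>X (k + k0)\<bar>) \<longlonglongrightarrow> 0"
            by (auto simp: o_def dest: LIMSEQ_ignore_initial_segment[of _ _ k0])
          moreover have "norm (F (X (k + k0)) y - F 0 y - X (k + k0) *\<^sub>R F' 0 y) / \<bar>X (k + k0)\<bar> = norm (Q k y)" for k
          proof -
            have "Q k y = (1 / X (k + k0)) *\<^sub>R (F (X (k + k0)) y - F 0 y - X (k + k0) *\<^sub>R F' 0 y)"
              unfolding Q_def using X0 by (simp add: scaleR_diff_right)
            then show ?thesis by simp
          qed
          ultimately show "(\<lambda>k. Q k y) \<longlonglongrightarrow> 0" by (simp add: tendsto_norm_zero_iff)
        qed
        show "AE y in lborel. norm (Q k y) \<le> 2 * g y" for k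
        proof (rule AE_I2)
          fix y
          have "norm (Q k y) \<le> norm ((1 / X (k + k0)) *\<^sub>R (F (X (k + k0)) y - F 0 y)) + norm (F' 0 y)"
            unfolding Q_def by (rule norm_triangle_ineq4)
          also have "norm ((1 / X (k + k0)) *\<^sub>R (F (X (k + k0)) y - F 0 y)) \<le> 1 / \<bar>X (k + k0)\<bar> * (\<bar>X (k + k0)\<bar> * g y)"
          proof -
            have "X (k + k0) \<noteq> 0" using X0 by simp
            then show ?thesis using lip[OF k0[of "k + k0"], of y] by (simp add: pos_divide_le_eq mult.commute)
          qed
          also have "\<dots> = g y" using X0 by simp
          finally show "norm (Q k y) \<le> 2 * g y" using bound[of 0 y] d by simp
        qed
      qed simp
      have eq: "(\<integral>y. Q k y \<partial>lborel) = (1 / X (k + k0)) *\<^sub>R ((\<integral>y. F (X (k + k0)) y \<partial>lborel) - (\<integral>y. F 0 y \<partial>lborel) - X (k + k0) *\<^sub>R D)" for k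
        unfolding Q_def D_def using intF[OF k0[of "k + k0"]] int intF' X0
        by (simp add: scaleR_diff_right)
      have "(\<lambda>k. norm ((\<integral>y. F (X (k + k0)) y \<partial>lborel) - (\<integral>y. F 0 y \<partial>lborel) - X (k + k0) *\<^sub>R D) / \<bar>X (k + k0)\<bar>) \<longlonglongrightarrow> 0"
      proof -
        have "norm ((\<integral>y. F (X (k + k0)) y \<partial>lborel) - (\<integral>y. F 0 y \<partial>lborel) - X (k + k0) *\<^sub>R D) / \<bar>X (k + k0)\<bar> = norm (\<integral>y. Q k y \<partial>lborel)" for k
          unfolding eq by simp
        moreover have "(\<lambda>k. norm (\<integral>y. Q k y \<partial>lborel)) \<longlonglongrightarrow> 0"
          by (rule tendsto_norm_zero) (use lim in simp)
        ultimately show ?thesis by simp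
      qed
      then show "((\<lambda>h. norm ((\<integral>y. F h y \<partial>lborel) - (\<integral>y. F 0 y \<partial>lborel) - (h - 0) *\<^sub>R (\<integral>y. F' 0 y \<partial>lborel)) / norm (h - 0)) \<circ> X) \<longlonglongrightarrow> 0"
        unfolding o_def D_def by - (rule LIMSEQ_offset[where k = k0], simp)
    qed
  qed
qed

section \<open>Rapidly decreasing functions whose transform vanishes near the origin\<close>

definition rapid :: "('a::euclidean_space \<Rightarrow> complex) \<Rightarrow> bool" where
  "rapid g \<longleftrightarrow> g \<in> borel_measurable borel \<and> (\<forall>N. \<exists>C. \<forall>x. norm (g x) \<le> C * wt N x)"

lemma rapidD: "rapid g \<Longrightarrow> g \<in> borel_measurable borel"
  by (simp add: rapid_def)

lemma rapid_bound:
  assumes "rapid g"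
  obtains C where "0 < C" "\<And>x. norm (g x) \<le> C * wt N x"
proof -
  obtain C where C: "\<And>x. norm (g x) \<le> C * wt N x" using assms unfolding rapid_def by blast
  have "norm (g x) \<le> (\<bar>C\<bar> + 1) * wt N x" for x
  proof -
    have "C * wt N x \<le> (\<bar>C\<bar> + 1) * wt N x" by (intro mult_right_mono) auto
    then show ?thesis using C[of x] by linarith
  qed
  then show ?thesis using that[of "\<bar>C\<bar> + 1"] by simp
qed

lemma rapid_integrable:
  assumes "rapid g"
  shows "integrable lborel g"
proof -
  obtain C where C: "0 < C" "\<And>x. norm (g x) \<le> C * wt (real DIM('a) + 1) x" using rapid_bound[OF assms] by blast
  show ?thesis
  proof (rule Bochner_Integration.integrable_bound)
    show "integrable lborel (\<lambda>x::'a. C * wt (real DIM('a) + 1) x)"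
      by (intro integrable_mult_right integrable_wt) simp
  qed (use C rapidD[OF assms] in \<open>auto simp: abs_mult\<close>)
qed

lemma rapid_add: "rapid f \<Longrightarrow> rapid g \<Longrightarrow> rapid (\<lambda>x. f x + g x)"
  unfolding rapid_def
proof (intro conjI allI)
  assume f: "f \<in> borel_measurable borel \<and> (\<forall>N. \<exists>C. \<forall>x. norm (f x) \<le> C * wt N x)"
    and g: "g \<in> borel_measurable borel \<and> (\<forall>N. \<exists>C. \<forall>x. norm (g x) \<le> C * wt N x)"
  then show "(\<lambda>x. f x + g x) \<in> borel_measurable borel" by auto
  fix N
  obtain C D where "\<And>x. norm (f x) \<le> C * wt N x" "\<And>x. norm (g x) \<le> D * wt N x" using f g by blast
  then have "norm (f x + g x) \<le> (C + D) * wt N x" for x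
    using norm_triangle_mono by (metis distrib_right)
  then show "\<exists>C. \<forall>x. norm (f x + g x) \<le> C * wt N x" by blast
qed

lemma rapid_mult_growth:
  assumes f: "rapid f" and g: "g \<in> borel_measurable borel" "\<And>x. norm (g x) \<le> B * wt (- k) x" and B: "0 \<le> B"
  shows "rapid (\<lambda>x. g x * f x)"
  unfolding rapid_def
proof (intro conjI allI)
  show "(\<lambda>x. g x * f x) \<in> borel_measurable borel" using rapidD[OF f] g(1) by simp
  fix N
  obtain C where C: "0 < C" "\<And>x. norm (f x) \<le> C * wt (N + k) x" using rapid_bound[OF f] by blast
  have "norm (g x * f x) \<le> (B * C) * wt N x" for x
  proof -
    have "norm (g x * f x) \<le> (B * wt (- k) x) * (C * wt (N + k) x)"
      unfolding norm_mult using C g B by (intro mult_mono) auto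
    also have "\<dots> = (B * C) * wt N x" using wt_add[of "- k" "N + k" x] by simp
    finally show ?thesis .
  qed
  then show "\<exists>C. \<forall>x. norm (g x * f x) \<le> C * wt N x" by blast
qed

text \<open>A spectral gap at the origin instead of a list of vanishing moments: it is stable under
  multiplication by coordinates and therefore implies that all moments vanish.\<close>

definition vanishing :: "('a::euclidean_space \<Rightarrow> complex) \<Rightarrow> bool" where
  "vanishing g \<longleftrightarrow> rapid g \<and> (\<exists>d>0. \<forall>\<xi>. norm \<xi> < d \<longrightarrow> fourier g \<xi> = 0)"

lemma norm_le_wt: "norm x \<le> wt (-1) x"
  by (simp add: wt_def)

text \<open>Up to the factor -2 pi i, multiplication by the inner product with v is differentiation
  of the transform in direction v; the transform is 0 on a ball about the origin, hence so is its
  derivative.\<close>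

lemma vanishing_inner:
  fixes g :: "'a::euclidean_space \<Rightarrow> complex"
  assumes g: "vanishing g"
  shows "vanishing (\<lambda>x. complex_of_real (x \<bullet> v) * g x)"
proof -
  have r: "rapid g" using g by (simp add: vanishing_def)
  have [measurable]: "g \<in> borel_measurable borel" using r by (rule rapidD)
  have r': "rapid (\<lambda>x. complex_of_real (x \<bullet> v) * g x)"
  proof (rule rapid_mult_growth[OF r, of _ "norm v" 1])
    show "norm (complex_of_real (x \<bullet> v)) \<le> norm v * wt (- 1) x" for x
      using Cauchy_Schwarz_ineq2[of x v] mult_right_mono[OF norm_le_wt norm_ge_zero[of v], of x]
      by (simp add: mult.commute)
  qed auto
  obtain d where d: "0 < d" "\<And>\<xi>. norm \<xi> < d \<Longrightarrow> fourier g \<xi> = 0" using g by (auto simp: vanishing_def)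
  have "fourier (\<lambda>x. complex_of_real (x \<bullet> v) * g x) \<xi> = 0" if \<xi>: "norm \<xi> < d" for \<xi>
  proof -
    define F where "F h x = g x * cis (- 2 * pi * (x \<bullet> (\<xi> + h *\<^sub>R v)))" for h x
    define F' where "F' h x = complex_of_real (- 2 * pi) * (\<i> * (cis (- 2 * pi * (x \<bullet> (\<xi> + h *\<^sub>R v))) * (complex_of_real (x \<bullet> v) * g x)))" for h x
    have "((\<lambda>h. \<integral>x. F h x \<partial>lborel) has_vector_derivative (\<integral>x. F' 0 x \<partial>lborel)) (at 0)"
    proof (rule has_vector_derivative_lborel_integral[where d = 1 and g = "\<lambda>x. 2 * pi * norm (complex_of_real (x \<bullet> v) * g x)"])
      show "integrable lborel (F 0)" unfolding F_def
        by (rule Bochner_Integration.integrable_bound[OF rapid_integrable[OF r]]) (auto simp: norm_mult)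
      show "integrable lborel (\<lambda>x. 2 * pi * norm (complex_of_real (x \<bullet> v) * g x))"
        by (intro integrable_mult_right integrable_norm rapid_integrable r')
      show "((\<lambda>h. F h x) has_vector_derivative F' h x) (at h)" for h x
        unfolding F_def F'_def cis_conv_exp inner_add_right inner_scaleR_right
        by (auto intro!: derivative_eq_intros has_vector_derivative_real_field simp: algebra_simps)
      show "norm (F' h x) \<le> 2 * pi * norm (complex_of_real (x \<bullet> v) * g x)" for h x
        by (simp add: F'_def norm_mult)
    qed (auto simp: F_def F'_def)
    moreover have "((\<lambda>h. \<integral>x. F h x \<partial>lborel) has_vector_derivative 0) (at 0)"
    proof (rule has_vector_derivative_transform_within_open[OF has_vector_derivative_const])
      \<comment> \<open>For |h| < e the point \<xi> + h v stays in the ball of radius d; the added 1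
        keeps the denominator positive when v = 0.\<close>
      define e where "e = (d - norm \<xi>) / (norm v + 1)"
      have nv: "0 < norm v + 1" using norm_ge_zero[of v] by linarith
      then have e: "0 < e" using \<xi> by (simp add: e_def)
      then show "0 \<in> {-e<..<e}" "open {-e<..<e}" by auto
      fix h assume "h \<in> {-e<..<e}"
      then have "\<bar>h\<bar> * norm v \<le> \<bar>h\<bar> * (norm v + 1)" "\<bar>h\<bar> * (norm v + 1) < e * (norm v + 1)"
        using nv by (auto intro!: mult_left_mono mult_strict_right_mono)
      then have "\<bar>h\<bar> * norm v < d - norm \<xi>" using nv by (simp add: e_def)
      then have "norm (\<xi> + h *\<^sub>R v) < d" using norm_triangle_ineq[of \<xi> "h *\<^sub>R v"] by simp
      then show "0 = (\<integral>x. F h x \<partial>lborel)"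
        using d(2) unfolding F_def by (simp add: fourier_lborel)
    qed
    ultimately have "(\<integral>x. F' 0 x \<partial>lborel) = 0" by (rule vector_derivative_unique_at)
    then have "(\<integral>x. cis (- 2 * pi * (x \<bullet> \<xi>)) * (complex_of_real (x \<bullet> v) * g x) \<partial>lborel) = 0"
      unfolding F'_def integral_mult_right_zero by simp
    then show ?thesis by (simp add: fourier_lborel mult.commute)
  qed
  then show ?thesis using r' d(1) by (auto simp: vanishing_def)
qed

lemma vanishing_cmult: "vanishing g \<Longrightarrow> vanishing (\<lambda>x. c * g x)"
proof -
  assume g: "vanishing g"
  then have r: "rapid g" and [measurable]: "g \<in> borel_measurable borel" by (auto simp: vanishing_def rapid_def)
  have "rapid (\<lambda>x. c * g x)" by (rule rapid_mult_growth[OF r, of _ "norm c" 0]) (auto simp: wt_def add_nonneg_eq_0_iff)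
  moreover have "fourier (\<lambda>x. c * g x) \<xi> = c * fourier g \<xi>" for \<xi>
    by (simp add: fourier_lborel mult.assoc)
  ultimately show ?thesis using g by (auto simp: vanishing_def)
qed

lemma fourier_add:
  assumes "rapid f" "rapid g"
  shows "fourier (\<lambda>x. f x + g x) \<xi> = fourier f \<xi> + fourier g \<xi>"
proof -
  have [measurable]: "f \<in> borel_measurable borel" "g \<in> borel_measurable borel" using assms by (auto simp: rapid_def)
  have "integrable lborel (\<lambda>x. h x * cis (- 2 * pi * (x \<bullet> \<xi>)))" if "rapid h" for h
    by (rule Bochner_Integration.integrable_bound[OF rapid_integrable[OF that]]) (use that in \<open>auto simp: norm_mult rapid_def\<close>)
  then show ?thesis using assms by (simp add: fourier_lborel distrib_right)
qed

lemma vanishing_add: "vanishing f \<Longrightarrow> vanishing g \<Longrightarrow> vanishing (\<lambda>x. f x + g x)"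
proof -
  assume f: "vanishing f" and g: "vanishing g"
  obtain d e where "0 < d" "\<And>\<xi>. norm \<xi> < d \<Longrightarrow> fourier f \<xi> = 0" "0 < e" "\<And>\<xi>. norm \<xi> < e \<Longrightarrow> fourier g \<xi> = 0"
    using f g by (auto simp: vanishing_def)
  then have "0 < min d e" "\<And>\<xi>. norm \<xi> < min d e \<Longrightarrow> fourier (\<lambda>x. f x + g x) \<xi> = 0"
    using f g by (auto simp: fourier_add vanishing_def)
  moreover have "rapid (\<lambda>x. f x + g x)" using f g rapid_add by (auto simp: vanishing_def)
  ultimately show ?thesis unfolding vanishing_def by blast
qed

text \<open>Structural induction with \<open>vanishing_inner\<close> in the linear case; g stays
  arbitrary because for a product one factor is first multiplied onto g.\<close>

lemma vanishing_polynomial: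
  fixes p :: "'a::euclidean_space \<Rightarrow> real"
  assumes "real_polynomial_function p" "vanishing g"
  shows "vanishing (\<lambda>x. complex_of_real (p x) * g x)"
  using assms
proof (induction p arbitrary: g rule: real_polynomial_function.induct)
  case (linear f)
  note v = linear(2)
  have lf: "linear f" using bounded_linear.linear[OF linear(1)] .
  have "f x = x \<bullet> (\<Sum>b\<in>Basis. f b *\<^sub>R b)" for x
  proof -
    have "f x = f (\<Sum>b\<in>Basis. (x \<bullet> b) *\<^sub>R b)" by (simp only: euclidean_representation)
    also have "\<dots> = (\<Sum>b\<in>Basis. (x \<bullet> b) * f b)"
      unfolding linear_sum[OF lf] by (simp add: linear_cmul[OF lf])
    also have "\<dots> = x \<bullet> (\<Sum>b\<in>Basis. f b *\<^sub>R b)" by (simp only: inner_sum_right inner_scaleR_right mult.commute)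
    finally show ?thesis .
  qed
  then have "f = (\<lambda>x. x \<bullet> (\<Sum>b\<in>Basis. f b *\<^sub>R b))" by blast
  then show ?case using vanishing_inner[OF v] by metis
next
  case (const c)
  then show ?case by (rule vanishing_cmult)
next
  case (add f h)
  have "vanishing (\<lambda>x. complex_of_real (f x) * g x + complex_of_real (h x) * g x)"
    by (rule vanishing_add) (rule add.IH add.prems)+
  then show ?case by (simp only: of_real_add distrib_right)
next
  case (mult f h)
  have "vanishing (\<lambda>x. complex_of_real (f x) * (complex_of_real (h x) * g x))"
    by (rule mult.IH)+ (rule mult.prems)
  then show ?case by (simp only: of_real_mult mult.assoc)
qed

text \<open>The moment is the value at \<xi> = 0 of the transform of the product.\<close>

lemma vanishing_moment:
  assumes "real_polynomial_function p" "vanishing g"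
  shows "(\<integral>x. complex_of_real (p x) * g x \<partial>lborel) = 0"
proof -
  have v: "vanishing (\<lambda>x. complex_of_real (p x) * g x)" by (rule vanishing_polynomial[OF assms])
  then have "fourier (\<lambda>x. complex_of_real (p x) * g x) 0 = 0" by (auto simp: vanishing_def)
  then show ?thesis using v by (subst (asm) fourier_lborel) (auto simp: vanishing_def rapid_def)
qed

section \<open>Derivatives of the Poisson kernel\<close>

definition radsq :: "real \<Rightarrow> 'a::euclidean_space \<Rightarrow> real" where
  "radsq t x = t\<^sup>2 + (norm x)\<^sup>2"

lemma radsq_pos: "0 < t \<Longrightarrow> 0 < radsq t x"
  by (simp add: radsq_def add_pos_nonneg)

lemma radsq_measurable [measurable]: "radsq t \<in> borel_measurable borel"
  unfolding radsq_def by measurable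

lemma radsq_scale: "radsq (l * t) (l *\<^sub>R x) = l\<^sup>2 * radsq t x"
  by (simp add: radsq_def power_mult_distrib distrib_left)

lemma poisson_kernel_radsq:
  fixes x :: "'a::euclidean_space"
  shows "poisson_kernel t x = poisson_const DIM('a) * t * radsq t x powr (- (real DIM('a) + 1) / 2)"
  by (simp add: poisson_kernel_def radsq_def)

lemma poisson_kernel_measurable [measurable]: "(poisson_kernel t :: 'a::euclidean_space \<Rightarrow> real) \<in> borel_measurable borel"
  unfolding poisson_kernel_radsq[abs_def] by measurable

lemma poisson_const_pos: "0 < poisson_const n"
  by (simp add: poisson_const_def Gamma_real_pos)

lemma power2_powr:
  assumes "0 < l"
  shows "(l\<^sup>2 :: real) powr (s / 2) = l powr s"
proof -
  have "l\<^sup>2 = l powr 2" using assms by simp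
  then show ?thesis by (simp only: powr_powr) simp
qed

lemma power2_mult_powr:
  fixes l q :: real
  assumes "0 < l"
  shows "(l\<^sup>2 * q) powr (- real k / 2) = (1 / l ^ k) * q powr (- real k / 2)"
proof -
  have "(l\<^sup>2 * q) powr (- real k / 2) = l powr (- real k) * q powr (- real k / 2)"
    using assms by (simp only: powr_mult power2_powr)
  then show ?thesis using assms by (simp only: powr_minus powr_realpow inverse_eq_divide)
qed

lemma poisson_kernel_scale:
  fixes z :: "'a::euclidean_space"
  assumes "0 < l"
  shows "poisson_kernel (l * t) (l *\<^sub>R z) = poisson_kernel t z / l ^ DIM('a)"
proof -
  define A where "A = radsq t z powr (- (real DIM('a) + 1) / 2)"
  have 1: "(l\<^sup>2 * radsq t z) powr (- (real DIM('a) + 1) / 2) = (1 / l ^ (DIM('a) + 1)) * A"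
    using power2_mult_powr[OF assms, of "radsq t z" "DIM('a) + 1"] by (simp only: of_nat_add of_nat_1 A_def)
  have 2: "l * (1 / l ^ (DIM('a) + 1)) = 1 / l ^ DIM('a)" using assms by simp
  have "poisson_kernel (l * t) (l *\<^sub>R z) = poisson_const DIM('a) * t * A * (l * (1 / l ^ (DIM('a) + 1)))"
    unfolding poisson_kernel_radsq radsq_scale 1 by (simp only: mult_ac)
  also have "\<dots> = poisson_kernel t z / l ^ DIM('a)"
    unfolding 2 poisson_kernel_radsq A_def[symmetric] by simp
  finally show ?thesis .
qed

text \<open>The derivative of the Poisson kernel in the direction \<open>(v, \<tau>)\<close> of the upper half space.\<close>

definition dpk :: "'a::euclidean_space \<Rightarrow> real \<Rightarrow> real \<Rightarrow> 'a \<Rightarrow> real" where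
  "dpk v \<tau> t x = poisson_const DIM('a) * (\<tau> * radsq t x powr (- (real DIM('a) + 1) / 2)
     - (real DIM('a) + 1) * (t * (t * \<tau> + x \<bullet> v)) * radsq t x powr (- (real DIM('a) + 3) / 2))"

lemma dpk_measurable [measurable]: "dpk v \<tau> t \<in> borel_measurable borel"
  unfolding dpk_def by measurable

text \<open>Homogeneity of degree -(n + 1) in (t, x), by which the estimates at scale 2^j are
  reduced to scale 1.\<close>

lemma dpk_scale:
  fixes x :: "'a::euclidean_space"
  assumes "0 < l"
  shows "dpk v \<tau> (l * t) (l *\<^sub>R x) = dpk v \<tau> t x / l ^ (DIM('a) + 1)"
proof -
  have 1: "(l\<^sup>2 * radsq t x) powr (- (real DIM('a) + 1) / 2) = (1 / l ^ (DIM('a) + 1)) * radsq t x powr (- (real DIM('a) + 1) / 2)"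
    using power2_mult_powr[OF assms, of "radsq t x" "DIM('a) + 1"] by (simp only: of_nat_add of_nat_1)
  have 2: "(l\<^sup>2 * radsq t x) powr (- (real DIM('a) + 3) / 2) = (1 / l ^ (DIM('a) + 3)) * radsq t x powr (- (real DIM('a) + 3) / 2)"
    using power2_mult_powr[OF assms, of "radsq t x" "DIM('a) + 3"] by (simp only: of_nat_add of_nat_numeral)
  have 3: "l * t * (l * t * \<tau> + l *\<^sub>R x \<bullet> v) = l\<^sup>2 * (t * (t * \<tau> + x \<bullet> v))"
    by (simp add: power2_eq_square algebra_simps)
  have 4: "l\<^sup>2 * (1 / l ^ (DIM('a) + 3)) = 1 / l ^ (DIM('a) + 1)"
    using assms by (simp add: power_add power2_eq_square eval_nat_numeral)
  define A where "A = radsq t x powr (- (real DIM('a) + 1) / 2)"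
  define B where "B = radsq t x powr (- (real DIM('a) + 3) / 2)"
  define c where "c = 1 / l ^ (DIM('a) + 1)"
  have "dpk v \<tau> (l * t) (l *\<^sub>R x) = poisson_const DIM('a) * (\<tau> * (c * A)
     - (real DIM('a) + 1) * (t * (t * \<tau> + x \<bullet> v)) * ((l\<^sup>2 * (1 / l ^ (DIM('a) + 3))) * B))"
    unfolding dpk_def radsq_scale 1 2 3 A_def[symmetric] B_def[symmetric] c_def by (simp only: mult_ac)
  also have "\<dots> = c * dpk v \<tau> t x"
    unfolding 4 c_def[symmetric] dpk_def A_def[symmetric] B_def[symmetric] by (simp add: algebra_simps)
  finally show ?thesis by (simp add: c_def)
qed

lemma poisson_kernel_deriv:
  fixes x v :: "'a::euclidean_space"
  assumes t: "0 < t + h * \<tau>"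
  shows "((\<lambda>h. poisson_kernel (t + h * \<tau>) (x + h *\<^sub>R v)) has_real_derivative dpk v \<tau> (t + h * \<tau>) (x + h *\<^sub>R v)) (at h)"
proof -
  define n where "n = real DIM('a)"
  \<comment> \<open>The squared distance as an explicit quadratic polynomial in h, so that only a
    real power of a positive polynomial has to be differentiated.\<close>
  define q where "q h = (t + h * \<tau>)\<^sup>2 + (x \<bullet> x + 2 * h * (x \<bullet> v) + h\<^sup>2 * (v \<bullet> v))" for h
  have q: "radsq (t + h * \<tau>) (x + h *\<^sub>R v) = q h" for h
    unfolding radsq_def q_def power2_norm_eq_inner
    by (simp add: inner_add_left inner_add_right inner_commute power2_eq_square algebra_simps)
  have qp: "0 < q h" using radsq_pos[OF t] q by metis
  have dq: "(q has_real_derivative 2 * ((t + h * \<tau>) * \<tau> + (x + h *\<^sub>R v) \<bullet> v)) (at h)"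
    unfolding q_def by (auto intro!: derivative_eq_intros simp: inner_add_left algebra_simps power2_eq_square)
  have dp: "((\<lambda>h. q h powr (- (n + 1) / 2)) has_real_derivative
      (- (n + 1) / 2) * q h powr (- (n + 3) / 2) * (2 * ((t + h * \<tau>) * \<tau> + (x + h *\<^sub>R v) \<bullet> v))) (at h)"
  proof -
    have e: "- (n + 1) / 2 - 1 = - (n + 3) / 2" by (simp add: field_simps)
    show ?thesis using DERIV_fun_powr[OF dq qp, of "- (n + 1) / 2"] unfolding of_nat_1 e .
  qed
  have "((\<lambda>h. poisson_const DIM('a) * (t + h * \<tau>) * q h powr (- (n + 1) / 2)) has_real_derivative
     poisson_const DIM('a) * (\<tau> * q h powr (- (n + 1) / 2)
     - (n + 1) * ((t + h * \<tau>) * ((t + h * \<tau>) * \<tau> + (x + h *\<^sub>R v) \<bullet> v)) * q h powr (- (n + 3) / 2))) (at h)"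
  proof -
    have "((\<lambda>h. t + h * \<tau>) has_real_derivative \<tau>) (at h)" by (auto intro!: derivative_eq_intros)
    from DERIV_cmult[OF DERIV_mult[OF this dp], of "poisson_const DIM('a)"]
    have 1: "((\<lambda>h. poisson_const DIM('a) * ((t + h * \<tau>) * q h powr (- (n + 1) / 2))) has_real_derivative
      poisson_const DIM('a) * (\<tau> * q h powr (- (n + 1) / 2)
       + ((- (n + 1) / 2) * q h powr (- (n + 3) / 2) * (2 * ((t + h * \<tau>) * \<tau> + (x + h *\<^sub>R v) \<bullet> v))) * (t + h * \<tau>))) (at h)" .
    have 2: "\<tau> * A + ((- (n + 1) / 2) * B * (2 * E)) * T = \<tau> * A - (n + 1) * (T * E) * B" for A B E T
      by (simp add: field_simps)
    show ?thesis using 1 unfolding 2 mult.assoc[of "poisson_const DIM('a)"] by (simp only: mult.assoc)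
  qed
  then show ?thesis unfolding poisson_kernel_radsq dpk_def q n_def .
qed

text \<open>Both t^2 and t |x| are at most t^2 + |x|^2, so the second term of \<open>dpk\<close>
  gains a factor \<open>radsq\<close> and has the size of the first.\<close>

lemma dpk_bound:
  fixes x :: "'a::euclidean_space"
  assumes t: "0 < t"
  shows "\<bar>dpk v \<tau> t x\<bar> \<le> poisson_const DIM('a) * (real DIM('a) + 2) * (\<bar>\<tau>\<bar> + norm v) * radsq t x powr (- (real DIM('a) + 1) / 2)"
proof -
  define n where "n = real DIM('a)"
  define q where "q = radsq t x"
  have q: "0 < q" using radsq_pos[OF t] by (simp add: q_def)
  define A where "A = q powr (- (n + 1) / 2)"
  have A: "0 \<le> A" by (simp add: A_def)
  have qA: "q * q powr (- (n + 3) / 2) = A"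
    using powr_mult_base[of q "- (n + 3) / 2"] q by (simp add: A_def field_simps)
  have "\<bar>t * (t * \<tau> + x \<bullet> v)\<bar> \<le> q * (\<bar>\<tau>\<bar> + norm v)"
  proof -
    have 1: "\<bar>x \<bullet> v\<bar> \<le> norm x * norm v" by (rule Cauchy_Schwarz_ineq2)
    have 2: "t * norm x \<le> q"
    proof -
      have "0 \<le> t * norm x" using t by simp
      then show ?thesis using sum_squares_bound[of t "norm x"] unfolding q_def radsq_def by linarith
    qed
    have 3: "t * t \<le> q" by (simp add: q_def radsq_def power2_eq_square)
    have "\<bar>t * (t * \<tau> + x \<bullet> v)\<bar> \<le> t * (t * \<bar>\<tau>\<bar> + norm x * norm v)"
      using t 1 abs_triangle_ineq[of "t * \<tau>" "x \<bullet> v"] by (simp add: abs_mult)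
    also have "\<dots> = t * t * \<bar>\<tau>\<bar> + t * norm x * norm v" by (simp add: algebra_simps)
    also have "\<dots> \<le> q * \<bar>\<tau>\<bar> + q * norm v" by (intro add_mono mult_right_mono 2 3) auto
    finally show ?thesis by (simp add: distrib_left)
  qed
  then have "\<bar>t * (t * \<tau> + x \<bullet> v)\<bar> * q powr (- (n + 3) / 2) \<le> q * (\<bar>\<tau>\<bar> + norm v) * q powr (- (n + 3) / 2)"
    by (intro mult_right_mono) auto
  also have "\<dots> = (\<bar>\<tau>\<bar> + norm v) * A" using qA by (simp add: mult_ac)
  finally have 4: "(n + 1) * (\<bar>t * (t * \<tau> + x \<bullet> v)\<bar> * q powr (- (n + 3) / 2)) \<le> (n + 1) * ((\<bar>\<tau>\<bar> + norm v) * A)"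
    by (intro mult_left_mono) (auto simp: n_def)
  have "\<bar>\<tau> * A - (n + 1) * (t * (t * \<tau> + x \<bullet> v)) * q powr (- (n + 3) / 2)\<bar>
     \<le> \<bar>\<tau>\<bar> * A + (n + 1) * (\<bar>t * (t * \<tau> + x \<bullet> v)\<bar> * q powr (- (n + 3) / 2))"
    using A by (intro order_trans[OF abs_triangle_ineq4] add_mono) (auto simp: abs_mult n_def)
  also have "\<dots> \<le> (\<bar>\<tau>\<bar> + norm v) * A + (n + 1) * ((\<bar>\<tau>\<bar> + norm v) * A)"
    using A by (intro add_mono 4 mult_right_mono) auto
  also have "\<dots> = (n + 2) * (\<bar>\<tau>\<bar> + norm v) * A" by (simp add: algebra_simps)
  finally have "\<bar>\<tau> * A - (n + 1) * (t * (t * \<tau> + x \<bullet> v)) * q powr (- (n + 3) / 2)\<bar> \<le> (n + 2) * (\<bar>\<tau>\<bar> + norm v) * A" .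
  then have "poisson_const DIM('a) * \<bar>\<tau> * A - (n + 1) * (t * (t * \<tau> + x \<bullet> v)) * q powr (- (n + 3) / 2)\<bar>
      \<le> poisson_const DIM('a) * ((n + 2) * (\<bar>\<tau>\<bar> + norm v) * A)"
    using poisson_const_pos by (intro mult_left_mono) (auto intro: less_imp_le)
  then show ?thesis
    unfolding dpk_def q_def[symmetric] n_def[symmetric] A_def[symmetric] abs_mult
    using poisson_const_pos[of "DIM('a)"] by (simp add: mult_ac)
qed

section \<open>Comparison of weights under scaling and small perturbations\<close>

lemma wt_le_scale:
  assumes "0 \<le> s" "0 < k" "1 + norm z \<le> k * (1 + norm w)"
  shows "wt s w \<le> k powr s * wt s z"
proof -
  have "wt s w \<le> ((1 + norm z) / k) powr (- s)"
    unfolding wt_def using assms add_pos_nonneg[of 1 "norm z"]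
    by (intro powr_mono2') (auto simp: pos_divide_le_eq mult.commute)
  also have "\<dots> = k powr s * wt s z"
    unfolding wt_def using assms by (simp add: powr_divide powr_minus field_simps)
  finally show ?thesis .
qed

lemma radsq_powr_le_wt:
  assumes "0 \<le> s" "0 < K" "(1 + norm z)\<^sup>2 \<le> K * radsq t x"
  shows "radsq t x powr (- s / 2) \<le> K powr (s / 2) * wt s z"
proof -
  have z: "0 < 1 + norm z" by (simp add: add_pos_nonneg)
  have "radsq t x powr (- s / 2) \<le> ((1 + norm z)\<^sup>2 / K) powr (- s / 2)"
    using assms z by (intro powr_mono2') (auto simp: pos_divide_le_eq mult.commute)
  also have "\<dots> = K powr (s / 2) * ((1 + norm z)\<^sup>2) powr (- s / 2)"
  proof -
    have "((1 + norm z)\<^sup>2 / K) powr (- s / 2) = ((1 + norm z)\<^sup>2) powr (- s / 2) / K powr (- s / 2)"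
      by (rule powr_divide)
    also have "K powr (- s / 2) = inverse (K powr (s / 2))" by (simp add: powr_minus)
    finally show ?thesis by (simp only: divide_inverse inverse_inverse_eq mult.commute)
  qed
  also have "((1 + norm z)\<^sup>2) powr (- s / 2) = wt s z"
    using z by (simp only: power2_powr wt_def)
  finally show ?thesis .
qed

text \<open>Bounds uniform in small h, as differentiation under the integral requires: h v moves the
  point by at most 1, and the height stays at least t/2.\<close>

lemma radsq_perturb:
  fixes x v y :: "'a::euclidean_space"
  assumes t: "0 < t" and h: "\<bar>h\<bar> < min (1 / (norm v + 1)) (t / (2 * (\<bar>\<tau>\<bar> + 1)))"
  shows "t / 2 \<le> t + h * \<tau>" and "\<bar>h\<bar> * norm v \<le> 1"
    and "(1 + norm z)\<^sup>2 \<le> (32 / t\<^sup>2 + 2) * radsq (t + h * \<tau>) (z + h *\<^sub>R v)"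
proof -
  have nv: "0 < norm v + 1" "0 < \<bar>\<tau>\<bar> + 1" using norm_ge_zero[of v] by linarith+
  have "\<bar>h\<bar> * (norm v + 1) < 1" using h nv by (simp add: pos_less_divide_eq)
  then show hv: "\<bar>h\<bar> * norm v \<le> 1" by (simp add: distrib_left)
  have "\<bar>h\<bar> * (2 * (\<bar>\<tau>\<bar> + 1)) < t" using h nv by (simp add: pos_less_divide_eq)
  then have "\<bar>h * \<tau>\<bar> \<le> t / 2" by (simp add: abs_mult algebra_simps)
  then show tt: "t / 2 \<le> t + h * \<tau>" by linarith
  define x' where "x' = z + h *\<^sub>R v"
  have "norm z \<le> norm x' + norm (h *\<^sub>R v)" unfolding x'_def by (metis add_diff_cancel norm_triangle_ineq4)
  then have "1 + norm z \<le> 2 + norm x'" using hv by simp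
  then have "(1 + norm z)\<^sup>2 \<le> (2 + norm x')\<^sup>2" by (intro power_mono) auto
  also have "\<dots> \<le> 8 + 2 * (norm x')\<^sup>2" using zero_le_power2[of "2 - norm x'"] by (simp add: power2_eq_square algebra_simps)
  \<comment> \<open>Origin of 32/t^2: the height is at least t/2, so its square is at least
    t^2/4.\<close>
  also have "8 \<le> 32 / t\<^sup>2 * (t + h * \<tau>)\<^sup>2"
  proof -
    have "(t / 2)\<^sup>2 \<le> (t + h * \<tau>)\<^sup>2" using tt t by (intro power_mono) auto
    then show ?thesis using t by (simp add: power_divide field_simps)
  qed
  also have "32 / t\<^sup>2 * (t + h * \<tau>)\<^sup>2 + 2 * (norm x')\<^sup>2 \<le> (32 / t\<^sup>2 + 2) * radsq (t + h * \<tau>) x'"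
    unfolding radsq_def using t by (simp add: distrib_left distrib_right)
  finally show "(1 + norm z)\<^sup>2 \<le> (32 / t\<^sup>2 + 2) * radsq (t + h * \<tau>) (z + h *\<^sub>R v)" unfolding x'_def by simp
qed

text \<open>
  The exponent \<open>n + 1/2\<close> exceeds \<open>n\<close>, so that bounded functions qualify, and is smaller than the decay \<open>n + 1\<close> of the
  derivatives of the Poisson kernel; the gap makes the dyadic sum over large scales converge.
\<close>

definition slow :: "('a::euclidean_space \<Rightarrow> complex) \<Rightarrow> bool" where
  "slow f \<longleftrightarrow> f \<in> borel_measurable borel \<and> (\<forall>x. integrable lborel (\<lambda>y. wt (real DIM('a) + 1/2) (x - y) * norm (f y)))"

lemma slow_integrable:
  fixes f :: "'a::euclidean_space \<Rightarrow> complex" and k :: "'a \<Rightarrow> complex"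
  assumes f: "slow f" and k: "k \<in> borel_measurable borel" "\<And>y. norm (k y) \<le> C * wt (real DIM('a) + 1/2) (x - y)"
  shows "integrable lborel (\<lambda>y. f y * k y)"
proof (rule Bochner_Integration.integrable_bound)
  show "integrable lborel (\<lambda>y. C * (wt (real DIM('a) + 1/2) (x - y) * norm (f y)))"
    using f by (simp add: slow_def)
  have "f \<in> borel_measurable borel" using f by (simp add: slow_def)
  then show "(\<lambda>y. f y * k y) \<in> borel_measurable lborel" using k(1) by simp
  show "AE y in lborel. norm (f y * k y) \<le> norm (C * (wt (real DIM('a) + 1/2) (x - y) * norm (f y)))"
  proof (rule AE_I2)
    fix y
    have "norm (f y * k y) \<le> norm (f y) * (C * wt (real DIM('a) + 1/2) (x - y))"
      unfolding norm_mult by (intro mult_left_mono k) auto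
    then show "norm (f y * k y) \<le> norm (C * (wt (real DIM('a) + 1/2) (x - y) * norm (f y)))"
      using abs_ge_self[of "C * (wt (real DIM('a) + 1/2) (x - y) * norm (f y))"]
      unfolding real_norm_def by (simp only: mult_ac)
  qed
qed

lemma poisson_integral_lborel:
  assumes [measurable]: "f \<in> borel_measurable borel"
  shows "poisson_integral f x t = (\<integral>y. f y * of_real (poisson_kernel t (x - y)) \<partial>lborel)"
  unfolding poisson_integral_def by (rule integral_completion) measurable

text \<open>By \<open>dpk_bound\<close> and \<open>radsq_perturb\<close> the differentiated kernel
  is bounded, uniformly in small h, by a multiple of the weight that defines
  \<open>slow\<close>.\<close>

lemma poisson_integral_deriv:
  fixes f :: "'a::euclidean_space \<Rightarrow> complex"
  assumes f: "slow f" and t: "0 < t"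
  shows "((\<lambda>h. poisson_integral f (x + h *\<^sub>R v) (t + h * \<tau>)) has_vector_derivative
    (\<integral>y. f y * of_real (dpk v \<tau> t (x - y)) \<partial>lborel)) (at 0)"
proof -
  have [measurable]: "f \<in> borel_measurable borel" using f by (simp add: slow_def)
  define n where "n = real DIM('a)"
  define d where "d = min (1 / (norm v + 1)) (t / (2 * (\<bar>\<tau>\<bar> + 1)))"
  have "0 < norm v + 1" using norm_ge_zero[of v] by linarith
  then have d: "0 < d" using t by (auto simp: d_def)
  define K where "K = (32 / t\<^sup>2 + 2) powr ((n + 1) / 2)"
  have K: "radsq (t + h * \<tau>) (z + h *\<^sub>R v) powr (- (n + 1) / 2) \<le> K * wt (n + 1/2) z" if "\<bar>h\<bar> < d" for h and z
  proof -
    have "radsq (t + h * \<tau>) (z + h *\<^sub>R v) powr (- (n + 1) / 2) \<le> K * wt (n + 1) z"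
      unfolding K_def using t that unfolding d_def
      by (intro radsq_powr_le_wt radsq_perturb) (auto simp: n_def intro!: add_nonneg_pos)
    also have "\<dots> \<le> K * wt (n + 1/2) z" by (intro mult_left_mono wt_antimono) (auto simp: K_def)
    finally show ?thesis .
  qed
  have tp: "0 < t + h * \<tau>" if "\<bar>h\<bar> < d" for h
    using radsq_perturb(1)[OF t that[unfolded d_def]] t by linarith
  define F where "F h y = f y * of_real (poisson_kernel (t + h * \<tau>) (x - y + h *\<^sub>R v))" for h y
  define F' where "F' h y = f y * of_real (dpk v \<tau> (t + h * \<tau>) (x - y + h *\<^sub>R v))" for h y
  define D where "D = poisson_const DIM('a) * (n + 2) * (\<bar>\<tau>\<bar> + norm v)"
  have D: "0 \<le> D" using poisson_const_pos[of "DIM('a)"] by (auto simp: D_def n_def)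
  have "((\<lambda>h. \<integral>y. F h y \<partial>lborel) has_vector_derivative (\<integral>y. F' 0 y \<partial>lborel)) (at 0)"
  proof (rule has_vector_derivative_lborel_integral[OF d])
    show "F h \<in> borel_measurable borel" "F' 0 \<in> borel_measurable borel" for h
      unfolding F_def F'_def by measurable
    show "integrable lborel (F 0)"
      unfolding F_def
    proof (rule slow_integrable[OF f])
      fix y
      have "norm (complex_of_real (poisson_kernel (t + 0 * \<tau>) (x - y + 0 *\<^sub>R v))) = poisson_const DIM('a) * t * radsq (t + 0 * \<tau>) (x - y + 0 *\<^sub>R v) powr (- (n + 1) / 2)"
        using t poisson_const_pos[of "DIM('a)"] unfolding norm_of_real poisson_kernel_radsq n_def by simp
      also have "\<dots> \<le> poisson_const DIM('a) * t * (K * wt (n + 1/2) (x - y))"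
        using t poisson_const_pos[of "DIM('a)"] d by (intro mult_left_mono K) auto
      finally show "norm (complex_of_real (poisson_kernel (t + 0 * \<tau>) (x - y + 0 *\<^sub>R v))) \<le> poisson_const DIM('a) * t * K * wt (real DIM('a) + 1/2) (x - y)"
        by (simp add: n_def)
    qed measurable
    show "((\<lambda>h. F h y) has_vector_derivative F' h y) (at h)" if "\<bar>h\<bar> < d" for h y
      unfolding F_def F'_def
      by (intro has_vector_derivative_mult_right has_vector_derivative_of_real
            poisson_kernel_deriv[OF tp[OF that]])
    show "norm (F' h y) \<le> D * K * (wt (n + 1/2) (x - y) * norm (f y))" if h: "\<bar>h\<bar> < d" for h y
    proof -
      have "norm (F' h y) \<le> norm (f y) * (D * radsq (t + h * \<tau>) (x - y + h *\<^sub>R v) powr (- (n + 1) / 2))"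
        unfolding F'_def norm_mult D_def n_def norm_of_real by (intro mult_left_mono dpk_bound tp h) auto
      also have "\<dots> \<le> norm (f y) * (D * (K * wt (n + 1/2) (x - y)))"
        by (intro mult_left_mono K h D) auto
      finally show ?thesis by (simp add: mult_ac)
    qed
    show "integrable lborel (\<lambda>y. D * K * (wt (n + 1/2) (x - y) * norm (f y)))"
      using f unfolding slow_def n_def by simp
  qed
  moreover have "poisson_integral f (x + h *\<^sub>R v) (t + h * \<tau>) = (\<integral>y. F h y \<partial>lborel)" for h
    unfolding F_def by (simp add: poisson_integral_lborel algebra_simps)
  ultimately show ?thesis by (simp add: F'_def)
qed

section \<open>Transfer of one derivative from the Poisson kernel to the other factor\<close>

definition partial_deriv :: "('a::euclidean_space \<Rightarrow> complex) \<Rightarrow> 'a \<Rightarrow> 'a \<Rightarrow> complex" where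
  "partial_deriv \<phi> b x = frechet_derivative \<phi> (at x) b"

text \<open>First derivatives are enough, since a single derivative is transferred. The condition
  \<open>rapid\<close> also supplies Borel measurability of the partial derivatives.\<close>

definition vanishing_C1 :: "('a::euclidean_space \<Rightarrow> complex) \<Rightarrow> bool" where
  "vanishing_C1 \<phi> \<longleftrightarrow> vanishing \<phi> \<and> (\<forall>x. \<phi> differentiable (at x)) \<and> (\<forall>b\<in>Basis. rapid (partial_deriv \<phi> b))"

lemma slow_rapid:
  fixes g :: "'a::euclidean_space \<Rightarrow> complex"
  assumes g: "rapid g"
  shows "slow g"
  unfolding slow_def
proof (intro conjI allI)
  show "g \<in> borel_measurable borel" using g by (rule rapidD)
  then have [measurable]: "g \<in> borel_measurable borel" .
  fix x :: 'a
  show "integrable lborel (\<lambda>y. wt (real DIM('a) + 1/2) (x - y) * norm (g y))"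
  proof (rule Bochner_Integration.integrable_bound[OF integrable_norm[OF rapid_integrable[OF g]]])
    show "AE y in lborel. norm (wt (real DIM('a) + 1/2) (x - y) * norm (g y)) \<le> norm (norm (g y))"
    proof (rule AE_I2)
      fix y
      have "wt (real DIM('a) + 1/2) (x - y) * norm (g y) \<le> 1 * norm (g y)"
        by (intro mult_right_mono wt_le_1) auto
      then show "norm (wt (real DIM('a) + 1/2) (x - y) * norm (g y)) \<le> norm (norm (g y))" by simp
    qed
  qed measurable
qed

lemma vanishing_C1_has_derivative:
  assumes "vanishing_C1 \<phi>"
  shows "(\<phi> has_derivative (\<lambda>v. \<Sum>b\<in>Basis. (v \<bullet> b) *\<^sub>R partial_deriv \<phi> b x)) (at x)"
proof -
  let ?D = "frechet_derivative \<phi> (at x)"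
  have d: "(\<phi> has_derivative ?D) (at x)"
    using assms by (simp add: vanishing_C1_def frechet_derivative_works[symmetric])
  then have l: "linear ?D" by (rule has_derivative_linear)
  have "?D v = (\<Sum>b\<in>Basis. (v \<bullet> b) *\<^sub>R partial_deriv \<phi> b x)" for v
  proof -
    have "?D v = ?D (\<Sum>b\<in>Basis. (v \<bullet> b) *\<^sub>R b)" by (simp only: euclidean_representation)
    also have "\<dots> = (\<Sum>b\<in>Basis. (v \<bullet> b) *\<^sub>R partial_deriv \<phi> b x)"
      unfolding linear_sum[OF l] by (simp add: linear_cmul[OF l] partial_deriv_def)
    finally show ?thesis .
  qed
  then show ?thesis using d by presburger
qed

lemma vanishing_C1_line_derivative:
  assumes "vanishing_C1 \<phi>"
  shows "((\<lambda>h. \<phi> (a + h *\<^sub>R w)) has_vector_derivative (\<Sum>b\<in>Basis. (w \<bullet> b) *\<^sub>R partial_deriv \<phi> b (a + h *\<^sub>R w))) (at h)"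
proof -
  have "((\<lambda>h. a + h *\<^sub>R w) has_derivative (\<lambda>k. k *\<^sub>R w)) (at h)"
    by (auto intro!: derivative_eq_intros)
  from has_derivative_compose[OF this vanishing_C1_has_derivative[OF assms]]
  have "((\<lambda>h. \<phi> (a + h *\<^sub>R w)) has_derivative (\<lambda>k. \<Sum>b\<in>Basis. (k *\<^sub>R w \<bullet> b) *\<^sub>R partial_deriv \<phi> b (a + h *\<^sub>R w))) (at h)" .
  then show ?thesis unfolding has_vector_derivative_def
    by (simp add: scaleR_sum_right)
qed

lemma vanishing_C1_continuous: "vanishing_C1 \<phi> \<Longrightarrow> continuous_on UNIV \<phi>"
  unfolding vanishing_C1_def by (auto intro!: continuous_at_imp_continuous_on differentiable_imp_continuous_within)

text \<open>The transform of the translate \<open>\<phi> (y + h *\<^sub>R b)\<close> is a unimodular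
  multiple of that of \<phi>, hence 0 near the origin for every h; differentiation in h at 0
  replaces integration by parts.\<close>

lemma vanishing_C1_deriv_vanishing:
  fixes \<phi> :: "'a::euclidean_space \<Rightarrow> complex"
  assumes \<phi>: "vanishing_C1 \<phi>" and b: "b \<in> Basis"
  shows "vanishing (partial_deriv \<phi> b)"
proof -
  have r: "rapid \<phi>" "rapid (partial_deriv \<phi> b)" using \<phi> b by (auto simp: vanishing_C1_def vanishing_def)
  have [measurable]: "\<phi> \<in> borel_measurable borel" "partial_deriv \<phi> b \<in> borel_measurable borel" using r by (auto simp: rapid_def)
  obtain d where d: "0 < d" "\<And>\<xi>. norm \<xi> < d \<Longrightarrow> fourier \<phi> \<xi> = 0" using \<phi> by (auto simp: vanishing_C1_def vanishing_def)
  have "fourier (partial_deriv \<phi> b) \<xi> = 0" if \<xi>: "norm \<xi> < d" for \<xi>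
  proof -
    define F where "F h y = \<phi> (y + h *\<^sub>R b) * cis (- 2 * pi * (y \<bullet> \<xi>))" for h y
    define F' where "F' h y = partial_deriv \<phi> b (y + h *\<^sub>R b) * cis (- 2 * pi * (y \<bullet> \<xi>))" for h y
    obtain C where C: "0 < C" "\<And>x. norm (partial_deriv \<phi> b x) \<le> C * wt (real DIM('a) + 1) x" using rapid_bound[OF r(2)] by blast
    have "((\<lambda>h. \<integral>y. F h y \<partial>lborel) has_vector_derivative (\<integral>y. F' 0 y \<partial>lborel)) (at 0)"
    proof (rule has_vector_derivative_lborel_integral[where d = 1 and g = "\<lambda>y. C * 2 powr (real DIM('a) + 1) * wt (real DIM('a) + 1) y"])
      show "integrable lborel (F 0)" unfolding F_def
        by (rule Bochner_Integration.integrable_bound[OF rapid_integrable[OF r(1)]]) (auto simp: norm_mult)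
      show "integrable lborel (\<lambda>y::'a. C * 2 powr (real DIM('a) + 1) * wt (real DIM('a) + 1) y)"
        by (intro integrable_mult_right integrable_wt) simp
      show "((\<lambda>h. F h y) has_vector_derivative F' h y) (at h)" for h y
      proof -
        have "(\<Sum>c\<in>Basis. (b \<bullet> c) *\<^sub>R partial_deriv \<phi> c (y + h *\<^sub>R b)) = partial_deriv \<phi> b (y + h *\<^sub>R b)"
          using b by (subst sum.remove[OF finite_Basis b]) (auto simp: inner_Basis intro!: sum.neutral split: if_splits)
        then show ?thesis using vanishing_C1_line_derivative[OF \<phi>, of y b h]
          unfolding F_def F'_def by (intro has_vector_derivative_mult_left) simp
      qed
      show "norm (F' h y) \<le> C * 2 powr (real DIM('a) + 1) * wt (real DIM('a) + 1) y" if "\<bar>h\<bar> < 1" for h y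
      proof -
        have "norm y \<le> norm (y + h *\<^sub>R b) + norm (h *\<^sub>R b)" by (metis add_diff_cancel norm_triangle_ineq4)
        moreover have "norm (h *\<^sub>R b) = \<bar>h\<bar>" using b by simp
        ultimately have "1 + norm y \<le> 2 * (1 + norm (y + h *\<^sub>R b))"
          using that norm_ge_zero[of "y + h *\<^sub>R b"] unfolding distrib_left by linarith
        then have "wt (real DIM('a) + 1) (y + h *\<^sub>R b) \<le> 2 powr (real DIM('a) + 1) * wt (real DIM('a) + 1) y"
          by (intro wt_le_scale) auto
        then have "C * wt (real DIM('a) + 1) (y + h *\<^sub>R b) \<le> C * (2 powr (real DIM('a) + 1) * wt (real DIM('a) + 1) y)"
          using C by (intro mult_left_mono) auto
        then show ?thesis using C(2)[of "y + h *\<^sub>R b"] by (simp add: F'_def norm_mult mult.assoc)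
      qed
    qed (auto simp: F_def F'_def)
    moreover have "(\<integral>y. F h y \<partial>lborel) = 0" for h
    proof -
      have "(\<integral>y. \<phi> y * cis (- 2 * pi * ((y - h *\<^sub>R b) \<bullet> \<xi>)) \<partial>lborel)
        = (\<bar>1\<bar> ^ DIM('a)) *\<^sub>R (\<integral>y. \<phi> (h *\<^sub>R b + 1 *\<^sub>R y) * cis (- 2 * pi * ((h *\<^sub>R b + 1 *\<^sub>R y - h *\<^sub>R b) \<bullet> \<xi>)) \<partial>lborel)"
        by (rule lborel_integral_affine) auto
      also have "\<dots> = (\<integral>y. F h y \<partial>lborel)" by (simp add: F_def add.commute)
      finally have "(\<integral>y. F h y \<partial>lborel) = (\<integral>y. cis (2 * pi * h * (b \<bullet> \<xi>)) * (\<phi> y * cis (- 2 * pi * (y \<bullet> \<xi>))) \<partial>lborel)"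
        by (simp add: inner_diff_left right_diff_distrib cis_divide[symmetric] mult_ac cis_mult)
      also have "\<dots> = cis (2 * pi * h * (b \<bullet> \<xi>)) * fourier \<phi> \<xi>"
        unfolding integral_mult_right_zero by (simp add: fourier_lborel)
      finally show ?thesis using d(2)[OF \<xi>] by simp
    qed
    ultimately have "((\<lambda>h. 0) has_vector_derivative (\<integral>y. F' 0 y \<partial>lborel)) (at 0)" by simp
    then have "(\<integral>y. F' 0 y \<partial>lborel) = 0"
      using vector_derivative_unique_at has_vector_derivative_const by blast
    then show ?thesis by (simp add: F'_def fourier_lborel)
  qed
  then show ?thesis using r d(1) by (auto simp: vanishing_def)
qed

lemma poisson_kernel_le: "\<bar>poisson_kernel 1 (z::'a::euclidean_space)\<bar> \<le> poisson_const DIM('a)"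
proof -
  have "radsq 1 z powr (- (real DIM('a) + 1) / 2) \<le> 1 powr (- (real DIM('a) + 1) / 2)"
    by (intro powr_mono2') (auto simp: radsq_def)
  then have "poisson_const DIM('a) * radsq 1 z powr (- (real DIM('a) + 1) / 2) \<le> poisson_const DIM('a) * 1"
    using poisson_const_pos[of "DIM('a)"] by (intro mult_left_mono) auto
  then show ?thesis using poisson_const_pos[of "DIM('a)"] by (simp add: poisson_kernel_radsq abs_mult)
qed

text \<open>
  The derivative is moved onto \<open>\<phi>\<close> after writing \<open>P\<^sub>t * \<phi>(x) = \<integral> P\<^sub>1(z) \<phi>(x - t z) dz\<close>. This trades the kernel of size
  \<open>(t + |x|)\<^sup>-\<^sup>n\<^sup>-\<^sup>1\<close> for one of size \<open>(t + |x|)\<^sup>-\<^sup>n\<close>, whose singularity as \<open>t \<rightarrow> 0\<close> is only logarithmic.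
\<close>

lemma poisson_deriv_conv:
  fixes \<phi> :: "'a::euclidean_space \<Rightarrow> complex"
  assumes \<phi>: "vanishing_C1 \<phi>" and t: "0 < t"
  shows "(\<integral>y. \<phi> y * of_real (dpk v \<tau> t (x - y)) \<partial>lborel)
    = (\<Sum>b\<in>Basis. \<integral>y. of_real (poisson_const DIM('a) * ((t * (v \<bullet> b) - \<tau> * ((x - y) \<bullet> b)) * radsq t (x - y) powr (- (real DIM('a) + 1) / 2))) * partial_deriv \<phi> b y \<partial>lborel)"
proof -
  define n where "n = real DIM('a)"
  have r: "rapid \<phi>" "\<And>b. b \<in> Basis \<Longrightarrow> rapid (partial_deriv \<phi> b)" using \<phi> by (auto simp: vanishing_C1_def vanishing_def)
  have [measurable]: "\<phi> \<in> borel_measurable borel" using r by (auto simp: rapid_def)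
  have pdm: "partial_deriv \<phi> b \<in> borel_measurable borel" if "b \<in> Basis" for b using r(2)[OF that] by (rule rapidD)
  define d where "d = min (1 / (norm v + 1)) (t / (2 * (\<bar>\<tau>\<bar> + 1)))"
  have "0 < norm v + 1" using norm_ge_zero[of v] by linarith
  then have d: "0 < d" using t by (auto simp: d_def)
  note hd = radsq_perturb(1,2)[OF t, of _ v \<tau>, folded d_def]
  have tp: "0 < t + h * \<tau>" if "\<bar>h\<bar> < d" for h using hd(1)[OF that] t by linarith
  \<comment> \<open>The argument of \<phi> after substituting y = x + h v - (t + h \<tau>) z; the
    dependence on (x, t) now sits in \<phi> alone.\<close>
  define w where "w h z = x + h *\<^sub>R v - (t + h * \<tau>) *\<^sub>R z" for h and z :: 'a
  have w_eq: "w h z = (x - t *\<^sub>R z) + h *\<^sub>R (v - \<tau> *\<^sub>R z)" for h z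
    by (simp add: w_def algebra_simps)
  \<comment> \<open>Solving for z gives (t/2) |z| \<le> |x| + 1 + |w|, so 1 + |z| is at most k (1 +
    |w|), uniformly in small h.\<close>
  define k where "k = 1 + 2 / t * (norm x + 1)"
  have "0 \<le> 2 / t * (norm x + 1)" using t by simp
  then have k: "1 \<le> k" by (simp add: k_def)
  have wk: "1 + norm z \<le> k * (1 + norm (w h z))" if h: "\<bar>h\<bar> < d" for h z
  proof -
    have "(t + h * \<tau>) *\<^sub>R z = x + h *\<^sub>R v - w h z" by (simp add: w_def)
    then have "norm ((t + h * \<tau>) *\<^sub>R z) \<le> norm x + norm (h *\<^sub>R v) + norm (w h z)"
      by (metis add.commute add_mono_thms_linordered_semiring(2) norm_triangle_ineq norm_triangle_ineq4 order_trans)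
    then have "(t + h * \<tau>) * norm z \<le> norm x + 1 + norm (w h z)" using hd(2)[OF h] tp[OF h] by simp
    moreover have "t / 2 * norm z \<le> (t + h * \<tau>) * norm z" using hd(1)[OF h] by (intro mult_right_mono) auto
    ultimately have "t / 2 * norm z \<le> norm x + 1 + norm (w h z)" by linarith
    then have "norm z \<le> 2 / t * (norm x + 1 + norm (w h z))" using t by (simp add: field_simps)
    also have "\<dots> \<le> 2 / t * ((norm x + 1) * (1 + norm (w h z)))"
      using t mult_nonneg_nonneg[OF norm_ge_zero[of x] norm_ge_zero[of "w h z"]]
      by (intro mult_left_mono) (auto simp: algebra_simps)
    finally have "norm z \<le> 2 / t * ((norm x + 1) * (1 + norm (w h z)))" .
    moreover have "k * (1 + norm (w h z)) = 1 + norm (w h z) + 2 / t * ((norm x + 1) * (1 + norm (w h z)))"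
      unfolding k_def by (simp only: distrib_right[of 1] mult.assoc mult_1)
    ultimately show ?thesis using norm_ge_zero[of "w h z"] by linarith
  qed
  define F where "F h z = \<phi> (w h z) * of_real (poisson_kernel 1 z)" for h z
  define F' where "F' h z = (\<Sum>b\<in>Basis. ((v - \<tau> *\<^sub>R z) \<bullet> b) *\<^sub>R partial_deriv \<phi> b (w h z)) * of_real (poisson_kernel 1 z)" for h z
  \<comment> \<open>Decay n + 2: one power pays for the factor v - \<tau> z, and the remaining n + 1
    is integrable.\<close>
  have "\<exists>C. 0 < C \<and> (\<forall>x. norm (partial_deriv \<phi> b x) \<le> C * wt (n + 2) x)" if "b \<in> Basis" for b
    using rapid_bound[OF r(2)[OF that]] by metis
  then obtain Cb where Cb: "\<And>b. b \<in> Basis \<Longrightarrow> 0 < Cb b" "\<And>b x. b \<in> Basis \<Longrightarrow> norm (partial_deriv \<phi> b x) \<le> Cb b * wt (n + 2) x"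
    by metis
  define G where "G = (\<Sum>b\<in>Basis. Cb b) * (norm v + \<bar>\<tau>\<bar>) * k powr (n + 2) * poisson_const DIM('a)"
  have der: "((\<lambda>h. \<integral>z. F h z \<partial>lborel) has_vector_derivative (\<integral>z. F' 0 z \<partial>lborel)) (at 0)"
  proof (rule has_vector_derivative_lborel_integral[OF d])
    show "F h \<in> borel_measurable borel" for h unfolding F_def w_def by measurable
    show "F' 0 \<in> borel_measurable borel" unfolding F'_def w_def
      by (intro borel_measurable_times borel_measurable_sum borel_measurable_scaleR measurable_compose[OF _ pdm]) auto
    obtain C where C: "0 < C" "\<And>x. norm (\<phi> x) \<le> C * wt (n + 1) x" using rapid_bound[OF r(1)] by blast
    show "integrable lborel (F 0)"
    proof (rule Bochner_Integration.integrable_bound)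
      show "integrable lborel (\<lambda>z::'a. C * (k powr (n + 1) * wt (n + 1) z) * poisson_const DIM('a))"
        by (intro integrable_mult_right integrable_mult_left integrable_wt) (simp add: n_def)
      show "F 0 \<in> borel_measurable lborel" unfolding F_def w_def by measurable
      show "AE z in lborel. norm (F 0 z) \<le> norm (C * (k powr (n + 1) * wt (n + 1) z) * poisson_const DIM('a))"
      proof (rule AE_I2)
        fix z
        have "wt (n + 1) (w 0 z) \<le> k powr (n + 1) * wt (n + 1) z"
          using k d by (intro wt_le_scale wk) (auto simp: n_def)
        then have "C * wt (n + 1) (w 0 z) \<le> C * (k powr (n + 1) * wt (n + 1) z)" using C by (intro mult_left_mono) auto
        then have "norm (\<phi> (w 0 z)) \<le> C * (k powr (n + 1) * wt (n + 1) z)" using C(2)[of "w 0 z"] by linarith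
        then have "norm (F 0 z) \<le> C * (k powr (n + 1) * wt (n + 1) z) * poisson_const DIM('a)"
          unfolding F_def norm_mult norm_of_real using C by (intro mult_mono poisson_kernel_le) auto
        then show "norm (F 0 z) \<le> norm (C * (k powr (n + 1) * wt (n + 1) z) * poisson_const DIM('a))" by simp
      qed
    qed
    show "((\<lambda>h. F h z) has_vector_derivative F' h z) (at h)" for h z
      unfolding F_def F'_def w_eq by (intro has_vector_derivative_mult_left vanishing_C1_line_derivative \<phi>)
    show "integrable lborel (\<lambda>z::'a. G * wt (n + 1) z)"
      by (intro integrable_mult_right integrable_wt) (simp add: n_def)
    show "norm (F' h z) \<le> G * wt (n + 1) z" if h: "\<bar>h\<bar> < d" for h z
    proof -
      have "wt (n + 2) (w h z) \<le> k powr (n + 2) * wt (n + 2) z"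
        using k by (intro wt_le_scale wk h) (auto simp: n_def)
      then have 1: "norm (partial_deriv \<phi> b (w h z)) \<le> Cb b * (k powr (n + 2) * wt (n + 2) z)" if "b \<in> Basis" for b
        using Cb[OF that] by (meson mult_left_mono order_trans less_imp_le)
      have 2: "\<bar>(v - \<tau> *\<^sub>R z) \<bullet> b\<bar> \<le> (norm v + \<bar>\<tau>\<bar>) * wt (-1) z" if "b \<in> Basis" for b
      proof -
        have "\<bar>(v - \<tau> *\<^sub>R z) \<bullet> b\<bar> \<le> norm (v - \<tau> *\<^sub>R z)" using that by (rule Basis_le_norm)
        also have "\<dots> \<le> norm v + \<bar>\<tau>\<bar> * norm z" using norm_triangle_ineq4[of v "\<tau> *\<^sub>R z"] by simp
        also have "\<dots> \<le> (norm v + \<bar>\<tau>\<bar>) * (1 + norm z)"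
          using mult_nonneg_nonneg[OF norm_ge_zero[of v] norm_ge_zero[of z]] by (simp add: algebra_simps)
        finally show ?thesis by (simp add: wt_def add_nonneg_nonneg)
      qed
      have "norm (\<Sum>b\<in>Basis. ((v - \<tau> *\<^sub>R z) \<bullet> b) *\<^sub>R partial_deriv \<phi> b (w h z))
        \<le> (\<Sum>b\<in>Basis. ((norm v + \<bar>\<tau>\<bar>) * wt (-1) z) * (Cb b * (k powr (n + 2) * wt (n + 2) z)))"
      proof (rule sum_norm_le)
        fix b :: 'a assume b: "b \<in> Basis"
        show "norm (((v - \<tau> *\<^sub>R z) \<bullet> b) *\<^sub>R partial_deriv \<phi> b (w h z)) \<le> ((norm v + \<bar>\<tau>\<bar>) * wt (-1) z) * (Cb b * (k powr (n + 2) * wt (n + 2) z))"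
          unfolding norm_scaleR using 1[OF b] 2[OF b] by (intro mult_mono) auto
      qed
      also have "\<dots> = (\<Sum>b\<in>Basis. Cb b) * (norm v + \<bar>\<tau>\<bar>) * k powr (n + 2) * wt (n + 1) z"
      proof -
        have "wt (n + 1) z = wt (-1) z * wt (n + 2) z" using wt_add[of "-1" "n + 2" z] by (simp add: add.commute)
        then show ?thesis by (simp add: sum_distrib_left sum_distrib_right mult_ac)
      qed
      finally have "norm (F' h z) \<le> ((\<Sum>b\<in>Basis. Cb b) * (norm v + \<bar>\<tau>\<bar>) * k powr (n + 2) * wt (n + 1) z) * poisson_const DIM('a)"
        unfolding F'_def norm_mult norm_of_real by (intro mult_mono poisson_kernel_le) (auto intro: order_trans[OF norm_ge_zero])
      then show ?thesis by (simp add: G_def mult_ac)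
    qed
  qed
  have eqF: "poisson_integral \<phi> (x + h *\<^sub>R v) (t + h * \<tau>) = (\<integral>z. F h z \<partial>lborel)" if h: "\<bar>h\<bar> < d" for h
  proof -
    define t' where "t' = t + h * \<tau>"
    have t': "0 < t'" using tp[OF h] by (simp add: t'_def)
    have "poisson_integral \<phi> (x + h *\<^sub>R v) t' = (\<bar>- t'\<bar> ^ DIM('a)) *\<^sub>R
      (\<integral>z. \<phi> ((x + h *\<^sub>R v) + (- t') *\<^sub>R z) * of_real (poisson_kernel t' ((x + h *\<^sub>R v) - ((x + h *\<^sub>R v) + (- t') *\<^sub>R z))) \<partial>lborel)"
      unfolding poisson_integral_lborel[OF \<open>\<phi> \<in> borel_measurable borel\<close>]
      by (rule lborel_integral_affine) (use t' in auto)
    also have "(\<lambda>z. \<phi> ((x + h *\<^sub>R v) + (- t') *\<^sub>R z) * complex_of_real (poisson_kernel t' ((x + h *\<^sub>R v) - ((x + h *\<^sub>R v) + (- t') *\<^sub>R z))))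
      = (\<lambda>z. (1 / t' ^ DIM('a)) *\<^sub>R F h z)"
    proof
      fix z :: 'a
      have "poisson_kernel t' (t' *\<^sub>R z) = poisson_kernel 1 z / t' ^ DIM('a)"
        using poisson_kernel_scale[OF t', of 1 z] by simp
      then show "\<phi> ((x + h *\<^sub>R v) + (- t') *\<^sub>R z) * complex_of_real (poisson_kernel t' ((x + h *\<^sub>R v) - ((x + h *\<^sub>R v) + (- t') *\<^sub>R z)))
        = (1 / t' ^ DIM('a)) *\<^sub>R F h z"
        unfolding F_def w_def t'_def[symmetric] by (simp add: scaleR_conv_of_real)
    qed
    finally show ?thesis using t' by (simp add: t'_def[symmetric])
  qed
  have "((\<lambda>h. poisson_integral \<phi> (x + h *\<^sub>R v) (t + h * \<tau>)) has_vector_derivative (\<integral>z. F' 0 z \<partial>lborel)) (at 0)"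
    using der by (rule has_vector_derivative_transform_within_open[of _ _ _ "{-d<..<d}"]) (use d eqF in \<open>auto simp: abs_less_iff\<close>)
  \<comment> \<open>Two expressions for one derivative: under the original integral, with the
    derivative on the kernel, and after the substitution, with the derivative on \<phi>.\<close>
  then have 1: "(\<integral>y. \<phi> y * of_real (dpk v \<tau> t (x - y)) \<partial>lborel) = (\<integral>z. F' 0 z \<partial>lborel)"
    using poisson_integral_deriv[OF slow_rapid[OF r(1)] t, of x v \<tau>] by (rule vector_derivative_unique_at[symmetric])
  define m where "m b y = poisson_const DIM('a) * ((t * (v \<bullet> b) - \<tau> * ((x - y) \<bullet> b)) * radsq t (x - y) powr (- (n + 1) / 2))" for b y
  have mm: "(\<lambda>y. complex_of_real (m b y) * partial_deriv \<phi> b y) \<in> borel_measurable borel" if "b \<in> Basis" for b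
    using pdm[OF that] unfolding m_def by measurable
  define H where "H y = (\<Sum>b\<in>Basis. complex_of_real (m b y) * partial_deriv \<phi> b y)" for y
  have [measurable]: "H \<in> borel_measurable borel" unfolding H_def by (intro borel_measurable_sum mm)
  \<comment> \<open>The substitution y = x - t z identifies the integral in the original variable
    with the one in z.\<close>
  have "(\<integral>y. H y \<partial>lborel) = (\<bar>- t\<bar> ^ DIM('a)) *\<^sub>R (\<integral>z. H (x + (- t) *\<^sub>R z) \<partial>lborel)"
    by (rule lborel_integral_affine) (use t in auto)
  also have "(\<lambda>z. H (x + (- t) *\<^sub>R z)) = (\<lambda>z. (1 / t ^ DIM('a)) *\<^sub>R F' 0 z)"
  proof
    fix z :: 'a
    have pk: "poisson_const DIM('a) * t * radsq t (t *\<^sub>R z) powr (- (n + 1) / 2) = poisson_kernel 1 z / t ^ DIM('a)"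
      using poisson_kernel_scale[OF t, of 1 z] by (simp add: poisson_kernel_radsq[of t] n_def)
    have "m b (x + (- t) *\<^sub>R z) = ((v - \<tau> *\<^sub>R z) \<bullet> b) * (poisson_kernel 1 z / t ^ DIM('a))" for b
      unfolding m_def pk[symmetric] by (simp add: inner_diff_left algebra_simps)
    then have "H (x + (- t) *\<^sub>R z) = (\<Sum>b\<in>Basis. complex_of_real (((v - \<tau> *\<^sub>R z) \<bullet> b) * (poisson_kernel 1 z / t ^ DIM('a))) * partial_deriv \<phi> b (w 0 z))"
      by (simp add: H_def w_def)
    also have "\<dots> = (1 / t ^ DIM('a)) *\<^sub>R F' 0 z"
      unfolding F'_def by (simp add: scaleR_conv_of_real sum_distrib_left sum_distrib_right sum_divide_distrib mult_ac)
    finally show "H (x + (- t) *\<^sub>R z) = (1 / t ^ DIM('a)) *\<^sub>R F' 0 z" .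
  qed
  finally have 2: "(\<integral>y. H y \<partial>lborel) = (\<integral>z. F' 0 z \<partial>lborel)" using t by simp
  have 3: "(\<integral>y. H y \<partial>lborel) = (\<Sum>b\<in>Basis. \<integral>y. complex_of_real (m b y) * partial_deriv \<phi> b y \<partial>lborel)"
    unfolding H_def
  proof (rule Bochner_Integration.integral_sum)
    fix b :: 'a assume b: "b \<in> Basis"
    show "integrable lborel (\<lambda>y. complex_of_real (m b y) * partial_deriv \<phi> b y)"
    proof (rule rapid_integrable, rule rapid_mult_growth[OF r(2)[OF b]])
      define B where "B = poisson_const DIM('a) * (t * norm v + \<bar>\<tau>\<bar> * (norm x + 1)) * (t\<^sup>2) powr (- (n + 1) / 2)"
      show "(\<lambda>y. complex_of_real (m b y)) \<in> borel_measurable borel" unfolding m_def by measurable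
      show "0 \<le> B" using t poisson_const_pos[of "DIM('a)"] by (auto simp: B_def intro!: mult_nonneg_nonneg add_nonneg_nonneg)
      show "norm (complex_of_real (m b y)) \<le> B * wt (- 1) y" for y
      proof -
        have q: "radsq t (x - y) powr (- (n + 1) / 2) \<le> (t\<^sup>2) powr (- (n + 1) / 2)"
          using t by (intro powr_mono2') (auto simp: radsq_def n_def)
        have "\<bar>t * (v \<bullet> b) - \<tau> * ((x - y) \<bullet> b)\<bar> \<le> t * norm v + \<bar>\<tau>\<bar> * norm (x - y)"
          using Basis_le_norm[OF b, of v] Basis_le_norm[OF b, of "x - y"] t
          by (intro order_trans[OF abs_triangle_ineq4] add_mono) (auto simp: abs_mult intro!: mult_left_mono)
        also have "\<dots> \<le> t * norm v + \<bar>\<tau>\<bar> * (norm x + norm y)"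
          by (intro add_left_mono mult_left_mono norm_triangle_ineq4) auto
        also have "\<dots> \<le> (t * norm v + \<bar>\<tau>\<bar> * (norm x + 1)) * (1 + norm y)"
          using t mult_nonneg_nonneg[OF norm_ge_zero[of x] norm_ge_zero[of y]]
          by (simp add: algebra_simps add_nonneg_nonneg)
        also have "\<dots> = (t * norm v + \<bar>\<tau>\<bar> * (norm x + 1)) * wt (-1) y" by (simp add: wt_def add_nonneg_nonneg)
        finally have "\<bar>t * (v \<bullet> b) - \<tau> * ((x - y) \<bullet> b)\<bar> * radsq t (x - y) powr (- (n + 1) / 2)
          \<le> ((t * norm v + \<bar>\<tau>\<bar> * (norm x + 1)) * wt (-1) y) * (t\<^sup>2) powr (- (n + 1) / 2)"
          using q by (intro mult_mono) (auto intro: order_trans[OF abs_ge_zero])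
        then have "poisson_const DIM('a) * (\<bar>t * (v \<bullet> b) - \<tau> * ((x - y) \<bullet> b)\<bar> * radsq t (x - y) powr (- (n + 1) / 2))
          \<le> poisson_const DIM('a) * (((t * norm v + \<bar>\<tau>\<bar> * (norm x + 1)) * wt (-1) y) * (t\<^sup>2) powr (- (n + 1) / 2))"
          using poisson_const_pos[of "DIM('a)"] by (intro mult_left_mono) auto
        then show ?thesis
          unfolding norm_of_real m_def abs_mult B_def using poisson_const_pos[of "DIM('a)"] by (simp add: mult_ac)
      qed
    qed
  qed
  show ?thesis using 1 2 3 unfolding m_def n_def by simp
qed

section \<open>Convolution with functions having vanishing moments\<close>

text \<open>The tail of the binomial series carries the factor z^N, and what is left is bounded by
  its absolute series at 9/16.\<close>

lemma binomial_remainder: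
  fixes a :: real
  obtains C where "0 < C" "\<And>z. \<bar>z\<bar> \<le> 9/16 \<Longrightarrow> \<bar>(1 + z) powr a - (\<Sum>k<N. (a gchoose k) * z ^ k)\<bar> \<le> C * \<bar>z\<bar> ^ N"
proof -
  define f where "f k = \<bar>a gchoose k\<bar> * (9/16) ^ k" for k
  \<comment> \<open>Convergence at 3/4 gives absolute convergence at 9/16; the latter is the bound
    for |z| that will hold when |y| is at most a quarter of R, where R^2 = u^2 + |x|^2.\<close>
  have "summable (\<lambda>k. (a gchoose k) * (3/4) ^ k)"
    using gen_binomial_real[of "3/4" a] by (auto simp: sums_iff)
  from powser_insidea[OF this, of "9/16"] have f: "summable f"
    by (simp add: f_def[abs_def] abs_mult)
  have fN: "summable (\<lambda>k. f (k + N))" using f by (simp add: summable_iff_shift)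
  define C where "C = (16/9) ^ N * (\<Sum>k. f (k + N)) + 1"
  have sf: "0 \<le> (\<Sum>k. f (k + N))" by (intro suminf_nonneg fN) (simp add: f_def)
  show ?thesis
  proof (rule that[of C])
    show "0 < C" using sf by (simp add: C_def add_nonneg_pos)
    fix z :: real assume z: "\<bar>z\<bar> \<le> 9/16"
    define g where "g k = (a gchoose k) * z ^ k" for k
    have "g sums (1 + z) powr a" unfolding g_def using z by (intro gen_binomial_real) simp
    from sums_split_initial_segment[OF this, of N]
    have s: "(\<lambda>k. g (k + N)) sums ((1 + z) powr a - (\<Sum>k<N. g k))" .
    have le: "norm (g (k + N)) \<le> ((16/9) ^ N * \<bar>z\<bar> ^ N) * f (k + N)" for k
    proof -
      have "norm (g (k + N)) = \<bar>z\<bar> ^ N * (\<bar>a gchoose (k + N)\<bar> * \<bar>z\<bar> ^ k)"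
        by (simp add: g_def abs_mult power_abs power_add mult_ac)
      also have "\<dots> \<le> \<bar>z\<bar> ^ N * (\<bar>a gchoose (k + N)\<bar> * (9/16) ^ k)"
        using z by (intro mult_left_mono power_mono) auto
      also have "\<dots> = ((16/9) ^ N * \<bar>z\<bar> ^ N) * f (k + N)"
      proof -
        have "(16/9 :: real) ^ N * (9/16) ^ N = 1" by (simp add: power_mult_distrib[symmetric])
        then have e: "(9/16::real) ^ k = (16/9) ^ N * (9/16) ^ (k + N)" by (simp add: power_add)
        show ?thesis unfolding f_def e by (simp only: mult_ac)
      qed
      finally show ?thesis .
    qed
    have sm: "summable (\<lambda>k. ((16/9) ^ N * \<bar>z\<bar> ^ N) * f (k + N))" using fN by (rule summable_mult)
    have "\<bar>(1 + z) powr a - (\<Sum>k<N. g k)\<bar> = norm (\<Sum>k. g (k + N))" using s by (simp add: sums_iff)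
    also have "\<dots> \<le> (\<Sum>k. ((16/9) ^ N * \<bar>z\<bar> ^ N) * f (k + N))"
      by (rule norm_suminf_le[OF le sm])
    also have "\<dots> = ((16/9) ^ N * \<bar>z\<bar> ^ N) * (\<Sum>k. f (k + N))" using fN by (rule suminf_mult)
    also have "\<dots> \<le> C * \<bar>z\<bar> ^ N" by (simp add: C_def algebra_simps)
    finally show "\<bar>(1 + z) powr a - (\<Sum>k<N. (a gchoose k) * z ^ k)\<bar> \<le> C * \<bar>z\<bar> ^ N" by (simp add: g_def)
  qed
qed

section \<open>Size of the kernel after the transfer of the derivative\<close>

definition radpow :: "real \<Rightarrow> 'a::euclidean_space \<Rightarrow> real" where
  "radpow u z = radsq u z powr (- real DIM('a) / 2)"

lemma radpow_nonneg [simp]: "0 \<le> radpow u z" by (simp add: radpow_def)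

lemma radpow_measurable [measurable]: "radpow u \<in> borel_measurable borel"
  unfolding radpow_def by measurable

text \<open>Where \<open>radsq\<close> is below 1, a larger exponent only increases the power, and n
  + e makes it integrable after rescaling by u, while the exponent n is borderline. Elsewhere the
  bound 1 holds.\<close>

lemma radpow_le:
  fixes z :: "'a::euclidean_space"
  assumes u: "0 < u" and e: "0 < e"
  shows "radpow u z \<le> 1 + 2 powr ((real DIM('a) + e) / 2) * u powr (- (real DIM('a) + e)) * wt (real DIM('a) + e) ((1 / u) *\<^sub>R z)"
proof -
  define s where "s = real DIM('a) + e"
  have s: "0 \<le> s" using e by (simp add: s_def)
  define w where "w = (1 / u) *\<^sub>R z"
  have nn: "0 \<le> 2 powr (s / 2) * u powr (- s) * wt s w" by simp
  have q: "0 < radsq u z" by (rule radsq_pos[OF u])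
  show ?thesis
  proof (cases "1 \<le> radsq u z")
    case True
    then have "radpow u z \<le> 1 powr (- real DIM('a) / 2)" unfolding radpow_def by (intro powr_mono2') auto
    then have "radpow u z \<le> 1" by simp
    then show ?thesis using nn unfolding s_def w_def by linarith
  next
    case False
    have "radpow u z \<le> radsq u z powr (- s / 2)"
      unfolding radpow_def using False q e by (intro powr_mono') (auto simp: s_def)
    also have "radsq u z = u\<^sup>2 * radsq 1 w"
      using radsq_scale[of u 1 w] u by (simp add: w_def)
    also have "(u\<^sup>2 * radsq 1 w) powr (- s / 2) = u powr (- s) * radsq 1 w powr (- s / 2)"
      using u by (simp only: powr_mult power2_powr)
    also have "radsq 1 w powr (- s / 2) \<le> 2 powr (s / 2) * wt s w"
    proof (rule radsq_powr_le_wt[OF s])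
      show "(1 + norm w)\<^sup>2 \<le> 2 * radsq 1 w"
        using sum_squares_bound[of 1 "norm w"] by (simp add: radsq_def power2_eq_square algebra_simps)
    qed simp
    finally show ?thesis using u unfolding s_def w_def by (simp add: mult_ac mult_left_mono)
  qed
qed

text \<open>Scaling gives u^n u^(-n-e) = u^(-e): the logarithmic singularity as u tends to 0 is
  traded for an arbitrarily small power.\<close>

lemma radpow_integral_bound:
  assumes e: "0 < e"
  obtains C where "0 < C" "\<And>u (x::'a::euclidean_space). 0 < u \<Longrightarrow>
    (\<integral>\<^sup>+y. ennreal ((1 + radpow u (x - y)) * wt (real DIM('a) + 1) y) \<partial>lborel) \<le> ennreal (C * (1 + u powr (- e)))"
proof -
  define n where "n = real DIM('a)"
  define A where "A = 2 * wt_int TYPE('a) (n + 1)"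
  define B where "B = 2 powr ((n + e) / 2) * wt_int TYPE('a) (n + e)"
  have AB: "0 \<le> A" "0 \<le> B" by (auto simp: A_def B_def)
  show ?thesis
  proof (rule that[of "A + B + 1"])
    show "0 < A + B + 1" using AB by simp
    fix u :: real and x :: 'a assume u: "0 < u"
    define D where "D = 2 powr ((n + e) / 2) * u powr (- (n + e))"
    have D: "0 \<le> D" by (simp add: D_def)
    have "(\<integral>\<^sup>+y. ennreal ((1 + radpow u (x - y)) * wt (n + 1) y) \<partial>lborel)
      \<le> (\<integral>\<^sup>+y. ennreal 2 * ennreal (wt (n + 1) y) + ennreal D * ennreal (wt (n + e) ((1 / u) *\<^sub>R (x - y))) \<partial>lborel)"
    proof (rule nn_integral_mono)
      fix y
      have "(1 + radpow u (x - y)) * wt (n + 1) y \<le> (2 + D * wt (n + e) ((1 / u) *\<^sub>R (x - y))) * wt (n + 1) y"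
        using radpow_le[OF u e, of "x - y"] unfolding D_def n_def by (intro mult_right_mono) auto
      also have "\<dots> \<le> 2 * wt (n + 1) y + D * wt (n + e) ((1 / u) *\<^sub>R (x - y)) * 1"
        unfolding distrib_right using D by (intro add_left_mono mult_left_mono wt_le_1 mult_nonneg_nonneg) (auto simp: n_def)
      finally have "ennreal ((1 + radpow u (x - y)) * wt (n + 1) y) \<le> ennreal (2 * wt (n + 1) y + D * wt (n + e) ((1 / u) *\<^sub>R (x - y)))"
        by (intro ennreal_leI) simp
      then show "ennreal ((1 + radpow u (x - y)) * wt (n + 1) y) \<le> ennreal 2 * ennreal (wt (n + 1) y) + ennreal D * ennreal (wt (n + e) ((1 / u) *\<^sub>R (x - y)))"
        using D by (simp add: ennreal_mult)
    qed
    also have "\<dots> = ennreal 2 * (\<integral>\<^sup>+y. ennreal (wt (n + 1) (y::'a)) \<partial>lborel) + ennreal D * (\<integral>\<^sup>+y. ennreal (wt (n + e) ((1 / u) *\<^sub>R (x - y))) \<partial>lborel)"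
      by (subst nn_integral_add) (auto simp: nn_integral_cmult)
    also have "(\<integral>\<^sup>+y. ennreal (wt (n + 1) (y::'a)) \<partial>lborel) = ennreal (wt_int TYPE('a) (n + 1))"
      by (rule nn_integral_wt) (simp add: n_def)
    also have "(\<integral>\<^sup>+y. ennreal (wt (n + e) ((1 / u) *\<^sub>R (x - y))) \<partial>lborel) = ennreal (u ^ DIM('a)) * ennreal (wt_int TYPE('a) (n + e))"
    proof -
      have "(\<integral>\<^sup>+y. ennreal (wt (n + e) ((1 / u) *\<^sub>R (x - y))) \<partial>lborel)
        = ennreal (\<bar>- u\<bar> ^ DIM('a)) * (\<integral>\<^sup>+y. ennreal (wt (n + e) ((1 / u) *\<^sub>R (x - (x + (- u) *\<^sub>R y)))) \<partial>lborel)"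
        by (rule nn_integral_lborel_affine) (use u in auto)
      also have "\<dots> = ennreal (u ^ DIM('a)) * (\<integral>\<^sup>+y. ennreal (wt (n + e) (y::'a)) \<partial>lborel)" using u by simp
      also have "(\<integral>\<^sup>+y. ennreal (wt (n + e) (y::'a)) \<partial>lborel) = ennreal (wt_int TYPE('a) (n + e))"
        by (rule nn_integral_wt) (use e in \<open>simp add: n_def\<close>)
      finally show ?thesis .
    qed
    also have "ennreal 2 * ennreal (wt_int TYPE('a) (n + 1)) + ennreal D * (ennreal (u ^ DIM('a)) * ennreal (wt_int TYPE('a) (n + e)))
       = ennreal (A + D * u ^ DIM('a) * wt_int TYPE('a) (n + e))"
      using D u by (simp add: A_def ennreal_mult mult.assoc)
    also have "D * u ^ DIM('a) * wt_int TYPE('a) (n + e) = B * u powr (- e)"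
    proof -
      have "u powr (- (n + e)) * u ^ DIM('a) = u powr (- e)"
        using u by (simp add: n_def powr_realpow[symmetric] powr_add[symmetric])
      then show ?thesis unfolding D_def B_def by (simp add: mult_ac)
    qed
    also have "ennreal (A + B * u powr (- e)) \<le> ennreal ((A + B + 1) * (1 + u powr (- e)))"
      using AB by (intro ennreal_leI) (simp add: algebra_simps)
    finally show "(\<integral>\<^sup>+y. ennreal ((1 + radpow u (x - y)) * wt (real DIM('a) + 1) y) \<partial>lborel) \<le> ennreal ((A + B + 1) * (1 + u powr (- e)))"
      by (simp add: n_def)
  qed
qed

lemma lborel_integral_norm_le:
  fixes f :: "'a::euclidean_space \<Rightarrow> 'b::{banach, second_countable_topology}"
  assumes [measurable]: "f \<in> borel_measurable borel" and fg: "\<And>y. norm (f y) \<le> D * g y" and D: "0 \<le> D" "0 \<le> E"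
    and [measurable]: "g \<in> borel_measurable borel" and g: "(\<integral>\<^sup>+y. ennreal (g y) \<partial>lborel) \<le> ennreal E"
  shows "integrable lborel f" and "norm (\<integral>y. f y \<partial>lborel) \<le> D * E"
proof -
  have "(\<integral>\<^sup>+y. ennreal (norm (f y)) \<partial>lborel) \<le> (\<integral>\<^sup>+y. ennreal D * ennreal (g y) \<partial>lborel)"
    using fg D by (intro nn_integral_mono) (simp add: ennreal_leI flip: ennreal_mult')
  also have "\<dots> \<le> ennreal D * ennreal E" by (subst nn_integral_cmult) (auto intro!: mult_left_mono g)
  finally have le: "(\<integral>\<^sup>+y. ennreal (norm (f y)) \<partial>lborel) \<le> ennreal (D * E)" using D by (simp add: ennreal_mult)
  then show i: "integrable lborel f" by (intro integrableI_bounded) (auto intro: le_less_trans)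
  have "ennreal (norm (\<integral>y. f y \<partial>lborel)) \<le> ennreal (D * E)"
    by (rule order_trans[OF integral_norm_bound_ennreal[OF i] le])
  then show "norm (\<integral>y. f y \<partial>lborel) \<le> D * E" using D by (simp add: ennreal_le_iff)
qed

text \<open>Both u and |x| are at most the square root of \<open>radsq\<close>, so the numerator
  lowers the exponent (n + 1)/2 to n/2.\<close>

lemma radpow_kernel_bound:
  fixes x :: "'a::euclidean_space"
  assumes b: "b \<in> Basis" and u: "0 < u"
  shows "\<bar>(u * \<alpha> - \<beta> * (x \<bullet> b)) * radsq u x powr (- (real DIM('a) + 1) / 2)\<bar> \<le> (\<bar>\<alpha>\<bar> + \<bar>\<beta>\<bar>) * radpow u x"
proof -
  define q where "q = radsq u x"
  have q: "0 < q" using radsq_pos[OF u] by (simp add: q_def)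
  have s1: "u \<le> sqrt q" unfolding q_def radsq_def by (rule real_le_rsqrt) simp
  have s2: "norm x \<le> sqrt q" unfolding q_def radsq_def by (rule real_le_rsqrt) simp
  have "\<bar>u * \<alpha> - \<beta> * (x \<bullet> b)\<bar> \<le> u * \<bar>\<alpha>\<bar> + \<bar>\<beta>\<bar> * norm x"
    using Basis_le_norm[OF b, of x] u
    by (intro order_trans[OF abs_triangle_ineq4] add_mono) (auto simp: abs_mult intro!: mult_left_mono)
  also have "\<dots> \<le> sqrt q * \<bar>\<alpha>\<bar> + \<bar>\<beta>\<bar> * sqrt q" by (intro add_mono mult_left_mono mult_right_mono s1 s2) auto
  finally have "\<bar>u * \<alpha> - \<beta> * (x \<bullet> b)\<bar> \<le> (\<bar>\<alpha>\<bar> + \<bar>\<beta>\<bar>) * sqrt q" by (simp add: algebra_simps)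
  then have "\<bar>(u * \<alpha> - \<beta> * (x \<bullet> b)) * q powr (- (real DIM('a) + 1) / 2)\<bar> \<le> (\<bar>\<alpha>\<bar> + \<bar>\<beta>\<bar>) * (sqrt q * q powr (- (real DIM('a) + 1) / 2))"
    unfolding abs_mult mult.assoc[symmetric] by (intro mult_mono) auto
  also have "sqrt q * q powr (- (real DIM('a) + 1) / 2) = q powr (1/2 + (- (real DIM('a) + 1) / 2))" using q by (simp add: powr_half_sqrt powr_add)
  also have "1/2 + (- (real DIM('a) + 1) / 2) = - real DIM('a) / 2" by (simp add: field_simps)
  finally show ?thesis unfolding radpow_def q_def .
qed

text \<open>
  The polynomial is the truncated binomial expansion of \<open>(1 + z)\<^sup>-\<^sup>a\<close> in \<open>z = (|y|\<^sup>2 - 2 x\<bullet>y) / (u\<^sup>2 + |x|\<^sup>2)\<close>; being a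
  polynomial in \<open>y\<close>, it is annihilated by functions with vanishing moments.
\<close>

lemma kernel_minus_polynomial:
  fixes b :: "'a::euclidean_space"
  assumes b: "b \<in> Basis"
  obtains D where "0 \<le> D" "\<And>u (x::'a). 0 < u \<Longrightarrow> 1 \<le> radsq u x \<Longrightarrow>
    \<exists>P. real_polynomial_function P \<and> (\<forall>y. \<bar>(u * \<alpha> - \<beta> * ((x - y) \<bullet> b)) * radsq u (x - y) powr (- (real DIM('a) + 1) / 2) - P y\<bar>
      \<le> D / sqrt (radsq u x) ^ N * ((1 + norm y) ^ (3 * N + 1) * (1 + radpow u (x - y))))"
proof -
  define n where "n = real DIM('a)"
  define a where "a = - (n + 1) / 2"
  define g where "g k = a gchoose k" for k
  obtain Cg where Cg: "0 < Cg" "\<And>z. \<bar>z\<bar> \<le> 9/16 \<Longrightarrow> \<bar>(1 + z) powr a - (\<Sum>k<N. g k * z ^ k)\<bar> \<le> Cg * \<bar>z\<bar> ^ N"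
    unfolding g_def using binomial_remainder by metis
  define Sg where "Sg = (\<Sum>k<N. \<bar>g k\<bar>)"
  have Sg: "0 \<le> Sg" by (simp add: Sg_def sum_nonneg)
  define c where "c = \<bar>\<alpha>\<bar> + \<bar>\<beta>\<bar>"
  have c: "0 \<le> c" by (simp add: c_def)
  \<comment> \<open>The first summand serves the region |y| \<le> R/4, the second its
    complement.\<close>
  define D where "D = 3 * c * (Cg * (9/4) ^ N) + c * 4 ^ N * (1 + 2 * Sg)"
  show ?thesis
  proof (rule that[of D])
    show D0: "0 \<le> D" using c Cg Sg by (simp add: D_def)
    fix u :: real and x :: 'a assume u: "0 < u" and q1: "1 \<le> radsq u x"
    define R where "R = sqrt (radsq u x)"
    have R: "1 \<le> R" "R\<^sup>2 = radsq u x" using q1 by (auto simp: R_def)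
    have uR: "u \<le> R" unfolding R_def radsq_def by (rule real_le_rsqrt) simp
    have xR: "norm x \<le> R" unfolding R_def radsq_def by (rule real_le_rsqrt) simp
    define Ra where "Ra = radsq u x powr a"
    have Ra: "Ra = 1 / R ^ (DIM('a) + 1)"
    proof -
      have "(R\<^sup>2 * 1) powr a = (1 / R ^ (DIM('a) + 1)) * 1 powr a"
        using power2_mult_powr[of R 1 "DIM('a) + 1"] R(1) unfolding a_def n_def by (simp only: of_nat_add of_nat_1)
      then show ?thesis by (simp add: Ra_def R(2))
    qed
    have Ra0: "0 \<le> Ra" by (simp add: Ra_def)
    have RaR: "Ra * R \<le> 1" unfolding Ra using R(1) by (simp add: one_le_power)
    have Ra1: "Ra \<le> 1" unfolding Ra using R(1) one_le_power[OF R(1), of "DIM('a) + 1"] by (simp del: power_Suc add: divide_le_eq)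
    define M where "M y = u * \<alpha> - \<beta> * ((x - y) \<bullet> b)" for y
    define z where "z y = (y \<bullet> y - 2 * (x \<bullet> y)) * (1 / radsq u x)" for y
    define P where "P y = M y * Ra * (\<Sum>k<N. g k * z y ^ k)" for y
    define ke where "ke y = M y * radsq u (x - y) powr a" for y
    have lin: "real_polynomial_function (\<lambda>y::'a. w \<bullet> y)" for w
      by (intro real_polynomial_function.intros bounded_linear_inner_right)
    have lin': "real_polynomial_function (\<lambda>y::'a. y \<bullet> w)" for w
      by (intro real_polynomial_function.intros bounded_linear_inner_left)
    have sq: "real_polynomial_function (\<lambda>y::'a. y \<bullet> y)"
    proof -
      have "real_polynomial_function (\<lambda>y::'a. \<Sum>c\<in>Basis. (y \<bullet> c) * (y \<bullet> c))"
        by (intro real_polynomial_function_sum real_polynomial_function.intros(4) lin') auto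
      then show ?thesis by (simp add: euclidean_inner[symmetric])
    qed
    have zp: "real_polynomial_function z"
      unfolding z_def by (intro real_polynomial_function_diff real_polynomial_function.intros(2,4) lin sq)
    have Mp: "real_polynomial_function M"
      unfolding M_def inner_diff_left by (intro real_polynomial_function_diff real_polynomial_function.intros(2,4) lin')
    have Pp: "real_polynomial_function P"
      unfolding P_def
      by (intro real_polynomial_function.intros(2,4) real_polynomial_function_sum real_polynomial_function_power zp Mp) auto
    have bound: "\<bar>ke y - P y\<bar> \<le> D / R ^ N * ((1 + norm y) ^ (3 * N + 1) * (1 + radpow u (x - y)))" for y
    proof -
      define r where "r = norm y"
      have r: "0 \<le> r" by (simp add: r_def)
      have qxy: "radsq u (x - y) = radsq u x * (1 + z y)"
        unfolding z_def distrib_left using q1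
        by (simp add: radsq_def power2_norm_eq_inner inner_diff_left inner_diff_right inner_commute)
      have z1: "0 \<le> 1 + z y"
      proof -
        have "0 < radsq u x * (1 + z y)" using radsq_pos[OF u, of "x - y"] qxy by simp
        then show ?thesis using q1 by (simp add: zero_less_mult_iff)
      qed
      have zle: "\<bar>z y\<bar> \<le> (r\<^sup>2 + 2 * R * r) / R\<^sup>2"
      proof -
        have "\<bar>y \<bullet> y - 2 * (x \<bullet> y)\<bar> \<le> y \<bullet> y + 2 * \<bar>x \<bullet> y\<bar>" using inner_ge_zero[of y] by linarith
        also have "\<bar>x \<bullet> y\<bar> \<le> norm x * norm y" by (rule Cauchy_Schwarz_ineq2)
        also have "norm x * norm y \<le> R * r" unfolding r_def using xR by (intro mult_right_mono) auto
        finally have "\<bar>y \<bullet> y - 2 * (x \<bullet> y)\<bar> \<le> r\<^sup>2 + 2 * R * r" by (simp add: r_def power2_norm_eq_inner)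
        then show ?thesis unfolding z_def abs_mult R(2)[symmetric] using R(1) by (simp add: divide_right_mono)
      qed
      have keH: "\<bar>ke y\<bar> \<le> c * radpow u (x - y)"
        unfolding ke_def M_def a_def n_def c_def by (rule radpow_kernel_bound[OF b u])
      have M_le: "\<bar>M y\<bar> \<le> c * (2 * R + r)"
      proof -
        have "\<bar>M y\<bar> \<le> u * \<bar>\<alpha>\<bar> + \<bar>\<beta>\<bar> * norm (x - y)"
          unfolding M_def using Basis_le_norm[OF b, of "x - y"] u
          by (intro order_trans[OF abs_triangle_ineq4] add_mono) (auto simp: abs_mult intro!: mult_left_mono)
        also have "\<dots> \<le> (2 * R + r) * \<bar>\<alpha>\<bar> + \<bar>\<beta>\<bar> * (2 * R + r)"
        proof -
          have "u \<le> 2 * R + r" "norm (x - y) \<le> 2 * R + r"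
            using uR xR R(1) norm_triangle_ineq4[of x y] norm_ge_zero[of y] unfolding r_def by linarith+
          then show ?thesis by (intro add_mono mult_left_mono mult_right_mono) auto
        qed
        finally show ?thesis by (simp add: c_def algebra_simps)
      qed
      show ?thesis
      proof (cases "r \<le> R / 4")
        \<comment> \<open>Here |z| \<le> (9/4)(r/R), so the binomial remainder supplies (r/R)^N; the
          factor \<open>M y\<close>, of size R, is balanced by Ra = R^(-n-1).\<close>
        case True
        have zr: "\<bar>z y\<bar> \<le> 9/4 * (r / R)"
        proof -
          have "r\<^sup>2 \<le> R / 4 * r" unfolding power2_eq_square using True r by (intro mult_right_mono) auto
          then have "r\<^sup>2 + 2 * R * r \<le> 9/4 * r * R" by (simp add: algebra_simps)
          then have "(r\<^sup>2 + 2 * R * r) / R\<^sup>2 \<le> 9/4 * r * R / R\<^sup>2" by (rule divide_right_mono) simp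
          also have "\<dots> = 9/4 * (r / R)" using R(1) by (simp add: power2_eq_square)
          finally show ?thesis using zle by simp
        qed
        have rR: "r / R \<le> 1/4" using True R(1) by (simp add: pos_divide_le_eq)
        then have z9: "\<bar>z y\<bar> \<le> 9/16" using zr by simp
        have "ke y - P y = M y * Ra * ((1 + z y) powr a - (\<Sum>k<N. g k * z y ^ k))"
        proof -
          have "(radsq u x * (1 + z y)) powr a = Ra * (1 + z y) powr a"
            unfolding Ra_def using q1 z1 by (simp only: powr_mult)
          then show ?thesis unfolding ke_def P_def qxy by (simp only: right_diff_distrib mult.assoc)
        qed
        then have "\<bar>ke y - P y\<bar> = \<bar>M y\<bar> * Ra * \<bar>(1 + z y) powr a - (\<Sum>k<N. g k * z y ^ k)\<bar>"
          by (simp only: abs_mult abs_of_nonneg[OF Ra0])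
        also have "\<dots> \<le> (c * (2 * R + r)) * Ra * (Cg * \<bar>z y\<bar> ^ N)"
          by (intro mult_mono Cg(2)[OF z9] M_le mult_nonneg_nonneg) (use c r R(1) Ra0 in auto)
        also have "\<dots> \<le> (c * (3 * R)) * Ra * (Cg * (9/4 * (r / R)) ^ N)"
          using True r R(1) c Ra0 Cg(1) zr by (intro mult_mono mult_left_mono power_mono) auto
        also have "\<dots> = 3 * c * (Ra * R) * (Cg * (9/4) ^ N * (r ^ N / R ^ N))"
          unfolding power_mult_distrib power_divide by (simp only: mult_ac)
        also have "\<dots> \<le> 3 * c * 1 * (Cg * (9/4) ^ N * (r ^ N / R ^ N))"
          using RaR c Cg(1) r R(1) by (intro mult_right_mono mult_left_mono) auto
        also have "\<dots> = 3 * c * (Cg * (9/4) ^ N) / R ^ N * r ^ N" by simp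
        also have "\<dots> \<le> D / R ^ N * r ^ N"
          unfolding D_def using c Sg r R(1) by (intro mult_right_mono divide_right_mono) auto
        also have "\<dots> \<le> D / R ^ N * ((1 + r) ^ (3 * N + 1) * (1 + radpow u (x - y)))"
        proof (intro mult_left_mono)
          have "r ^ N \<le> (1 + r) ^ N" using r by (intro power_mono) auto
          also have "\<dots> \<le> (1 + r) ^ (3 * N + 1)" using r by (intro power_increasing) auto
          also have "\<dots> \<le> (1 + r) ^ (3 * N + 1) * (1 + radpow u (x - y))" using r by (simp add: distrib_left)
          finally show "r ^ N \<le> (1 + r) ^ (3 * N + 1) * (1 + radpow u (x - y))" .
        qed (use D0 R(1) in auto)
        finally show ?thesis by (simp add: r_def)
      next
        case False
        \<comment> \<open>In the far region there is no cancellation: kernel and polynomial are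
          bounded separately, and (4 r/R)^N \<ge> 1 inserts the required decay in R at the price of
          a power of r, to be paid for later by rapid decay in y.\<close>
        have E: "1 \<le> 4 ^ N * r ^ N / R ^ N"
        proof -
          have "1 \<le> (4 * r / R) ^ N" using False R(1) by (intro one_le_power) (simp add: pos_le_divide_eq)
          then show ?thesis by (simp add: power_mult_distrib power_divide)
        qed
        have z2: "\<bar>z y\<bar> \<le> (1 + r)\<^sup>2"
        proof -
          have "(r\<^sup>2 + 2 * R * r) / R\<^sup>2 = r\<^sup>2 / R\<^sup>2 + 2 * r / R" using R(1) by (simp add: add_divide_distrib power2_eq_square)
          also have "\<dots> \<le> r\<^sup>2 / 1 + 2 * r / 1" using R(1) r by (intro add_mono divide_left_mono) auto
          also have "\<dots> \<le> (1 + r)\<^sup>2" by (simp add: power2_eq_square algebra_simps)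
          finally show ?thesis using zle by simp
        qed
        have "\<bar>\<Sum>k<N. g k * z y ^ k\<bar> \<le> (\<Sum>k<N. \<bar>g k\<bar> * (1 + r) ^ (2 * N))"
        proof (rule order_trans[OF sum_abs sum_mono])
          fix k assume k: "k \<in> {..<N}"
          have "\<bar>z y\<bar> ^ k \<le> ((1 + r)\<^sup>2) ^ k" by (intro power_mono z2) auto
          also have "\<dots> \<le> ((1 + r)\<^sup>2) ^ N" using k r by (intro power_increasing) (auto intro!: one_le_power)
          finally show "\<bar>g k * z y ^ k\<bar> \<le> \<bar>g k\<bar> * (1 + r) ^ (2 * N)"
            unfolding abs_mult power_abs by (intro mult_left_mono) (auto simp: power_mult)
        qed
        then have S: "\<bar>\<Sum>k<N. g k * z y ^ k\<bar> \<le> Sg * (1 + r) ^ (2 * N)" by (simp add: Sg_def sum_distrib_right)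
        have "\<bar>P y\<bar> \<le> (c * (2 * R + r)) * Ra * (Sg * (1 + r) ^ (2 * N))"
          unfolding P_def abs_mult abs_of_nonneg[OF Ra0] using S M_le Ra0 c r R(1) by (intro mult_mono mult_nonneg_nonneg) auto
        also have "\<dots> = c * (2 * (Ra * R) + Ra * r) * (Sg * (1 + r) ^ (2 * N))" by (simp add: algebra_simps)
        also have "\<dots> \<le> c * (2 * 1 + 1 * r) * (Sg * (1 + r) ^ (2 * N))"
          using RaR Ra1 c r Sg by (intro mult_right_mono mult_left_mono add_mono) auto
        also have "\<dots> \<le> c * (2 * (1 + r)) * (Sg * (1 + r) ^ (2 * N))"
          using c r Sg by (intro mult_right_mono mult_left_mono) auto
        also have "\<dots> = c * (2 * Sg) * (1 + r) ^ (2 * N + 1)" by simp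
        finally have "\<bar>ke y - P y\<bar> \<le> c * radpow u (x - y) + c * (2 * Sg) * (1 + r) ^ (2 * N + 1)"
          using keH by linarith
        also have "\<dots> \<le> c * radpow u (x - y) * (1 + r) ^ (2 * N + 1) + c * (2 * Sg) * (1 + r) ^ (2 * N + 1)"
        proof -
          have "c * radpow u (x - y) * 1 \<le> c * radpow u (x - y) * (1 + r) ^ (2 * N + 1)"
            using c r by (intro mult_left_mono one_le_power) auto
          then show ?thesis by simp
        qed
        also have "\<dots> = c * (radpow u (x - y) + 2 * Sg) * (1 + r) ^ (2 * N + 1)" by (simp add: algebra_simps)
        also have "\<dots> \<le> c * ((1 + 2 * Sg) * (1 + radpow u (x - y))) * (1 + r) ^ (2 * N + 1)"
        proof (intro mult_right_mono mult_left_mono)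
          have "0 \<le> Sg * radpow u (x - y)" using Sg by simp
          then show "radpow u (x - y) + 2 * Sg \<le> (1 + 2 * Sg) * (1 + radpow u (x - y))"
            by (simp add: algebra_simps)
        qed (use c r in auto)
        also have "\<dots> = 1 * (c * ((1 + 2 * Sg) * (1 + radpow u (x - y))) * (1 + r) ^ (2 * N + 1))" by simp
        also have "\<dots> \<le> (4 ^ N * r ^ N / R ^ N) * (c * ((1 + 2 * Sg) * (1 + radpow u (x - y))) * (1 + r) ^ (2 * N + 1))"
          using c r Sg by (intro mult_right_mono E) auto
        also have "\<dots> \<le> (4 ^ N * (1 + r) ^ N / R ^ N) * (c * ((1 + 2 * Sg) * (1 + radpow u (x - y))) * (1 + r) ^ (2 * N + 1))"
          using c r Sg R(1) by (intro mult_right_mono divide_right_mono mult_left_mono power_mono) auto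
        also have "\<dots> = c * 4 ^ N * (1 + 2 * Sg) / R ^ N * ((1 + r) ^ (3 * N + 1) * (1 + radpow u (x - y)))"
        proof -
          have "(1 + r) ^ (3 * N + 1) = (1 + r) ^ N * (1 + r) ^ (2 * N + 1)" by (simp add: power_add[symmetric])
          then show ?thesis by (simp only: divide_inverse mult_ac)
        qed
        also have "\<dots> \<le> D / R ^ N * ((1 + r) ^ (3 * N + 1) * (1 + radpow u (x - y)))"
          unfolding D_def using c Cg(1) Sg r R(1) by (intro mult_right_mono divide_right_mono) auto
        finally show ?thesis by (simp add: r_def)
      qed
    qed
    show "\<exists>P. real_polynomial_function P \<and> (\<forall>y. \<bar>(u * \<alpha> - \<beta> * ((x - y) \<bullet> b)) * radsq u (x - y) powr (- (real DIM('a) + 1) / 2) - P y\<bar>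
      \<le> D / sqrt (radsq u x) ^ N * ((1 + norm y) ^ (3 * N + 1) * (1 + radpow u (x - y))))"
      using Pp bound unfolding ke_def M_def a_def n_def R_def by blast
  qed
qed

text \<open>The polynomial integrates to 0 against \<eta>, so only the difference of kernel and
  polynomial contributes, and it is small at large distance. Where \<open>radsq\<close> is below 1,
  the denominator is at most 3^N and the size of the kernel is enough.\<close>

lemma vanishing_conv_bound:
  fixes b :: "'a::euclidean_space"
  assumes \<eta>: "vanishing \<eta>" and b: "b \<in> Basis" and e: "0 < e"
  obtains C where "0 < C" "\<And>u (x::'a). 0 < u \<Longrightarrow>
    norm (\<integral>y. complex_of_real ((u * \<alpha> - \<beta> * ((x - y) \<bullet> b)) * radsq u (x - y) powr (- (real DIM('a) + 1) / 2)) * \<eta> y \<partial>lborel)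
      \<le> C * (1 + u powr (- e)) / (1 + u + norm x) ^ N"
proof -
  define n where "n = real DIM('a)"
  have r: "rapid \<eta>" using \<eta> by (simp add: vanishing_def)
  have [measurable]: "\<eta> \<in> borel_measurable borel" using r by (rule rapidD)
  obtain D where D: "0 \<le> D" "\<And>u (x::'a). 0 < u \<Longrightarrow> 1 \<le> radsq u x \<Longrightarrow>
    \<exists>P. real_polynomial_function P \<and> (\<forall>y. \<bar>(u * \<alpha> - \<beta> * ((x - y) \<bullet> b)) * radsq u (x - y) powr (- (n + 1) / 2) - P y\<bar>
      \<le> D / sqrt (radsq u x) ^ N * ((1 + norm y) ^ (3 * N + 1) * (1 + radpow u (x - y))))"
    unfolding n_def using kernel_minus_polynomial[OF b, of \<alpha> \<beta> N] by blast
  obtain Ch where Ch: "0 < Ch" "\<And>u (x::'a). 0 < u \<Longrightarrow>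
    (\<integral>\<^sup>+y. ennreal ((1 + radpow u (x - y)) * wt (n + 1) y) \<partial>lborel) \<le> ennreal (Ch * (1 + u powr (- e)))"
    unfolding n_def using radpow_integral_bound[OF e, where 'a='a] by blast
  \<comment> \<open>The extra 3 N + 1 powers absorb the growth in y of the remainder; n + 1 powers
    are left for integrability.\<close>
  obtain C1 where C1: "0 < C1" "\<And>y. norm (\<eta> y) \<le> C1 * wt (n + 1 + real (3 * N + 1)) y" using rapid_bound[OF r] by blast
  have C1': "norm (\<eta> y) \<le> C1 * wt (n + 1) y" for y
    using C1(2)[of y] C1(1) wt_antimono[of "n + 1" "n + 1 + real (3 * N + 1)" y]
    by (meson le_add_same_cancel1 mult_left_mono less_imp_le of_nat_0_le_iff order_trans)
  have C1'': "(1 + norm y) ^ (3 * N + 1) * norm (\<eta> y) \<le> C1 * wt (n + 1) y" for y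
  proof -
    have p: "0 < 1 + norm y" by (simp add: add_pos_nonneg)
    have "(1 + norm y) ^ (3 * N + 1) * norm (\<eta> y) \<le> (1 + norm y) ^ (3 * N + 1) * (C1 * wt (n + 1 + real (3 * N + 1)) y)"
      by (intro mult_left_mono C1) auto
    also have "\<dots> = C1 * wt (n + 1) y * ((1 + norm y) ^ (3 * N + 1) * wt (real (3 * N + 1)) y)"
      by (simp only: wt_add mult_ac)
    also have "(1 + norm y) ^ (3 * N + 1) * wt (real (3 * N + 1)) y = 1"
      unfolding wt_def powr_minus powr_realpow[OF p] by (rule right_inverse) (use p in simp)
    finally show ?thesis by simp
  qed
  define c where "c = \<bar>\<alpha>\<bar> + \<bar>\<beta>\<bar>"
  have c: "0 \<le> c" by (simp add: c_def)
  define C where "C = (c + D) * C1 * Ch * 3 ^ N + 1"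
  show ?thesis
  proof (rule that[of C])
    show "0 < C" using c D(1) C1(1) Ch(1) by (simp add: C_def add_nonneg_pos)
    fix u :: real and x :: 'a assume u: "0 < u"
    define ke where "ke y = (u * \<alpha> - \<beta> * ((x - y) \<bullet> b)) * radsq u (x - y) powr (- (n + 1) / 2)" for y
    have [measurable]: "ke \<in> borel_measurable borel" unfolding ke_def by measurable
    define E where "E = Ch * (1 + u powr (- e))"
    have E: "0 \<le> E" using Ch(1) by (simp add: E_def add_nonneg_nonneg)
    have ke1: "norm (complex_of_real (ke y) * \<eta> y) \<le> (c * C1) * ((1 + radpow u (x - y)) * wt (n + 1) y)" for y
    proof -
      have "\<bar>ke y\<bar> \<le> c * radpow u (x - y)" unfolding ke_def n_def c_def by (rule radpow_kernel_bound[OF b u])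
      also have "\<dots> \<le> c * (1 + radpow u (x - y))" using c by (intro mult_left_mono) auto
      finally have "norm (complex_of_real (ke y) * \<eta> y) \<le> (c * (1 + radpow u (x - y))) * (C1 * wt (n + 1) y)"
        unfolding norm_mult norm_of_real using c by (intro mult_mono C1') (auto simp: add_nonneg_nonneg)
      then show ?thesis by (simp only: mult_ac)
    qed
    note L = lborel_integral_norm_le[OF _ ke1 _ E _ Ch(2)[OF u, of x, folded E_def]]
    have iK: "integrable lborel (\<lambda>y. complex_of_real (ke y) * \<eta> y)" by (rule L) (use c C1(1) in auto)
    have bK: "norm (\<integral>y. complex_of_real (ke y) * \<eta> y \<partial>lborel) \<le> (c * C1) * E" by (rule L) (use c C1(1) in auto)
    have pos: "0 < 1 + u + norm x" using u by (simp add: add_pos_nonneg)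
    have goal: "norm (\<integral>y. complex_of_real (ke y) * \<eta> y \<partial>lborel) \<le> C * (1 + u powr (- e)) / (1 + u + norm x) ^ N"
    proof (cases "1 \<le> radsq u x")
      case False
      have "u \<le> 1" "norm x \<le> 1"
      proof -
        have "u\<^sup>2 \<le> 1\<^sup>2" "(norm x)\<^sup>2 \<le> 1\<^sup>2"
          using False zero_le_power2[of u] zero_le_power2[of "norm x"] unfolding radsq_def one_power2 by linarith+
        then show "u \<le> 1" "norm x \<le> 1" by (auto intro: power2_le_imp_le)
      qed
      then have "(1 + u + norm x) ^ N \<le> 3 ^ N" using pos by (intro power_mono) auto
      then have "1 \<le> 3 ^ N / (1 + u + norm x) ^ N" using pos by (simp add: le_divide_eq)
      then have "(c * C1) * E * 1 \<le> (c * C1) * E * (3 ^ N / (1 + u + norm x) ^ N)"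
        using c C1(1) E by (intro mult_left_mono) auto
      also have "\<dots> = (c * C1 * Ch * 3 ^ N) * (1 + u powr (- e)) / (1 + u + norm x) ^ N" by (simp add: E_def)
      also have "\<dots> \<le> C * (1 + u powr (- e)) / (1 + u + norm x) ^ N"
        using D(1) C1(1) Ch(1) pos
        by (intro divide_right_mono mult_right_mono) (auto simp: C_def algebra_simps add_nonneg_nonneg)
      finally show ?thesis using bK by simp
    next
      case True
      define R where "R = sqrt (radsq u x)"
      have R: "1 \<le> R" using True by (simp add: R_def)
      have uR: "u \<le> R" unfolding R_def radsq_def by (rule real_le_rsqrt) simp
      have xR: "norm x \<le> R" unfolding R_def radsq_def by (rule real_le_rsqrt) simp
      obtain P where P: "real_polynomial_function P" "\<And>y. \<bar>ke y - P y\<bar> \<le> D / R ^ N * ((1 + norm y) ^ (3 * N + 1) * (1 + radpow u (x - y)))"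
        using D(2)[OF u True] unfolding ke_def R_def by blast
      have v: "vanishing (\<lambda>y. complex_of_real (P y) * \<eta> y)" by (rule vanishing_polynomial[OF P(1) \<eta>])
      then have iP: "integrable lborel (\<lambda>y. complex_of_real (P y) * \<eta> y)" by (intro rapid_integrable) (simp add: vanishing_def)
      have "P \<in> borel_measurable borel"
        by (intro borel_measurable_continuous_onI continuous_at_imp_continuous_on ballI
            differentiable_imp_continuous_within differentiable_at_real_polynomial_function P(1))
      note [measurable] = this
      have kp: "norm (complex_of_real (ke y - P y) * \<eta> y) \<le> (D / R ^ N * C1) * ((1 + radpow u (x - y)) * wt (n + 1) y)" for y
      proof -
        have "norm (complex_of_real (ke y - P y) * \<eta> y) \<le> (D / R ^ N * ((1 + norm y) ^ (3 * N + 1) * (1 + radpow u (x - y)))) * norm (\<eta> y)"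
          unfolding norm_mult norm_of_real by (intro mult_right_mono P) auto
        also have "\<dots> = D / R ^ N * (1 + radpow u (x - y)) * ((1 + norm y) ^ (3 * N + 1) * norm (\<eta> y))" by (simp only: mult_ac)
        also have "\<dots> \<le> D / R ^ N * (1 + radpow u (x - y)) * (C1 * wt (n + 1) y)"
          using D(1) R by (intro mult_left_mono C1'') (auto simp: add_nonneg_nonneg)
        finally show ?thesis by (simp only: mult_ac)
      qed
      have "(\<integral>y. complex_of_real (ke y) * \<eta> y \<partial>lborel) = (\<integral>y. complex_of_real (ke y - P y) * \<eta> y \<partial>lborel)"
        using iK iP vanishing_moment[OF P(1) \<eta>] by (simp add: left_diff_distrib)
      also have "norm \<dots> \<le> (D / R ^ N * C1) * E"
        by (rule lborel_integral_norm_le[OF _ kp _ E _ Ch(2)[OF u, of x, folded E_def]]) (use D(1) R C1(1) in auto)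
      also have "\<dots> = D * C1 * E * (1 / R ^ N)" by simp
      also have "\<dots> \<le> D * C1 * E * (3 ^ N / (1 + u + norm x) ^ N)"
      proof (intro mult_left_mono)
        have "(1 + u + norm x) ^ N \<le> (3 * R) ^ N" using R uR xR pos by (intro power_mono) auto
        then show "1 / R ^ N \<le> 3 ^ N / (1 + u + norm x) ^ N"
          using pos R by (simp add: power_mult_distrib divide_simps)
      qed (use D(1) C1(1) E in auto)
      also have "\<dots> = (D * C1 * Ch * 3 ^ N) * (1 + u powr (- e)) / (1 + u + norm x) ^ N" by (simp add: E_def)
      also have "\<dots> \<le> C * (1 + u powr (- e)) / (1 + u + norm x) ^ N"
        using c C1(1) Ch(1) pos
        by (intro divide_right_mono mult_right_mono) (auto simp: C_def algebra_simps add_nonneg_nonneg)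
      finally show ?thesis .
    qed
    then show "norm (\<integral>y. complex_of_real ((u * \<alpha> - \<beta> * ((x - y) \<bullet> b)) * radsq u (x - y) powr (- (real DIM('a) + 1) / 2)) * \<eta> y \<partial>lborel)
      \<le> C * (1 + u powr (- e)) / (1 + u + norm x) ^ N"
      unfolding ke_def n_def .
  qed
qed

text \<open>For t > 0 and slow \<phi> this is the derivative of the Poisson integral of \<phi> in
  the direction (v, \<tau>), by \<open>poisson_integral_deriv\<close>.\<close>

definition dpk_conv :: "('a::euclidean_space \<Rightarrow> complex) \<Rightarrow> 'a \<Rightarrow> real \<Rightarrow> real \<Rightarrow> 'a \<Rightarrow> complex" where
  "dpk_conv \<phi> v \<tau> t x = (\<integral>y. \<phi> y * of_real (dpk v \<tau> t (x - y)) \<partial>lborel)"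

lemma dpk_conv_bound:
  fixes \<phi> :: "'a::euclidean_space \<Rightarrow> complex"
  assumes \<phi>: "vanishing_C1 \<phi>" and e: "0 < e"
  obtains C where "0 < C" "\<And>u x. 0 < u \<Longrightarrow> norm (dpk_conv \<phi> v \<tau> u x) \<le> C * (1 + u powr (- e)) / (1 + u + norm x) ^ N"
proof -
  define I where "I b u x = (\<integral>y. complex_of_real ((u * (v \<bullet> b) - \<tau> * ((x - y) \<bullet> b)) * radsq u (x - y) powr (- (real DIM('a) + 1) / 2)) * partial_deriv \<phi> b y \<partial>lborel)"
    for b u and x :: 'a
  have "\<exists>C. 0 < C \<and> (\<forall>u x. 0 < u \<longrightarrow> norm (I b u x) \<le> C * (1 + u powr (- e)) / (1 + u + norm x) ^ N)" if b: "b \<in> Basis" for b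
  proof -
    obtain C where "0 < C" "\<And>u x. 0 < u \<Longrightarrow> norm (I b u x) \<le> C * (1 + u powr (- e)) / (1 + u + norm x) ^ N"
      unfolding I_def by (rule vanishing_conv_bound[OF vanishing_C1_deriv_vanishing[OF \<phi> b] b e, of "v \<bullet> b" \<tau> N]) blast
    then show ?thesis by blast
  qed
  then obtain C where C: "\<And>b. b \<in> Basis \<Longrightarrow> 0 < C b"
    "\<And>b u x. b \<in> Basis \<Longrightarrow> 0 < u \<Longrightarrow> norm (I b u x) \<le> C b * (1 + u powr (- e)) / (1 + u + norm x) ^ N"
    by metis
  define D where "D = poisson_const DIM('a) * (\<Sum>b\<in>Basis. C b)"
  show ?thesis
  proof (rule that[of D])
    show "0 < D" using C poisson_const_pos[of "DIM('a)"] by (auto simp: D_def intro!: mult_pos_pos sum_pos)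
    fix u x assume u: "0 < (u::real)"
    have "dpk_conv \<phi> v \<tau> u x = (\<Sum>b\<in>Basis. poisson_const DIM('a) * I b u x)"
      unfolding dpk_conv_def poisson_deriv_conv[OF \<phi> u] I_def
      by (simp only: of_real_mult mult.assoc integral_mult_right_zero)
    moreover have "norm (\<Sum>b\<in>Basis. complex_of_real (poisson_const DIM('a)) * I b u x)
        \<le> (\<Sum>b\<in>Basis. poisson_const DIM('a) * (C b * (1 + u powr (- e)) / (1 + u + norm x) ^ N))"
    proof (rule sum_norm_le)
      fix b :: 'a assume "b \<in> Basis"
      then show "norm (complex_of_real (poisson_const DIM('a)) * I b u x) \<le> poisson_const DIM('a) * (C b * (1 + u powr (- e)) / (1 + u + norm x) ^ N)"
        unfolding norm_mult norm_of_real abs_of_pos[OF poisson_const_pos]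
        by (intro mult_left_mono C(2) u less_imp_le[OF poisson_const_pos])
    qed
    ultimately have "norm (dpk_conv \<phi> v \<tau> u x) \<le> (\<Sum>b\<in>Basis. poisson_const DIM('a) * (C b * (1 + u powr (- e)) / (1 + u + norm x) ^ N))"
      by simp
    also have "\<dots> = D * (1 + u powr (- e)) / (1 + u + norm x) ^ N"
      by (simp add: D_def sum_distrib_left sum_distrib_right sum_divide_distrib mult_ac)
    finally show "norm (dpk_conv \<phi> v \<tau> u x) \<le> D * (1 + u powr (- e)) / (1 + u + norm x) ^ N" .
  qed
qed

lemma dpk_conv_scale:
  fixes \<phi> :: "'a::euclidean_space \<Rightarrow> complex"
  assumes l: "0 < l" and [measurable]: "\<phi> \<in> borel_measurable borel"
  shows "dpk_conv (\<lambda>x. of_real (l ^ DIM('a)) * \<phi> (l *\<^sub>R x)) v \<tau> t x = of_real (l ^ (DIM('a) + 1)) * dpk_conv \<phi> v \<tau> (l * t) (l *\<^sub>R x)"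
proof -
  have "dpk_conv \<phi> v \<tau> (l * t) (l *\<^sub>R x) = (\<bar>l\<bar> ^ DIM('a)) *\<^sub>R (\<integral>y. \<phi> (0 + l *\<^sub>R y) * of_real (dpk v \<tau> (l * t) (l *\<^sub>R x - (0 + l *\<^sub>R y))) \<partial>lborel)"
    unfolding dpk_conv_def by (rule lborel_integral_affine) (use l in auto)
  also have "(\<lambda>y. \<phi> (0 + l *\<^sub>R y) * complex_of_real (dpk v \<tau> (l * t) (l *\<^sub>R x - (0 + l *\<^sub>R y))))
    = (\<lambda>y. of_real (1 / l ^ (DIM('a) + 1)) * (\<phi> (l *\<^sub>R y) * of_real (dpk v \<tau> t (x - y))))"
    using dpk_scale[OF l, of v \<tau> t] by (simp add: scaleR_diff_right[symmetric])
  finally have "dpk_conv \<phi> v \<tau> (l * t) (l *\<^sub>R x) = of_real (l ^ DIM('a)) * (of_real (1 / l ^ (DIM('a) + 1)) * (\<integral>y. \<phi> (l *\<^sub>R y) * of_real (dpk v \<tau> t (x - y)) \<partial>lborel))"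
    using l unfolding integral_mult_right_zero by (simp add: scaleR_conv_of_real)
  moreover have "dpk_conv (\<lambda>x. of_real (l ^ DIM('a)) * \<phi> (l *\<^sub>R x)) v \<tau> t x = of_real (l ^ DIM('a)) * (\<integral>y. \<phi> (l *\<^sub>R y) * of_real (dpk v \<tau> t (x - y)) \<partial>lborel)"
    unfolding dpk_conv_def mult.assoc integral_mult_right_zero ..
  ultimately show ?thesis using l by (simp add: field_simps)
qed

section \<open>The Littlewood-Paley reproducing formula\<close>

definition convolution :: "('a::euclidean_space \<Rightarrow> complex) \<Rightarrow> ('a \<Rightarrow> complex) \<Rightarrow> 'a \<Rightarrow> complex" where
  "convolution a b x = (\<integral>y. a (x - y) * b y \<partial>lborel)"

lemma convolution_measurable [measurable]:
  assumes [measurable]: "a \<in> borel_measurable borel" "b \<in> borel_measurable borel"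
  shows "convolution a b \<in> borel_measurable borel"
  unfolding convolution_def by measurable

definition slow_exp :: "'a::euclidean_space itself \<Rightarrow> real" where
  "slow_exp _ = real DIM('a) + 1/2"

lemma wt_slow_exp_integrable: "integrable lborel (wt (slow_exp TYPE('a)) :: 'a::euclidean_space \<Rightarrow> real)"
  by (rule integrable_wt) (simp add: slow_exp_def)

text \<open>Half of the doubled exponent serves, by Peetre's inequality, to move the weight to x -
  y, the other half for integrability in z.\<close>

lemma wt_conv_bound:
  fixes x y :: "'a::euclidean_space"
  shows "(\<integral>\<^sup>+z. ennreal (wt (slow_exp TYPE('a)) (x - z) * wt (2 * slow_exp TYPE('a)) (z - y)) \<partial>lborel)
    \<le> ennreal (wt_int TYPE('a) (slow_exp TYPE('a)) * wt (slow_exp TYPE('a)) (x - y))"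
proof -
  define w where "w = slow_exp TYPE('a)"
  have w: "0 \<le> w" "real DIM('a) < w" by (auto simp: w_def slow_exp_def)
  have "(\<integral>\<^sup>+z. ennreal (wt w (x - z) * wt (2 * w) (z - y)) \<partial>lborel) \<le> (\<integral>\<^sup>+z. ennreal (wt w (x - y)) * ennreal (wt w (z - y)) \<partial>lborel)"
  proof (rule nn_integral_mono)
    fix z
    have "wt w (x - z) * wt (2 * w) (z - y) = (wt w (x - z) * wt w (z - y)) * wt w (z - y)"
      using wt_add[of w w "z - y"] by (simp add: mult.assoc)
    also have "\<dots> \<le> wt w (x - y) * wt w (z - y)"
      using wt_Peetre[OF w(1), of "x - z" "z - y"] by (intro mult_right_mono) auto
    finally show "ennreal (wt w (x - z) * wt (2 * w) (z - y)) \<le> ennreal (wt w (x - y)) * ennreal (wt w (z - y))"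
      by (simp add: ennreal_leI flip: ennreal_mult)
  qed
  also have "\<dots> = ennreal (wt w (x - y)) * (\<integral>\<^sup>+z. ennreal (wt w (z - y)) \<partial>lborel)"
    by (rule nn_integral_cmult) measurable
  also have "(\<integral>\<^sup>+z. ennreal (wt w (z - y)) \<partial>lborel) = ennreal (wt_int TYPE('a) w)"
    using nn_integral_lborel_shift[of "\<lambda>z::'a. ennreal (wt w z)" y] nn_integral_wt[OF w(2)] by simp
  finally show ?thesis by (simp add: w_def mult.commute flip: ennreal_mult)
qed

text \<open>The first factor may decay only like the slow weight, as is the case for derivatives of
  the Poisson kernel; b compensates with decay of twice that order, so that Fubini's theorem applies
  to the triple product.\<close>

lemma convolution_assoc:
  fixes a b f :: "'a::euclidean_space \<Rightarrow> complex"
  assumes a: "a \<in> borel_measurable borel" "\<And>x. norm (a x) \<le> A * wt (slow_exp TYPE('a)) x" and A: "0 \<le> A"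
    and b: "rapid b" and f: "slow f"
  shows "convolution a (convolution b f) x = convolution (convolution a b) f x"
proof -
  define w where "w = slow_exp TYPE('a)"
  have [measurable]: "a \<in> borel_measurable borel" "b \<in> borel_measurable borel" "f \<in> borel_measurable borel"
    using a(1) b f by (auto simp: rapid_def slow_def)
  obtain B where B: "0 < B" "\<And>x. norm (b x) \<le> B * wt (2 * w) x" using rapid_bound[OF b] by blast
  have "convolution a (convolution b f) x = (\<integral>z. \<integral>y. a (x - z) * (b (z - y) * f y) \<partial>lborel \<partial>lborel)"
    unfolding convolution_def by simp
  also have "\<dots> = (\<integral>y. \<integral>z. a (x - z) * (b (z - y) * f y) \<partial>lborel \<partial>lborel)"
  proof (rule lborel_Fubini)
    show "(\<lambda>(z, y). a (x - z) * (b (z - y) * f y)) \<in> borel_measurable (borel \<Otimes>\<^sub>M borel)" by measurable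
    have "(\<integral>\<^sup>+z. \<integral>\<^sup>+y. ennreal (norm (a (x - z) * (b (z - y) * f y))) \<partial>lborel \<partial>lborel)
      = (\<integral>\<^sup>+y. \<integral>\<^sup>+z. ennreal (norm (a (x - z) * (b (z - y) * f y))) \<partial>lborel \<partial>lborel)"
      by (rule lborel_pair.Fubini') measurable
    also have "\<dots> \<le> (\<integral>\<^sup>+y. ennreal (A * B * norm (f y)) * ennreal (wt_int TYPE('a) w * wt w (x - y)) \<partial>lborel)"
    proof (rule nn_integral_mono)
      fix y
      have "(\<integral>\<^sup>+z. ennreal (norm (a (x - z) * (b (z - y) * f y))) \<partial>lborel)
        \<le> (\<integral>\<^sup>+z. ennreal (A * B * norm (f y)) * ennreal (wt w (x - z) * wt (2 * w) (z - y)) \<partial>lborel)"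
      proof (rule nn_integral_mono)
        fix z
        have "norm (a (x - z) * (b (z - y) * f y)) \<le> (A * wt w (x - z)) * ((B * wt (2 * w) (z - y)) * norm (f y))"
          unfolding norm_mult using a(2) B A by (intro mult_mono) (auto simp: w_def)
        also have "\<dots> = (A * B * norm (f y)) * (wt w (x - z) * wt (2 * w) (z - y))" by (simp only: mult_ac)
        finally show "ennreal (norm (a (x - z) * (b (z - y) * f y))) \<le> ennreal (A * B * norm (f y)) * ennreal (wt w (x - z) * wt (2 * w) (z - y))"
          using A B(1) by (simp add: ennreal_leI flip: ennreal_mult)
      qed
      also have "\<dots> = ennreal (A * B * norm (f y)) * (\<integral>\<^sup>+z. ennreal (wt w (x - z) * wt (2 * w) (z - y)) \<partial>lborel)"
        by (rule nn_integral_cmult) measurable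
      also have "\<dots> \<le> ennreal (A * B * norm (f y)) * ennreal (wt_int TYPE('a) w * wt w (x - y))"
        unfolding w_def by (intro mult_left_mono wt_conv_bound) auto
      finally show "(\<integral>\<^sup>+z. ennreal (norm (a (x - z) * (b (z - y) * f y))) \<partial>lborel) \<le> \<dots>" .
    qed
    also have "\<dots> = (\<integral>\<^sup>+y. ennreal (A * B * wt_int TYPE('a) w) * ennreal (wt w (x - y) * norm (f y)) \<partial>lborel)"
      using A B(1) by (intro nn_integral_cong) (simp add: mult_ac flip: ennreal_mult)
    also have "\<dots> = ennreal (A * B * wt_int TYPE('a) w) * (\<integral>\<^sup>+y. ennreal (wt w (x - y) * norm (f y)) \<partial>lborel)"
      by (rule nn_integral_cmult) measurable
    also have "\<dots> < \<infinity>"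
      using f unfolding slow_def w_def slow_exp_def integrable_iff_bounded by (auto simp: ennreal_mult_less_top)
    finally show "(\<integral>\<^sup>+z. \<integral>\<^sup>+y. ennreal (norm (a (x - z) * (b (z - y) * f y))) \<partial>lborel \<partial>lborel) < \<infinity>" .
  qed
  also have "\<dots> = (\<integral>y. convolution a b (x - y) * f y \<partial>lborel)"
  proof (rule Bochner_Integration.integral_cong[OF refl])
    fix y
    have "(\<integral>z. a (x - z) * (b (z - y) * f y) \<partial>lborel) = (\<integral>z. (a (x - z) * b (z - y)) * f y \<partial>lborel)"
      by (simp only: mult.assoc)
    also have "\<dots> = (\<integral>z. a (x - z) * b (z - y) \<partial>lborel) * f y" by (rule integral_mult_left_zero)
    also have "(\<integral>z. a (x - z) * b (z - y) \<partial>lborel) = (\<bar>1\<bar> ^ DIM('a)) *\<^sub>R (\<integral>z. a (x - (y + 1 *\<^sub>R z)) * b ((y + 1 *\<^sub>R z) - y) \<partial>lborel)"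
      by (rule lborel_integral_affine) auto
    also have "\<dots> = convolution a b (x - y)" by (simp add: convolution_def algebra_simps)
    finally show "(\<integral>z. a (x - z) * (b (z - y) * f y) \<partial>lborel) = convolution a b (x - y) * f y" .
  qed
  finally show ?thesis by (simp add: convolution_def)
qed

lemma convolution_fourier:
  fixes a b :: "'a::euclidean_space \<Rightarrow> complex"
  assumes a: "integrable lborel a" and b: "integrable lborel b"
  shows "fourier (convolution a b) \<xi> = fourier a \<xi> * fourier b \<xi>"
proof -
  have [measurable]: "a \<in> borel_measurable borel" "b \<in> borel_measurable borel"
    using borel_measurable_integrable[OF a] borel_measurable_integrable[OF b] by auto
  have "fourier (convolution a b) \<xi> = (\<integral>x. \<integral>y. a (x - y) * b y * cis (- 2 * pi * (x \<bullet> \<xi>)) \<partial>lborel \<partial>lborel)"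
    unfolding fourier_lborel[OF convolution_measurable[OF \<open>a \<in> borel_measurable borel\<close> \<open>b \<in> borel_measurable borel\<close>]]
    unfolding convolution_def by simp
  also have "\<dots> = (\<integral>y. \<integral>x. a (x - y) * b y * cis (- 2 * pi * (x \<bullet> \<xi>)) \<partial>lborel \<partial>lborel)"
  proof (rule lborel_Fubini)
    show "(\<lambda>(x, y). a (x - y) * b y * cis (- 2 * pi * (x \<bullet> \<xi>))) \<in> borel_measurable (borel \<Otimes>\<^sub>M borel)" by measurable
    have "(\<integral>\<^sup>+x. \<integral>\<^sup>+y. ennreal (norm (a (x - y) * b y * cis (- 2 * pi * (x \<bullet> \<xi>)))) \<partial>lborel \<partial>lborel)
      = (\<integral>\<^sup>+x. nnconv (\<lambda>x. ennreal (norm (a x))) (\<lambda>x. ennreal (norm (b x))) x \<partial>lborel)"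
      unfolding nnconv_def by (simp add: norm_mult ennreal_mult)
    also have "\<dots> < \<infinity>"
      using a b by (subst nn_integral_nnconv) (auto simp: integrable_iff_bounded ennreal_mult_less_top)
    finally show "(\<integral>\<^sup>+x. \<integral>\<^sup>+y. ennreal (norm (a (x - y) * b y * cis (- 2 * pi * (x \<bullet> \<xi>)))) \<partial>lborel \<partial>lborel) < \<infinity>" .
  qed
  also have "\<dots> = (\<integral>y. fourier a \<xi> * (b y * cis (- 2 * pi * (y \<bullet> \<xi>))) \<partial>lborel)"
  proof (rule Bochner_Integration.integral_cong[OF refl])
    fix y
    have "(\<integral>x. a (x - y) * b y * cis (- 2 * pi * (x \<bullet> \<xi>)) \<partial>lborel)
      = (\<bar>1\<bar> ^ DIM('a)) *\<^sub>R (\<integral>x. a ((y + 1 *\<^sub>R x) - y) * b y * cis (- 2 * pi * ((y + 1 *\<^sub>R x) \<bullet> \<xi>)) \<partial>lborel)"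
      by (rule lborel_integral_affine) auto
    also have "\<dots> = (\<integral>x. (b y * cis (- 2 * pi * (y \<bullet> \<xi>))) * (a x * cis (- 2 * pi * (x \<bullet> \<xi>))) \<partial>lborel)"
    proof -
      have "cis (- 2 * pi * ((y + 1 *\<^sub>R x) \<bullet> \<xi>)) = cis (- 2 * pi * (y \<bullet> \<xi>)) * cis (- 2 * pi * (x \<bullet> \<xi>))" for x
        unfolding cis_mult by (simp add: inner_add_left algebra_simps)
      then show ?thesis by (simp add: mult_ac del: mult_minus_left)
    qed
    also have "\<dots> = (b y * cis (- 2 * pi * (y \<bullet> \<xi>))) * fourier a \<xi>"
      unfolding integral_mult_right_zero by (simp add: fourier_lborel)
    finally show "(\<integral>x. a (x - y) * b y * cis (- 2 * pi * (x \<bullet> \<xi>)) \<partial>lborel) = fourier a \<xi> * (b y * cis (- 2 * pi * (y \<bullet> \<xi>)))"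
      by (simp only: mult_ac)
  qed
  also have "\<dots> = fourier a \<xi> * fourier b \<xi>" unfolding integral_mult_right_zero by (simp add: fourier_lborel)
  finally show ?thesis .
qed

lemma convolution_integrable:
  fixes a b :: "'a::euclidean_space \<Rightarrow> complex"
  assumes a: "integrable lborel a" and b: "integrable lborel b"
  shows "integrable lborel (convolution a b)"
proof (rule integrableI_bounded)
  have [measurable]: "a \<in> borel_measurable borel" "b \<in> borel_measurable borel"
    using borel_measurable_integrable[OF a] borel_measurable_integrable[OF b] by auto
  show "convolution a b \<in> borel_measurable lborel" by measurable
  have "(\<integral>\<^sup>+x. ennreal (norm (convolution a b x)) \<partial>lborel) \<le> (\<integral>\<^sup>+x. nnconv (\<lambda>x. ennreal (norm (a x))) (\<lambda>x. ennreal (norm (b x))) x \<partial>lborel)"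
  proof (rule nn_integral_mono)
    fix x
    show "ennreal (norm (convolution a b x)) \<le> nnconv (\<lambda>x. ennreal (norm (a x))) (\<lambda>x. ennreal (norm (b x))) x"
    proof (cases "integrable lborel (\<lambda>y. a (x - y) * b y)")
      case True
      show ?thesis unfolding convolution_def nnconv_def using integral_norm_bound_ennreal[OF True]
        by (simp add: norm_mult ennreal_mult)
    qed (simp add: convolution_def not_integrable_integral_eq)
  qed
  also have "\<dots> < \<infinity>"
    using a b by (subst nn_integral_nnconv) (auto simp: integrable_iff_bounded ennreal_mult_less_top)
  finally show "(\<integral>\<^sup>+x. ennreal (norm (convolution a b x)) \<partial>lborel) < \<infinity>" .
qed

lemma convolution_continuous:
  fixes a b :: "'a::euclidean_space \<Rightarrow> complex"
  assumes a: "continuous_on UNIV a" "\<And>x. norm (a x) \<le> A" and b: "integrable lborel b"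
  shows "continuous_on UNIV (convolution a b)"
proof -
  have [measurable]: "a \<in> borel_measurable borel" using a(1) by (rule borel_measurable_continuous_onI)
  have [measurable]: "b \<in> borel_measurable borel" using borel_measurable_integrable[OF b] by auto
  show ?thesis
    unfolding continuous_on_sequentially
  proof (intro allI ballI impI, elim conjE)
    fix X :: "nat \<Rightarrow> 'a" and x assume X: "X \<longlonglongrightarrow> x"
    have "(\<lambda>k. \<integral>y. a (X k - y) * b y \<partial>lborel) \<longlonglongrightarrow> (\<integral>y. a (x - y) * b y \<partial>lborel)"
    proof (rule integral_dominated_convergence[where w = "\<lambda>y. A * norm (b y)"])
      show "integrable lborel (\<lambda>y. A * norm (b y))" using b by simp
      show "AE y in lborel. (\<lambda>k. a (X k - y) * b y) \<longlonglongrightarrow> a (x - y) * b y"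
      proof (intro AE_I2 tendsto_mult tendsto_const)
        fix y
        show "(\<lambda>k. a (X k - y)) \<longlonglongrightarrow> a (x - y)"
          using continuous_on_tendsto_compose[OF a(1), of "\<lambda>k. X k - y" "x - y" sequentially] X
          by (simp add: tendsto_diff)
      qed
      show "AE y in lborel. norm (a (X k - y) * b y) \<le> A * norm (b y)" for k
        using a(2) by (intro AE_I2) (simp add: norm_mult mult_right_mono)
    qed measurable
    then show "(convolution a b \<circ> X) \<longlonglongrightarrow> convolution a b x" by (simp add: o_def convolution_def)
  qed
qed

lemma convolution_bounded:
  fixes a b :: "'a::euclidean_space \<Rightarrow> complex"
  assumes a: "\<And>x. norm (a x) \<le> A" and b: "integrable lborel b"
  shows "norm (convolution a b x) \<le> A * (\<integral>y. norm (b y) \<partial>lborel)"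
proof (cases "integrable lborel (\<lambda>y. a (x - y) * b y)")
  case True
  have "norm (convolution a b x) \<le> (\<integral>y. norm (a (x - y) * b y) \<partial>lborel)"
    unfolding convolution_def by (rule integral_norm_bound)
  also have "\<dots> \<le> (\<integral>y. A * norm (b y) \<partial>lborel)"
    using b a by (intro integral_mono integrable_norm[OF True]) (auto simp: norm_mult intro!: mult_right_mono)
  finally show ?thesis by simp
next
  case False
  have "0 \<le> A" using a[of 0] norm_ge_zero order_trans by blast
  then show ?thesis using False by (simp add: convolution_def not_integrable_integral_eq)
qed

section \<open>Dilations and the Littlewood-Paley pieces\<close>

definition dilate :: "real \<Rightarrow> ('a::euclidean_space \<Rightarrow> complex) \<Rightarrow> 'a \<Rightarrow> complex" where
  "dilate l \<phi> x = of_real (l ^ DIM('a)) * \<phi> (l *\<^sub>R x)"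

lemma dilate_measurable [measurable]:
  assumes [measurable]: "\<phi> \<in> borel_measurable borel"
  shows "dilate l \<phi> \<in> borel_measurable borel"
  unfolding dilate_def by measurable

lemma fourier_dilate:
  fixes \<phi> :: "'a::euclidean_space \<Rightarrow> complex"
  assumes l: "0 < l" and [measurable]: "\<phi> \<in> borel_measurable borel"
  shows "fourier (dilate l \<phi>) \<xi> = fourier \<phi> ((1 / l) *\<^sub>R \<xi>)"
proof -
  have "fourier \<phi> ((1 / l) *\<^sub>R \<xi>) = (\<bar>l\<bar> ^ DIM('a)) *\<^sub>R (\<integral>x. \<phi> (0 + l *\<^sub>R x) * cis (- 2 * pi * ((0 + l *\<^sub>R x) \<bullet> ((1 / l) *\<^sub>R \<xi>))) \<partial>lborel)"
    unfolding fourier_lborel[OF \<open>\<phi> \<in> borel_measurable borel\<close>]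
    by (rule lborel_integral_affine) (use l in auto)
  also have "\<dots> = (\<integral>x. of_real (l ^ DIM('a)) * (\<phi> (l *\<^sub>R x) * cis (- 2 * pi * (x \<bullet> \<xi>))) \<partial>lborel)"
    unfolding integral_mult_right_zero using l by (simp add: scaleR_conv_of_real)
  also have "\<dots> = fourier (dilate l \<phi>) \<xi>"
    unfolding fourier_lborel[OF dilate_measurable[OF \<open>\<phi> \<in> borel_measurable borel\<close>]] by (simp only: dilate_def mult.assoc)
  finally show ?thesis ..
qed

lemma rapid_dilate:
  fixes \<phi> :: "'a::euclidean_space \<Rightarrow> complex"
  assumes l: "0 < l" and \<phi>: "rapid \<phi>"
  shows "rapid (\<lambda>x. \<phi> (l *\<^sub>R x))"
  unfolding rapid_def
proof (intro conjI allI)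
  have [measurable]: "\<phi> \<in> borel_measurable borel" using \<phi> by (rule rapidD)
  show "(\<lambda>x. \<phi> (l *\<^sub>R x)) \<in> borel_measurable borel" by measurable
  fix N :: real
  \<comment> \<open>The comparison of weights under scaling holds for nonnegative exponents, and
    decay of order max N 0 implies decay of order N.\<close>
  define M where "M = max N 0"
  obtain C where C: "0 < C" "\<And>x. norm (\<phi> x) \<le> C * wt M x" using rapid_bound[OF \<phi>] by blast
  define k where "k = max 1 (1 / l)"
  have "norm (\<phi> (l *\<^sub>R x)) \<le> (C * k powr M) * wt N x" for x :: 'a
  proof -
    have "norm x = 1 / l * norm (l *\<^sub>R x)" using l by simp
    also have "\<dots> \<le> k * norm (l *\<^sub>R x)" by (intro mult_right_mono) (auto simp: k_def)
    finally have "1 + norm x \<le> k * (1 + norm (l *\<^sub>R x))" by (simp add: distrib_left k_def)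
    then have "wt M (l *\<^sub>R x) \<le> k powr M * wt M x" by (intro wt_le_scale) (auto simp: M_def k_def)
    also have "\<dots> \<le> k powr M * wt N x" by (intro mult_left_mono wt_antimono) (auto simp: M_def)
    finally have "C * wt M (l *\<^sub>R x) \<le> C * (k powr M * wt N x)" using C(1) by (intro mult_left_mono) auto
    then show ?thesis using C(2)[of "l *\<^sub>R x"] by simp
  qed
  then show "\<exists>C. \<forall>x. norm (\<phi> (l *\<^sub>R x)) \<le> C * wt N x" by blast
qed

lemma rapid_cmult: "rapid g \<Longrightarrow> rapid (\<lambda>x. c * g x)"
  by (rule rapid_mult_growth[of g _ "norm c" 0]) (auto simp: wt_def add_nonneg_eq_0_iff)

lemma vanishing_dilate:
  fixes \<phi> :: "'a::euclidean_space \<Rightarrow> complex"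
  assumes l: "0 < l" and \<phi>: "vanishing \<phi>"
  shows "vanishing (dilate l \<phi>)"
proof -
  have r: "rapid \<phi>" using \<phi> by (simp add: vanishing_def)
  have "rapid (dilate l \<phi>)" unfolding dilate_def[abs_def] by (intro rapid_cmult rapid_dilate l r)
  moreover obtain d where d: "0 < d" "\<And>\<xi>. norm \<xi> < d \<Longrightarrow> fourier \<phi> \<xi> = 0" using \<phi> by (auto simp: vanishing_def)
  have "fourier (dilate l \<phi>) \<xi> = 0" if "norm \<xi> < l * d" for \<xi>
    using that l by (subst fourier_dilate[OF l rapidD[OF r]]) (intro d, simp add: pos_divide_less_eq mult.commute)
  moreover have "0 < l * d" using l d by simp
  ultimately show ?thesis unfolding vanishing_def by blast
qed

lemma vanishing_C1_add:
  assumes f: "vanishing_C1 f" and g: "vanishing_C1 g"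
  shows "vanishing_C1 (\<lambda>x. f x + g x)"
proof -
  have d: "f differentiable (at x)" "g differentiable (at x)" for x using f g by (auto simp: vanishing_C1_def)
  have "partial_deriv (\<lambda>x. f x + g x) b = (\<lambda>x. partial_deriv f b x + partial_deriv g b x)" for b
  proof
    fix x
    have "((\<lambda>x. f x + g x) has_derivative (\<lambda>v. frechet_derivative f (at x) v + frechet_derivative g (at x) v)) (at x)"
      using d by (intro has_derivative_add) (simp_all add: frechet_derivative_works[symmetric])
    from frechet_derivative_at[OF this] show "partial_deriv (\<lambda>x. f x + g x) b x = partial_deriv f b x + partial_deriv g b x"
      by (simp add: partial_deriv_def fun_eq_iff)
  qed
  then show ?thesis using f g d by (auto simp: vanishing_C1_def intro!: vanishing_add rapid_add differentiable_add)
qed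

lemma vanishing_C1_dilate:
  fixes \<phi> :: "'a::euclidean_space \<Rightarrow> complex"
  assumes l: "0 < l" and \<phi>: "vanishing_C1 \<phi>"
  shows "vanishing_C1 (dilate l \<phi>)"
proof -
  have D: "(dilate l \<phi> has_derivative (\<lambda>v. of_real (l ^ DIM('a)) * frechet_derivative \<phi> (at (l *\<^sub>R x)) (l *\<^sub>R v))) (at x)" for x
  proof -
    have "(\<phi> has_derivative frechet_derivative \<phi> (at (l *\<^sub>R x))) (at (l *\<^sub>R x))"
      using \<phi> by (simp add: vanishing_C1_def frechet_derivative_works[symmetric])
    moreover have "((\<lambda>x. l *\<^sub>R x) has_derivative (\<lambda>v. l *\<^sub>R v)) (at x)" by (auto intro!: derivative_eq_intros)
    ultimately have "((\<lambda>x. \<phi> (l *\<^sub>R x)) has_derivative (\<lambda>v. frechet_derivative \<phi> (at (l *\<^sub>R x)) (l *\<^sub>R v))) (at x)"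
      using has_derivative_compose by blast
    then show ?thesis unfolding dilate_def by (rule has_derivative_mult_right)
  qed
  have "partial_deriv (dilate l \<phi>) b = (\<lambda>x. of_real (l ^ DIM('a) * l) * partial_deriv \<phi> b (l *\<^sub>R x))" for b
  proof
    fix x
    have lin: "linear (frechet_derivative \<phi> (at (l *\<^sub>R x)))"
      using \<phi> by (intro linear_frechet_derivative) (simp add: vanishing_C1_def)
    show "partial_deriv (dilate l \<phi>) b x = of_real (l ^ DIM('a) * l) * partial_deriv \<phi> b (l *\<^sub>R x)"
      unfolding partial_deriv_def using fun_cong[OF frechet_derivative_at[OF D[of x]], of b]
      by (simp add: linear_cmul[OF lin] scaleR_conv_of_real mult.assoc)
  qed
  then have "rapid (partial_deriv (dilate l \<phi>) b)" if "b \<in> Basis" for b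
    using \<phi> that l by (auto simp: vanishing_C1_def intro!: rapid_cmult rapid_dilate)
  moreover have "dilate l \<phi> differentiable (at x)" for x using D by (auto simp: differentiable_def)
  ultimately show ?thesis using vanishing_dilate[OF l] \<phi> by (auto simp: vanishing_C1_def)
qed

lemma LP_admissible_support:
  assumes "LP_admissible \<psi>" "fourier \<psi> \<xi> \<noteq> 0"
  shows "1/2 \<le> norm \<xi>" "norm \<xi> < 2"
  using assms closure_subset[of "{\<xi>. fourier \<psi> \<xi> \<noteq> 0}"] unfolding LP_admissible_def by blast+

text \<open>The annular support gives the spectral gap |\<xi>| < 1/2; the Schwartz bounds for
  integer exponents cover all real exponents by monotonicity of the weights.\<close>

lemma LP_admissible_vanishing_C1:
  fixes \<psi> :: "'a::euclidean_space \<Rightarrow> complex"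
  assumes \<psi>: "LP_admissible \<psi>"
  shows "vanishing_C1 \<psi>"
proof -
  have diff: "iter_partial vs \<psi> differentiable_on UNIV" if "set vs \<subseteq> Basis" for vs
    using \<psi> that by (auto simp: LP_admissible_def schwartz_def)
  have bd: "bounded (range (\<lambda>x. (1 + norm x) ^ N * norm (iter_partial vs \<psi> x)))" if "set vs \<subseteq> Basis" for vs N
    using \<psi> that by (auto simp: LP_admissible_def schwartz_def)
  have rap: "rapid (iter_partial vs \<psi>)" if vs: "set vs \<subseteq> Basis" for vs
    unfolding rapid_def
  proof (intro conjI allI)
    show "iter_partial vs \<psi> \<in> borel_measurable borel"
      by (intro borel_measurable_continuous_onI differentiable_imp_continuous_on diff vs)
    fix N :: real
    obtain k :: nat where k: "N \<le> real k" using real_arch_simple by blast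
    obtain B where B: "\<And>x. norm ((1 + norm x) ^ k * norm (iter_partial vs \<psi> x)) \<le> B"
      using bd[OF vs, of k] unfolding bounded_iff by blast
    have B0: "0 \<le> B" using B[of 0] norm_ge_zero order_trans by blast
    have "norm (iter_partial vs \<psi> x) \<le> B * wt N x" for x
    proof -
      have p: "0 < 1 + norm x" by (simp add: add_pos_nonneg)
      have "norm (iter_partial vs \<psi> x) \<le> B / (1 + norm x) ^ k"
        using B[of x] p by (simp add: pos_le_divide_eq mult.commute)
      also have "\<dots> = B * wt (real k) x"
        unfolding wt_def powr_minus powr_realpow[OF p] by (simp add: divide_inverse)
      also have "\<dots> \<le> B * wt N x" using B0 k by (intro mult_left_mono wt_antimono) auto
      finally show ?thesis .
    qed
    then show "\<exists>C. \<forall>x. norm (iter_partial vs \<psi> x) \<le> C * wt N x" by blast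
  qed
  have "vanishing \<psi>"
    unfolding vanishing_def
  proof (intro conjI exI[of _ "1/2"] allI impI)
    show "rapid \<psi>" using rap[of "[]"] by simp
    fix \<xi> :: 'a assume "norm \<xi> < 1/2"
    then show "fourier \<psi> \<xi> = 0" using LP_admissible_support(1)[OF \<psi>, of \<xi>] by linarith
  qed simp
  moreover have "\<psi> differentiable (at x)" for x
    using diff[of "[]"] by (simp add: differentiable_on_def)
  moreover have "rapid (partial_deriv \<psi> b)" if "b \<in> Basis" for b
    using rap[of "[b]"] that by (simp add: partial_deriv_def[abs_def])
  ultimately show ?thesis by (auto simp: vanishing_C1_def)
qed

lemma psi_dil_eq: "psi_dil \<psi> j = dilate (2 powr real_of_int j) \<psi>"
  by (simp add: psi_dil_def dilate_def fun_eq_iff powr_powr[symmetric] powr_realpow)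

lemma vanishing_C1_psi_dil: "LP_admissible \<psi> \<Longrightarrow> vanishing_C1 (psi_dil \<psi> j)"
  unfolding psi_dil_eq by (intro vanishing_C1_dilate LP_admissible_vanishing_C1) auto

lemma vanishing_C1_rapid: "vanishing_C1 \<phi> \<Longrightarrow> rapid \<phi>"
  by (simp add: vanishing_C1_def vanishing_def)

lemma vanishing_C1_measurable: "vanishing_C1 \<phi> \<Longrightarrow> \<phi> \<in> borel_measurable borel"
  by (rule rapidD[OF vanishing_C1_rapid])

lemma vanishing_C1_integrable: "vanishing_C1 \<phi> \<Longrightarrow> integrable lborel \<phi>"
  by (rule rapid_integrable[OF vanishing_C1_rapid])

lemma fourier_psi_dil:
  assumes "LP_admissible \<psi>"
  shows "fourier (psi_dil \<psi> j) \<xi> = fourier \<psi> ((2 powr (- real_of_int j)) *\<^sub>R \<xi>)"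
  unfolding psi_dil_eq using vanishing_C1_measurable[OF LP_admissible_vanishing_C1[OF assms]]
  by (subst fourier_dilate) (auto simp: powr_minus divide_inverse)

definition LP_fat :: "('a::euclidean_space \<Rightarrow> complex) \<Rightarrow> int \<Rightarrow> 'a \<Rightarrow> complex" where
  "LP_fat \<psi> j x = psi_dil \<psi> (j - 1) x + (psi_dil \<psi> j x + psi_dil \<psi> (j + 1) x)"

lemma LP_fat_dilate: "LP_fat \<psi> j = dilate (2 powr real_of_int j) (LP_fat \<psi> 0)"
proof
  fix x
  have "dilate (2 powr real_of_int j) (psi_dil \<psi> i) x = psi_dil \<psi> (j + i) x" for i
    unfolding psi_dil_eq dilate_def by (simp add: powr_add power_mult_distrib mult_ac)
  from this[of "-1"] this[of 0] this[of 1]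
  show "LP_fat \<psi> j x = dilate (2 powr real_of_int j) (LP_fat \<psi> 0) x"
    by (simp add: LP_fat_def dilate_def distrib_left)
qed

lemma vanishing_C1_LP_fat: "LP_admissible \<psi> \<Longrightarrow> vanishing_C1 (LP_fat \<psi> j)"
  unfolding LP_fat_def[abs_def] by (intro vanishing_C1_add vanishing_C1_psi_dil)

text \<open>The annulus [1/2, 2) has ratio 4, so pieces whose indices differ by 2 or more have
  disjoint spectral supports. Where the transform of \<open>psi_dil \<psi> j\<close> is nonzero, the
  partition of unity thus reduces to the three terms of \<open>LP_fat\<close>.\<close>

lemma fourier_LP_fat:
  assumes \<psi>: "LP_admissible \<psi>"
  shows "fourier (LP_fat \<psi> j) \<xi> * fourier (psi_dil \<psi> j) \<xi> = fourier (psi_dil \<psi> j) \<xi>"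
proof (cases "fourier (psi_dil \<psi> j) \<xi> = 0")
  case False
  define F where "F i = fourier (psi_dil \<psi> i) \<xi>" for i
  have supp: "1/2 \<le> 2 powr (- real_of_int i) * norm \<xi> \<and> 2 powr (- real_of_int i) * norm \<xi> < 2" if "F i \<noteq> 0" for i
    using LP_admissible_support[OF \<psi>, of "(2 powr (- real_of_int i)) *\<^sub>R \<xi>"] that
    by (simp add: F_def fourier_psi_dil[OF \<psi>])
  have j: "F j \<noteq> 0" using False by (simp add: F_def)
  have "i \<in> {j - 1, j, j + 1}" if "F i \<noteq> 0" for i
  proof (rule ccontr)
    assume "i \<notin> {j - 1, j, j + 1}"
    then consider "i \<le> j - 2" | "j + 2 \<le> i" by fastforce
    then show False
    proof cases
      case 1
      have "2 powr (- real_of_int j) * norm \<xi> * 2 powr 2 \<le> 2 powr (- real_of_int j) * norm \<xi> * 2 powr (real_of_int (j - i))"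
        using 1 by (intro mult_left_mono powr_mono) auto
      also have "\<dots> = 2 powr (- real_of_int i) * norm \<xi>" by (simp add: powr_diff powr_minus field_simps)
      finally show False using supp[OF j] supp[OF that] by simp
    next
      case 2
      have "2 powr (- real_of_int i) * norm \<xi> * 2 powr 2 \<le> 2 powr (- real_of_int i) * norm \<xi> * 2 powr (real_of_int (i - j))"
        using 2 by (intro mult_left_mono powr_mono) auto
      also have "\<dots> = 2 powr (- real_of_int j) * norm \<xi>" by (simp add: powr_diff powr_minus field_simps)
      finally show False using supp[OF j] supp[OF that] by simp
    qed
  qed
  then have zero: "F i = 0" if "i \<notin> {j - 1, j, j + 1}" for i using that by blast
  have "\<xi> \<noteq> 0" using supp[OF j] by auto
  then have "(F has_sum 1) UNIV"
    using \<psi> unfolding LP_admissible_def F_def fourier_psi_dil[OF \<psi>] by blast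
  moreover have "(F has_sum (\<Sum>i\<in>{j - 1, j, j + 1}. F i)) {j - 1, j, j + 1}"
    by (rule has_sum_finite) simp
  then have "(F has_sum (\<Sum>i\<in>{j - 1, j, j + 1}. F i)) UNIV"
    by (rule has_sum_cong_neutral[THEN iffD1, rotated -1]) (use zero in auto)
  ultimately have "(\<Sum>i\<in>{j - 1, j, j + 1}. F i) = 1" by (rule has_sum_unique[symmetric])
  moreover have "fourier (LP_fat \<psi> j) \<xi> = F (j - 1) + (F j + F (j + 1))"
    unfolding LP_fat_def[abs_def] F_def
    by (simp add: fourier_add rapid_add vanishing_C1_rapid vanishing_C1_psi_dil[OF \<psi>])
  ultimately show ?thesis by simp
qed simp

lemma continuous_bounded_injective:
  fixes f g :: "'a::euclidean_space \<Rightarrow> complex"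
  assumes f: "continuous_on UNIV f" "integrable lborel f" "\<And>x. norm (f x) \<le> A"
    and g: "continuous_on UNIV g" "integrable lborel g" "\<And>x. norm (g x) \<le> B"
    and eq: "\<And>\<xi>. \<xi> \<noteq> 0 \<Longrightarrow> fourier f \<xi> = fourier g \<xi>"
  shows "f = g"
proof
  fix x
  have [measurable]: "f \<in> borel_measurable borel" "g \<in> borel_measurable borel"
    using f(2) g(2) borel_measurable_integrable by fastforce+
  have i: "integrable lborel (\<lambda>x. h x * cis (- 2 * pi * (x \<bullet> \<xi>)))" if "integrable lborel h" for h :: "'a \<Rightarrow> complex" and \<xi>
  proof (rule Bochner_Integration.integrable_bound[OF that])
    have [measurable]: "h \<in> borel_measurable borel" using borel_measurable_integrable[OF that] by simp
    show "(\<lambda>x. h x * cis (- 2 * pi * (x \<bullet> \<xi>))) \<in> borel_measurable lborel" by measurable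
  qed (auto simp: norm_mult)
  have "(\<lambda>x. f x - g x) x = 0"
  proof (rule fourier_injective[where g = "\<lambda>x. f x - g x" and B = "A + B"])
    show "continuous_on UNIV (\<lambda>x. f x - g x)" by (intro continuous_intros f g)
    show "integrable lborel (\<lambda>x. f x - g x)" using f g by simp
    show "norm (f x - g x) \<le> A + B" for x
      using f(3)[of x] g(3)[of x] norm_triangle_ineq4[of "f x" "g x"] by linarith
    show "fourier (\<lambda>x. f x - g x) \<xi> = 0" if "\<xi> \<noteq> 0" for \<xi>
      using eq[OF that] i[OF f(2), of \<xi>] i[OF g(2), of \<xi>] by (simp add: fourier_lborel left_diff_distrib)
  qed
  then show "f x = g x" by simp
qed

lemma rapid_bounded:
  assumes "rapid g"
  obtains C where "0 < C" "\<And>x. norm (g x) \<le> C"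
proof -
  obtain C where C: "0 < C" "\<And>x. norm (g x) \<le> C * wt 0 x" using rapid_bound[OF assms] by blast
  have "C * wt 0 x \<le> C * 1" for x using C(1) by (intro mult_left_mono wt_le_1) auto
  then have "norm (g x) \<le> C" for x using C(2)[of x] by (metis mult.right_neutral order_trans)
  then show ?thesis using that C(1) by blast
qed

text \<open>Both sides are continuous, bounded and integrable with equal transforms by
  \<open>fourier_LP_fat\<close>, and uniqueness applies.\<close>

lemma LP_fat_psi_conv:
  assumes \<psi>: "LP_admissible \<psi>"
  shows "convolution (LP_fat \<psi> j) (psi_dil \<psi> j) = psi_dil \<psi> j"
proof -
  note n = vanishing_C1_LP_fat[OF \<psi>, of j] vanishing_C1_psi_dil[OF \<psi>, of j]
  obtain A where A: "0 < A" "\<And>x. norm (LP_fat \<psi> j x) \<le> A" using rapid_bounded[OF vanishing_C1_rapid[OF n(1)]] by blast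
  obtain B where B: "0 < B" "\<And>x. norm (psi_dil \<psi> j x) \<le> B" using rapid_bounded[OF vanishing_C1_rapid[OF n(2)]] by blast
  show ?thesis
  proof (rule continuous_bounded_injective)
    show "continuous_on UNIV (convolution (LP_fat \<psi> j) (psi_dil \<psi> j))"
      by (rule convolution_continuous[OF vanishing_C1_continuous[OF n(1)] A(2) vanishing_C1_integrable[OF n(2)]])
    show "integrable lborel (convolution (LP_fat \<psi> j) (psi_dil \<psi> j))" by (intro convolution_integrable vanishing_C1_integrable n)
    show "norm (convolution (LP_fat \<psi> j) (psi_dil \<psi> j) x) \<le> A * (\<integral>y. norm (psi_dil \<psi> j y) \<partial>lborel)" for x
      by (rule convolution_bounded[OF A(2) vanishing_C1_integrable[OF n(2)]])
    show "continuous_on UNIV (psi_dil \<psi> j)" by (rule vanishing_C1_continuous[OF n(2)])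
    show "integrable lborel (psi_dil \<psi> j)" by (rule vanishing_C1_integrable[OF n(2)])
    show "norm (psi_dil \<psi> j x) \<le> B" for x by (rule B(2))
    show "fourier (convolution (LP_fat \<psi> j) (psi_dil \<psi> j)) \<xi> = fourier (psi_dil \<psi> j) \<xi>" for \<xi>
      using convolution_fourier[OF vanishing_C1_integrable[OF n(1)] vanishing_C1_integrable[OF n(2)]] fourier_LP_fat[OF \<psi>] by simp
  qed
qed

section \<open>Decomposition of the differentiated Poisson kernel\<close>

definition dpk_complex :: "'a::euclidean_space \<Rightarrow> real \<Rightarrow> real \<Rightarrow> 'a \<Rightarrow> complex" where
  "dpk_complex v \<tau> t x = complex_of_real (dpk v \<tau> t x)"

lemma dpk_complex_measurable [measurable]: "dpk_complex v \<tau> t \<in> borel_measurable borel"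
  unfolding dpk_complex_def by measurable

lemma dpk_complex_bound:
  fixes v :: "'a::euclidean_space"
  assumes t: "0 < t"
  obtains C where "0 < C" "\<And>x. norm (dpk_complex v \<tau> t x) \<le> C * wt (real DIM('a) + 1) x"
proof -
  define n where "n = real DIM('a)"
  define D where "D = poisson_const DIM('a) * (n + 2) * (\<bar>\<tau>\<bar> + norm v)"
  have D: "0 \<le> D" using poisson_const_pos[of "DIM('a)"] by (auto simp: D_def n_def)
  define K where "K = (32 / t\<^sup>2 + 2) powr ((n + 1) / 2)"
  have "norm (dpk_complex v \<tau> t x) \<le> (D * K + 1) * wt (n + 1) x" for x
  proof -
    have "(1 + norm x)\<^sup>2 \<le> (32 / t\<^sup>2 + 2) * radsq t x"
      using radsq_perturb(3)[OF t, of 0 "0::'a" 0 x] t by simp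
    then have "radsq t x powr (- (n + 1) / 2) \<le> K * wt (n + 1) x"
      unfolding K_def using t by (intro radsq_powr_le_wt) (auto simp: n_def intro!: add_nonneg_pos)
    then have "D * radsq t x powr (- (n + 1) / 2) \<le> D * (K * wt (n + 1) x)" using D by (intro mult_left_mono)
    moreover have "norm (dpk_complex v \<tau> t x) \<le> D * radsq t x powr (- (n + 1) / 2)"
      unfolding dpk_complex_def norm_of_real D_def n_def by (rule dpk_bound[OF t])
    ultimately show ?thesis using wt_nonneg[of "n + 1" x] unfolding distrib_right mult_1 mult.assoc by linarith
  qed
  moreover have "0 < D * K + 1" using D by (simp add: K_def add_nonneg_pos)
  ultimately show ?thesis using that by (simp add: n_def)
qed

lemma dpk_complex_continuous:
  fixes v :: "'a::euclidean_space"
  assumes t: "0 < t"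
  shows "continuous_on UNIV (dpk_complex v \<tau> t)"
proof -
  have q: "continuous_on UNIV (radsq t :: 'a \<Rightarrow> real)" unfolding radsq_def[abs_def] by (intro continuous_intros)
  have "radsq t x \<noteq> 0" for x :: 'a using radsq_pos[OF t, of x] by simp
  then show ?thesis unfolding dpk_complex_def dpk_def by (intro continuous_intros q) auto
qed

lemma dpk_complex_integrable:
  fixes v :: "'a::euclidean_space"
  assumes t: "0 < t"
  shows "integrable lborel (dpk_complex v \<tau> t)"
proof -
  obtain C where C: "0 < C" "\<And>x. norm (dpk_complex v \<tau> t x) \<le> C * wt (real DIM('a) + 1) x" using dpk_complex_bound[OF t] by blast
  show ?thesis
  proof (rule Bochner_Integration.integrable_bound)
    show "integrable lborel (\<lambda>x::'a. C * wt (real DIM('a) + 1) x)" by (intro integrable_mult_right integrable_wt) simp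
  qed (use C in \<open>auto simp: abs_mult\<close>)
qed

lemma dpk_conv_convolution:
  assumes [measurable]: "\<phi> \<in> borel_measurable borel"
  shows "dpk_conv \<phi> v \<tau> t = convolution (dpk_complex v \<tau> t) \<phi>"
  by (simp add: fun_eq_iff dpk_conv_def convolution_def dpk_complex_def mult.commute)

lemma dpk_conv_dilate_bound:
  fixes \<phi> :: "'a::euclidean_space \<Rightarrow> complex"
  assumes \<phi>: "vanishing_C1 \<phi>" and e: "0 < e"
  obtains C where "0 < C" "\<And>l t x. 0 < l \<Longrightarrow> 0 < t \<Longrightarrow>
    norm (dpk_conv (dilate l \<phi>) v \<tau> t x) \<le> C * l ^ (DIM('a) + 1) * (1 + (l * t) powr (- e)) / (1 + l * t + l * norm x) ^ N"
proof -
  obtain C where C: "0 < C" "\<And>u x. 0 < u \<Longrightarrow> norm (dpk_conv \<phi> v \<tau> u x) \<le> C * (1 + u powr (- e)) / (1 + u + norm x) ^ N"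
    by (rule dpk_conv_bound[OF \<phi> e, of v \<tau> N]) blast
  have "norm (dpk_conv (dilate l \<phi>) v \<tau> t x) \<le> C * l ^ (DIM('a) + 1) * (1 + (l * t) powr (- e)) / (1 + l * t + l * norm x) ^ N"
    if l: "0 < l" and t: "0 < t" for l t :: real and x
  proof -
    have "norm (dpk_conv (dilate l \<phi>) v \<tau> t x) = l ^ (DIM('a) + 1) * norm (dpk_conv \<phi> v \<tau> (l * t) (l *\<^sub>R x))"
      unfolding dilate_def[abs_def] dpk_conv_scale[OF l vanishing_C1_measurable[OF \<phi>]] norm_mult norm_of_real using l by simp
    also have "\<dots> \<le> l ^ (DIM('a) + 1) * (C * (1 + (l * t) powr (- e)) / (1 + l * t + norm (l *\<^sub>R x)) ^ N)"
      using l t by (intro mult_left_mono C) auto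
    finally show ?thesis using l by (simp add: mult_ac)
  qed
  then show ?thesis using that C(1) by blast
qed

text \<open>Geometric decay in both directions of j under one fixed weight, so that the sum over j
  has an integrable majorant. Let l = 2^j. For l \<le> 1 the factor l^(n+1) meets l^(-n-1/2) from
  the weight and l^(-1/4) from the singularity, leaving l^(1/4); for l > 1 the decay in l t
  wins.\<close>

lemma dpk_conv_psi_dil_bound:
  fixes \<psi> :: "'a::euclidean_space \<Rightarrow> complex"
  assumes \<psi>: "LP_admissible \<psi>" and t: "0 < t"
  obtains C where "0 < C" "\<And>j x. norm (dpk_conv (psi_dil \<psi> j) v \<tau> t x) \<le> C * (2 powr (-1/4)) ^ nat \<bar>j\<bar> * wt (slow_exp TYPE('a)) x"
proof -
  define n where "n = DIM('a)"
  define w where "w = slow_exp TYPE('a)"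
  have w: "w = real n + 1/2" by (simp add: w_def slow_exp_def n_def)
  \<comment> \<open>The order 2 n + 3 splits as (n + 1) + (n + 2): for large l, n + 1 powers give
    the decay in x, and n + 2 powers of l t outweigh l^(n+1).\<close>
  obtain C where C: "0 < C" "\<And>l t x. 0 < l \<Longrightarrow> 0 < t \<Longrightarrow>
    norm (dpk_conv (dilate l \<psi>) v \<tau> t x) \<le> C * l ^ (n + 1) * (1 + (l * t) powr (- (1/4))) / (1 + l * t + l * norm x) ^ (2 * n + 3)"
    unfolding n_def by (rule dpk_conv_dilate_bound[OF LP_admissible_vanishing_C1[OF \<psi>], of "1/4" v \<tau> "2 * DIM('a) + 3"]) auto
  define T where "T = 1 + t powr (- (1/4))"
  have T: "0 < T" by (simp add: T_def add_pos_nonneg)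
  define D where "D = C * T * (1 + 1 / t ^ (n + 2))"
  have D: "C * T \<le> D" "C * T * (1 / t ^ (n + 2)) \<le> D" using C(1) T t by (auto simp: D_def distrib_left)
  have D0: "0 < D" using C(1) T D(1) mult_pos_pos[of C T] by linarith
  show ?thesis
  proof (rule that[OF D0])
    fix j :: int and x :: 'a
    define l where "l = 2 powr real_of_int j"
    have l: "0 < l" by (simp add: l_def)
    have S: "norm (dpk_conv (psi_dil \<psi> j) v \<tau> t x) \<le> C * l ^ (n + 1) * (1 + (l * t) powr (- (1/4))) / (1 + l * t + l * norm x) ^ (2 * n + 3)"
      unfolding psi_dil_eq l_def[symmetric] by (rule C(2)[OF l t])
    have lt: "0 < l * t" "0 \<le> l * norm x" using l t by auto
    define Y where "Y = 1 + l * t + l * norm x"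
    have Y: "1 \<le> Y" "l * t \<le> Y" "1 + l * norm x \<le> Y" using lt by (auto simp: Y_def)
    have xp: "0 < 1 + norm x" by (simp add: add_pos_nonneg)
    have "C * l ^ (n + 1) * (1 + (l * t) powr (- (1/4))) / Y ^ (2 * n + 3) \<le> D * (2 powr (-1/4)) ^ nat \<bar>j\<bar> * wt w x"
    proof (cases "j \<le> 0")
      case True
      then have l1: "l \<le> 1" unfolding l_def using powr_mono[of "real_of_int j" 0 2] by simp
      have "1 + (l * t) powr (- (1/4)) \<le> l powr (- (1/4)) * T"
      proof -
        have "1 \<le> l powr (- (1/4))" using l l1 powr_mono2'[of "-(1/4)" l 1] by simp
        then show ?thesis using l t by (simp add: T_def powr_mult distrib_left)
      qed
      moreover have "1 / Y ^ (2 * n + 3) \<le> l powr (- w) * wt w x"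
      proof -
        have "l * (1 + norm x) \<le> Y" using Y(3) l1 by (simp add: distrib_left)
        then have "(l * (1 + norm x)) powr w \<le> Y powr w" using l w xp by (intro powr_mono2) auto
        also have "\<dots> \<le> Y powr (real (2 * n + 3))" using Y(1) w by (intro powr_mono) auto
        also have "\<dots> = Y ^ (2 * n + 3)" using Y(1) by (intro powr_realpow) auto
        finally have "1 / Y ^ (2 * n + 3) \<le> 1 / (l * (1 + norm x)) powr w"
          by (intro divide_left_mono mult_pos_pos zero_less_power) (use Y(1) l xp in auto)
        also have "\<dots> = l powr (- w) * wt w x"
          using l xp by (simp add: wt_def powr_mult powr_minus divide_inverse)
        finally show ?thesis .
      qed
      ultimately have "(C * l ^ (n + 1)) * (1 + (l * t) powr (- (1/4))) * (1 / Y ^ (2 * n + 3)) \<le> (C * l ^ (n + 1)) * (l powr (- (1/4)) * T) * (l powr (- w) * wt w x)"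
        using C(1) l Y(1) T by (intro mult_mono) auto
      also have "\<dots> = C * T * (l powr real (n + 1) * l powr (- (1/4)) * l powr (- w)) * wt w x"
        using l by (simp only: powr_realpow mult_ac)
      also have "l powr real (n + 1) * l powr (- (1/4)) * l powr (- w) = l powr (1/4)"
        unfolding powr_add[symmetric] by (simp add: w)
      also have "l powr (1/4) = (2 powr (-1/4)) ^ nat \<bar>j\<bar>"
        unfolding l_def using True by (simp add: powr_powr powr_realpow[symmetric])
      also have "C * T * (2 powr (-1/4)) ^ nat \<bar>j\<bar> * wt w x \<le> D * (2 powr (-1/4)) ^ nat \<bar>j\<bar> * wt w x"
        using D(1) by (intro mult_right_mono) auto
      finally show ?thesis by simp
    next
      case False
      then have l1: "1 \<le> l" unfolding l_def using powr_mono[of 0 "real_of_int j" 2] by simp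
      have "1 + (l * t) powr (- (1/4)) \<le> T"
      proof -
        have "t \<le> l * t" using l1 t by simp
        then have "(l * t) powr (- (1/4)) \<le> t powr (- (1/4))" using t by (intro powr_mono2') auto
        then show ?thesis by (simp add: T_def)
      qed
      moreover have ll: "l ^ (n + 1) / l ^ (n + 2) \<le> (2 powr (-1/4)) ^ nat \<bar>j\<bar>"
      proof -
        have "l ^ (n + 1) / l ^ (n + 2) = l powr (-1)" using l by (simp add: powr_minus field_simps)
        also have "\<dots> \<le> l powr (-1/4)" using l1 by (intro powr_mono) auto
        also have "\<dots> = (2 powr (-1/4)) ^ nat \<bar>j\<bar>"
          unfolding l_def using False by (simp add: powr_powr powr_realpow[symmetric])
        finally show ?thesis .
      qed
      moreover have "1 / Y ^ (2 * n + 3) \<le> wt w x * (1 / (l ^ (n + 2) * t ^ (n + 2)))"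
      proof -
        have "norm x \<le> l * norm x" using l1 by (intro mult_right_mono[of 1 l, simplified]) auto
        then have "(1 + norm x) ^ (n + 1) \<le> Y ^ (n + 1)" using Y(3) xp by (intro power_mono) auto
        moreover have "(l * t) ^ (n + 2) \<le> Y ^ (n + 2)" using Y(2) lt by (intro power_mono) auto
        ultimately have "(1 + norm x) ^ (n + 1) * (l * t) ^ (n + 2) \<le> Y ^ (n + 1) * Y ^ (n + 2)"
          using lt Y(1) by (intro mult_mono) auto
        also have "\<dots> = Y ^ (2 * n + 3)" unfolding power_add[symmetric] by (rule arg_cong[where f = "power Y"]) simp
        finally have "1 / Y ^ (2 * n + 3) \<le> 1 / ((1 + norm x) ^ (n + 1) * (l * t) ^ (n + 2))"
          using lt xp Y(1) by (intro divide_left_mono) (auto intro!: mult_pos_pos zero_less_power)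
        also have "\<dots> = wt (real (n + 1)) x * (1 / (l ^ (n + 2) * t ^ (n + 2)))"
          unfolding wt_def powr_minus powr_realpow[OF xp] by (simp add: power_mult_distrib divide_inverse)
        also have "\<dots> \<le> wt w x * (1 / (l ^ (n + 2) * t ^ (n + 2)))"
          using l t by (intro mult_right_mono wt_antimono) (auto simp: w)
        finally show ?thesis .
      qed
      ultimately have "(C * l ^ (n + 1)) * (1 + (l * t) powr (- (1/4))) * (1 / Y ^ (2 * n + 3)) \<le> (C * l ^ (n + 1)) * T * (wt w x * (1 / (l ^ (n + 2) * t ^ (n + 2))))"
        using C(1) l Y(1) T by (intro mult_mono) auto
      also have "\<dots> = C * T * (1 / t ^ (n + 2)) * (l ^ (n + 1) / l ^ (n + 2)) * wt w x" by simp
      also have "\<dots> \<le> C * T * (1 / t ^ (n + 2)) * (2 powr (-1/4)) ^ nat \<bar>j\<bar> * wt w x"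
        using C(1) T t by (intro mult_right_mono mult_left_mono ll) auto
      also have "\<dots> \<le> D * (2 powr (-1/4)) ^ nat \<bar>j\<bar> * wt w x"
        using D(2) by (intro mult_right_mono) auto
      finally show ?thesis by simp
    qed
    then show "norm (dpk_conv (psi_dil \<psi> j) v \<tau> t x) \<le> D * (2 powr (-1/4)) ^ nat \<bar>j\<bar> * wt (slow_exp TYPE('a)) x"
      using S by (simp add: Y_def w_def)
  qed
qed

text \<open>Pairing j with -j turns symmetric partial sums over the integers into partial sums of an
  ordinary series; the index 0 is counted once.\<close>

lemma sum_int_split:
  fixes f :: "int \<Rightarrow> 'b::comm_monoid_add"
  defines "T \<equiv> \<lambda>i::nat. if i = 0 then f 0 else f (int i) + f (- int i)"
  shows "(\<Sum>i<Suc J. T i) = (\<Sum>j\<in>{- int J..int J}. f j)"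
proof (induction J)
  case (Suc J)
  have "{- int (Suc J)..int (Suc J)} = insert (int (Suc J)) (insert (- int (Suc J)) {- int J..int J})" by auto
  moreover have "int (Suc J) \<noteq> - int (Suc J)" by simp
  ultimately have "(\<Sum>j\<in>{- int (Suc J)..int (Suc J)}. f j) = f (int (Suc J)) + (f (- int (Suc J)) + (\<Sum>j\<in>{- int J..int J}. f j))"
    by simp
  moreover have "(\<Sum>i<Suc (Suc J). T i) = (\<Sum>i<Suc J. T i) + T (Suc J)" by (rule sum.lessThan_Suc)
  ultimately show ?case using Suc by (simp only: T_def add_ac) (simp add: add_ac)
qed (simp add: T_def)

text \<open>Connects \<open>has_sum\<close>, the form in which the partition of unity is given, with
  symmetric partial sums.\<close>

lemma filterlim_int_intervals: "filterlim (\<lambda>J. {- int J..int J}) (finite_subsets_at_top UNIV) sequentially"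
  unfolding filterlim_finite_subsets_at_top
proof (intro allI impI)
  fix X :: "int set" assume "finite X \<and> X \<subseteq> UNIV"
  then have X: "finite X" by simp
  define M where "M = nat (Max (insert 0 (abs ` X)))"
  have "X \<subseteq> {- int J..int J}" if "M \<le> J" for J
  proof
    fix j assume "j \<in> X"
    then have "\<bar>j\<bar> \<le> Max (insert 0 (abs ` X))" using X by (intro Max_ge) auto
    then have "\<bar>j\<bar> \<le> int J" using that by (simp add: M_def nat_le_iff)
    then show "j \<in> {- int J..int J}" by auto
  qed
  then show "\<forall>\<^sub>F J in sequentially. finite {- int J..int J} \<and> X \<subseteq> {- int J..int J} \<and> {- int J..int J} \<subseteq> UNIV"
    by (auto simp: eventually_sequentially)
qed

text \<open>The Weierstrass test gives a continuous limit g below an integrable majorant. The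
  transforms of the partial sums converge to that of g and, by the partition of unity, to that of
  the kernel for every \<xi> \<noteq> 0; uniqueness identifies g.\<close>

lemma kernel_decomposition:
  fixes \<psi> :: "'a::euclidean_space \<Rightarrow> complex"
  assumes \<psi>: "LP_admissible \<psi>" and t: "0 < t"
  obtains C where "0 < C" "\<And>J x. norm (\<Sum>j\<in>{- int J..int J}. dpk_conv (psi_dil \<psi> j) v \<tau> t x) \<le> C * wt (slow_exp TYPE('a)) x"
    "\<And>x. (\<lambda>J. \<Sum>j\<in>{- int J..int J}. dpk_conv (psi_dil \<psi> j) v \<tau> t x) \<longlonglongrightarrow> dpk_complex v \<tau> t x"
proof -
  define w where "w = slow_exp TYPE('a)"
  define S where "S j = dpk_conv (psi_dil \<psi> j) v \<tau> t" for j
  define b where "b = (2::real) powr (-1/4)"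
  have b: "0 < b" "b < 1" by (auto simp: b_def powr_less_one)
  obtain C where C: "0 < C" "\<And>j x. norm (S j x) \<le> C * b ^ nat \<bar>j\<bar> * wt w x"
    unfolding S_def b_def w_def by (rule dpk_conv_psi_dil_bound[OF \<psi> t, of v \<tau>]) blast
  define T where "T i x = (if i = 0 then S 0 x else S (int i) x + S (- int i) x)" for i :: nat and x
  have T: "norm (T i x) \<le> 2 * C * b ^ i * wt w x" for i x
  proof (cases "i = 0")
    case True
    have "0 \<le> C * wt w x" using C(1) by simp
    then show ?thesis using C(2)[of 0 x] True by (simp add: T_def)
  next
    case False
    have "norm (T i x) \<le> norm (S (int i) x) + norm (S (- int i) x)"
      using False by (simp add: T_def norm_triangle_ineq)
    then show ?thesis using C(2)[of "int i" x] C(2)[of "- int i" x] by simp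
  qed
  have T': "norm (T i x) \<le> 2 * C * b ^ i" for i x
  proof -
    have "2 * C * b ^ i * wt w x \<le> 2 * C * b ^ i * 1"
      using C(1) b by (intro mult_left_mono wt_le_1) (auto simp: w_def slow_exp_def)
    then show ?thesis using T[of i x] by simp
  qed
  have sb: "summable (\<lambda>i. 2 * C * b ^ i)" using b by (intro summable_mult summable_geometric) auto
  define E where "E = (\<Sum>i. 2 * C * b ^ i)"
  define s where "s k x = (\<Sum>i<k. T i x)" for k x
  define g where "g x = (\<Sum>i. T i x)" for x
  have sn: "norm (s k x) \<le> E * wt w x" for k x
  proof -
    have "norm (s k x) \<le> (\<Sum>i<k. 2 * C * b ^ i * wt w x)" unfolding s_def by (intro sum_norm_le T)
    also have "\<dots> = (\<Sum>i<k. 2 * C * b ^ i) * wt w x" by (simp add: sum_distrib_right)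
    also have "\<dots> \<le> E * wt w x"
      unfolding E_def using sb C(1) b by (intro mult_right_mono sum_le_suminf) auto
    finally show ?thesis .
  qed
  have E: "0 \<le> E" unfolding E_def using C(1) b by (intro suminf_nonneg sb) auto
  have ul: "uniform_limit UNIV s g sequentially"
    unfolding s_def[abs_def] g_def[abs_def] by (rule Weierstrass_m_test[OF T' sb])
  have lim: "(\<lambda>k. s k x) \<longlonglongrightarrow> g x" for x
    using tendsto_uniform_limitI[OF ul] by simp
  have Sn: "vanishing_C1 (psi_dil \<psi> j)" for j by (rule vanishing_C1_psi_dil[OF \<psi>])
  obtain A where A: "0 < A" "\<And>x. norm (dpk_complex v \<tau> t x) \<le> A * wt (real DIM('a) + 1) x" using dpk_complex_bound[OF t] by blast
  have A': "norm (dpk_complex v \<tau> t x) \<le> A" for x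
  proof -
    have "A * wt (real DIM('a) + 1) x \<le> A * 1" using A(1) by (intro mult_left_mono wt_le_1) auto
    then show ?thesis using A(2)[of x] by simp
  qed
  have Sc: "S j = convolution (dpk_complex v \<tau> t) (psi_dil \<psi> j)" for j
    unfolding S_def by (rule dpk_conv_convolution[OF vanishing_C1_measurable[OF Sn]])
  have contS: "continuous_on UNIV (S j)" for j
    unfolding Sc by (rule convolution_continuous[OF dpk_complex_continuous[OF t] A' vanishing_C1_integrable[OF Sn]])
  have contT: "continuous_on UNIV (T i)" for i
    unfolding T_def[abs_def] by (cases "i = 0") (auto intro!: continuous_intros contS)
  have conts: "continuous_on UNIV (s k)" for k
    unfolding s_def[abs_def] by (intro continuous_on_sum contT)
  have contg: "continuous_on UNIV g"
    by (rule uniform_limit_theorem[OF _ ul]) (auto intro!: always_eventually conts)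
  have [measurable]: "s k \<in> borel_measurable borel" "g \<in> borel_measurable borel" for k
    using conts contg by (auto intro: borel_measurable_continuous_onI)
  have gn: "norm (g x) \<le> E * wt w x" for x
    by (rule LIMSEQ_le_const2[OF tendsto_norm[OF lim]]) (use sn in auto)
  have iw: "integrable lborel (\<lambda>x::'a. E * wt w x)" unfolding w_def by (intro integrable_mult_right wt_slow_exp_integrable)
  have ig: "integrable lborel g"
    by (rule Bochner_Integration.integrable_bound[OF iw]) (use gn E in \<open>auto simp: abs_mult\<close>)
  have gb: "norm (g x) \<le> E" for x
  proof -
    have "E * wt w x \<le> E * 1" using E by (intro mult_left_mono wt_le_1) (auto simp: w_def slow_exp_def)
    then show ?thesis using gn[of x] by simp
  qed
  \<comment> \<open>Off by one: \<open>s k\<close> runs over the indices below k, so the symmetric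
    sum up to J is \<open>s (Suc J)\<close>.\<close>
  have sS: "s (Suc J) x = (\<Sum>j\<in>{- int J..int J}. S j x)" for J x
    unfolding s_def T_def by (rule sum_int_split)
  have "g = dpk_complex v \<tau> t"
  proof (rule continuous_bounded_injective[OF contg ig gb dpk_complex_continuous[OF t] dpk_complex_integrable[OF t] A'])
    fix \<xi> :: 'a assume \<xi>: "\<xi> \<noteq> 0"
    have "(\<lambda>k. \<integral>x. s (Suc k) x * cis (- 2 * pi * (x \<bullet> \<xi>)) \<partial>lborel) \<longlonglongrightarrow> (\<integral>x. g x * cis (- 2 * pi * (x \<bullet> \<xi>)) \<partial>lborel)"
    proof (rule integral_dominated_convergence[where w = "\<lambda>x. E * wt w x"])
      show "AE x in lborel. (\<lambda>k. s (Suc k) x * cis (- 2 * pi * (x \<bullet> \<xi>))) \<longlonglongrightarrow> g x * cis (- 2 * pi * (x \<bullet> \<xi>))"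
        by (intro AE_I2 tendsto_mult tendsto_const LIMSEQ_Suc lim)
      show "AE x in lborel. norm (s (Suc k) x * cis (- 2 * pi * (x \<bullet> \<xi>))) \<le> E * wt w x" for k
        using sn by (simp add: norm_mult)
    qed (use iw in auto)
    then have 1: "(\<lambda>k. fourier (s (Suc k)) \<xi>) \<longlonglongrightarrow> fourier g \<xi>" by (simp add: fourier_lborel)
    have 2: "fourier (s (Suc k)) \<xi> = fourier (dpk_complex v \<tau> t) \<xi> * (\<Sum>j\<in>{- int k..int k}. fourier (psi_dil \<psi> j) \<xi>)" for k
    proof -
      have iS: "integrable lborel (S j)" for j unfolding Sc by (intro convolution_integrable dpk_complex_integrable t vanishing_C1_integrable Sn)
      have mS [measurable]: "S j \<in> borel_measurable borel" for j using borel_measurable_integrable[OF iS] by simp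
      have iSc: "integrable lborel (\<lambda>x. S j x * cis (- 2 * pi * (x \<bullet> \<xi>)))" for j
        by (rule Bochner_Integration.integrable_bound[OF iS[of j]]) (auto simp: norm_mult)
      have "fourier (s (Suc k)) \<xi> = (\<integral>x. (\<Sum>j\<in>{- int k..int k}. S j x * cis (- 2 * pi * (x \<bullet> \<xi>))) \<partial>lborel)"
        by (simp add: fourier_lborel sS sum_distrib_right)
      also have "\<dots> = (\<Sum>j\<in>{- int k..int k}. fourier (S j) \<xi>)"
        unfolding fourier_lborel[OF mS] by (rule Bochner_Integration.integral_sum) (rule iSc)
      also have "\<dots> = (\<Sum>j\<in>{- int k..int k}. fourier (dpk_complex v \<tau> t) \<xi> * fourier (psi_dil \<psi> j) \<xi>)"
        unfolding Sc by (simp add: convolution_fourier[OF dpk_complex_integrable[OF t] vanishing_C1_integrable[OF Sn]])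
      finally show ?thesis by (simp add: sum_distrib_left)
    qed
    have "((\<lambda>j. fourier (psi_dil \<psi> j) \<xi>) has_sum 1) UNIV"
      using \<psi> \<xi> unfolding LP_admissible_def fourier_psi_dil[OF \<psi>] by blast
    then have "(\<lambda>k. \<Sum>j\<in>{- int k..int k}. fourier (psi_dil \<psi> j) \<xi>) \<longlonglongrightarrow> 1"
      unfolding has_sum_def by (rule filterlim_compose[OF _ filterlim_int_intervals])
    then have "(\<lambda>k. fourier (s (Suc k)) \<xi>) \<longlonglongrightarrow> fourier (dpk_complex v \<tau> t) \<xi> * 1"
      unfolding 2 by (intro tendsto_mult tendsto_const)
    then show "fourier g \<xi> = fourier (dpk_complex v \<tau> t) \<xi>" using LIMSEQ_unique[OF 1] by simp
  qed
  then have lim': "(\<lambda>J. \<Sum>j\<in>{- int J..int J}. S j x) \<longlonglongrightarrow> dpk_complex v \<tau> t x" for x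
    using LIMSEQ_Suc[OF lim[of x]] by (simp add: sS)
  have "norm (\<Sum>j\<in>{- int J..int J}. S j x) \<le> (E + 1) * wt w x" for J x
    using sn[of "Suc J" x] wt_nonneg[of w x] unfolding sS distrib_right by linarith
  then show ?thesis using that[of "E + 1"] E lim' unfolding S_def w_def by simp
qed

text \<open>The kernel decomposition is integrated against f, dominated by the weight that defines
  \<open>slow\<close>. In each term \<psi>_j is replaced by \<phi>_j * \<psi>_j, and associativity
  is used twice to reach (k_t * \<phi>_j) * (\<psi>_j * f). Stating an inequality in
  \<open>ennreal\<close> leaves open whether the sum of the norms converges.\<close>

lemma slow_reproducing:
  fixes \<psi> f :: "'a::euclidean_space \<Rightarrow> complex"
  assumes \<psi>: "LP_admissible \<psi>" and f: "slow f" and t: "0 < t"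
  shows "ennreal (norm (\<integral>y. f y * of_real (dpk v \<tau> t (x - y)) \<partial>lborel))
    \<le> (\<integral>\<^sup>+j. ennreal (norm (convolution (dpk_conv (LP_fat \<psi> j) v \<tau> t) (convolution (psi_dil \<psi> j) f) x)) \<partial>count_space UNIV)"
proof -
  define w where "w = slow_exp TYPE('a)"
  have [measurable]: "f \<in> borel_measurable borel" using f by (simp add: slow_def)
  define S where "S j = dpk_conv (psi_dil \<psi> j) v \<tau> t" for j
  obtain C where C: "0 < C" "\<And>J x. norm (\<Sum>j\<in>{- int J..int J}. S j x) \<le> C * wt w x"
    "\<And>x. (\<lambda>J. \<Sum>j\<in>{- int J..int J}. S j x) \<longlonglongrightarrow> dpk_complex v \<tau> t x"
    unfolding S_def w_def by (rule kernel_decomposition[OF \<psi> t, of v \<tau>]) blast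
  note nP = vanishing_C1_LP_fat[OF \<psi>] and np = vanishing_C1_psi_dil[OF \<psi>]
  have [measurable]: "psi_dil \<psi> j \<in> borel_measurable borel" "LP_fat \<psi> j \<in> borel_measurable borel" for j
    using nP np vanishing_C1_measurable by blast+
  have Sc: "S j = convolution (dpk_complex v \<tau> t) (psi_dil \<psi> j)" for j unfolding S_def by (rule dpk_conv_convolution) measurable
  have [measurable]: "S j \<in> borel_measurable borel" for j unfolding Sc by measurable
  obtain Cs where Cs: "0 < Cs" "\<And>j x. norm (S j x) \<le> Cs * (2 powr (-1/4)) ^ nat \<bar>j\<bar> * wt w x"
    unfolding S_def w_def by (rule dpk_conv_psi_dil_bound[OF \<psi> t, of v \<tau>]) blast
  define G where "G j = convolution (dpk_conv (LP_fat \<psi> j) v \<tau> t) (convolution (psi_dil \<psi> j) f) x" for j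
  have G: "(\<integral>y. S j (x - y) * f y \<partial>lborel) = G j" for j
  proof -
    obtain A where A: "0 < A" "\<And>x. norm (dpk_complex v \<tau> t x) \<le> A * wt (real DIM('a) + 1) x" using dpk_complex_bound[OF t] by blast
    have A': "norm (dpk_complex v \<tau> t x) \<le> A * wt w x" for x
    proof -
      have "A * wt (real DIM('a) + 1) x \<le> A * wt w x" using A(1) by (intro mult_left_mono wt_antimono) (auto simp: w_def slow_exp_def)
      then show ?thesis using A(2)[of x] by simp
    qed
    have 1: "S j = convolution (convolution (dpk_complex v \<tau> t) (LP_fat \<psi> j)) (psi_dil \<psi> j)"
    proof
      fix z
      have "S j z = convolution (dpk_complex v \<tau> t) (convolution (LP_fat \<psi> j) (psi_dil \<psi> j)) z"
        unfolding Sc LP_fat_psi_conv[OF \<psi>] ..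
      also have "\<dots> = convolution (convolution (dpk_complex v \<tau> t) (LP_fat \<psi> j)) (psi_dil \<psi> j) z"
        by (rule convolution_assoc[OF _ A'[unfolded w_def] _ vanishing_C1_rapid[OF nP] slow_rapid[OF vanishing_C1_rapid[OF np]]]) (use A(1) in auto)
      finally show "S j z = convolution (convolution (dpk_complex v \<tau> t) (LP_fat \<psi> j)) (psi_dil \<psi> j) z" .
    qed
    have K: "dpk_conv (LP_fat \<psi> j) v \<tau> t = convolution (dpk_complex v \<tau> t) (LP_fat \<psi> j)" by (rule dpk_conv_convolution) measurable
    obtain B where B: "0 < B" "\<And>u x. 0 < u \<Longrightarrow> norm (dpk_conv (LP_fat \<psi> j) v \<tau> u x) \<le> B * (1 + u powr (- 1)) / (1 + u + norm x) ^ (DIM('a) + 1)"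
      by (rule dpk_conv_bound[OF nP[of j], of 1 v \<tau> "DIM('a) + 1"]) auto
    define B' where "B' = B * (1 + t powr (- 1))"
    have B'0: "0 \<le> B'" using B(1) by (simp add: B'_def add_nonneg_nonneg)
    have B': "norm (dpk_conv (LP_fat \<psi> j) v \<tau> t z) \<le> B' * wt w z" for z
    proof -
      have p: "0 < 1 + norm z" by (simp add: add_pos_nonneg)
      have "norm (dpk_conv (LP_fat \<psi> j) v \<tau> t z) \<le> B' / (1 + t + norm z) ^ (DIM('a) + 1)"
        unfolding B'_def by (rule B(2)[OF t])
      also have "\<dots> \<le> B' / (1 + norm z) ^ (DIM('a) + 1)"
        using B'0 p t by (intro divide_left_mono power_mono mult_pos_pos zero_less_power) auto
      also have "\<dots> = B' * wt (real (DIM('a) + 1)) z"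
        unfolding wt_def powr_minus powr_realpow[OF p] by (simp add: divide_inverse)
      also have "\<dots> \<le> B' * wt w z" using B'0 by (intro mult_left_mono wt_antimono) (auto simp: w_def slow_exp_def)
      finally show ?thesis .
    qed
    have "(\<integral>y. S j (x - y) * f y \<partial>lborel) = convolution (convolution (convolution (dpk_complex v \<tau> t) (LP_fat \<psi> j)) (psi_dil \<psi> j)) f x"
      unfolding 1 by (simp add: convolution_def[of "convolution (convolution (dpk_complex v \<tau> t) (LP_fat \<psi> j)) (psi_dil \<psi> j)"])
    also have "\<dots> = convolution (dpk_conv (LP_fat \<psi> j) v \<tau> t) (convolution (psi_dil \<psi> j) f) x"
      unfolding K[symmetric]
      by (rule convolution_assoc[symmetric, OF _ B'[unfolded w_def] B'0 vanishing_C1_rapid[OF np] f]) (simp add: K)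
    finally show ?thesis by (simp add: G_def)
  qed
  have iS: "integrable lborel (\<lambda>y. S j (x - y) * f y)" for j
  proof -
    have "integrable lborel (\<lambda>y. f y * S j (x - y))"
      by (rule slow_integrable[OF f, where C = "Cs * (2 powr (-1/4)) ^ nat \<bar>j\<bar>" and x = x])
         (use Cs(2)[of j] in \<open>auto simp: w_def slow_exp_def\<close>)
    then show ?thesis by (simp add: mult.commute)
  qed
  have lim: "(\<lambda>J. \<integral>y. (\<Sum>j\<in>{- int J..int J}. S j (x - y)) * f y \<partial>lborel) \<longlonglongrightarrow> (\<integral>y. dpk_complex v \<tau> t (x - y) * f y \<partial>lborel)"
  proof (rule integral_dominated_convergence[where w = "\<lambda>y. C * (wt w (x - y) * norm (f y))"])
    show "integrable lborel (\<lambda>y. C * (wt w (x - y) * norm (f y)))"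
      using f unfolding slow_def w_def slow_exp_def by simp
    show "AE y in lborel. (\<lambda>J. (\<Sum>j\<in>{- int J..int J}. S j (x - y)) * f y) \<longlonglongrightarrow> dpk_complex v \<tau> t (x - y) * f y"
      by (intro AE_I2 tendsto_mult tendsto_const C(3))
    show "AE y in lborel. norm ((\<Sum>j\<in>{- int J..int J}. S j (x - y)) * f y) \<le> C * (wt w (x - y) * norm (f y))" for J
    proof (rule AE_I2)
      fix y
      have "norm ((\<Sum>j\<in>{- int J..int J}. S j (x - y)) * f y) \<le> (C * wt w (x - y)) * norm (f y)"
        unfolding norm_mult by (intro mult_right_mono C(2)) auto
      then show "norm ((\<Sum>j\<in>{- int J..int J}. S j (x - y)) * f y) \<le> C * (wt w (x - y) * norm (f y))" by (simp only: mult.assoc)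
    qed
  qed measurable
  have "ennreal (norm (\<integral>y. dpk_complex v \<tau> t (x - y) * f y \<partial>lborel)) \<le> (\<integral>\<^sup>+j. ennreal (norm (G j)) \<partial>count_space UNIV)"
  proof (rule LIMSEQ_le_const2)
    show "(\<lambda>J. ennreal (norm (\<integral>y. (\<Sum>j\<in>{- int J..int J}. S j (x - y)) * f y \<partial>lborel))) \<longlonglongrightarrow> ennreal (norm (\<integral>y. dpk_complex v \<tau> t (x - y) * f y \<partial>lborel))"
      by (intro tendsto_ennrealI tendsto_norm lim)
    have "ennreal (norm (\<integral>y. (\<Sum>j\<in>{- int J..int J}. S j (x - y)) * f y \<partial>lborel)) \<le> (\<integral>\<^sup>+j. ennreal (norm (G j)) \<partial>count_space UNIV)" for J
    proof -
      have "(\<integral>y. (\<Sum>j\<in>{- int J..int J}. S j (x - y)) * f y \<partial>lborel) = (\<Sum>j\<in>{- int J..int J}. G j)"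
        unfolding sum_distrib_right by (subst Bochner_Integration.integral_sum) (auto intro: iS simp: G)
      then have "norm (\<integral>y. (\<Sum>j\<in>{- int J..int J}. S j (x - y)) * f y \<partial>lborel) \<le> (\<Sum>j\<in>{- int J..int J}. norm (G j))"
        by (simp add: norm_sum)
      then have "ennreal (norm (\<integral>y. (\<Sum>j\<in>{- int J..int J}. S j (x - y)) * f y \<partial>lborel)) \<le> (\<Sum>j\<in>{- int J..int J}. ennreal (norm (G j)))"
        by (simp add: ennreal_leI)
      also have "\<dots> \<le> (\<integral>\<^sup>+j. ennreal (norm (G j)) \<partial>count_space UNIV)"
        unfolding nn_integral_count_space_int_SUP by (rule SUP_upper) simp
      finally show ?thesis .
    qed
    then show "\<exists>N. \<forall>J\<ge>N. ennreal (norm (\<integral>y. (\<Sum>j\<in>{- int J..int J}. S j (x - y)) * f y \<partial>lborel)) \<le> (\<integral>\<^sup>+j. ennreal (norm (G j)) \<partial>count_space UNIV)"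
      by blast
  qed
  then show ?thesis by (simp add: G_def dpk_complex_def mult.commute)
qed

section \<open>The Peetre inequality\<close>

lemma norm_convolution_le: "ennreal (norm (convolution a b x)) \<le> (\<integral>\<^sup>+y. ennreal (norm (a (x - y)) * norm (b y)) \<partial>lborel)"
proof (cases "integrable lborel (\<lambda>y. a (x - y) * b y)")
  case True
  show ?thesis unfolding convolution_def using integral_norm_bound_ennreal[OF True] by (simp add: norm_mult)
qed (simp add: convolution_def not_integrable_integral_eq)

lemma wt_powr: "wt a x powr r = wt (a * r) x"
  by (simp add: wt_def powr_powr)

text \<open>Provides the a priori finiteness of the Peetre maximal function: Peetre's inequality
  moves the weight from x - z to x - y under the integral.\<close>

lemma convolution_slow_growth:
  fixes a f :: "'a::euclidean_space \<Rightarrow> complex"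
  assumes a: "rapid a" and f: "slow f"
  obtains B where "0 \<le> B" "\<And>z. norm (convolution a f z) * wt (slow_exp TYPE('a)) (x - z) \<le> B"
proof -
  define w where "w = slow_exp TYPE('a)"
  have w: "0 \<le> w" by (simp add: w_def slow_exp_def)
  have [measurable]: "f \<in> borel_measurable borel" using f by (simp add: slow_def)
  obtain A where A: "0 < A" "\<And>x. norm (a x) \<le> A * wt w x" using rapid_bound[OF a] by blast
  define I where "I = (\<integral>y. wt w (x - y) * norm (f y) \<partial>lborel)"
  have i: "integrable lborel (\<lambda>y. wt w (x - y) * norm (f y))" using f by (simp add: slow_def w_def slow_exp_def)
  have "norm (convolution a f z) * wt w (x - z) \<le> A * I" for z
  proof -
    have "ennreal (norm (convolution a f z) * wt w (x - z)) = ennreal (wt w (x - z)) * ennreal (norm (convolution a f z))"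
      by (simp add: mult.commute flip: ennreal_mult)
    also have "\<dots> \<le> ennreal (wt w (x - z)) * (\<integral>\<^sup>+y. ennreal (A * wt w (z - y)) * ennreal (norm (f y)) \<partial>lborel)"
      using A by (intro mult_left_mono order_trans[OF norm_convolution_le] nn_integral_mono)
        (auto intro!: ennreal_leI mult_right_mono simp flip: ennreal_mult)
    also have "\<dots> = (\<integral>\<^sup>+y. ennreal (wt w (x - z)) * (ennreal (A * wt w (z - y)) * ennreal (norm (f y))) \<partial>lborel)"
      by (rule nn_integral_cmult[symmetric]) measurable
    also have "\<dots> \<le> (\<integral>\<^sup>+y. ennreal (A * (wt w (x - y) * norm (f y))) \<partial>lborel)"
    proof (rule nn_integral_mono)
      fix y
      have "wt w (x - z) * (A * wt w (z - y) * norm (f y)) = A * ((wt w (x - z) * wt w (z - y)) * norm (f y))" by (simp only: mult_ac)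
      also have "\<dots> \<le> A * (wt w (x - y) * norm (f y))"
        using A(1) wt_Peetre[OF w, of "x - z" "z - y"] by (intro mult_left_mono mult_right_mono) auto
      finally show "ennreal (wt w (x - z)) * (ennreal (A * wt w (z - y)) * ennreal (norm (f y))) \<le> ennreal (A * (wt w (x - y) * norm (f y)))"
        using A(1) by (simp add: ennreal_leI flip: ennreal_mult)
    qed
    also have "\<dots> = ennreal (A * I)"
      using nn_integral_eq_integral[OF integrable_mult_right[OF i, of A]] A(1) by (simp add: I_def)
    finally show ?thesis using A(1) by (subst (asm) ennreal_le_iff) (auto simp: I_def integral_nonneg_AE)
  qed
  moreover have "0 \<le> A * I" using A(1) by (simp add: I_def integral_nonneg_AE)
  ultimately show ?thesis using that unfolding w_def by blast
qed

text \<open>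
  The number \<open>m\<close> is the Peetre maximal function of \<open>f\<^sub>j\<close> at \<open>x\<close>. Inserting \<open>|f\<^sub>j| = |f\<^sub>j|\<^sup>r |f\<^sub>j|\<^sup>1\<^sup>-\<^sup>r\<close> into \<open>f\<^sub>j = \<phi>\<^sub>j * f\<^sub>j\<close> gives
  \<open>m \<le> A m\<^sup>1\<^sup>-\<^sup>r (\<eta>\<^sub>j * |f\<^sub>j|\<^sup>r)(x)\<close>, and \<open>m\<close> is finite because \<open>f\<close> is slowly growing.
\<close>

lemma Peetre_inequality:
  fixes \<psi> :: "'a::euclidean_space \<Rightarrow> complex"
  assumes \<psi>: "LP_admissible \<psi>" and r: "0 < r" "r \<le> 1" and lam: "slow_exp TYPE('a) \<le> \<mu>"
  obtains A where "0 < A" "\<And>f j x. slow f \<Longrightarrow> \<exists>m\<ge>0.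
    (\<forall>z. norm (convolution (psi_dil \<psi> j) f z) * wt \<mu> ((2 powr real_of_int j) *\<^sub>R (x - z)) \<le> m) \<and>
    ennreal (m powr r) \<le> ennreal A * nnconv (wt_kernel (\<mu> * r) (2 powr real_of_int j)) (\<lambda>z. ennreal (norm (convolution (psi_dil \<psi> j) f z) powr r)) x"
proof -
  note nP = vanishing_C1_LP_fat[OF \<psi>] and np = vanishing_C1_psi_dil[OF \<psi>]
  obtain A where A: "0 < A" "\<And>x. norm (LP_fat \<psi> 0 x) \<le> A * wt \<mu> x" using rapid_bound[OF vanishing_C1_rapid[OF nP]] by blast
  have lam0: "0 \<le> \<mu>" using lam by (simp add: slow_exp_def)
  show ?thesis
  proof (rule that[OF A(1)])
    fix f :: "'a \<Rightarrow> complex" and j and x :: 'a assume f: "slow f"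
    define l where "l = 2 powr real_of_int j"
    have l: "0 < l" by (simp add: l_def)
    define F where "F = convolution (psi_dil \<psi> j) f"
    have [measurable]: "f \<in> borel_measurable borel" using f by (simp add: slow_def)
    have [measurable]: "psi_dil \<psi> j \<in> borel_measurable borel" by (rule vanishing_C1_measurable[OF np])
    have [measurable]: "F \<in> borel_measurable borel" unfolding F_def by measurable
    define M where "M = (SUP z. norm (F z) * wt \<mu> (l *\<^sub>R (x - z)))"
    \<comment> \<open>The weight at scale 2^j is compared with the one at scale 1; the loss depends
      on j, but only finiteness is asserted.\<close>
    have bdd: "bdd_above (range (\<lambda>z. norm (F z) * wt \<mu> (l *\<^sub>R (x - z))))"
    proof -
      obtain B where B: "0 \<le> B" "\<And>z. norm (F z) * wt (slow_exp TYPE('a)) (x - z) \<le> B"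
        unfolding F_def using convolution_slow_growth[OF vanishing_C1_rapid[OF np] f] by blast
      define k where "k = max 1 (1 / l)"
      have "norm (F z) * wt \<mu> (l *\<^sub>R (x - z)) \<le> k powr \<mu> * B" for z
      proof -
        have "norm (x - z) = 1 / l * norm (l *\<^sub>R (x - z))" using l by simp
        also have "\<dots> \<le> k * norm (l *\<^sub>R (x - z))" by (intro mult_right_mono) (auto simp: k_def)
        finally have "1 + norm (x - z) \<le> k * (1 + norm (l *\<^sub>R (x - z)))" by (simp add: distrib_left k_def)
        then have "wt \<mu> (l *\<^sub>R (x - z)) \<le> k powr \<mu> * wt \<mu> (x - z)" using lam0 by (intro wt_le_scale) (auto simp: k_def)
        also have "\<dots> \<le> k powr \<mu> * wt (slow_exp TYPE('a)) (x - z)" using lam by (intro mult_left_mono wt_antimono) auto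
        finally have "norm (F z) * wt \<mu> (l *\<^sub>R (x - z)) \<le> norm (F z) * (k powr \<mu> * wt (slow_exp TYPE('a)) (x - z))"
          by (intro mult_left_mono) auto
        also have "\<dots> = k powr \<mu> * (norm (F z) * wt (slow_exp TYPE('a)) (x - z))" by simp
        also have "\<dots> \<le> k powr \<mu> * B" by (intro mult_left_mono B) auto
        finally show ?thesis .
      qed
      then show ?thesis by (auto intro!: bdd_aboveI2)
    qed
    have M: "norm (F z) * wt \<mu> (l *\<^sub>R (x - z)) \<le> M" for z unfolding M_def by (rule cSUP_upper[OF _ bdd]) simp
    have M0: "0 \<le> M" using M[of x] by (meson mult_nonneg_nonneg norm_ge_zero order_trans wt_nonneg)
    define G where "G = nnconv (wt_kernel (\<mu> * r) l) (\<lambda>z. ennreal (norm (F z) powr r)) x"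
    have main: "ennreal (norm (F z) * wt \<mu> (l *\<^sub>R (x - z))) \<le> ennreal (A * M powr (1 - r)) * G" for z
    proof -
      have rep: "F z = convolution (LP_fat \<psi> j) F z"
      proof -
        obtain B where B: "0 < B" "\<And>x. norm (LP_fat \<psi> j x) \<le> B * wt (slow_exp TYPE('a)) x" using rapid_bound[OF vanishing_C1_rapid[OF nP]] by blast
        have "convolution (LP_fat \<psi> j) F z = convolution (convolution (LP_fat \<psi> j) (psi_dil \<psi> j)) f z"
          unfolding F_def by (rule convolution_assoc[OF vanishing_C1_measurable[OF nP] B(2) _ vanishing_C1_rapid[OF np] f]) (use B in simp)
        then show ?thesis unfolding LP_fat_psi_conv[OF \<psi>] F_def by simp
      qed
      have Pj: "norm (LP_fat \<psi> j y) \<le> l ^ DIM('a) * (A * wt \<mu> (l *\<^sub>R y))" for y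
        unfolding LP_fat_dilate[of \<psi> j] dilate_def l_def[symmetric] norm_mult norm_of_real using l A(2) by (simp add: mult_left_mono)
      have "ennreal (norm (F z) * wt \<mu> (l *\<^sub>R (x - z))) = ennreal (wt \<mu> (l *\<^sub>R (x - z))) * ennreal (norm (convolution (LP_fat \<psi> j) F z))"
        using rep by (simp add: mult.commute flip: ennreal_mult)
      also have "\<dots> \<le> ennreal (wt \<mu> (l *\<^sub>R (x - z))) * (\<integral>\<^sup>+y. ennreal (l ^ DIM('a) * (A * wt \<mu> (l *\<^sub>R (z - y)))) * ennreal (norm (F y)) \<partial>lborel)"
        using Pj by (intro mult_left_mono order_trans[OF norm_convolution_le] nn_integral_mono)
          (auto intro!: ennreal_leI mult_right_mono simp flip: ennreal_mult'')
      also have "\<dots> = (\<integral>\<^sup>+y. ennreal (wt \<mu> (l *\<^sub>R (x - z))) * (ennreal (l ^ DIM('a) * (A * wt \<mu> (l *\<^sub>R (z - y)))) * ennreal (norm (F y))) \<partial>lborel)"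
        by (rule nn_integral_cmult[symmetric]) measurable
      also have "\<dots> \<le> (\<integral>\<^sup>+y. ennreal (A * M powr (1 - r)) * (wt_kernel (\<mu> * r) l (x - y) * ennreal (norm (F y) powr r)) \<partial>lborel)"
      proof (rule nn_integral_mono)
        fix y
        define W where "W = wt \<mu> (l *\<^sub>R (x - y))"
        have W: "0 < W" unfolding W_def by (rule wt_pos)
        have p: "wt \<mu> (l *\<^sub>R (x - z)) * wt \<mu> (l *\<^sub>R (z - y)) \<le> W"
          using wt_Peetre[OF lam0, of "l *\<^sub>R (x - z)" "l *\<^sub>R (z - y)"] unfolding W_def scaleR_add_right[symmetric] by simp
        \<comment> \<open>The bound of W |F y| by M is applied to the power 1 - r only; the power r
          stays under the integral.\<close>
        have WF: "W * norm (F y) \<le> W powr r * norm (F y) powr r * M powr (1 - r)"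
        proof -
          have "W * norm (F y) = (W * norm (F y)) powr r * (W * norm (F y)) powr (1 - r)"
            using W by (simp add: powr_add[symmetric])
          also have "\<dots> \<le> (W * norm (F y)) powr r * M powr (1 - r)"
            using M[of y] W r by (intro mult_left_mono powr_mono2) (auto simp: W_def mult.commute)
          finally show ?thesis using W by (simp add: powr_mult)
        qed
        have "wt \<mu> (l *\<^sub>R (x - z)) * (l ^ DIM('a) * (A * wt \<mu> (l *\<^sub>R (z - y))) * norm (F y))
          = (A * l ^ DIM('a)) * ((wt \<mu> (l *\<^sub>R (x - z)) * wt \<mu> (l *\<^sub>R (z - y))) * norm (F y))" by (simp only: mult_ac)
        also have "\<dots> \<le> (A * l ^ DIM('a)) * (W * norm (F y))" using A(1) l p by (intro mult_left_mono mult_right_mono) auto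
        also have "\<dots> \<le> (A * l ^ DIM('a)) * (W powr r * norm (F y) powr r * M powr (1 - r))" using A(1) l WF by (intro mult_left_mono) auto
        also have "\<dots> = (A * M powr (1 - r)) * (l ^ DIM('a) * wt (\<mu> * r) (l *\<^sub>R (x - y)) * norm (F y) powr r)"
          unfolding W_def wt_powr by (simp only: mult_ac)
        finally show "ennreal (wt \<mu> (l *\<^sub>R (x - z))) * (ennreal (l ^ DIM('a) * (A * wt \<mu> (l *\<^sub>R (z - y)))) * ennreal (norm (F y)))
          \<le> ennreal (A * M powr (1 - r)) * (wt_kernel (\<mu> * r) l (x - y) * ennreal (norm (F y) powr r))"
          unfolding wt_kernel_def using A(1) l by (simp add: ennreal_leI flip: ennreal_mult)
      qed
      also have "\<dots> = ennreal (A * M powr (1 - r)) * G"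
        unfolding G_def nnconv_def by (rule nn_integral_cmult) measurable
      finally show ?thesis .
    qed
    have "ennreal (M powr r) \<le> ennreal A * G"
    proof (cases "M = 0")
      case False
      then have Mp: "0 < M" using M0 by simp
      show ?thesis
      proof (cases G)
        \<comment> \<open>The supremum over z gives M \<le> A M^(1-r) g, and M is finite and
          positive, so M^(1-r) can be cancelled.\<close>
        case (real g)
        have "M \<le> A * M powr (1 - r) * g"
          unfolding M_def
        proof (rule cSUP_least)
          fix z
          have "ennreal (norm (F z) * wt \<mu> (l *\<^sub>R (x - z))) \<le> ennreal (A * M powr (1 - r) * g)"
            using main[of z] real A(1) by (simp add: ennreal_mult)
          then show "norm (F z) * wt \<mu> (l *\<^sub>R (x - z)) \<le> A * (SUP z. norm (F z) * wt \<mu> (l *\<^sub>R (x - z))) powr (1 - r) * g"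
            using A(1) real by (subst (asm) ennreal_le_iff) (auto simp: M_def)
        qed simp
        then have "M powr (1 - r) * M powr r \<le> M powr (1 - r) * (A * g)"
          using Mp by (simp add: powr_add[symmetric] mult_ac)
        then have "M powr r \<le> A * g" using Mp by simp
        then show ?thesis using real A(1) by (simp add: ennreal_leI flip: ennreal_mult)
      qed (use A(1) in \<open>simp add: ennreal_mult_top\<close>)
    qed simp
    then show "\<exists>m\<ge>0. (\<forall>z. norm (convolution (psi_dil \<psi> j) f z) * wt \<mu> ((2 powr real_of_int j) *\<^sub>R (x - z)) \<le> m) \<and>
      ennreal (m powr r) \<le> ennreal A * nnconv (wt_kernel (\<mu> * r) (2 powr real_of_int j)) (\<lambda>z. ennreal (norm (convolution (psi_dil \<psi> j) f z) powr r)) x"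
      using M M0 unfolding G_def F_def l_def by blast
  qed
qed

text \<open>Of the decay 3 + k of the kernel, k pays for the weight \<mu> hidden in m and for an
  integrable rest of order n + 1; the power 3 remains as decay in 2^j t.\<close>

lemma kernel_times_Peetre:
  fixes \<psi> :: "'a::euclidean_space \<Rightarrow> complex"
  assumes \<psi>: "LP_admissible \<psi>" and e: "0 < e" and lam: "0 \<le> \<mu>"
  obtains C where "0 < C" "\<And>F j x m t. F \<in> borel_measurable borel \<Longrightarrow> 0 < t \<Longrightarrow> 0 \<le> m \<Longrightarrow>
    (\<And>z. norm (F z) * wt \<mu> ((2 powr real_of_int j) *\<^sub>R (x - z)) \<le> m) \<Longrightarrow>
    norm (convolution (dpk_conv (LP_fat \<psi> j) v \<tau> t) F x)
      \<le> C * (2 powr real_of_int j * (1 + (2 powr real_of_int j * t) powr (- e)) / (1 + 2 powr real_of_int j * t) ^ 3) * m"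
proof -
  define n where "n = DIM('a)"
  obtain k :: nat where k: "\<mu> + real n + 1 \<le> real k" using real_arch_simple by blast
  obtain C where C: "0 < C" "\<And>l t x. 0 < l \<Longrightarrow> 0 < t \<Longrightarrow>
    norm (dpk_conv (dilate l (LP_fat \<psi> 0)) v \<tau> t x) \<le> C * l ^ (n + 1) * (1 + (l * t) powr (- e)) / (1 + l * t + l * norm x) ^ (3 + k)"
    unfolding n_def by (rule dpk_conv_dilate_bound[OF vanishing_C1_LP_fat[OF \<psi>, of 0] e, of v \<tau> "3 + k"]) blast
  define I where "I = wt_int TYPE('a) (real n + 1)"
  have I: "0 \<le> I" by (simp add: I_def)
  show ?thesis
  proof (rule that[of "C * (I + 1)"])
    show "0 < C * (I + 1)" using C(1) I by simp
    fix F :: "'a \<Rightarrow> complex" and j and x :: 'a and m t :: real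
    assume [measurable]: "F \<in> borel_measurable borel" and t: "0 < t" and m: "0 \<le> m"
      and Fm: "\<And>z. norm (F z) * wt \<mu> ((2 powr real_of_int j) *\<^sub>R (x - z)) \<le> m"
    define l where "l = 2 powr real_of_int j"
    have l: "0 < l" by (simp add: l_def)
    define a where "a = l * (1 + (l * t) powr (- e)) / (1 + l * t) ^ 3"
    have lt: "0 < l * t" using l t by simp
    have a: "0 \<le> a" using l lt by (simp add: a_def)
    have bound: "norm (dpk_conv (LP_fat \<psi> j) v \<tau> t y) * norm (F (x - y)) \<le> C * a * m * (l ^ n * wt (real n + 1) (l *\<^sub>R y))" for y
    proof -
      define u where "u = 1 + norm (l *\<^sub>R y)"
      have u: "1 \<le> u" by (simp add: u_def)
      have ly: "0 \<le> l * norm y" using l by simp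
      have lty: "0 < 1 + l * t + l * norm y" using lt ly by linarith
      have "norm (dpk_conv (LP_fat \<psi> j) v \<tau> t y) \<le> C * l ^ (n + 1) * (1 + (l * t) powr (- e)) / (1 + l * t + l * norm y) ^ (3 + k)"
        unfolding LP_fat_dilate[of \<psi> j] l_def[symmetric] by (rule C(2)[OF l t])
      also have "\<dots> \<le> C * l ^ (n + 1) * (1 + (l * t) powr (- e)) / ((1 + l * t) ^ 3 * u ^ k)"
      proof (rule divide_left_mono)
        show "(1 + l * t) ^ 3 * u ^ k \<le> (1 + l * t + l * norm y) ^ (3 + k)"
          unfolding power_add u_def using l lt ly by (intro mult_mono power_mono) auto
      qed (use C(1) l lt ly lty u in \<open>auto intro!: mult_pos_pos zero_less_power add_nonneg_nonneg\<close>)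
      also have "\<dots> = C * a * l ^ n * (1 / u ^ k)" by (simp add: a_def)
      also have "1 / u ^ k = wt (real k) (l *\<^sub>R y)"
        using u unfolding wt_def u_def[symmetric] powr_minus by (simp add: powr_realpow divide_inverse)
      also have "C * a * l ^ n * wt (real k) (l *\<^sub>R y) \<le> C * a * l ^ n * wt (\<mu> + (real n + 1)) (l *\<^sub>R y)"
        using C(1) a l k by (intro mult_left_mono wt_antimono) auto
      finally have "norm (dpk_conv (LP_fat \<psi> j) v \<tau> t y) * norm (F (x - y)) \<le> (C * a * l ^ n * wt (\<mu> + (real n + 1)) (l *\<^sub>R y)) * norm (F (x - y))"
        by (intro mult_right_mono) auto
      also have "\<dots> = C * a * l ^ n * wt (real n + 1) (l *\<^sub>R y) * (norm (F (x - y)) * wt \<mu> (l *\<^sub>R y))"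
        unfolding wt_add by (simp only: mult_ac)
      also have "\<dots> \<le> C * a * l ^ n * wt (real n + 1) (l *\<^sub>R y) * m"
        using C(1) a l Fm[of "x - y"] by (intro mult_left_mono) (auto simp: l_def)
      finally show ?thesis by (simp only: mult_ac)
    qed
    have "ennreal (norm (convolution (dpk_conv (LP_fat \<psi> j) v \<tau> t) F x)) \<le> (\<integral>\<^sup>+y. ennreal (norm (dpk_conv (LP_fat \<psi> j) v \<tau> t (x - y)) * norm (F y)) \<partial>lborel)"
      by (rule norm_convolution_le)
    also have "\<dots> \<le> (\<integral>\<^sup>+y. ennreal (C * a * m) * wt_kernel (real n + 1) l (x - y) \<partial>lborel)"
    proof (rule nn_integral_mono)
      fix y
      have "norm (dpk_conv (LP_fat \<psi> j) v \<tau> t (x - y)) * norm (F y) \<le> C * a * m * (l ^ n * wt (real n + 1) (l *\<^sub>R (x - y)))"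
        using bound[of "x - y"] by simp
      then show "ennreal (norm (dpk_conv (LP_fat \<psi> j) v \<tau> t (x - y)) * norm (F y)) \<le> ennreal (C * a * m) * wt_kernel (real n + 1) l (x - y)"
        unfolding wt_kernel_def n_def[symmetric] using C(1) a m l by (simp add: ennreal_leI flip: ennreal_mult)
    qed
    also have "\<dots> = ennreal (C * a * m) * (\<integral>\<^sup>+y. wt_kernel (real n + 1) l (x - y) \<partial>lborel)" by (rule nn_integral_cmult) measurable
    also have "(\<integral>\<^sup>+y. wt_kernel (real n + 1) l (x - y) \<partial>lborel) = ennreal I"
      using nn_integral_lborel_reflect[of "wt_kernel (real n + 1) l" x] nn_integral_wt_kernel[OF l, where 'a='a, of "real n + 1"] by (simp add: I_def n_def)
    also have "ennreal (C * a * m) * ennreal I = ennreal (C * a * m * I)" using C(1) a m I by (simp add: ennreal_mult)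
    finally have "norm (convolution (dpk_conv (LP_fat \<psi> j) v \<tau> t) F x) \<le> C * a * m * I" using C(1) a m I by (subst (asm) ennreal_le_iff) auto
    also have "\<dots> \<le> C * (I + 1) * a * m" using C(1) a m by (simp add: algebra_simps)
    finally show "norm (convolution (dpk_conv (LP_fat \<psi> j) v \<tau> t) F x)
      \<le> C * (I + 1) * (2 powr real_of_int j * (1 + (2 powr real_of_int j * t) powr (- e)) / (1 + 2 powr real_of_int j * t) ^ 3) * m"
      unfolding a_def l_def .
  qed
qed

section \<open>Integration in the dyadic parameter\<close>

text \<open>Two-sided decay about u = 1; with u = 2^j t it measures how far the height t is from the
  scale 2^(-j).\<close>

definition tent :: "real \<Rightarrow> real \<Rightarrow> real" where
  "tent \<theta> u = min (u powr \<theta>) (u powr (- \<theta>))"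

lemma tent_nonneg [simp]: "0 \<le> tent \<theta> u" by (simp add: tent_def)

lemma tent_measurable [measurable]: "tent \<theta> \<in> borel_measurable borel"
  unfolding tent_def by measurable

lemma tent_le:
  assumes "0 < u" "0 < \<theta>"
  shows "u \<le> 1 \<Longrightarrow> tent \<theta> u = u powr \<theta>" and "1 \<le> u \<Longrightarrow> tent \<theta> u = u powr (- \<theta>)"
proof -
  show "tent \<theta> u = u powr \<theta>" if "u \<le> 1"
    using powr_mono'[of "-\<theta>" \<theta> u] assms that by (simp add: tent_def min_def)
  show "tent \<theta> u = u powr (- \<theta>)" if "1 \<le> u"
    using powr_mono[of "-\<theta>" \<theta> u] assms that by (simp add: tent_def min_def antisym)
qed

lemma tent_powr:
  assumes "0 < u" "0 < \<theta>" "0 < \<beta>"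
  shows "tent \<theta> u powr \<beta> = tent (\<theta> * \<beta>) u"
proof (cases "u \<le> 1")
  case True
  then show ?thesis using assms by (simp add: tent_le(1) powr_powr)
next
  case False
  then show ?thesis using assms by (simp add: tent_le(2) powr_powr)
qed

lemma nn_integral_tent_finite:
  assumes th: "0 < \<theta>"
  shows "(\<integral>\<^sup>+t\<in>{0<..}. ennreal (tent \<theta> t / t) \<partial>lborel) < \<infinity>"
proof -
  have i1: "((\<lambda>t. t powr (\<theta> - 1)) has_integral (1 powr (\<theta> - 1 + 1) / (\<theta> - 1 + 1))) {0..1}"
    by (rule has_integral_powr_from_0) (use th in auto)
  have i2: "((\<lambda>t. t powr (- \<theta> - 1)) has_integral (- (1 powr (- \<theta> - 1 + 1)) / (- \<theta> - 1 + 1))) {1..}"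
    by (rule has_integral_powr_to_inf) (use th in auto)
  have "(\<integral>\<^sup>+t\<in>{0<..}. ennreal (tent \<theta> t / t) \<partial>lborel)
    \<le> (\<integral>\<^sup>+t. ennreal (indicator {0..1} t * t powr (\<theta> - 1)) + ennreal (indicator {1..} t * t powr (- \<theta> - 1)) \<partial>lborel)"
  proof (rule nn_integral_mono)
    fix t :: real
    show "ennreal (tent \<theta> t / t) * indicator {0<..} t
      \<le> ennreal (indicator {0..1} t * t powr (\<theta> - 1)) + ennreal (indicator {1..} t * t powr (- \<theta> - 1))"
    proof (cases "0 < t")
      case True
      show ?thesis
      proof (cases "t \<le> 1")
        case le: True
        then have "tent \<theta> t / t = t powr (\<theta> - 1)" using tent_le(1)[OF True th le] True by (simp add: powr_diff)
        then show ?thesis using True le by simp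
      next
        case False
        then have "tent \<theta> t / t = t powr (- \<theta> - 1)" using tent_le(2)[OF True th] True by (simp add: powr_diff)
        then show ?thesis using True False by simp
      qed
    qed simp
  qed
  also have "\<dots> = (\<integral>\<^sup>+t. ennreal (indicator {0..1} t * t powr (\<theta> - 1)) \<partial>lborel) + (\<integral>\<^sup>+t. ennreal (indicator {1..} t * t powr (- \<theta> - 1)) \<partial>lborel)"
    by (rule nn_integral_add) measurable
  also have "\<dots> < \<infinity>"
    using nn_integral_has_integral_lebesgue[OF _ i1] nn_integral_has_integral_lebesgue[OF _ i2]
    by (simp add: nn_integral_completion)
  finally show ?thesis .
qed

text \<open>Invariance of dt/t under dilations.\<close>

lemma nn_integral_tent_scale:
  assumes l: "0 < l"
  shows "(\<integral>\<^sup>+t\<in>{0<..}. ennreal (tent \<theta> (l * t) / t) \<partial>lborel) = (\<integral>\<^sup>+t\<in>{0<..}. ennreal (tent \<theta> t / t) \<partial>lborel)"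
proof -
  have "(\<integral>\<^sup>+t\<in>{0<..}. ennreal (tent \<theta> t / t) \<partial>lborel)
    = ennreal \<bar>l\<bar> * (\<integral>\<^sup>+t. ennreal (tent \<theta> (0 + l * t) / (0 + l * t)) * indicator {0<..} (0 + l * t) \<partial>lborel)"
    by (rule nn_integral_real_affine) (use l in auto)
  also have "\<dots> = (\<integral>\<^sup>+t. ennreal l * (ennreal (tent \<theta> (l * t) / (l * t)) * indicator {0<..} (l * t)) \<partial>lborel)"
    using l by (subst nn_integral_cmult) auto
  also have "\<dots> = (\<integral>\<^sup>+t\<in>{0<..}. ennreal (tent \<theta> (l * t) / t) \<partial>lborel)"
  proof (rule nn_integral_cong)
    fix t :: real
    show "ennreal l * (ennreal (tent \<theta> (l * t) / (l * t)) * indicator {0<..} (l * t)) = ennreal (tent \<theta> (l * t) / t) * indicator {0<..} t"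
    proof (cases "0 < t")
      case True
      have "l * (tent \<theta> (l * t) / (l * t)) = tent \<theta> (l * t) / t" using l True by simp
      then show ?thesis using l True by (simp add: ennreal_mult[symmetric])
    qed (use l in \<open>simp add: zero_less_mult_iff indicator_def\<close>)
  qed
  finally show ?thesis ..
qed

lemma nn_integral_swap_int:
  fixes F :: "int \<Rightarrow> real \<Rightarrow> ennreal"
  assumes [measurable]: "\<And>j. F j \<in> borel_measurable borel"
  shows "(\<integral>\<^sup>+t. \<integral>\<^sup>+j. F j t \<partial>count_space UNIV \<partial>lborel) = (\<integral>\<^sup>+j. \<integral>\<^sup>+t. F j t \<partial>lborel \<partial>count_space UNIV)"
proof -
  have "(\<integral>\<^sup>+t. \<integral>\<^sup>+j. F j t \<partial>count_space UNIV \<partial>lborel) = (SUP L. \<integral>\<^sup>+t. (\<Sum>j\<in>{- int L..int L}. F j t) \<partial>lborel)"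
    unfolding nn_integral_count_space_int_SUP
    by (rule nn_integral_monotone_convergence_SUP) (auto simp: incseq_def le_fun_def intro!: sum_mono2)
  also have "\<dots> = (\<integral>\<^sup>+j. \<integral>\<^sup>+t. F j t \<partial>lborel \<partial>count_space UNIV)"
    unfolding nn_integral_count_space_int_SUP by (simp add: nn_integral_sum)
  finally show ?thesis .
qed

lemma sum_tent_bounded:
  assumes th: "0 < \<theta>"
  obtains C where "0 < C" "\<And>t. 0 < t \<Longrightarrow> (\<integral>\<^sup>+j. ennreal (tent \<theta> (2 powr real_of_int j * t)) \<partial>count_space UNIV) \<le> ennreal C"
proof -
  define b where "b = (2::real) powr (- \<theta>)"
  have b: "0 < b" "b < 1" using th by (auto simp: b_def powr_less_one)
  have sb: "summable (\<lambda>i. b ^ i)" using b by (intro summable_geometric) auto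
  define E where "E = (\<Sum>i. b ^ i)"
  have E: "0 < E" unfolding E_def using b by (intro suminf_pos sb) auto
  show ?thesis
  proof (rule that[of "2 powr \<theta> * (2 * E)"])
    show "0 < 2 powr \<theta> * (2 * E)" using E by simp
    fix t :: real assume t: "0 < t"
    \<comment> \<open>With 2^i \<le> t < 2^(i+1) the product 2^j t is comparable to 2^(i+j), so the
      terms decay geometrically in |i + j|; the factor 2^\<theta> absorbs the rounding.\<close>
    define i where "i = \<lfloor>log 2 t\<rfloor>"
    have ti: "2 powr real_of_int i \<le> t" "t < 2 powr (real_of_int i + 1)"
      using t unfolding i_def by (simp_all add: le_log_iff[symmetric] log_less_iff[symmetric])
    have h: "tent \<theta> (2 powr real_of_int j * t) \<le> 2 powr \<theta> * b ^ nat \<bar>i + j\<bar>" for j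
    proof (cases "0 \<le> i + j")
      case True
      have "tent \<theta> (2 powr real_of_int j * t) \<le> (2 powr real_of_int j * t) powr (- \<theta>)" by (simp add: tent_def)
      also have "\<dots> \<le> (2 powr real_of_int j * 2 powr real_of_int i) powr (- \<theta>)"
        using ti th by (intro powr_mono2') auto
      also have "\<dots> = b ^ nat \<bar>i + j\<bar>"
        using True by (simp add: b_def powr_add[symmetric] powr_powr powr_realpow[symmetric] algebra_simps)
      also have "\<dots> \<le> 2 powr \<theta> * b ^ nat \<bar>i + j\<bar>" using th b ge_one_powr_ge_zero[of 2 \<theta>] by simp
      finally show ?thesis .
    next
      case False
      have "tent \<theta> (2 powr real_of_int j * t) \<le> (2 powr real_of_int j * t) powr \<theta>" by (simp add: tent_def)
      also have "\<dots> \<le> (2 powr real_of_int j * 2 powr (real_of_int i + 1)) powr \<theta>"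
        using ti th t by (intro powr_mono2) auto
      also have "\<dots> = 2 powr \<theta> * b ^ nat \<bar>i + j\<bar>"
        using False by (simp add: b_def powr_add[symmetric] powr_powr powr_realpow[symmetric] algebra_simps)
      finally show ?thesis .
    qed
    have g: "(\<Sum>k\<in>{- int L..int L}. b ^ nat \<bar>k\<bar>) \<le> 2 * E" for L
    proof -
      have "(\<Sum>k\<in>{- int L..int L}. b ^ nat \<bar>k\<bar>) = (\<Sum>i<Suc L. if i = 0 then b ^ nat \<bar>0\<bar> else b ^ nat \<bar>int i\<bar> + b ^ nat \<bar>- int i\<bar>)"
        by (rule sum_int_split[symmetric])
      also have "\<dots> \<le> (\<Sum>i<Suc L. 2 * b ^ i)" using b by (intro sum_mono) auto
      also have "\<dots> \<le> 2 * E"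
        unfolding E_def sum_distrib_left[symmetric] using b by (intro mult_left_mono sum_le_suminf sb) auto
      finally show ?thesis .
    qed
    have "(\<integral>\<^sup>+j. ennreal (tent \<theta> (2 powr real_of_int j * t)) \<partial>count_space UNIV) \<le> (\<integral>\<^sup>+j. ennreal (2 powr \<theta> * b ^ nat \<bar>i + j\<bar>) \<partial>count_space UNIV)"
      by (intro nn_integral_mono ennreal_leI h)
    also have "\<dots> = (\<integral>\<^sup>+k. ennreal (2 powr \<theta> * b ^ nat \<bar>k\<bar>) \<partial>count_space UNIV)"
      by (rule nn_integral_bij_count_space[of "\<lambda>j. i + j"]) (auto intro!: bij_betwI[where g = "\<lambda>k. k - i"])
    also have "\<dots> \<le> ennreal (2 powr \<theta> * (2 * E))"
      unfolding nn_integral_count_space_int_SUP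
    proof (rule SUP_least)
      fix L
      have "(\<Sum>k\<in>{- int L..int L}. ennreal (2 powr \<theta> * b ^ nat \<bar>k\<bar>)) = ennreal (2 powr \<theta> * (\<Sum>k\<in>{- int L..int L}. b ^ nat \<bar>k\<bar>))"
        using b by (simp add: sum_distrib_left)
      also have "\<dots> \<le> ennreal (2 powr \<theta> * (2 * E))" by (intro ennreal_leI mult_left_mono g) auto
      finally show "(\<Sum>k\<in>{- int L..int L}. ennreal (2 powr \<theta> * b ^ nat \<bar>k\<bar>)) \<le> ennreal (2 powr \<theta> * (2 * E))" .
    qed
    finally show "(\<integral>\<^sup>+j. ennreal (tent \<theta> (2 powr real_of_int j * t)) \<partial>count_space UNIV) \<le> ennreal (2 powr \<theta> * (2 * E))" .
  qed
qed

lemma epowr_count_space_le: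
  fixes f :: "int \<Rightarrow> ennreal"
  assumes "0 < r" "r \<le> 1"
  shows "epowr (\<integral>\<^sup>+j. f j \<partial>count_space UNIV) r \<le> (\<integral>\<^sup>+j. epowr (f j) r \<partial>count_space UNIV)"
  unfolding nn_integral_count_space_int_SUP epowr_SUP[OF assms(1)]
proof (rule SUP_mono)
  fix L :: nat
  show "\<exists>M\<in>UNIV. epowr (\<Sum>i\<in>{- int L..int L}. f i) r \<le> (\<Sum>i\<in>{- int M..int M}. epowr (f i) r)"
    by (intro bexI[of _ L] epowr_sum_le assms) auto
qed

text \<open>For q \<ge> 1 this is Jensen's inequality for weights whose sum over j is bounded
  uniformly in t; for q < 1 it is subadditivity of the q-th power, at the cost of the smaller
  exponent \<theta> q.\<close>

lemma tent_convolution: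
  assumes th: "0 < \<theta>" and q: "0 < q"
  obtains C \<theta>' where "0 < C" "0 < \<theta>'" "\<And>t (c :: int \<Rightarrow> ennreal). 0 < t \<Longrightarrow>
    epowr (\<integral>\<^sup>+j. ennreal (tent \<theta> (2 powr real_of_int j * t)) * c j \<partial>count_space UNIV) q
     \<le> ennreal C * (\<integral>\<^sup>+j. ennreal (tent \<theta>' (2 powr real_of_int j * t)) * epowr (c j) q \<partial>count_space UNIV)"
proof (cases "1 \<le> q")
  case True
  obtain C where C: "0 < C" "\<And>t. 0 < t \<Longrightarrow> (\<integral>\<^sup>+j. ennreal (tent \<theta> (2 powr real_of_int j * t)) \<partial>count_space UNIV) \<le> ennreal C"
    by (rule sum_tent_bounded[OF th]) blast
  show ?thesis
  proof (rule that[of "C powr (q - 1)" \<theta>])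
    fix t :: real and c :: "int \<Rightarrow> ennreal" assume t: "0 < t"
    show "epowr (\<integral>\<^sup>+j. ennreal (tent \<theta> (2 powr real_of_int j * t)) * c j \<partial>count_space UNIV) q
     \<le> ennreal (C powr (q - 1)) * (\<integral>\<^sup>+j. ennreal (tent \<theta> (2 powr real_of_int j * t)) * epowr (c j) q \<partial>count_space UNIV)"
      by (rule ennreal_Jensen_weight[OF True _ _ C(2)[OF t] C(1)]) auto
  qed (use C th in auto)
next
  case False
  show ?thesis
  proof (rule that[of 1 "\<theta> * q"])
    fix t :: real and c :: "int \<Rightarrow> ennreal" assume t: "0 < t"
    have "epowr (\<integral>\<^sup>+j. ennreal (tent \<theta> (2 powr real_of_int j * t)) * c j \<partial>count_space UNIV) q
      \<le> (\<integral>\<^sup>+j. epowr (ennreal (tent \<theta> (2 powr real_of_int j * t)) * c j) q \<partial>count_space UNIV)"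
      using False q by (intro epowr_count_space_le) auto
    also have "\<dots> = (\<integral>\<^sup>+j. ennreal (tent (\<theta> * q) (2 powr real_of_int j * t)) * epowr (c j) q \<partial>count_space UNIV)"
      using t q th by (simp add: epowr_mult epowr_ennreal tent_powr)
    finally show "epowr (\<integral>\<^sup>+j. ennreal (tent \<theta> (2 powr real_of_int j * t)) * c j \<partial>count_space UNIV) q
     \<le> ennreal 1 * (\<integral>\<^sup>+j. ennreal (tent (\<theta> * q) (2 powr real_of_int j * t)) * epowr (c j) q \<partial>count_space UNIV)" by simp
  qed (use th q in auto)
qed

text \<open>Once the q-th power stands inside the sum, the integral of each tent over dt/t is the
  same finite constant by dilation invariance.\<close>

lemma tent_square_function:
  assumes th: "0 < \<theta>" and q: "0 < q"
  obtains C where "0 < C" "\<And>c :: int \<Rightarrow> ennreal.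
    (\<integral>\<^sup>+t\<in>{0<..}. ennreal (1 / t) * epowr (\<integral>\<^sup>+j. ennreal (tent \<theta> (2 powr real_of_int j * t)) * c j \<partial>count_space UNIV) q \<partial>lborel)
     \<le> ennreal C * (\<integral>\<^sup>+j. epowr (c j) q \<partial>count_space UNIV)"
proof -
  obtain C th' where C: "0 < C" "0 < th'" "\<And>t (c :: int \<Rightarrow> ennreal). 0 < t \<Longrightarrow>
    epowr (\<integral>\<^sup>+j. ennreal (tent \<theta> (2 powr real_of_int j * t)) * c j \<partial>count_space UNIV) q
     \<le> ennreal C * (\<integral>\<^sup>+j. ennreal (tent th' (2 powr real_of_int j * t)) * epowr (c j) q \<partial>count_space UNIV)"
    by (rule tent_convolution[OF th q]) blast
  obtain D where D: "0 \<le> D" "(\<integral>\<^sup>+t\<in>{0<..}. ennreal (tent th' t / t) \<partial>lborel) = ennreal D"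
    using nn_integral_tent_finite[OF C(2)] by (cases "\<integral>\<^sup>+t\<in>{0<..}. ennreal (tent th' t / t) \<partial>lborel") auto
  show ?thesis
  proof (rule that[of "C * (D + 1)"])
    show "0 < C * (D + 1)" using C(1) D(1) by simp
    fix c :: "int \<Rightarrow> ennreal"
    have "(\<integral>\<^sup>+t\<in>{0<..}. ennreal (1 / t) * epowr (\<integral>\<^sup>+j. ennreal (tent \<theta> (2 powr real_of_int j * t)) * c j \<partial>count_space UNIV) q \<partial>lborel)
      \<le> (\<integral>\<^sup>+t. \<integral>\<^sup>+j. ennreal C * epowr (c j) q * (ennreal (tent th' (2 powr real_of_int j * t) / t) * indicator {0<..} t) \<partial>count_space UNIV \<partial>lborel)"
    proof (rule nn_integral_mono)
      fix t :: real
      show "ennreal (1 / t) * epowr (\<integral>\<^sup>+j. ennreal (tent \<theta> (2 powr real_of_int j * t)) * c j \<partial>count_space UNIV) q * indicator {0<..} t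
        \<le> (\<integral>\<^sup>+j. ennreal C * epowr (c j) q * (ennreal (tent th' (2 powr real_of_int j * t) / t) * indicator {0<..} t) \<partial>count_space UNIV)"
      proof (cases "0 < t")
        case True
        have "ennreal (1 / t) * epowr (\<integral>\<^sup>+j. ennreal (tent \<theta> (2 powr real_of_int j * t)) * c j \<partial>count_space UNIV) q
          \<le> ennreal (1 / t) * (ennreal C * (\<integral>\<^sup>+j. ennreal (tent th' (2 powr real_of_int j * t)) * epowr (c j) q \<partial>count_space UNIV))"
          by (intro mult_left_mono C(3) True) auto
        also have "\<dots> = (\<integral>\<^sup>+j. ennreal (1 / t) * (ennreal C * (ennreal (tent th' (2 powr real_of_int j * t)) * epowr (c j) q)) \<partial>count_space UNIV)"
          by (simp add: nn_integral_cmult)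
        also have "\<dots> = (\<integral>\<^sup>+j. ennreal C * epowr (c j) q * ennreal (tent th' (2 powr real_of_int j * t) / t) \<partial>count_space UNIV)"
        proof (rule nn_integral_cong)
          fix j
          have "ennreal (tent th' (2 powr real_of_int j * t) / t) = ennreal (1 / t) * ennreal (tent th' (2 powr real_of_int j * t))"
            using True by (subst ennreal_mult[symmetric]) auto
          then show "ennreal (1 / t) * (ennreal C * (ennreal (tent th' (2 powr real_of_int j * t)) * epowr (c j) q))
            = ennreal C * epowr (c j) q * ennreal (tent th' (2 powr real_of_int j * t) / t)" by (simp only: mult_ac)
        qed
        finally show ?thesis using True by simp
      qed simp
    qed
    also have "\<dots> = (\<integral>\<^sup>+j. \<integral>\<^sup>+t. ennreal C * epowr (c j) q * (ennreal (tent th' (2 powr real_of_int j * t) / t) * indicator {0<..} t) \<partial>lborel \<partial>count_space UNIV)"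
      by (rule nn_integral_swap_int) measurable
    also have "\<dots> = (\<integral>\<^sup>+j. ennreal C * epowr (c j) q * ennreal D \<partial>count_space UNIV)"
      by (subst nn_integral_cmult) (auto simp: nn_integral_tent_scale D(2))
    also have "\<dots> = (\<integral>\<^sup>+j. ennreal (C * D) * epowr (c j) q \<partial>count_space UNIV)"
      using C(1) D(1) by (simp add: ennreal_mult mult_ac)
    also have "\<dots> = ennreal (C * D) * (\<integral>\<^sup>+j. epowr (c j) q \<partial>count_space UNIV)"
      by (rule nn_integral_cmult) simp
    also have "\<dots> \<le> ennreal (C * (D + 1)) * (\<integral>\<^sup>+j. epowr (c j) q \<partial>count_space UNIV)"
      using C(1) by (intro mult_right_mono ennreal_leI) auto
    finally show "(\<integral>\<^sup>+t\<in>{0<..}. ennreal (1 / t) * epowr (\<integral>\<^sup>+j. ennreal (tent \<theta> (2 powr real_of_int j * t)) * c j \<partial>count_space UNIV) q \<partial>lborel)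
     \<le> ennreal (C * (D + 1)) * (\<integral>\<^sup>+j. epowr (c j) q \<partial>count_space UNIV)" .
  qed
qed

text \<open>With e = (1 - s)/4 the left side behaves like u^(3 e) near 0 and like u^(4 e - 3) at
  infinity. The former is at most u^(2 e) for u \<le> 1; the latter is at most u^(-2 e) for u \<ge>
  1 because e < 1/2, that is, s > -1.\<close>

lemma tent_dominates:
  assumes s: "\<bar>s\<bar> < 1" and u: "0 < u"
  shows "u powr (1 - s) * ((1 + u powr (- ((1 - s) / 4))) / (1 + u) ^ 3) \<le> 2 * tent ((1 - s) / 2) u"
proof -
  define e where "e = (1 - s) / 4"
  have e: "0 < e" "e < 1/2" using s by (auto simp: e_def)
  have th: "(1 - s) / 4 = e" "(1 - s) / 2 = 2 * e" "1 - s = 4 * e" by (auto simp: e_def)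
  show ?thesis
  proof (cases "u \<le> 1")
    case True
    have "1 \<le> u powr (- e)" using powr_mono2'[of "-e" u 1] u True e by simp
    moreover have "1 \<le> (1 + u) ^ 3" using u by (intro one_le_power) auto
    then have "(1 + u powr (- e)) / (1 + u) ^ 3 \<le> (1 + u powr (- e)) / 1"
      using u by (intro divide_left_mono) (auto intro!: add_nonneg_nonneg)
    ultimately have "(1 + u powr (- e)) / (1 + u) ^ 3 \<le> 2 * u powr (- e)" by simp
    then have "u powr (4 * e) * ((1 + u powr (- e)) / (1 + u) ^ 3) \<le> u powr (4 * e) * (2 * u powr (- e))"
      by (intro mult_left_mono) auto
    also have "\<dots> = 2 * u powr (3 * e)" by (simp add: powr_add[symmetric])
    also have "\<dots> \<le> 2 * u powr (2 * e)" using u True e by (intro mult_left_mono powr_mono') auto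
    also have "u powr (2 * e) = tent (2 * e) u" using tent_le(1)[of u "2 * e"] u True e by simp
    finally show ?thesis unfolding th(1,2) unfolding th(3) .
  next
    case False
    have "u powr (- e) \<le> 1" using powr_mono2'[of "-e" 1 u] u False e by simp
    moreover have "u ^ 3 \<le> (1 + u) ^ 3" using u by (intro power_mono) auto
    ultimately have "(1 + u powr (- e)) / (1 + u) ^ 3 \<le> 2 / u ^ 3" using u by (intro frac_le) auto
    then have "u powr (4 * e) * ((1 + u powr (- e)) / (1 + u) ^ 3) \<le> u powr (4 * e) * (2 / u ^ 3)"
      by (intro mult_left_mono) auto
    also have "\<dots> = 2 * u powr (4 * e - 3)" using u by (simp add: powr_diff)
    also have "\<dots> \<le> 2 * u powr (- (2 * e))" using u False e by (intro mult_left_mono powr_mono) auto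
    also have "u powr (- (2 * e)) = tent (2 * e) u" using tent_le(2)[of u "2 * e"] u False e by simp
    finally show ?thesis unfolding th(1,2) unfolding th(3) .
  qed
qed

section \<open>The Littlewood-Paley-Poisson function\<close>

text \<open>For slow f each vector derivative in the definition is a genuine one, given by
  integration against \<open>dpk\<close>; the Euclidean norm is at most the sum of the
  components.\<close>

lemma poisson_grad_norm_le:
  fixes f :: "'a::euclidean_space \<Rightarrow> complex"
  assumes f: "slow f" and t: "0 < t"
  shows "poisson_grad_norm f x t \<le> (\<Sum>b\<in>Basis. norm (\<integral>y. f y * of_real (dpk b 0 t (x - y)) \<partial>lborel))
    + norm (\<integral>y. f y * of_real (dpk 0 1 t (x - y)) \<partial>lborel)"
proof -
  define D where "D b = norm (\<integral>y. f y * of_real (dpk b 0 t (x - y)) \<partial>lborel)" for b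
  define E where "E = norm (\<integral>y. f y * of_real (dpk 0 1 t (x - y)) \<partial>lborel)"
  have 1: "vector_derivative (\<lambda>h. poisson_integral f (x + h *\<^sub>R b) t) (at 0) = (\<integral>y. f y * of_real (dpk b 0 t (x - y)) \<partial>lborel)" for b
    using poisson_integral_deriv[OF f t, of x b 0] by (intro vector_derivative_at) simp
  have 2: "vector_derivative (\<lambda>h. poisson_integral f x (t + h)) (at 0) = (\<integral>y. f y * of_real (dpk 0 1 t (x - y)) \<partial>lborel)"
    using poisson_integral_deriv[OF f t, of x 0 1] by (intro vector_derivative_at) simp
  have "poisson_grad_norm f x t = sqrt ((\<Sum>b\<in>Basis. (D b)\<^sup>2) + E\<^sup>2)"
    unfolding poisson_grad_norm_def 1 2 D_def E_def ..
  also have "\<dots> \<le> sqrt (((\<Sum>b\<in>Basis. D b) + E)\<^sup>2)"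
  proof (rule real_sqrt_le_mono)
    have D0: "0 \<le> D b" for b by (simp add: D_def)
    have E0: "0 \<le> E" by (simp add: E_def)
    have S0: "0 \<le> (\<Sum>b\<in>(Basis :: 'a set). D b)" using D0 by (intro sum_nonneg)
    have "(\<Sum>b\<in>Basis. (D b)\<^sup>2) \<le> (\<Sum>b\<in>Basis. D b * (\<Sum>b\<in>Basis. D b))"
      unfolding power2_eq_square by (intro sum_mono mult_left_mono member_le_sum D0) auto
    also have "\<dots> = (\<Sum>b\<in>Basis. D b)\<^sup>2" by (simp add: power2_eq_square sum_distrib_right)
    finally show "(\<Sum>b\<in>Basis. (D b)\<^sup>2) + E\<^sup>2 \<le> ((\<Sum>b\<in>Basis. D b) + E)\<^sup>2"
      using mult_nonneg_nonneg[OF S0 E0] by (simp add: power2_sum)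
  qed
  also have "\<dots> = (\<Sum>b\<in>Basis. D b) + E"
    by (simp add: D_def E_def sum_nonneg add_nonneg_nonneg)
  finally show ?thesis unfolding D_def E_def .
qed

lemma poisson_grad_dyadic_bound:
  fixes \<psi> :: "'a::euclidean_space \<Rightarrow> complex"
  assumes \<psi>: "LP_admissible \<psi>" and e: "0 < e" and lam: "0 \<le> \<mu>"
  obtains C where "0 < C" "\<And>f x m t. slow f \<Longrightarrow> 0 < t \<Longrightarrow> (\<And>j. 0 \<le> m j) \<Longrightarrow>
    (\<And>j z. norm (convolution (psi_dil \<psi> j) f z) * wt \<mu> ((2 powr real_of_int j) *\<^sub>R (x - z)) \<le> m j) \<Longrightarrow>
    ennreal (poisson_grad_norm f x t) \<le> ennreal C * (\<integral>\<^sup>+j. ennreal (2 powr real_of_int j * ((1 + (2 powr real_of_int j * t) powr (- e)) / (1 + 2 powr real_of_int j * t) ^ 3) * m j) \<partial>count_space UNIV)"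
proof -
  define a where "a j t = 2 powr real_of_int j * ((1 + (2 powr real_of_int j * t) powr (- e)) / (1 + 2 powr real_of_int j * t) ^ 3)" for j t
  \<comment> \<open>The bound for one direction (v, \<tau>) as a predicate of its constant, so that
    constants can be chosen for all basis vectors and for the t-direction and then added.\<close>
  define bd where "bd v \<tau> C \<longleftrightarrow> (\<forall>f x m t. slow f \<longrightarrow> 0 < t \<longrightarrow> (\<forall>j. 0 \<le> m j) \<longrightarrow>
    (\<forall>j z. norm (convolution (psi_dil \<psi> j) f z) * wt \<mu> ((2 powr real_of_int j) *\<^sub>R (x - z)) \<le> m j) \<longrightarrow>
    ennreal (norm (\<integral>y. f y * of_real (dpk v \<tau> t (x - y)) \<partial>lborel)) \<le> ennreal C * (\<integral>\<^sup>+j. ennreal (a j t * m j) \<partial>count_space UNIV))" for v :: 'a and \<tau> C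
  have bdD: "ennreal (norm (\<integral>y. f y * of_real (dpk v \<tau> t (x - y)) \<partial>lborel)) \<le> ennreal C * (\<integral>\<^sup>+j. ennreal (a j t * m j) \<partial>count_space UNIV)"
    if "bd v \<tau> C" "slow f" "0 < t" "\<And>j. 0 \<le> m j"
      "\<And>j z. norm (convolution (psi_dil \<psi> j) f z) * wt \<mu> ((2 powr real_of_int j) *\<^sub>R (x - z)) \<le> m j" for v \<tau> C f t m x
    using that unfolding bd_def by simp
  have one: "\<exists>C. 0 < C \<and> bd v \<tau> C" for v :: 'a and \<tau>
  proof -
    obtain C where C: "0 < C" "\<And>F j (x::'a) m t. F \<in> borel_measurable borel \<Longrightarrow> 0 < t \<Longrightarrow> 0 \<le> m \<Longrightarrow>
      (\<And>z. norm (F z) * wt \<mu> ((2 powr real_of_int j) *\<^sub>R (x - z)) \<le> m) \<Longrightarrow>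
      norm (convolution (dpk_conv (LP_fat \<psi> j) v \<tau> t) F x)
      \<le> C * (2 powr real_of_int j * (1 + (2 powr real_of_int j * t) powr (- e)) / (1 + 2 powr real_of_int j * t) ^ 3) * m"
      by (rule kernel_times_Peetre[OF \<psi> e lam, of v \<tau>]) blast
    show ?thesis unfolding bd_def
    proof (intro exI[of _ C] conjI allI impI C(1))
      fix f :: "'a \<Rightarrow> complex" and x :: 'a and m :: "int \<Rightarrow> real" and t :: real assume f: "slow f" and t: "0 < t" and m: "\<forall>j. 0 \<le> m j"
        and fm: "\<forall>j z. norm (convolution (psi_dil \<psi> j) f z) * wt \<mu> ((2 powr real_of_int j) *\<^sub>R (x - z)) \<le> m j"
      have [measurable]: "f \<in> borel_measurable borel" using f by (simp add: slow_def)
      have "ennreal (norm (\<integral>y. f y * of_real (dpk v \<tau> t (x - y)) \<partial>lborel))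
        \<le> (\<integral>\<^sup>+j. ennreal (norm (convolution (dpk_conv (LP_fat \<psi> j) v \<tau> t) (convolution (psi_dil \<psi> j) f) x)) \<partial>count_space UNIV)"
        by (rule slow_reproducing[OF \<psi> f t])
      also have "\<dots> \<le> (\<integral>\<^sup>+j. ennreal C * ennreal (a j t * m j) \<partial>count_space UNIV)"
      proof (rule nn_integral_mono)
        fix j
        have [measurable]: "psi_dil \<psi> j \<in> borel_measurable borel" by (rule vanishing_C1_measurable[OF vanishing_C1_psi_dil[OF \<psi>]])
        have "norm (convolution (dpk_conv (LP_fat \<psi> j) v \<tau> t) (convolution (psi_dil \<psi> j) f) x)
          \<le> C * (2 powr real_of_int j * (1 + (2 powr real_of_int j * t) powr (- e)) / (1 + 2 powr real_of_int j * t) ^ 3) * m j"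
          by (rule C(2)) (use t m fm in auto)
        also have "\<dots> = C * (a j t * m j)" by (simp add: a_def)
        finally show "ennreal (norm (convolution (dpk_conv (LP_fat \<psi> j) v \<tau> t) (convolution (psi_dil \<psi> j) f) x)) \<le> ennreal C * ennreal (a j t * m j)"
          using C(1) by (simp add: ennreal_leI flip: ennreal_mult')
      qed
      also have "\<dots> = ennreal C * (\<integral>\<^sup>+j. ennreal (a j t * m j) \<partial>count_space UNIV)" by (rule nn_integral_cmult) simp
      finally show "ennreal (norm (\<integral>y. f y * of_real (dpk v \<tau> t (x - y)) \<partial>lborel)) \<le> ennreal C * (\<integral>\<^sup>+j. ennreal (a j t * m j) \<partial>count_space UNIV)" .
    qed
  qed
  have "\<exists>Cb. \<forall>b. 0 < Cb b \<and> bd b 0 (Cb b)" by (intro choice allI one)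
  then obtain Cb where Cb: "\<And>b. 0 < Cb b" "\<And>b. bd b 0 (Cb b)" by blast
  obtain C1 where C1: "0 < C1" "bd 0 1 C1" using one[of 0 1] by blast
  define D where "D = (\<Sum>b\<in>Basis. Cb b) + C1"
  have S: "0 \<le> (\<Sum>b\<in>Basis. Cb b)" using Cb(1) by (intro sum_nonneg) (auto intro: less_imp_le)
  show ?thesis
  proof (rule that[of D])
    show "0 < D" using S C1(1) by (simp add: D_def)
    fix f :: "'a \<Rightarrow> complex" and x :: 'a and m :: "int \<Rightarrow> real" and t :: real assume *: "slow f" "0 < t" "\<And>j. 0 \<le> m j"
      "\<And>j z. norm (convolution (psi_dil \<psi> j) f z) * wt \<mu> ((2 powr real_of_int j) *\<^sub>R (x - z)) \<le> m j"
    define I where "I = (\<integral>\<^sup>+j. ennreal (a j t * m j) \<partial>count_space UNIV)"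
    have "ennreal (poisson_grad_norm f x t) \<le> ennreal ((\<Sum>b\<in>Basis. norm (\<integral>y. f y * of_real (dpk b 0 t (x - y)) \<partial>lborel))
      + norm (\<integral>y. f y * of_real (dpk 0 1 t (x - y)) \<partial>lborel))"
      by (intro ennreal_leI poisson_grad_norm_le *)
    also have "\<dots> = (\<Sum>b\<in>Basis. ennreal (norm (\<integral>y. f y * of_real (dpk b 0 t (x - y)) \<partial>lborel)))
      + ennreal (norm (\<integral>y. f y * of_real (dpk 0 1 t (x - y)) \<partial>lborel))"
      by (simp add: sum_nonneg)
    also have "\<dots> \<le> (\<Sum>b\<in>Basis. ennreal (Cb b) * I) + ennreal C1 * I"
      unfolding I_def by (intro add_mono sum_mono bdD[OF Cb(2)] bdD[OF C1(2)] *)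
    also have "\<dots> = ennreal D * I"
    proof -
      have "ennreal D = (\<Sum>b\<in>Basis. ennreal (Cb b)) + ennreal C1"
        unfolding D_def using Cb(1) S C1(1) by (subst ennreal_plus) (auto simp: less_imp_le)
      then show ?thesis by (simp add: distrib_right sum_distrib_right)
    qed
    finally show "ennreal (poisson_grad_norm f x t) \<le> ennreal D * (\<integral>\<^sup>+j. ennreal (2 powr real_of_int j * ((1 + (2 powr real_of_int j * t) powr (- e)) / (1 + 2 powr real_of_int j * t) ^ 3) * m j) \<partial>count_space UNIV)"
      unfolding I_def a_def .
  qed
qed

lemma poisson_grad_nonneg: "0 \<le> poisson_grad_norm f x t"
  by (simp add: poisson_grad_norm_def sum_nonneg add_nonneg_nonneg)

text \<open>The factor t^(1-s) from the definition combines with 2^j to (2^j t)^(1-s) 2^(j s): the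
  first part joins the kernel bound and is dominated by \<open>tent\<close>, the second is the
  weight of the Triebel-Lizorkin norm.\<close>

lemma g_function_pointwise:
  fixes \<psi> :: "'a::euclidean_space \<Rightarrow> complex"
  assumes \<psi>: "LP_admissible \<psi>" and q: "0 < q" and s: "\<bar>s\<bar> < 1" and lam: "0 \<le> \<mu>"
  obtains C where "0 < C" "\<And>f x m. slow f \<Longrightarrow> (\<And>j. 0 \<le> m j) \<Longrightarrow>
    (\<And>j z. norm (convolution (psi_dil \<psi> j) f z) * wt \<mu> ((2 powr real_of_int j) *\<^sub>R (x - z)) \<le> m j) \<Longrightarrow>
    epowr (g_function s q f x) q \<le> ennreal C * (\<integral>\<^sup>+j. ennreal ((2 powr (real_of_int j * s) * m j) powr q) \<partial>count_space UNIV)"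
proof -
  define e where "e = (1 - s) / 4"
  define th where "th = (1 - s) / 2"
  have e: "0 < e" "0 < th" using s by (auto simp: e_def th_def)
  obtain C where C: "0 < C" "\<And>f x m t. slow f \<Longrightarrow> 0 < t \<Longrightarrow> (\<And>j. 0 \<le> m j) \<Longrightarrow>
    (\<And>j z. norm (convolution (psi_dil \<psi> j) f z) * wt \<mu> ((2 powr real_of_int j) *\<^sub>R (x - z)) \<le> m j) \<Longrightarrow>
    ennreal (poisson_grad_norm f x t) \<le> ennreal C * (\<integral>\<^sup>+j. ennreal (2 powr real_of_int j * ((1 + (2 powr real_of_int j * t) powr (- e)) / (1 + 2 powr real_of_int j * t) ^ 3) * m j) \<partial>count_space UNIV)"
    by (rule poisson_grad_dyadic_bound[OF \<psi> e(1) lam]) blast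
  obtain D where D: "0 < D" "\<And>c :: int \<Rightarrow> ennreal.
    (\<integral>\<^sup>+t\<in>{0<..}. ennreal (1 / t) * epowr (\<integral>\<^sup>+j. ennreal (tent th (2 powr real_of_int j * t)) * c j \<partial>count_space UNIV) q \<partial>lborel)
     \<le> ennreal D * (\<integral>\<^sup>+j. epowr (c j) q \<partial>count_space UNIV)"
    by (rule tent_square_function[OF e(2) q]) blast
  show ?thesis
  proof (rule that[of "(2 * C) powr q * D"])
    show "0 < (2 * C) powr q * D" using C(1) D(1) by simp
    fix f :: "'a \<Rightarrow> complex" and x :: 'a and m :: "int \<Rightarrow> real" assume f: "slow f" and m: "\<And>j. 0 \<le> m j"
      and fm: "\<And>j z. norm (convolution (psi_dil \<psi> j) f z) * wt \<mu> ((2 powr real_of_int j) *\<^sub>R (x - z)) \<le> m j"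
    define c where "c j = ennreal (2 powr (real_of_int j * s) * m j)" for j
    have key: "ennreal (t powr (q - s * q - 1) * poisson_grad_norm f x t powr q)
      \<le> ennreal ((2 * C) powr q) * (ennreal (1 / t) * epowr (\<integral>\<^sup>+j. ennreal (tent th (2 powr real_of_int j * t)) * c j \<partial>count_space UNIV) q)"
      if t: "0 < t" for t
    proof -
      have "t powr (q - s * q - 1) * poisson_grad_norm f x t powr q = 1 / t * (t powr (1 - s) * poisson_grad_norm f x t) powr q"
      proof -
        have "t powr (q - s * q - 1) = 1 / t * (t powr (1 - s)) powr q"
        proof -
          have "q - s * q - 1 = (1 - s) * q - 1" by (simp add: algebra_simps)
          then have "t powr (q - s * q - 1) = t powr ((1 - s) * q) / t" using t by (simp only: powr_diff powr_one less_imp_le)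
          then show ?thesis by (simp add: powr_powr)
        qed
        then show ?thesis using poisson_grad_nonneg by (simp add: powr_mult)
      qed
      then have "ennreal (t powr (q - s * q - 1) * poisson_grad_norm f x t powr q)
        = ennreal (1 / t) * epowr (ennreal (t powr (1 - s)) * ennreal (poisson_grad_norm f x t)) q"
        using t poisson_grad_nonneg[of f x t] by (simp add: epowr_ennreal ennreal_mult[symmetric] del: times_divide_eq_left)
      also have "\<dots> \<le> ennreal (1 / t) * epowr (ennreal (2 * C) * (\<integral>\<^sup>+j. ennreal (tent th (2 powr real_of_int j * t)) * c j \<partial>count_space UNIV)) q"
      proof (intro mult_left_mono epowr_mono)
        have "ennreal (t powr (1 - s)) * ennreal (poisson_grad_norm f x t)
          \<le> ennreal (t powr (1 - s)) * (ennreal C * (\<integral>\<^sup>+j. ennreal (2 powr real_of_int j * ((1 + (2 powr real_of_int j * t) powr (- e)) / (1 + 2 powr real_of_int j * t) ^ 3) * m j) \<partial>count_space UNIV))"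
          by (intro mult_left_mono C(2) f t m fm) auto
        also have "\<dots> = (\<integral>\<^sup>+j. ennreal (t powr (1 - s)) * (ennreal C * ennreal (2 powr real_of_int j * ((1 + (2 powr real_of_int j * t) powr (- e)) / (1 + 2 powr real_of_int j * t) ^ 3) * m j)) \<partial>count_space UNIV)"
          by (simp add: nn_integral_cmult)
        also have "\<dots> \<le> (\<integral>\<^sup>+j. ennreal (2 * C) * (ennreal (tent th (2 powr real_of_int j * t)) * c j) \<partial>count_space UNIV)"
        proof (rule nn_integral_mono)
          fix j
          define l where "l = 2 powr real_of_int j"
          have l: "0 < l" by (simp add: l_def)
          define w where "w = (1 + (l * t) powr (- e)) / (1 + l * t) ^ 3"
          have w: "0 \<le> w" using l t by (simp add: w_def add_nonneg_nonneg)
          have ls: "2 powr (real_of_int j * s) = l powr s" by (simp add: l_def powr_powr)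
          have "t powr (1 - s) * (C * (l * w * m j)) = C * ((l * t) powr (1 - s) * w) * (l powr s * m j)"
          proof -
            have "(l * t) powr (1 - s) * l powr s = l * t powr (1 - s)"
              using l t by (simp add: powr_mult powr_diff)
            then have "C * w * m j * ((l * t) powr (1 - s) * l powr s) = C * w * m j * (l * t powr (1 - s))" by (simp only:)
            then show ?thesis by (simp only: mult_ac)
          qed
          also have "\<dots> \<le> C * (2 * tent th (l * t)) * (l powr s * m j)"
            using C(1) m tent_dominates[OF s, of "l * t"] l t unfolding w_def e_def th_def
            by (intro mult_right_mono mult_left_mono) auto
          also have "\<dots> = (2 * C) * (tent th (l * t) * (l powr s * m j))" by simp
          finally show "ennreal (t powr (1 - s)) * (ennreal C * ennreal (2 powr real_of_int j * ((1 + (2 powr real_of_int j * t) powr (- e)) / (1 + 2 powr real_of_int j * t) ^ 3) * m j))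
            \<le> ennreal (2 * C) * (ennreal (tent th (2 powr real_of_int j * t)) * c j)"
            unfolding c_def ls l_def[symmetric] w_def[symmetric] using C(1) w l m[of j]
            by (simp only: ennreal_mult[symmetric] mult_nonneg_nonneg powr_ge_zero tent_nonneg less_imp_le zero_le_numeral) (rule ennreal_leI)
        qed
        also have "\<dots> = ennreal (2 * C) * (\<integral>\<^sup>+j. ennreal (tent th (2 powr real_of_int j * t)) * c j \<partial>count_space UNIV)"
          by (rule nn_integral_cmult) simp
        finally show "ennreal (t powr (1 - s)) * ennreal (poisson_grad_norm f x t) \<le> \<dots>" .
      qed (use q in auto)
      also have "\<dots> = ennreal ((2 * C) powr q) * (ennreal (1 / t) * epowr (\<integral>\<^sup>+j. ennreal (tent th (2 powr real_of_int j * t)) * c j \<partial>count_space UNIV) q)"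
        using C(1) by (simp only: epowr_mult epowr_ennreal mult_ac less_imp_le mult_nonneg_nonneg zero_le_numeral)
      finally show ?thesis .
    qed
    have "epowr (g_function s q f x) q = (\<integral>\<^sup>+t\<in>{0<..}. ennreal (t powr (q - s * q - 1) * poisson_grad_norm f x t powr q) \<partial>lborel)"
      unfolding g_function_def using q by (simp add: epowr_epowr)
    also have "\<dots> \<le> (\<integral>\<^sup>+t. ennreal ((2 * C) powr q) * ((ennreal (1 / t) * epowr (\<integral>\<^sup>+j. ennreal (tent th (2 powr real_of_int j * t)) * c j \<partial>count_space UNIV) q) * indicator {0<..} t) \<partial>lborel)"
      using key by (intro nn_integral_mono) (auto simp: indicator_def)
    also have "\<dots> = ennreal ((2 * C) powr q) * (\<integral>\<^sup>+t\<in>{0<..}. ennreal (1 / t) * epowr (\<integral>\<^sup>+j. ennreal (tent th (2 powr real_of_int j * t)) * c j \<partial>count_space UNIV) q \<partial>lborel)"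
    proof (rule nn_integral_cmult)
      have [measurable]: "(\<lambda>t. \<integral>\<^sup>+j. ennreal (tent th (2 powr real_of_int j * t)) * c j \<partial>count_space UNIV) \<in> borel_measurable borel"
        unfolding nn_integral_count_space_int_SUP by measurable
      show "(\<lambda>t. ennreal (1 / t) * epowr (\<integral>\<^sup>+j. ennreal (tent th (2 powr real_of_int j * t)) * c j \<partial>count_space UNIV) q * indicator {0<..} t) \<in> borel_measurable lborel"
        by measurable
    qed
    also have "\<dots> \<le> ennreal ((2 * C) powr q) * (ennreal D * (\<integral>\<^sup>+j. epowr (c j) q \<partial>count_space UNIV))"
      by (intro mult_left_mono D(2)) auto
    also have "\<dots> = ennreal ((2 * C) powr q * D) * (\<integral>\<^sup>+j. ennreal ((2 powr (real_of_int j * s) * m j) powr q) \<partial>count_space UNIV)"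
    proof -
      have "epowr (c j) q = ennreal ((2 powr (real_of_int j * s) * m j) powr q)" for j
        unfolding c_def by (rule epowr_ennreal) (use m in simp)
      moreover have "ennreal ((2 * C) powr q * D) = ennreal ((2 * C) powr q) * ennreal D"
        using D(1) by (intro ennreal_mult) auto
      ultimately show ?thesis by (simp only: mult.assoc)
    qed
    finally show "epowr (g_function s q f x) q \<le> \<dots>" .
  qed
qed

section \<open>Reduction to Borel functions and conclusion\<close>

text \<open>With w the weight, w |g| \<le> w + |g|^p0, according to whether |g| \<le> 1 or not; for
  essentially bounded f the integrability of w suffices.\<close>

lemma in_Lp_slow:
  fixes f :: "'a::euclidean_space \<Rightarrow> complex"
  assumes f: "(\<exists>p0\<ge>1. in_Lp p0 f) \<or> in_Linfty f"
  obtains g where "slow g" "AE x in lebesgue. f x = g x"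
proof -
  have fm: "f \<in> borel_measurable lebesgue" using f by (auto simp: in_Lp_def in_Linfty_def)
  have re: "(\<lambda>x. Re (f x)) \<in> borel_measurable (completion lborel)" and im: "(\<lambda>x. Im (f x)) \<in> borel_measurable (completion lborel)"
    using fm by auto
  obtain g1 :: "'a \<Rightarrow> real" where g1: "g1 \<in> borel_measurable lborel" "AE x in lborel. Re (f x) = g1 x"
    using completion_ex_borel_measurable_real[OF re] by blast
  obtain g2 :: "'a \<Rightarrow> real" where g2: "g2 \<in> borel_measurable lborel" "AE x in lborel. Im (f x) = g2 x"
    using completion_ex_borel_measurable_real[OF im] by blast
  have [measurable]: "g1 \<in> borel_measurable borel" "g2 \<in> borel_measurable borel" using g1 g2 by auto
  define g where "g x = complex_of_real (g1 x) + \<i> * complex_of_real (g2 x)" for x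
  have gm [measurable]: "g \<in> borel_measurable borel" unfolding g_def by measurable
  have "AE x in lborel. f x = g x"
    using g1(2) g2(2) by eventually_elim (simp add: g_def complex_eq_iff)
  then have ae: "AE x in lebesgue. f x = g x" by (rule AE_completion)
  define w where "w = real DIM('a) + 1/2"
  have iw: "(\<integral>\<^sup>+y. ennreal (wt w (x - y)) \<partial>lborel) < \<infinity>" for x :: 'a
    using nn_integral_lborel_reflect[of "\<lambda>y::'a. ennreal (wt w y)" x] nn_integral_wt_finite[where 'a='a, of w] by (simp add: w_def)
  have "integrable lborel (\<lambda>y. wt w (x - y) * norm (g y))" for x
  proof (rule integrableI_bounded)
    show "(\<lambda>y. wt w (x - y) * norm (g y)) \<in> borel_measurable lborel" by measurable
    show "(\<integral>\<^sup>+y. ennreal (norm (wt w (x - y) * norm (g y))) \<partial>lborel) < \<infinity>"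
      using f
    proof
      assume "\<exists>p0\<ge>1. in_Lp p0 f"
      then obtain p0 where p0: "1 \<le> p0" "in_Lp p0 f" by blast
      have "(\<integral>\<^sup>+y. ennreal (norm (g y) powr p0) \<partial>lborel) = (\<integral>\<^sup>+y. ennreal (norm (f y) powr p0) \<partial>lebesgue)"
        unfolding nn_integral_completion[symmetric, of lborel]
        using ae by (intro nn_integral_cong_AE) auto
      also have "\<dots> < \<infinity>" using p0(2) by (simp add: in_Lp_def)
      finally have gp: "(\<integral>\<^sup>+y. ennreal (norm (g y) powr p0) \<partial>lborel) < \<infinity>" .
      have "(\<integral>\<^sup>+y. ennreal (norm (wt w (x - y) * norm (g y))) \<partial>lborel) \<le> (\<integral>\<^sup>+y. ennreal (wt w (x - y)) + ennreal (norm (g y) powr p0) \<partial>lborel)"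
      proof (rule nn_integral_mono)
        fix y
        have "wt w (x - y) * norm (g y) \<le> wt w (x - y) + norm (g y) powr p0"
        proof (cases "norm (g y) \<le> 1")
          case True
          then have "wt w (x - y) * norm (g y) \<le> wt w (x - y) * 1" by (intro mult_left_mono) auto
          then show ?thesis by (simp add: add_increasing2)
        next
          case False
          then have "norm (g y) powr 1 \<le> norm (g y) powr p0" using p0 by (intro powr_mono) auto
          moreover have "wt w (x - y) * norm (g y) \<le> 1 * norm (g y)" by (intro mult_right_mono wt_le_1) (auto simp: w_def)
          moreover have "norm (g y) powr 1 = norm (g y)" by simp
          ultimately show ?thesis using wt_nonneg[of w "x - y"] by linarith
        qed
        then show "ennreal (norm (wt w (x - y) * norm (g y))) \<le> ennreal (wt w (x - y)) + ennreal (norm (g y) powr p0)"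
          by (simp add: ennreal_leI flip: ennreal_plus)
      qed
      also have "\<dots> = (\<integral>\<^sup>+y. ennreal (wt w (x - y)) \<partial>lborel) + (\<integral>\<^sup>+y. ennreal (norm (g y) powr p0) \<partial>lborel)"
        by (rule nn_integral_add) measurable
      also have "\<dots> < \<infinity>" using iw[of x] gp by simp
      finally show ?thesis .
    next
      assume "in_Linfty f"
      then obtain M where "AE x in lebesgue. norm (f x) \<le> M" by (auto simp: in_Linfty_def)
      with ae have "AE x in lebesgue. norm (g x) \<le> M" by eventually_elim simp
      then have M: "AE x in lborel. norm (g x) \<le> M"
        by (subst (asm) AE_completion_iff) simp_all
      have "(\<integral>\<^sup>+y. ennreal (norm (wt w (x - y) * norm (g y))) \<partial>lborel) \<le> (\<integral>\<^sup>+y. ennreal \<bar>M\<bar> * ennreal (wt w (x - y)) \<partial>lborel)"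
      proof (rule nn_integral_mono_AE, use M in eventually_elim)
        fix y assume "norm (g y) \<le> M"
        then have "wt w (x - y) * norm (g y) \<le> \<bar>M\<bar> * wt w (x - y)" by (subst mult.commute) (intro mult_right_mono, auto)
        then show "ennreal (norm (wt w (x - y) * norm (g y))) \<le> ennreal \<bar>M\<bar> * ennreal (wt w (x - y))"
          by (simp add: ennreal_leI flip: ennreal_mult)
      qed
      also have "\<dots> = ennreal \<bar>M\<bar> * (\<integral>\<^sup>+y. ennreal (wt w (x - y)) \<partial>lborel)" by (rule nn_integral_cmult) measurable
      also have "\<dots> < \<infinity>" using iw[of x] by (simp add: ennreal_mult_less_top)
      finally show ?thesis .
    qed
  qed
  then have "slow g" using gm by (simp add: slow_def w_def)
  then show ?thesis using that ae by blast
qed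

text \<open>A change of f on a null set leaves the integral unchanged, so the equality holds at
  every point x.\<close>

lemma LP_piece_cong:
  assumes \<psi>: "LP_admissible \<psi>" and g: "slow g" and ae: "AE x in lebesgue. f x = g x" and f: "f \<in> borel_measurable lebesgue"
  shows "LP_piece \<psi> f j x = convolution (psi_dil \<psi> j) g x"
proof -
  have [measurable]: "psi_dil \<psi> j \<in> borel_measurable borel" by (rule vanishing_C1_measurable[OF vanishing_C1_psi_dil[OF \<psi>]])
  have [measurable]: "g \<in> borel_measurable borel" using g by (simp add: slow_def)
  have "(\<lambda>y. psi_dil \<psi> j (x - y)) \<in> borel_measurable lborel" by measurable
  then have m: "(\<lambda>y. psi_dil \<psi> j (x - y)) \<in> borel_measurable lebesgue" by (rule measurable_completion)
  have "LP_piece \<psi> f j x = (\<integral>y. psi_dil \<psi> j (x - y) * g y \<partial>lebesgue)"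
    unfolding LP_piece_def
    by (rule integral_cong_AE) (use ae m f measurable_completion[of g lborel borel] in auto)
  also have "\<dots> = convolution (psi_dil \<psi> j) g x" unfolding convolution_def by (rule integral_completion) measurable
  finally show ?thesis .
qed

lemma poisson_integral_cong:
  fixes f g :: "'a::euclidean_space \<Rightarrow> complex"
  assumes g: "slow g" and ae: "AE x in lebesgue. f x = g x" and f: "f \<in> borel_measurable lebesgue"
  shows "poisson_integral f = poisson_integral g"
proof (intro ext)
  fix x :: 'a and t :: real
  have [measurable]: "g \<in> borel_measurable borel" using g by (simp add: slow_def)
  have "(\<lambda>y. complex_of_real (poisson_kernel t (x - y))) \<in> borel_measurable lborel" by measurable
  then have m: "(\<lambda>y. complex_of_real (poisson_kernel t (x - y))) \<in> borel_measurable lebesgue" by (rule measurable_completion)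
  show "poisson_integral f x t = poisson_integral g x t"
    unfolding poisson_integral_def
    by (rule integral_cong_AE) (use ae m f measurable_completion[of g lborel borel] in auto)
qed

lemma g_function_Lp_bound:
  fixes \<psi> :: "'a::euclidean_space \<Rightarrow> complex"
  assumes \<psi>: "LP_admissible \<psi>" and p: "0 < p" and q: "0 < q" and s: "\<bar>s\<bar> < 1"
  obtains C where "0 < C" "\<And>f. slow f \<Longrightarrow> (\<integral>\<^sup>+x. epowr (g_function s q f x) p \<partial>lborel)
    \<le> ennreal C * (\<integral>\<^sup>+x. epowr (\<integral>\<^sup>+j. ennreal ((2 powr (real_of_int j * s) * norm (convolution (psi_dil \<psi> j) f x)) powr q) \<partial>count_space UNIV) (p / q) \<partial>lborel)"
proof -
  define n where "n = real DIM('a)"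
  \<comment> \<open>Below p and q, so that P and Q exceed 1, and at most 1, as the Peetre inequality
    requires.\<close>
  define r where "r = min 1 (min p q / 2)"
  have r: "0 < r" "r \<le> 1" "r < p" "r < q" using p q by (auto simp: r_def min_def)
  \<comment> \<open>Gives the kernel of the Peetre inequality the decay \<mu> r = n + 1, which
    exceeds the dimension.\<close>
  define \<mu> where "\<mu> = (n + 1) / r"
  have "n + 1 \<le> (n + 1) / r" using r by (simp add: le_divide_eq n_def mult_left_le)
  then have mu: "slow_exp TYPE('a) \<le> \<mu>" "0 \<le> \<mu>" "\<mu> * r = n + 1" using r by (auto simp: \<mu>_def slow_exp_def n_def)
  define P where "P = p / r"
  define Q where "Q = q / r"
  have PQ: "1 < P" "1 < Q" "P / Q = p / q" using r p q by (auto simp: P_def Q_def)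
  obtain A where A: "0 < A" "\<And>f j x. slow f \<Longrightarrow> \<exists>m\<ge>0.
    (\<forall>z. norm (convolution (psi_dil \<psi> j) f z) * wt \<mu> ((2 powr real_of_int j) *\<^sub>R (x - z)) \<le> m) \<and>
    ennreal (m powr r) \<le> ennreal A * nnconv (wt_kernel (n + 1) (2 powr real_of_int j)) (\<lambda>z. ennreal (norm (convolution (psi_dil \<psi> j) f z) powr r)) x"
    by (rule Peetre_inequality[OF \<psi> r(1,2) mu(1), unfolded mu(3)]) blast
  obtain C where C: "0 < C" "\<And>f x m. slow f \<Longrightarrow> (\<And>j. 0 \<le> m j) \<Longrightarrow>
    (\<And>j z. norm (convolution (psi_dil \<psi> j) f z) * wt \<mu> ((2 powr real_of_int j) *\<^sub>R (x - z)) \<le> m j) \<Longrightarrow>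
    epowr (g_function s q f x) q \<le> ennreal C * (\<integral>\<^sup>+j. ennreal ((2 powr (real_of_int j * s) * m j) powr q) \<partial>count_space UNIV)"
    by (rule g_function_pointwise[OF \<psi> q s mu(2)]) blast
  obtain K where K: "0 \<le> K" "\<And>(l::int \<Rightarrow> real) (g::int \<Rightarrow> 'a \<Rightarrow> ennreal). (\<And>i. 0 < l i) \<Longrightarrow>
    (\<And>i j. i \<le> j \<Longrightarrow> l i \<le> l j) \<Longrightarrow> (\<And>i. g i \<in> borel_measurable borel) \<Longrightarrow>
    (\<integral>\<^sup>+x. epowr (\<integral>\<^sup>+i. epowr (nnconv (wt_kernel (n + 1) (l i)) (g i) x) Q \<partial>count_space UNIV) (P / Q) \<partial>lborel)
       \<le> ennreal K * (\<integral>\<^sup>+x. epowr (\<integral>\<^sup>+i. epowr (g i x) Q \<partial>count_space UNIV) (P / Q) \<partial>lborel)"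
    by (rule vector_valued_maximal[OF PQ(1,2), where 'a='a, of "n + 1"]) (auto simp: n_def)
  define B where "B = (C * A powr Q) powr (p / q)"
  have B: "0 < B" using C(1) A(1) by (simp add: B_def)
  show ?thesis
  proof (rule that[of "B * (K + 1)"])
    show "0 < B * (K + 1)" using B K(1) by simp
    fix f :: "'a \<Rightarrow> complex" assume f: "slow f"
    have [measurable]: "f \<in> borel_measurable borel" using f by (simp add: slow_def)
    have [measurable]: "psi_dil \<psi> j \<in> borel_measurable borel" for j by (rule vanishing_C1_measurable[OF vanishing_C1_psi_dil[OF \<psi>]])
    define F where "F j = convolution (psi_dil \<psi> j) f" for j
    have [measurable]: "F j \<in> borel_measurable borel" for j unfolding F_def by measurable
    define l where "l j = 2 powr real_of_int j" for j
    \<comment> \<open>The weight 2^(j s) is put inside the convolution, so that the vector-valued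
      bound produces the Triebel-Lizorkin norm directly.\<close>
    define g where "g j z = ennreal ((2 powr (real_of_int j * s) * norm (F j z)) powr r)" for j z
    have [measurable]: "g j \<in> borel_measurable borel" for j unfolding g_def by measurable
    define N where "N j x = nnconv (wt_kernel (n + 1) (l j)) (g j) x" for j x
    have point: "epowr (g_function s q f x) q \<le> ennreal (C * A powr Q) * (\<integral>\<^sup>+j. epowr (N j x) Q \<partial>count_space UNIV)" for x
    proof -
      have "\<exists>m. \<forall>j. 0 \<le> m j \<and> (\<forall>z. norm (F j z) * wt \<mu> ((2 powr real_of_int j) *\<^sub>R (x - z)) \<le> m j) \<and>
        ennreal (m j powr r) \<le> ennreal A * nnconv (wt_kernel (n + 1) (l j)) (\<lambda>z. ennreal (norm (F j z) powr r)) x"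
        unfolding F_def l_def by (intro choice allI) (use A(2)[OF f] in blast)
      then obtain m where m: "\<And>j. 0 \<le> m j" "\<And>j z. norm (F j z) * wt \<mu> ((2 powr real_of_int j) *\<^sub>R (x - z)) \<le> m j"
        "\<And>j. ennreal (m j powr r) \<le> ennreal A * nnconv (wt_kernel (n + 1) (l j)) (\<lambda>z. ennreal (norm (F j z) powr r)) x"
        by blast
      have "epowr (g_function s q f x) q \<le> ennreal C * (\<integral>\<^sup>+j. ennreal ((2 powr (real_of_int j * s) * m j) powr q) \<partial>count_space UNIV)"
        by (rule C(2)[OF f m(1) m(2)[unfolded F_def]])
      also have "\<dots> \<le> ennreal C * (\<integral>\<^sup>+j. ennreal (A powr Q) * epowr (N j x) Q \<partial>count_space UNIV)"
      proof (intro mult_left_mono nn_integral_mono)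
        fix j
        define a where "a = 2 powr (real_of_int j * s)"
        have a: "0 < a" by (simp add: a_def)
        have "ennreal ((a * m j) powr q) = epowr (ennreal (a powr r) * ennreal (m j powr r)) Q"
          using a m(1)[of j] r by (simp add: ennreal_mult[symmetric] epowr_ennreal powr_mult powr_powr Q_def)
        also have "\<dots> \<le> epowr (ennreal (a powr r) * (ennreal A * nnconv (wt_kernel (n + 1) (l j)) (\<lambda>z. ennreal (norm (F j z) powr r)) x)) Q"
          using PQ by (intro epowr_mono mult_left_mono m(3)) auto
        also have "ennreal (a powr r) * (ennreal A * nnconv (wt_kernel (n + 1) (l j)) (\<lambda>z. ennreal (norm (F j z) powr r)) x)
          = ennreal A * (ennreal (a powr r) * nnconv (wt_kernel (n + 1) (l j)) (\<lambda>z. ennreal (norm (F j z) powr r)) x)" by (simp only: mult_ac)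
        also have "ennreal (a powr r) * nnconv (wt_kernel (n + 1) (l j)) (\<lambda>z. ennreal (norm (F j z) powr r)) x = N j x"
        proof -
          have "g j = (\<lambda>z. ennreal (a powr r) * ennreal (norm (F j z) powr r))"
            using a by (simp add: g_def a_def powr_mult ennreal_mult fun_eq_iff)
          then show ?thesis unfolding N_def by (simp add: nnconv_cmult)
        qed
        also have "epowr (ennreal A * N j x) Q = ennreal (A powr Q) * epowr (N j x) Q"
          using A(1) by (simp add: epowr_mult epowr_ennreal)
        finally show "ennreal ((2 powr (real_of_int j * s) * m j) powr q) \<le> ennreal (A powr Q) * epowr (N j x) Q"
          unfolding a_def .
      qed auto
      also have "\<dots> = ennreal (C * A powr Q) * (\<integral>\<^sup>+j. epowr (N j x) Q \<partial>count_space UNIV)"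
        using C(1) A(1) by (simp add: nn_integral_cmult ennreal_mult mult.assoc)
      finally show ?thesis .
    qed
    have mN: "(\<lambda>x. \<integral>\<^sup>+j. epowr (N j x) Q \<partial>count_space UNIV) \<in> borel_measurable borel"
      unfolding nn_integral_count_space_int_SUP N_def by measurable
    have "(\<integral>\<^sup>+x. epowr (g_function s q f x) p \<partial>lborel) = (\<integral>\<^sup>+x. epowr (epowr (g_function s q f x) q) (p / q) \<partial>lborel)"
      using q by (simp add: epowr_epowr)
    \<comment> \<open>Monotonicity of the nonnegative integral holds for arbitrary integrands, so no
      measurability of \<open>g_function\<close> in x enters.\<close>
    also have "\<dots> \<le> (\<integral>\<^sup>+x. epowr (ennreal (C * A powr Q) * (\<integral>\<^sup>+j. epowr (N j x) Q \<partial>count_space UNIV)) (p / q) \<partial>lborel)"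
      using p q by (intro nn_integral_mono epowr_mono point) auto
    also have "\<dots> = (\<integral>\<^sup>+x. ennreal B * epowr (\<integral>\<^sup>+j. epowr (N j x) Q \<partial>count_space UNIV) (P / Q) \<partial>lborel)"
      unfolding PQ(3) B_def using C(1) A(1) by (simp add: epowr_mult epowr_ennreal)
    also have "\<dots> = ennreal B * (\<integral>\<^sup>+x. epowr (\<integral>\<^sup>+j. epowr (N j x) Q \<partial>count_space UNIV) (P / Q) \<partial>lborel)"
      by (rule nn_integral_cmult) (use mN in measurable)
    also have "\<dots> \<le> ennreal B * (ennreal K * (\<integral>\<^sup>+x. epowr (\<integral>\<^sup>+j. epowr (g j x) Q \<partial>count_space UNIV) (P / Q) \<partial>lborel))"
      unfolding N_def by (intro mult_left_mono K(2)) (auto simp: l_def)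
    also have "\<dots> \<le> ennreal B * (ennreal (K + 1) * (\<integral>\<^sup>+x. epowr (\<integral>\<^sup>+j. epowr (g j x) Q \<partial>count_space UNIV) (P / Q) \<partial>lborel))"
      by (intro mult_left_mono mult_right_mono ennreal_leI) auto
    also have "\<dots> = ennreal (B * (K + 1)) * (\<integral>\<^sup>+x. epowr (\<integral>\<^sup>+j. epowr (g j x) Q \<partial>count_space UNIV) (P / Q) \<partial>lborel)"
      using B K(1) by (simp add: ennreal_mult mult.assoc)
    also have "(\<lambda>x. epowr (\<integral>\<^sup>+j. epowr (g j x) Q \<partial>count_space UNIV) (P / Q))
      = (\<lambda>x. epowr (\<integral>\<^sup>+j. ennreal ((2 powr (real_of_int j * s) * norm (convolution (psi_dil \<psi> j) f x)) powr q) \<partial>count_space UNIV) (p / q))"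
    proof -
      have "epowr (g j x) Q = ennreal ((2 powr (real_of_int j * s) * norm (convolution (psi_dil \<psi> j) f x)) powr q)" for j x
        using r by (simp add: g_def epowr_ennreal powr_powr Q_def F_def)
      then show ?thesis unfolding PQ(3) by simp
    qed
    finally show "(\<integral>\<^sup>+x. epowr (g_function s q f x) p \<partial>lborel)
      \<le> ennreal (B * (K + 1)) * (\<integral>\<^sup>+x. epowr (\<integral>\<^sup>+j. ennreal ((2 powr (real_of_int j * s) * norm (convolution (psi_dil \<psi> j) f x)) powr q) \<partial>count_space UNIV) (p / q) \<partial>lborel)" .
  qed
qed

theorem theorem3:
  fixes \<psi> :: "'a::euclidean_space \<Rightarrow> complex" and p q s :: real
  assumes "0 < p" and "0 < q" and "\<bar>s\<bar> < 1" and "LP_admissible \<psi>"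
  shows "\<exists>C::real. 0 < C \<and> (\<forall>f::'a \<Rightarrow> complex.
           TL_norm \<psi> s p q f < \<infinity> \<and>
           ((\<exists>p0\<ge>1. in_Lp p0 f) \<or> in_Linfty f) \<longrightarrow>
           Lp_enorm p (g_function s q f) \<le> ennreal C * TL_norm \<psi> s p q f)"
proof -
  obtain C where C: "0 < C" "\<And>f. slow f \<Longrightarrow> (\<integral>\<^sup>+x. epowr (g_function s q f x) p \<partial>lborel)
    \<le> ennreal C * (\<integral>\<^sup>+x. epowr (\<integral>\<^sup>+j. ennreal ((2 powr (real_of_int j * s) * norm (convolution (psi_dil \<psi> j) f x)) powr q) \<partial>count_space UNIV) (p / q) \<partial>lborel)"
    by (rule g_function_Lp_bound[OF assms(4,1,2,3)]) blast
  show ?thesis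
  \<comment> \<open>The bound with constant C concerns p-th powers, hence the p-th root.\<close>
  proof (intro exI[of _ "C powr (1 / p)"] conjI allI impI)
    show "0 < C powr (1 / p)" using C(1) by simp
    fix f :: "'a \<Rightarrow> complex"
    assume "TL_norm \<psi> s p q f < \<infinity> \<and> ((\<exists>p0\<ge>1. in_Lp p0 f) \<or> in_Linfty f)"
    then have f: "(\<exists>p0\<ge>1. in_Lp p0 f) \<or> in_Linfty f" by simp
    then have fm: "f \<in> borel_measurable lebesgue" by (auto simp: in_Lp_def in_Linfty_def)
    obtain g where g: "slow g" "AE x in lebesgue. f x = g x" using in_Lp_slow[OF f] by blast
    have piece: "LP_piece \<psi> f j x = convolution (psi_dil \<psi> j) g x" for j x
      by (rule LP_piece_cong[OF assms(4) g fm])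
    \<comment> \<open>The Poisson integrals of f and g agree as functions of (x, t), hence so do all
      their derivatives.\<close>
    have gf: "g_function s q f = g_function s q g"
      unfolding g_function_def[abs_def] poisson_grad_norm_def poisson_integral_cong[OF g fm] ..
    have "Lp_enorm p (g_function s q f) = epowr (\<integral>\<^sup>+x. epowr (g_function s q g x) p \<partial>lborel) (1 / p)"
      unfolding Lp_enorm_def gf by (simp add: nn_integral_completion)
    also have "\<dots> \<le> epowr (ennreal C * (\<integral>\<^sup>+x. epowr (\<integral>\<^sup>+j. ennreal ((2 powr (real_of_int j * s) * norm (convolution (psi_dil \<psi> j) g x)) powr q) \<partial>count_space UNIV) (p / q) \<partial>lborel)) (1 / p)"
      using assms(1) by (intro epowr_mono C(2) g) auto
    also have "\<dots> = ennreal (C powr (1 / p)) * TL_norm \<psi> s p q f"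
      unfolding TL_norm_def piece using C(1)
      by (simp add: epowr_mult epowr_ennreal epowr_epowr nn_integral_completion)
    finally show "Lp_enorm p (g_function s q f) \<le> ennreal (C powr (1 / p)) * TL_norm \<psi> s p q f" .
  qed
qed

end
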